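(* There exists a projective surface (over an algebraically closed field of characteristic $p>0$) which is $F$-injective except possibly at finitely many points, and whose general hyperplane section is not $F$-injective. That is, there exist an algebraically closed field $k$ of characteristic $p>0$ and a projective surface $X\subseteq\mathbb{P}^N_k$ such that $\mathcal{O}_{X,x}$ is $F$-injective for all but finitely many points $x\in X$, while for all hyperplanes $H$ in a nonempty open subset of $(\mathbb{P}^N_k)^{\vee}$ the scheme $X\cap H$ is not $F$-injective.
   Context: An $F$-finite local ring $(R,\mathfrak{m})$ of characteristic $p>0$ (i.e. $R$ is Noetherian and a finite module over itself via Frobenius) is $F$-injective if the map $H^i_{\mathfrak m}(R)\to H^i_{\mathfrak m}(F_*R)$ induced by Frobenius $R\to F_*R$ is injective for every $i\geq 0$, where $F_*R$ denotes $R$ viewed as an $R$-module via Frobenius. A scheme is $F$-injective if all its local rings are. $(\mathbb{P}^N_k)^{\vee}$ is the dual projective space of hyperplanes of $\mathbb{P}^N_k$. *)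

theory Defs
  imports "HOL-Algebra.Algebra"
begin

section \<open>Localization of rings and modules\<close>

text \<open>The fraction \<open>m/w\<close> in \<open>W\<inverse>M\<close>, as an equivalence class of pairs; \<open>W\<close> is
  meant to be a multiplicative subset of \<open>R\<close>. The operations below are given on representatives,
  the union over all representatives being a single class when they are compatible with the
  equivalence.\<close>

definition fraction ::
  "('r, 'c) ring_scheme \<Rightarrow> 'r set \<Rightarrow> ('r, 'm, 'd) module_scheme \<Rightarrow> 'm \<Rightarrow> 'r \<Rightarrow> ('m \<times> 'r) set"
  where "fraction R W M m w =
    {(n, v). n \<in> carrier M \<and> v \<in> W \<and>
      (\<exists>u\<in>W. u \<odot>\<^bsub>M\<^esub> (v \<odot>\<^bsub>M\<^esub> m) = u \<odot>\<^bsub>M\<^esub> (w \<odot>\<^bsub>M\<^esub> n))}"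

text \<open>In HOL-Algebra a module record extends a ring record; its multiplicative part plays no
  role and is left undefined here.\<close>

definition loc_module ::
  "('r, 'c) ring_scheme \<Rightarrow> 'r set \<Rightarrow> ('r, 'm, 'd) module_scheme \<Rightarrow> ('r, ('m \<times> 'r) set) module"
  where "loc_module R W M =
    \<lparr>carrier = {fraction R W M m w | m w. m \<in> carrier M \<and> w \<in> W},
     monoid.mult = undefined,
     monoid.one = undefined,
     ring.zero = fraction R W M \<zero>\<^bsub>M\<^esub> \<one>\<^bsub>R\<^esub>,
     ring.add = (\<lambda>C D. \<Union>(m, w)\<in>C. \<Union>(n, v)\<in>D.
              fraction R W M ((v \<odot>\<^bsub>M\<^esub> m) \<oplus>\<^bsub>M\<^esub> (w \<odot>\<^bsub>M\<^esub> n)) (w \<otimes>\<^bsub>R\<^esub> v)),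
     module.smult = (\<lambda>r C. \<Union>(m, w)\<in>C. fraction R W M (r \<odot>\<^bsub>M\<^esub> m) w)\<rparr>"

definition self_module :: "('r, 'c) ring_scheme \<Rightarrow> ('r, 'r) module"
  where "self_module R =
    \<lparr>carrier = carrier R, monoid.mult = monoid.mult R, monoid.one = monoid.one R, ring.zero = ring.zero R, ring.add = ring.add R,
     module.smult = monoid.mult R\<rparr>"

definition loc_ring :: "('r, 'c) ring_scheme \<Rightarrow> 'r set \<Rightarrow> ('r \<times> 'r) set ring"
  where "loc_ring R W =
    (let L = loc_module R W (self_module R) in
    \<lparr>carrier = carrier L,
     monoid.mult = (\<lambda>C D. \<Union>(a, w)\<in>C. \<Union>(b, v)\<in>D.
               fraction R W (self_module R) (a \<otimes>\<^bsub>R\<^esub> b) (w \<otimes>\<^bsub>R\<^esub> v)),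
     monoid.one = fraction R W (self_module R) \<one>\<^bsub>R\<^esub> \<one>\<^bsub>R\<^esub>,
     ring.zero = ring.zero L,
     ring.add = ring.add L\<rparr>)"


section \<open>Local cohomology\<close>

text \<open>Local cohomology with support in the ideal generated by a finite list \<open>xs\<close> of elements of a
  Noetherian ring, defined as the cohomology of the Cech complex with terms
  \[ C^i = \prod_{|J| = i} M_{x_J}, \qquad x_J = \prod_{j \in J} x_j. \]
  The localization \<open>M\<^bsub>x_J\<^esub>\<close> is formed with respect to all monomials in the \<open>x\<^sub>j\<close>,
  \<open>j \<in> J\<close>, instead of only the powers of \<open>x_J\<close>; the result is the same module, and the maps
  \<open>M\<^bsub>x_J\<^esub> \<rightarrow> M\<^bsub>x_J'\<^esub>\<close> for \<open>J \<subseteq> J'\<close> simply send \<open>m/w\<close> to \<open>m/w\<close>.\<close>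

definition monomials :: "('r, 'c) ring_scheme \<Rightarrow> 'r list \<Rightarrow> nat set \<Rightarrow> 'r set"
  where "monomials R xs J = {finprod R (\<lambda>j. (xs ! j) [^]\<^bsub>R\<^esub> e j) J | e :: nat \<Rightarrow> nat. True}"

definition cech_index :: "'r list \<Rightarrow> nat \<Rightarrow> nat set set"
  where "cech_index xs i = {J. J \<subseteq> {..<length xs} \<and> card J = i}"

definition cech_loc ::
  "('r, 'c) ring_scheme \<Rightarrow> 'r list \<Rightarrow> ('r, 'm, 'd) module_scheme \<Rightarrow> nat set \<Rightarrow>
    ('r, ('m \<times> 'r) set) module"
  where "cech_loc R xs M J = loc_module R (monomials R xs J) M"

definition cech_cochains ::
  "('r, 'c) ring_scheme \<Rightarrow> 'r list \<Rightarrow> ('r, 'm, 'd) module_scheme \<Rightarrow> nat \<Rightarrow>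
    (nat set \<Rightarrow> ('m \<times> 'r) set) monoid"
  where "cech_cochains R xs M i =
    product_group (cech_index xs i) (\<lambda>J. add_monoid (cech_loc R xs M J))"

definition cech_diff ::
  "('r, 'c) ring_scheme \<Rightarrow> 'r list \<Rightarrow> ('r, 'm, 'd) module_scheme \<Rightarrow> nat \<Rightarrow>
    (nat set \<Rightarrow> ('m \<times> 'r) set) \<Rightarrow> nat set \<Rightarrow> ('m \<times> 'r) set"
  where "cech_diff R xs M i c =
    (\<lambda>J\<in>cech_index xs (Suc i).
      \<Oplus>\<^bsub>cech_loc R xs M J\<^esub> j\<in>J.
        (let y = (\<Union>(m, w)\<in>c (J - {j}). fraction R (monomials R xs J) M m w)
         in if even (card {l \<in> J. l < j}) then y else \<ominus>\<^bsub>cech_loc R xs M J\<^esub> y))"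

definition cech_cocycles ::
  "('r, 'c) ring_scheme \<Rightarrow> 'r list \<Rightarrow> ('r, 'm, 'd) module_scheme \<Rightarrow> nat \<Rightarrow>
    (nat set \<Rightarrow> ('m \<times> 'r) set) set"
  where "cech_cocycles R xs M i =
    kernel (cech_cochains R xs M i) (cech_cochains R xs M (Suc i)) (cech_diff R xs M i)"

definition cech_coboundaries ::
  "('r, 'c) ring_scheme \<Rightarrow> 'r list \<Rightarrow> ('r, 'm, 'd) module_scheme \<Rightarrow> nat \<Rightarrow>
    (nat set \<Rightarrow> ('m \<times> 'r) set) set"
  where "cech_coboundaries R xs M i =
    (case i of
       0 \<Rightarrow> {\<one>\<^bsub>cech_cochains R xs M 0\<^esub>}
     | Suc j \<Rightarrow> cech_diff R xs M j ` carrier (cech_cochains R xs M j))"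

definition local_cohomology ::
  "('r, 'c) ring_scheme \<Rightarrow> 'r list \<Rightarrow> ('r, 'm, 'd) module_scheme \<Rightarrow> nat \<Rightarrow>
    (nat set \<Rightarrow> ('m \<times> 'r) set) set monoid"
  where "local_cohomology R xs M i =
    (cech_cochains R xs M i)\<lparr>carrier := cech_cocycles R xs M i\<rparr> Mod cech_coboundaries R xs M i"

text \<open>The maps induced by a module homomorphism \<open>h\<close> with target \<open>N\<close>, on cochains and on
  cohomology. The class of a cocycle \<open>c\<close> is a coset, and its image is the coset of the image
  of \<open>c\<close>.\<close>

definition cech_map ::
  "('r, 'c) ring_scheme \<Rightarrow> 'r list \<Rightarrow> ('r, 'n, 'e) module_scheme \<Rightarrow> ('m \<Rightarrow> 'n) \<Rightarrow> nat \<Rightarrow>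
    (nat set \<Rightarrow> ('m \<times> 'r) set) \<Rightarrow> nat set \<Rightarrow> ('n \<times> 'r) set"
  where "cech_map R xs N h i c =
    (\<lambda>J\<in>cech_index xs i. \<Union>(m, w)\<in>c J. fraction R (monomials R xs J) N (h m) w)"

definition local_cohomology_map ::
  "('r, 'c) ring_scheme \<Rightarrow> 'r list \<Rightarrow> ('r, 'n, 'e) module_scheme \<Rightarrow> ('m \<Rightarrow> 'n) \<Rightarrow> nat \<Rightarrow>
    (nat set \<Rightarrow> ('m \<times> 'r) set) set \<Rightarrow> (nat set \<Rightarrow> ('n \<times> 'r) set) set"
  where "local_cohomology_map R xs N h i C =
    (\<Union>c\<in>C. cech_coboundaries R xs N i #>\<^bsub>cech_cochains R xs N i\<^esub> cech_map R xs N h i c)"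


section \<open>F-injectivity\<close>

definition frobenius_pushforward :: "nat \<Rightarrow> ('r, 'c) ring_scheme \<Rightarrow> ('r, 'r) module"
  where "frobenius_pushforward p R =
    \<lparr>carrier = carrier R, monoid.mult = monoid.mult R, monoid.one = monoid.one R, ring.zero = ring.zero R, ring.add = ring.add R,
     module.smult = (\<lambda>r x. (r [^]\<^bsub>R\<^esub> p) \<otimes>\<^bsub>R\<^esub> x)\<rparr>"

definition fin_gen_module :: "('r, 'c) ring_scheme \<Rightarrow> ('r, 'm, 'd) module_scheme \<Rightarrow> bool"
  where "fin_gen_module R M \<longleftrightarrow>
    (\<exists>B. finite B \<and> B \<subseteq> carrier M \<and>
      (\<forall>x\<in>carrier M. \<exists>c\<in>B \<rightarrow> carrier R. x = (\<Oplus>\<^bsub>M\<^esub> b\<in>B. c b \<odot>\<^bsub>M\<^esub> b)))"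

text \<open>Prime characteristic only; characteristic \<open>0\<close> is not covered.\<close>

definition has_char :: "('r, 'c) ring_scheme \<Rightarrow> nat \<Rightarrow> bool"
  where "has_char R p \<longleftrightarrow>
    Factorial_Ring.prime p \<and> [p] \<cdot>\<^bsub>R\<^esub> \<one>\<^bsub>R\<^esub> = \<zero>\<^bsub>R\<^esub> \<and> \<one>\<^bsub>R\<^esub> \<noteq> \<zero>\<^bsub>R\<^esub>"

locale F_finite_local_ring = cring R + noetherian_ring R for R (structure) +
  fixes p :: nat
  assumes local_ring: "\<exists>!\<mm>. maximalideal \<mm> R"
    and char_p: "has_char R p"
    and F_finite: "fin_gen_module R (frobenius_pushforward p R)"
begin

definition max_ideal :: "'a set"
  where "max_ideal = (THE \<mm>. maximalideal \<mm> R)"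

text \<open>Local cohomology and its functoriality do not depend on the choice of generators of the
  maximal ideal, so neither does this condition. The Frobenius is a map of \<open>R\<close>-modules from
  \<open>R\<close> to its pushforward.\<close>

definition F_injective :: bool
  where "F_injective \<longleftrightarrow>
    (\<exists>xs. set xs \<subseteq> carrier R \<and> Idl (set xs) = max_ideal \<and>
      (\<forall>i. inj_on
        (local_cohomology_map R xs (frobenius_pushforward p R) (\<lambda>x. x [^] p) i)
        (carrier (local_cohomology R xs (self_module R) i))))"

end


section \<open>Closed subschemes of projective space\<close>

text \<open>The polynomial ring \<open>K[x\<^sub>0,\<dots>,x\<^sub>N]\<close>. A monomial is the multiset of its variables, so that
  the degree of a monomial is its size.\<close>

definition mpoly_ring :: "('a, 'c) ring_scheme \<Rightarrow> nat \<Rightarrow> (nat multiset \<Rightarrow> 'a) ring"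
  where "mpoly_ring K N =
    \<lparr>carrier = {f. (\<forall>m. f m \<in> carrier K) \<and> finite {m. f m \<noteq> \<zero>\<^bsub>K\<^esub>} \<and>
                   (\<forall>m. f m \<noteq> \<zero>\<^bsub>K\<^esub> \<longrightarrow> set_mset m \<subseteq> {..N})},
     monoid.mult = (\<lambda>f g m. \<Oplus>\<^bsub>K\<^esub> a\<in>{a. a \<subseteq># m}. f a \<otimes>\<^bsub>K\<^esub> g (m - a)),
     monoid.one = (\<lambda>m. if m = {#} then \<one>\<^bsub>K\<^esub> else \<zero>\<^bsub>K\<^esub>),
     ring.zero = (\<lambda>m. \<zero>\<^bsub>K\<^esub>),
     ring.add = (\<lambda>f g m. f m \<oplus>\<^bsub>K\<^esub> g m)\<rparr>"

definition mpoly_eval :: "('a, 'c) ring_scheme \<Rightarrow> (nat multiset \<Rightarrow> 'a) \<Rightarrow> (nat \<Rightarrow> 'a) \<Rightarrow> 'a"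
  where "mpoly_eval K f a =
    (\<Oplus>\<^bsub>K\<^esub> m\<in>{m. f m \<noteq> \<zero>\<^bsub>K\<^esub>}.
      f m \<otimes>\<^bsub>K\<^esub> finprod K (\<lambda>i. a i [^]\<^bsub>K\<^esub> count m i) (set_mset m))"

definition homogeneous :: "('a, 'c) ring_scheme \<Rightarrow> nat \<Rightarrow> nat \<Rightarrow> (nat multiset \<Rightarrow> 'a) \<Rightarrow> bool"
  where "homogeneous K N d f \<longleftrightarrow>
    f \<in> carrier (mpoly_ring K N) \<and> (\<forall>m. f m \<noteq> \<zero>\<^bsub>K\<^esub> \<longrightarrow> size m = d)"

definition homogeneous_component ::
  "('a, 'c) ring_scheme \<Rightarrow> nat \<Rightarrow> (nat multiset \<Rightarrow> 'a) \<Rightarrow> nat multiset \<Rightarrow> 'a"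
  where "homogeneous_component K d f = (\<lambda>m. if size m = d then f m else \<zero>\<^bsub>K\<^esub>)"

definition homogeneous_ideal ::
  "('a, 'c) ring_scheme \<Rightarrow> nat \<Rightarrow> (nat multiset \<Rightarrow> 'a) set \<Rightarrow> bool"
  where "homogeneous_ideal K N J \<longleftrightarrow>
    ideal J (mpoly_ring K N) \<and> (\<forall>f\<in>J. \<forall>d. homogeneous_component K d f \<in> J)"

definition irrelevant_ideal :: "('a, 'c) ring_scheme \<Rightarrow> nat \<Rightarrow> (nat multiset \<Rightarrow> 'a) set"
  where "irrelevant_ideal K N = {f \<in> carrier (mpoly_ring K N). f {#} = \<zero>\<^bsub>K\<^esub>}"

text \<open>A homogeneous ideal \<open>I\<close> stands for the closed subscheme \<open>Proj (K[x\<^sub>0,\<dots>,x\<^sub>N]/I)\<close> of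
  projective \<open>N\<close>-space. Its points (all scheme-theoretic points, not only the closed ones) are
  written as homogeneous primes of \<open>K[x\<^sub>0,\<dots>,x\<^sub>N]\<close> containing \<open>I\<close>.\<close>

definition proj_points ::
  "('a, 'c) ring_scheme \<Rightarrow> nat \<Rightarrow> (nat multiset \<Rightarrow> 'a) set \<Rightarrow> (nat multiset \<Rightarrow> 'a) set set"
  where "proj_points K N I =
    {Q. primeideal Q (mpoly_ring K N) \<and> homogeneous_ideal K N Q \<and> I \<subseteq> Q \<and>
        \<not> irrelevant_ideal K N \<subseteq> Q}"

text \<open>The local ring at \<open>Q\<close>: the degree \<open>0\<close> part of the localization of the graded ring
  \<open>K[x\<^sub>0,\<dots>,x\<^sub>N]/I\<close> at its homogeneous elements outside \<open>Q/I\<close>.\<close>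

definition proj_stalk ::
  "('a, 'c) ring_scheme \<Rightarrow> nat \<Rightarrow> (nat multiset \<Rightarrow> 'a) set \<Rightarrow> (nat multiset \<Rightarrow> 'a) set \<Rightarrow>
    ((nat multiset \<Rightarrow> 'a) set \<times> (nat multiset \<Rightarrow> 'a) set) set ring"
  where "proj_stalk K N I Q =
    (let S = mpoly_ring K N;
         A = S Quot I;
         T = {I +>\<^bsub>S\<^esub> g | g d. homogeneous K N d g \<and> g \<notin> Q}
     in (loc_ring A T)\<lparr>carrier :=
          {fraction A T (self_module A) (I +>\<^bsub>S\<^esub> f) (I +>\<^bsub>S\<^esub> g) | f g d.
             homogeneous K N d f \<and> homogeneous K N d g \<and> g \<notin> Q}\<rparr>)"

definition F_injective_at ::
  "nat \<Rightarrow> ('a, 'c) ring_scheme \<Rightarrow> nat \<Rightarrow> (nat multiset \<Rightarrow> 'a) set \<Rightarrow> (nat multiset \<Rightarrow> 'a) set \<Rightarrow> bool"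
  where "F_injective_at p K N I Q \<longleftrightarrow> F_finite_local_ring.F_injective (proj_stalk K N I Q) p"

definition F_injective_scheme ::
  "nat \<Rightarrow> ('a, 'c) ring_scheme \<Rightarrow> nat \<Rightarrow> (nat multiset \<Rightarrow> 'a) set \<Rightarrow> bool"
  where "F_injective_scheme p K N I \<longleftrightarrow> (\<forall>Q\<in>proj_points K N I. F_injective_at p K N I Q)"

definition zariski_closed ::
  "('a, 'c) ring_scheme \<Rightarrow> nat \<Rightarrow> (nat multiset \<Rightarrow> 'a) set \<Rightarrow> (nat multiset \<Rightarrow> 'a) set set \<Rightarrow> bool"
  where "zariski_closed K N I Z \<longleftrightarrow>
    (\<exists>J. homogeneous_ideal K N J \<and> Z = {Q \<in> proj_points K N I. J \<subseteq> Q})"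

definition irreducible_closed ::
  "('a, 'c) ring_scheme \<Rightarrow> nat \<Rightarrow> (nat multiset \<Rightarrow> 'a) set \<Rightarrow> (nat multiset \<Rightarrow> 'a) set set \<Rightarrow> bool"
  where "irreducible_closed K N I Z \<longleftrightarrow>
    zariski_closed K N I Z \<and> Z \<noteq> {} \<and>
    (\<forall>A B. zariski_closed K N I A \<and> zariski_closed K N I B \<and> Z = A \<union> B \<longrightarrow> Z = A \<or> Z = B)"

definition irreducible_chain ::
  "('a, 'c) ring_scheme \<Rightarrow> nat \<Rightarrow> (nat multiset \<Rightarrow> 'a) set \<Rightarrow> nat \<Rightarrow>
    (nat \<Rightarrow> (nat multiset \<Rightarrow> 'a) set set) \<Rightarrow> bool"
  where "irreducible_chain K N I n Z \<longleftrightarrow>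
    (\<forall>i\<le>n. irreducible_closed K N I (Z i)) \<and> (\<forall>i<n. Z i \<subset> Z (Suc i))"

definition has_dimension ::
  "('a, 'c) ring_scheme \<Rightarrow> nat \<Rightarrow> (nat multiset \<Rightarrow> 'a) set \<Rightarrow> nat \<Rightarrow> bool"
  where "has_dimension K N I n \<longleftrightarrow>
    (\<exists>Z. irreducible_chain K N I n Z) \<and> \<not> (\<exists>Z. irreducible_chain K N I (Suc n) Z)"

text \<open>A surface is an integral scheme of dimension \<open>2\<close>; integral closed subschemes of projective
  space are those given by homogeneous primes not containing the irrelevant ideal.\<close>

definition projective_surface ::
  "('a, 'c) ring_scheme \<Rightarrow> nat \<Rightarrow> (nat multiset \<Rightarrow> 'a) set \<Rightarrow> bool"
  where "projective_surface K N I \<longleftrightarrow>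
    primeideal I (mpoly_ring K N) \<and> homogeneous_ideal K N I \<and> \<not> irrelevant_ideal K N \<subseteq> I \<and>
    has_dimension K N I 2"


section \<open>Hyperplanes\<close>

definition linear_forms :: "('a, 'c) ring_scheme \<Rightarrow> nat \<Rightarrow> (nat multiset \<Rightarrow> 'a) set"
  where "linear_forms K N = {l. homogeneous K N 1 l \<and> l \<noteq> \<zero>\<^bsub>mpoly_ring K N\<^esub>}"

definition hyperplane ::
  "('a, 'c) ring_scheme \<Rightarrow> nat \<Rightarrow> (nat multiset \<Rightarrow> 'a) \<Rightarrow> (nat multiset \<Rightarrow> 'a) set"
  where "hyperplane K N l = PIdl\<^bsub>mpoly_ring K N\<^esub> l"

text \<open>Zariski open sets of hyperplanes (closed points of the dual projective space). The
  homogeneous coordinates of a hyperplane are the coefficients of a linear form defining it; an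
  open set is the complement of the common zeros of a set \<open>G\<close> of homogeneous polynomials.\<close>

definition dual_open ::
  "('a, 'c) ring_scheme \<Rightarrow> nat \<Rightarrow> (nat multiset \<Rightarrow> 'a) set set \<Rightarrow> bool"
  where "dual_open K N U \<longleftrightarrow>
    (\<exists>G. (\<forall>g\<in>G. \<exists>d. homogeneous K N d g) \<and>
      U = {hyperplane K N l | l. l \<in> linear_forms K N \<and>
             (\<exists>g\<in>G. mpoly_eval K g (\<lambda>i. l {#i#}) \<noteq> \<zero>\<^bsub>K\<^esub>)})"

definition hyperplane_section ::
  "('a, 'c) ring_scheme \<Rightarrow> nat \<Rightarrow> (nat multiset \<Rightarrow> 'a) set \<Rightarrow> (nat multiset \<Rightarrow> 'a) set \<Rightarrow>
    (nat multiset \<Rightarrow> 'a) set"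
  where "hyperplane_section K N I H = I <+>\<^bsub>mpoly_ring K N\<^esub> H"

end

theory Submission
  imports Defs
    "HOL-Library.Poly_Mapping" "HOL-Library.Multiset_Order" "HOL-Library.Z2" "HOL-Library.Countable_Set"
    "HOL-Computational_Algebra.Primes" "HOL-Computational_Algebra.Fraction_Field"
    "HOL-Algebra.Algebraic_Closure_Type"
begin

text \<open>Take an algebraically closed field \<open>k\<close> of characteristic \<open>2\<close>. The surface is the closure in
projective \<open>4\<close>-space of the image of
\<open>(x, y) \<mapsto> (1 : x\<^sup>2 + y : x y : x\<^sup>2 y : x y\<^sup>2)\<close>.
On the affine chart \<open>X\<^sub>0 \<noteq> 0\<close> its coordinate ring \<open>R\<close> consists of the polynomials \<open>F\<close> with
\<open>F(x, 0) = F(0, x\<^sup>2)\<close>: the plane is the normalization, with conductor \<open>x y k[x, y]\<close>, and the surface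
is double along a curve \<open>C\<close> onto which the line \<open>x = 0\<close> maps isomorphically and the line \<open>y = 0\<close>
maps by the Frobenius \<open>x \<mapsto> x\<^sup>2\<close>. The defect \<open>\<delta> F = F(x, 0) - F(0, x\<^sup>2)\<close> measures how far \<open>F\<close>
is from \<open>R\<close>; it is linear over \<open>R\<close> acting through restriction to \<open>y = 0\<close>, and
\<open>\<delta> (F\<^sup>2) = (\<delta> F)\<^sup>2\<close>, so that \<open>R\<close> is weakly normal.

A point where \<open>X\<^sub>3\<close> or \<open>X\<^sub>4\<close> does not vanish is F-split: forms of degree \<open>n\<close> become, after
multiplication by a power of that coordinate, all polynomials supported on the \<open>n\<close>-fold multiple
of a polygon, and the splitting that halves exponents and takes roots of coefficients preserves
these polygons (\<open>F_injective_chart\<close>). A point where both coordinates vanish lies on the closure of \<open>C\<close>; it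
is \<open>(0 : 1 : 0 : 0 : 0)\<close> or on the chart. On \<open>C\<close>, weak normality handles local cohomology in degree \<open>1\<close>; in degree
\<open>2\<close> a class that the Frobenius kills is a fraction whose defect is, by unique factorization in
\<open>k[x]\<close>, divisible by the right power of the local parameter of \<open>C\<close>, pulled back to \<open>y = 0\<close>
(\<open>F_injective_generic\<close>, \<open>F_injective_closed\<close>). The argument breaks down only at the branch point
\<open>(1 : 0 : 0 : 0 : 0)\<close>, so at most two points are exceptional.

A general hyperplane meets \<open>C\<close> in a point where the parameter of \<open>C\<close> is \<open>c = \<gamma>\<^sup>2 \<noteq> 0\<close>. Its
equation restricted to the line \<open>y = 0\<close> is a multiple of \<open>x\<^sup>2 - c = (x - \<gamma>)\<^sup>2\<close>, because \<open>y = 0\<close>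
is inseparable over \<open>C\<close>. Hence the section is not weakly normal there: \<open>s = x\<^sup>2 + \<gamma> x\<close> has a
defect that vanishes simply at \<open>\<gamma>\<close>, so \<open>s\<close> is not in the local ring of the section, although
\<open>s\<^sup>2\<close> is and \<open>s\<close> times the maximal ideal is. The class of \<open>s\<close> in the first local cohomology is
therefore nonzero and killed by the Frobenius (\<open>cohomology_map_not_injective\<close>,
\<open>section_not_F_injective\<close>). The fraction \<open>s\<close> is handled as \<open>xys / xy\<close>, whose numerator and
denominator come from the surface.

The remaining work is general: stalks of closed subschemes of projective space over a perfect field
are F-finite Noetherian local rings, and the surface has dimension \<open>2\<close>. A field on the natural
numbers is obtained from the countable algebraic closure of the field with two elements.\<close>

section \<open>Localization\<close>

locale localization = module R M for R (structure) and M (structure) +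
  fixes W
  assumes W_subset: "W \<subseteq> carrier R"
    and W_one: "\<one> \<in> W"
    and W_mult: "\<And>u v. u \<in> W \<Longrightarrow> v \<in> W \<Longrightarrow> u \<otimes> v \<in> W"
begin

abbreviation frac where "frac \<equiv> fraction R W M"
abbreviation LM where "LM \<equiv> loc_module R W M"

lemma W_carrier [simp, intro]: "w \<in> W \<Longrightarrow> w \<in> carrier R"
  using W_subset by blast

lemmas [simp, intro] = W_one W_mult

lemma mem_frac_iff:
  assumes "m \<in> carrier M" "w \<in> W"
  shows "(n, v) \<in> frac m w \<longleftrightarrow>
    n \<in> carrier M \<and> v \<in> W \<and> (\<exists>u\<in>W. (u \<otimes> v) \<odot>\<^bsub>M\<^esub> m = (u \<otimes> w) \<odot>\<^bsub>M\<^esub> n)"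
  using assms by (auto simp: fraction_def smult_assoc1)

lemma frac_refl: "m \<in> carrier M \<Longrightarrow> w \<in> W \<Longrightarrow> (m, w) \<in> frac m w"
  by (auto simp: mem_frac_iff intro!: bexI[of _ \<one>])

lemma smult_trans:
  assumes c: "m \<in> carrier M" "w \<in> W" "n \<in> carrier M" "v \<in> W" "l \<in> carrier M" "t \<in> W" "u \<in> W" "u' \<in> W"
    and 1: "(u \<otimes> v) \<odot>\<^bsub>M\<^esub> m = (u \<otimes> w) \<odot>\<^bsub>M\<^esub> n"
    and 2: "(u' \<otimes> t) \<odot>\<^bsub>M\<^esub> n = (u' \<otimes> v) \<odot>\<^bsub>M\<^esub> l"
  shows "((u \<otimes> u' \<otimes> v) \<otimes> t) \<odot>\<^bsub>M\<^esub> m = ((u \<otimes> u' \<otimes> v) \<otimes> w) \<odot>\<^bsub>M\<^esub> l"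
proof -
  have "((u \<otimes> u' \<otimes> v) \<otimes> t) \<odot>\<^bsub>M\<^esub> m = (u' \<otimes> t) \<odot>\<^bsub>M\<^esub> ((u \<otimes> v) \<odot>\<^bsub>M\<^esub> m)"
    using c by (simp add: smult_assoc1[symmetric] m_ac)
  also have "\<dots> = (u \<otimes> w) \<odot>\<^bsub>M\<^esub> ((u' \<otimes> t) \<odot>\<^bsub>M\<^esub> n)"
    unfolding 1 using c by (simp add: smult_assoc1[symmetric] m_ac)
  also have "\<dots> = ((u \<otimes> u' \<otimes> v) \<otimes> w) \<odot>\<^bsub>M\<^esub> l"
    unfolding 2 using c by (simp add: smult_assoc1[symmetric] m_ac)
  finally show ?thesis .
qed

text \<open>Fractions are classes of the usual equivalence relation; its transitivity is the preceding lemma.\<close>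

lemma frac_eq_iff:
  assumes c: "m \<in> carrier M" "w \<in> W" "n \<in> carrier M" "v \<in> W"
  shows "frac m w = frac n v \<longleftrightarrow> (\<exists>u\<in>W. (u \<otimes> v) \<odot>\<^bsub>M\<^esub> m = (u \<otimes> w) \<odot>\<^bsub>M\<^esub> n)"
proof
  assume "frac m w = frac n v"
  then show "\<exists>u\<in>W. (u \<otimes> v) \<odot>\<^bsub>M\<^esub> m = (u \<otimes> w) \<odot>\<^bsub>M\<^esub> n"
    using frac_refl[OF c(3,4)] c mem_frac_iff[of m w n v] by auto
next
  have sub: "frac m w \<subseteq> frac n v"
    if c: "m \<in> carrier M" "w \<in> W" "n \<in> carrier M" "v \<in> W"
      and ex: "\<exists>u\<in>W. (u \<otimes> v) \<odot>\<^bsub>M\<^esub> m = (u \<otimes> w) \<odot>\<^bsub>M\<^esub> n" for m w n v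
  proof
    fix x assume x: "x \<in> frac m w"
    obtain l t where lt: "x = (l, t)" by force
    obtain u' where u': "u' \<in> W" and c': "l \<in> carrier M" "t \<in> W"
      and 1: "(u' \<otimes> t) \<odot>\<^bsub>M\<^esub> m = (u' \<otimes> w) \<odot>\<^bsub>M\<^esub> l"
      using x c mem_frac_iff[of m w l t] by (auto simp: lt)
    obtain u where u: "u \<in> W" and 2: "(u \<otimes> v) \<odot>\<^bsub>M\<^esub> m = (u \<otimes> w) \<odot>\<^bsub>M\<^esub> n"
      using ex by auto
    have "((u \<otimes> u' \<otimes> w) \<otimes> t) \<odot>\<^bsub>M\<^esub> n = ((u \<otimes> u' \<otimes> w) \<otimes> v) \<odot>\<^bsub>M\<^esub> l"
      by (rule smult_trans[OF c(3,4,1,2) c' u u' 2[symmetric] 1])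
    then show "x \<in> frac n v"
      unfolding lt using c c' u u' mem_frac_iff[of n v l t] by blast
  qed
  assume ex: "\<exists>u\<in>W. (u \<otimes> v) \<odot>\<^bsub>M\<^esub> m = (u \<otimes> w) \<odot>\<^bsub>M\<^esub> n"
  have ex': "\<exists>u\<in>W. (u \<otimes> w) \<odot>\<^bsub>M\<^esub> n = (u \<otimes> v) \<odot>\<^bsub>M\<^esub> m"
    using ex by metis
  show "frac m w = frac n v"
    using sub[OF c ex] sub[OF c(3,4,1,2) ex'] by blast
qed

lemma frac_eqI:
  assumes "m \<in> carrier M" "w \<in> W" "n \<in> carrier M" "v \<in> W" "v \<odot>\<^bsub>M\<^esub> m = w \<odot>\<^bsub>M\<^esub> n"
  shows "frac m w = frac n v"
  using assms by (subst frac_eq_iff) (auto intro!: bexI[of _ \<one>])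

lemma mem_frac_imp_eq:
  assumes "m \<in> carrier M" "w \<in> W" "(n, v) \<in> frac m w"
  shows "n \<in> carrier M" "v \<in> W" "frac n v = frac m w"
  using assms mem_frac_iff[OF assms(1,2)] frac_eq_iff[of m w n v] by auto

text \<open>A union over a class evaluates a function of representatives that does not depend on the choice.\<close>

lemma UN_frac:
  assumes mw: "m \<in> carrier M" "w \<in> W"
    and eq: "\<And>n v. n \<in> carrier M \<Longrightarrow> v \<in> W \<Longrightarrow> frac n v = frac m w \<Longrightarrow> F n v = F m w"
  shows "(\<Union>(n, v)\<in>frac m w. F n v) = F m w"
proof -
  have "F n v = F m w" if "(n, v) \<in> frac m w" for n v
    using eq mem_frac_imp_eq[OF mw that] by blast
  then show ?thesis using frac_refl[OF mw] by blast
qed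

lemma frac_carrier [simp, intro]: "m \<in> carrier M \<Longrightarrow> w \<in> W \<Longrightarrow> frac m w \<in> carrier LM"
  by (auto simp: loc_module_def)

lemma LM_cases:
  assumes "C \<in> carrier LM"
  obtains m w where "m \<in> carrier M" "w \<in> W" "C = frac m w"
  using assms by (auto simp: loc_module_def)

lemma zero_LM: "\<zero>\<^bsub>LM\<^esub> = frac \<zero>\<^bsub>M\<^esub> \<one>"
  by (simp add: loc_module_def)

lemma frac_zero: "w \<in> W \<Longrightarrow> frac \<zero>\<^bsub>M\<^esub> w = \<zero>\<^bsub>LM\<^esub>"
  unfolding zero_LM by (rule frac_eqI) auto

lemma add_LM:
  assumes c: "m \<in> carrier M" "w \<in> W" "n \<in> carrier M" "v \<in> W"
  shows "frac m w \<oplus>\<^bsub>LM\<^esub> frac n v = frac ((v \<odot>\<^bsub>M\<^esub> m) \<oplus>\<^bsub>M\<^esub> (w \<odot>\<^bsub>M\<^esub> n)) (w \<otimes> v)"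
proof -
  let ?F = "\<lambda>m w n v. frac ((v \<odot>\<^bsub>M\<^esub> m) \<oplus>\<^bsub>M\<^esub> (w \<odot>\<^bsub>M\<^esub> n)) (w \<otimes> v)"
  have key: "?F m w n v = ?F m' w' n' v'"
    if c: "m \<in> carrier M" "w \<in> W" "n \<in> carrier M" "v \<in> W"
      and c': "m' \<in> carrier M" "w' \<in> W" "n' \<in> carrier M" "v' \<in> W"
      and eq: "frac m w = frac m' w'" "frac n v = frac n' v'" for m w n v m' w' n' v'
  proof -
    obtain u where u: "u \<in> W" "(u \<otimes> w') \<odot>\<^bsub>M\<^esub> m = (u \<otimes> w) \<odot>\<^bsub>M\<^esub> m'"
      using eq(1) c c' by (auto simp: frac_eq_iff)
    obtain t where t: "t \<in> W" "(t \<otimes> v') \<odot>\<^bsub>M\<^esub> n = (t \<otimes> v) \<odot>\<^bsub>M\<^esub> n'"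
      using eq(2) c c' by (auto simp: frac_eq_iff)
    have "((u \<otimes> t) \<otimes> (w' \<otimes> v')) \<odot>\<^bsub>M\<^esub> ((v \<odot>\<^bsub>M\<^esub> m) \<oplus>\<^bsub>M\<^esub> (w \<odot>\<^bsub>M\<^esub> n)) =
       (t \<otimes> v' \<otimes> v) \<odot>\<^bsub>M\<^esub> ((u \<otimes> w') \<odot>\<^bsub>M\<^esub> m) \<oplus>\<^bsub>M\<^esub> (u \<otimes> w' \<otimes> w) \<odot>\<^bsub>M\<^esub> ((t \<otimes> v') \<odot>\<^bsub>M\<^esub> n)"
      using c c' u(1) t(1) by (simp add: smult_r_distr smult_assoc1[symmetric] m_ac)
    also have "\<dots> = ((u \<otimes> t) \<otimes> (w \<otimes> v)) \<odot>\<^bsub>M\<^esub> ((v' \<odot>\<^bsub>M\<^esub> m') \<oplus>\<^bsub>M\<^esub> (w' \<odot>\<^bsub>M\<^esub> n'))"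
      unfolding u(2) t(2) using c c' u(1) t(1) by (simp add: smult_r_distr smult_assoc1[symmetric] m_ac)
    finally show ?thesis
      using c c' u(1) t(1) by (subst frac_eq_iff) (auto intro!: bexI[of _ "u \<otimes> t"])
  qed
  have 1: "(\<Union>(n', v')\<in>frac n v. ?F m' w' n' v') = ?F m' w' n v"
    if "m' \<in> carrier M" "w' \<in> W" for m' w'
    by (rule UN_frac, (use c in simp)+, rule key) (use that c in auto)
  have 2: "(\<Union>(m', w')\<in>frac m w. \<Union>(n', v')\<in>frac n v. ?F m' w' n' v')
      = (\<Union>(n', v')\<in>frac n v. ?F m w n' v')"
  proof (rule UN_frac[OF c(1,2)])
    fix m' w' assume a: "m' \<in> carrier M" "w' \<in> W" "frac m' w' = frac m w"
    show "(\<Union>(n', v')\<in>frac n v. ?F m' w' n' v') = (\<Union>(n', v')\<in>frac n v. ?F m w n' v')"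
      unfolding 1[OF a(1,2)] 1[OF c(1,2)]
      by (rule key) (use a c in auto)
  qed
  show ?thesis
    using 2 1[OF c(1,2)] by (simp add: loc_module_def)
qed

lemma frac_add_same:
  assumes c: "m \<in> carrier M" "n \<in> carrier M" "w \<in> W"
  shows "frac m w \<oplus>\<^bsub>LM\<^esub> frac n w = frac (m \<oplus>\<^bsub>M\<^esub> n) w"
  unfolding add_LM[OF c(1,3,2,3)] using c
  by (intro frac_eqI) (auto simp: smult_r_distr smult_assoc1[symmetric] m_ac)

lemma frac_expand:
  assumes "m \<in> carrier M" "w \<in> W" "v \<in> W"
  shows "frac m w = frac (v \<odot>\<^bsub>M\<^esub> m) (v \<otimes> w)"
  using assms by (intro frac_eqI) (auto simp: smult_assoc1[symmetric] m_ac)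

lemma common_denominator:
  assumes "C \<in> carrier LM" "D \<in> carrier LM"
  obtains m n w where "m \<in> carrier M" "n \<in> carrier M" "w \<in> W" "C = frac m w" "D = frac n w"
proof -
  obtain m w where c1: "m \<in> carrier M" "w \<in> W" "C = frac m w"
    by (rule LM_cases[OF assms(1)])
  obtain n v where c2: "n \<in> carrier M" "v \<in> W" "D = frac n v"
    by (rule LM_cases[OF assms(2)])
  note c = c1 c2
  show ?thesis
    using c frac_expand[OF c(1,2,5)] frac_expand[OF c(4,5,2)]
    by (intro that[of "v \<odot>\<^bsub>M\<^esub> m" "w \<odot>\<^bsub>M\<^esub> n" "v \<otimes> w"]) (auto simp: m_ac)
qed

lemma LM_abelian_group: "abelian_group LM"
proof (rule abelian_groupI)
  fix C D assume CD: "C \<in> carrier LM" "D \<in> carrier LM"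
  then obtain m n w where c: "m \<in> carrier M" "n \<in> carrier M" "w \<in> W" "C = frac m w" "D = frac n w"
    by (rule common_denominator)
  then show "C \<oplus>\<^bsub>LM\<^esub> D \<in> carrier LM" by (simp add: frac_add_same)
  show "C \<oplus>\<^bsub>LM\<^esub> D = D \<oplus>\<^bsub>LM\<^esub> C" using c by (simp add: frac_add_same M.add.m_comm)
  fix E assume "E \<in> carrier LM"
  then obtain l u where l: "l \<in> carrier M" "u \<in> W" "E = frac l u" by (rule LM_cases)
  define m' n' l' w' where "m' = u \<odot>\<^bsub>M\<^esub> m" and "n' = u \<odot>\<^bsub>M\<^esub> n" and "l' = w \<odot>\<^bsub>M\<^esub> l" and "w' = u \<otimes> w"
  have c': "m' \<in> carrier M" "n' \<in> carrier M" "l' \<in> carrier M" "w' \<in> W"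
    using c l by (auto simp: m'_def n'_def l'_def w'_def)
  have "C = frac m' w'" "D = frac n' w'" "E = frac l' w'"
    using c l frac_expand[of m w u] frac_expand[of n w u] frac_expand[of l u w]
    by (auto simp: m'_def n'_def l'_def w'_def m_ac)
  then show "C \<oplus>\<^bsub>LM\<^esub> D \<oplus>\<^bsub>LM\<^esub> E = C \<oplus>\<^bsub>LM\<^esub> (D \<oplus>\<^bsub>LM\<^esub> E)"
    using c' by (simp add: frac_add_same M.add.m_assoc)
next
  show "\<zero>\<^bsub>LM\<^esub> \<in> carrier LM" by (simp add: zero_LM)
  fix C assume "C \<in> carrier LM"
  then obtain m w where c: "m \<in> carrier M" "w \<in> W" "C = frac m w" by (rule LM_cases)
  show "\<zero>\<^bsub>LM\<^esub> \<oplus>\<^bsub>LM\<^esub> C = C"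
    using c by (simp add: frac_zero[symmetric, of w] frac_add_same)
  show "\<exists>D\<in>carrier LM. D \<oplus>\<^bsub>LM\<^esub> C = \<zero>\<^bsub>LM\<^esub>"
    using c by (intro bexI[of _ "frac (\<ominus>\<^bsub>M\<^esub> m) w"])
      (auto simp: frac_add_same M.l_neg frac_zero)
qed

sublocale LM: abelian_group LM by (rule LM_abelian_group)

end

lemma (in cring) self_module_module: "module R (self_module R)"
proof (rule moduleI)
  show "abelian_group (self_module R)"
    using a_ac add.l_inv_ex by (intro abelian_groupI) (auto simp: self_module_def)
qed (auto simp: self_module_def is_cring m_ac l_distr r_distr)

lemma self_module_simps [simp]:
  "carrier (self_module R) = carrier R"
  "ring.zero (self_module R) = ring.zero R"
  "ring.add (self_module R) = ring.add R"
  "module.smult (self_module R) = monoid.mult R"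
  by (simp_all add: self_module_def)

text \<open>The ring structure on the localization of a ring, read off from representatives.\<close>

locale ring_localization = cring R for R (structure) +
  fixes W
  assumes W_subset': "W \<subseteq> carrier R"
    and W_one': "\<one> \<in> W"
    and W_mult': "\<And>u v. u \<in> W \<Longrightarrow> v \<in> W \<Longrightarrow> u \<otimes> v \<in> W"
begin

sublocale localization R "self_module R" W
  using self_module_module W_subset' W_one' W_mult'
  by (simp add: localization_def localization_axioms_def)

abbreviation LR where "LR \<equiv> loc_ring R W"

lemma LR_simps:
  "carrier LR = carrier LM" "\<zero>\<^bsub>LR\<^esub> = \<zero>\<^bsub>LM\<^esub>" "ring.add LR = ring.add LM" "\<one>\<^bsub>LR\<^esub> = frac \<one> \<one>"
  by (simp_all add: loc_ring_def Let_def)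

lemma frac_ring_eq_iff:
  assumes "a \<in> carrier R" "w \<in> W" "b \<in> carrier R" "v \<in> W"
  shows "frac a w = frac b v \<longleftrightarrow> (\<exists>u\<in>W. u \<otimes> v \<otimes> a = u \<otimes> w \<otimes> b)"
  using assms by (simp add: frac_eq_iff)

lemma LR_cases:
  assumes "C \<in> carrier LR"
  obtains a w where "a \<in> carrier R" "w \<in> W" "C = frac a w"
  using assms LM_cases[of C] by (auto simp: LR_simps)

lemma mult_LR:
  assumes c: "a \<in> carrier R" "w \<in> W" "b \<in> carrier R" "v \<in> W"
  shows "frac a w \<otimes>\<^bsub>LR\<^esub> frac b v = frac (a \<otimes> b) (w \<otimes> v)"
proof -
  let ?F = "\<lambda>m w n v. frac (m \<otimes> n) (w \<otimes> v)"
  have key: "?F m w n v = ?F m' w' n' v'"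
    if c: "m \<in> carrier R" "w \<in> W" "n \<in> carrier R" "v \<in> W"
      and c': "m' \<in> carrier R" "w' \<in> W" "n' \<in> carrier R" "v' \<in> W"
      and eq: "frac m w = frac m' w'" "frac n v = frac n' v'" for m w n v m' w' n' v'
  proof -
    obtain u where u: "u \<in> W" "u \<otimes> w' \<otimes> m = u \<otimes> w \<otimes> m'"
      using eq(1) c c' by (auto simp: frac_ring_eq_iff)
    obtain t where t: "t \<in> W" "t \<otimes> v' \<otimes> n = t \<otimes> v \<otimes> n'"
      using eq(2) c c' by (auto simp: frac_ring_eq_iff)
    have "(u \<otimes> t) \<otimes> (w' \<otimes> v') \<otimes> (m \<otimes> n) = (u \<otimes> w' \<otimes> m) \<otimes> (t \<otimes> v' \<otimes> n)"
      using c c' u(1) t(1) by (simp add: m_ac)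
    also have "\<dots> = (u \<otimes> t) \<otimes> (w \<otimes> v) \<otimes> (m' \<otimes> n')"
      using c c' u(1) t(1) by (simp only: u(2) t(2)) (simp add: m_ac)
    finally show ?thesis
      using c c' u(1) t(1) by (subst frac_ring_eq_iff) (auto intro!: bexI[of _ "u \<otimes> t"])
  qed
  have 1: "(\<Union>(n', v')\<in>frac b v. ?F m' w' n' v') = ?F m' w' b v"
    if "m' \<in> carrier R" "w' \<in> W" for m' w'
  proof (rule UN_frac)
    show "b \<in> carrier (self_module R)" "v \<in> W" using c by auto
    fix n' v' assume "n' \<in> carrier (self_module R)" "v' \<in> W" "frac n' v' = frac b v"
    then show "?F m' w' n' v' = ?F m' w' b v"
      using c that key[of m' w' n' v' m' w' b v] by simp
  qed
  have 2: "(\<Union>(m', w')\<in>frac a w. \<Union>(n', v')\<in>frac b v. ?F m' w' n' v')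
      = (\<Union>(n', v')\<in>frac b v. ?F a w n' v')"
  proof (rule UN_frac)
    show "a \<in> carrier (self_module R)" "w \<in> W" using c by auto
    fix m' w' assume a: "m' \<in> carrier (self_module R)" "w' \<in> W" "frac m' w' = frac a w"
    show "(\<Union>(n', v')\<in>frac b v. ?F m' w' n' v') = (\<Union>(n', v')\<in>frac b v. ?F a w n' v')"
      unfolding 1[OF a(1,2)[simplified]] 1[OF c(1,2)]
      by (rule key) (use a c in auto)
  qed
  show ?thesis
    using 2 1[OF c(1,2)] by (simp add: loc_ring_def Let_def)
qed

lemma add_LR:
  assumes "a \<in> carrier R" "w \<in> W" "b \<in> carrier R" "v \<in> W"
  shows "frac a w \<oplus>\<^bsub>LR\<^esub> frac b v = frac ((v \<otimes> a) \<oplus> (w \<otimes> b)) (w \<otimes> v)"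
  using assms add_LM[of a w b v] by (simp add: LR_simps)

lemma LR_cring: "cring LR"
proof (rule cringI)
  show "abelian_group LR"
    using LM.a_ac LM.add.l_inv_ex by (intro abelian_groupI) (auto simp: LR_simps)
  show "comm_monoid LR"
  proof (rule comm_monoidI)
    fix C D E assume CDE: "C \<in> carrier LR" "D \<in> carrier LR" "E \<in> carrier LR"
    obtain a w where a: "a \<in> carrier R" "w \<in> W" "C = frac a w" by (rule LR_cases[OF CDE(1)])
    obtain b v where b: "b \<in> carrier R" "v \<in> W" "D = frac b v" by (rule LR_cases[OF CDE(2)])
    obtain c t where c: "c \<in> carrier R" "t \<in> W" "E = frac c t" by (rule LR_cases[OF CDE(3)])
    show "C \<otimes>\<^bsub>LR\<^esub> D \<otimes>\<^bsub>LR\<^esub> E = C \<otimes>\<^bsub>LR\<^esub> (D \<otimes>\<^bsub>LR\<^esub> E)"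
      unfolding a(3) b(3) c(3) using a b c by (simp add: mult_LR m_ac)
  next
    fix C D assume CD: "C \<in> carrier LR" "D \<in> carrier LR"
    obtain a w where a: "a \<in> carrier R" "w \<in> W" "C = frac a w" by (rule LR_cases[OF CD(1)])
    obtain b v where b: "b \<in> carrier R" "v \<in> W" "D = frac b v" by (rule LR_cases[OF CD(2)])
    show "C \<otimes>\<^bsub>LR\<^esub> D \<in> carrier LR" "C \<otimes>\<^bsub>LR\<^esub> D = D \<otimes>\<^bsub>LR\<^esub> C"
      unfolding a(3) b(3) using a b by (simp_all add: mult_LR m_ac LR_simps(1))
  next
    fix C assume "C \<in> carrier LR"
    then obtain a w where "a \<in> carrier R" "w \<in> W" "C = frac a w" by (rule LR_cases)
    then show "\<one>\<^bsub>LR\<^esub> \<otimes>\<^bsub>LR\<^esub> C = C" by (simp add: mult_LR LR_simps(4))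
  qed (simp add: LR_simps)
next
  fix C D E assume CDE: "C \<in> carrier LR" "D \<in> carrier LR" "E \<in> carrier LR"
  obtain a b w where c: "a \<in> carrier R" "b \<in> carrier R" "w \<in> W" "C = frac a w" "D = frac b w"
    using CDE(1,2) common_denominator[of C D] by (auto simp: LR_simps(1))
  obtain e t where e: "e \<in> carrier R" "t \<in> W" "E = frac e t" by (rule LR_cases[OF CDE(3)])
  have 1: "C \<oplus>\<^bsub>LR\<^esub> D = frac (a \<oplus> b) w"
    unfolding c(4,5) LR_simps(3) using c frac_add_same[of a b w] by simp
  have 2: "C \<otimes>\<^bsub>LR\<^esub> E \<oplus>\<^bsub>LR\<^esub> D \<otimes>\<^bsub>LR\<^esub> E = frac (a \<otimes> e \<oplus> b \<otimes> e) (w \<otimes> t)"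
    unfolding c(4,5) e(3) LR_simps(3) mult_LR[OF c(1,3) e(1,2)] mult_LR[OF c(2,3) e(1,2)]
    using c e frac_add_same[of "a \<otimes> e" "b \<otimes> e" "w \<otimes> t"] by simp
  show "(C \<oplus>\<^bsub>LR\<^esub> D) \<otimes>\<^bsub>LR\<^esub> E = C \<otimes>\<^bsub>LR\<^esub> E \<oplus>\<^bsub>LR\<^esub> D \<otimes>\<^bsub>LR\<^esub> E"
    unfolding 2 unfolding 1 e(3) using c e by (simp add: mult_LR l_distr)
qed

end

section \<open>The Cech complex\<close>

locale module_map = M: module R M + N: module R N for R (structure) and M and N +
  fixes h
  assumes h_closed [simp, intro]: "m \<in> carrier M \<Longrightarrow> h m \<in> carrier N"
    and h_add: "m \<in> carrier M \<Longrightarrow> n \<in> carrier M \<Longrightarrow> h (m \<oplus>\<^bsub>M\<^esub> n) = h m \<oplus>\<^bsub>N\<^esub> h n"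
    and h_smult: "r \<in> carrier R \<Longrightarrow> m \<in> carrier M \<Longrightarrow> h (r \<odot>\<^bsub>M\<^esub> m) = r \<odot>\<^bsub>N\<^esub> h m"

definition loc_map where
  "loc_map R W N h C = (\<Union>(m, w)\<in>C. fraction R W N (h m) w)"

locale localized_map = module_map R M N h + M: localization R M W + N: localization R N W'
  for R (structure) and M and N and h and W and W' +
  assumes W_sub: "W \<subseteq> W'"
begin

lemma loc_map_frac:
  assumes c: "m \<in> carrier M" "w \<in> W"
  shows "loc_map R W' N h (M.frac m w) = N.frac (h m) w"
  unfolding loc_map_def
proof (rule M.UN_frac[OF c])
  fix n v assume a: "n \<in> carrier M" "v \<in> W" "M.frac n v = M.frac m w"
  then obtain u where u: "u \<in> W" "(u \<otimes> w) \<odot>\<^bsub>M\<^esub> n = (u \<otimes> v) \<odot>\<^bsub>M\<^esub> m"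
    using c by (auto simp: M.frac_eq_iff)
  then have "h ((u \<otimes> w) \<odot>\<^bsub>M\<^esub> n) = h ((u \<otimes> v) \<odot>\<^bsub>M\<^esub> m)" by simp
  then have "(u \<otimes> w) \<odot>\<^bsub>N\<^esub> h n = (u \<otimes> v) \<odot>\<^bsub>N\<^esub> h m"
    using u(1) a c by (simp add: h_smult)
  then show "N.frac (h n) v = N.frac (h m) w"
    using a c u(1) W_sub by (subst N.frac_eq_iff) auto
qed

lemma loc_map_closed:
  assumes "C \<in> carrier M.LM"
  shows "loc_map R W' N h C \<in> carrier N.LM"
proof -
  obtain m w where "m \<in> carrier M" "w \<in> W" "C = M.frac m w" by (rule M.LM_cases[OF assms])
  moreover from this have "w \<in> W'" using W_sub by blast
  ultimately show ?thesis by (simp add: loc_map_frac)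
qed

lemma loc_map_add:
  assumes "C \<in> carrier M.LM" "D \<in> carrier M.LM"
  shows "loc_map R W' N h (C \<oplus>\<^bsub>M.LM\<^esub> D) = loc_map R W' N h C \<oplus>\<^bsub>N.LM\<^esub> loc_map R W' N h D"
proof -
  obtain m n w where c: "m \<in> carrier M" "n \<in> carrier M" "w \<in> W" "C = M.frac m w" "D = M.frac n w"
    by (rule M.common_denominator[OF assms])
  have "w \<in> W'" using c W_sub by auto
  then show ?thesis
    using c by (simp add: M.frac_add_same N.frac_add_same loc_map_frac h_add)
qed

lemma loc_map_zero: "loc_map R W' N h \<zero>\<^bsub>M.LM\<^esub> = \<zero>\<^bsub>N.LM\<^esub>"
  using loc_map_add[of "\<zero>\<^bsub>M.LM\<^esub>" "\<zero>\<^bsub>M.LM\<^esub>"] loc_map_closed[of "\<zero>\<^bsub>M.LM\<^esub>"] by simp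

lemma loc_map_minus:
  assumes "C \<in> carrier M.LM"
  shows "loc_map R W' N h (\<ominus>\<^bsub>M.LM\<^esub> C) = \<ominus>\<^bsub>N.LM\<^esub> loc_map R W' N h C"
  by (rule N.LM.minus_equality[symmetric])
     (use assms loc_map_zero in \<open>simp_all add: loc_map_closed loc_map_add[symmetric] M.LM.l_neg\<close>)

lemma loc_map_finsum:
  assumes "finite A" "\<And>j. j \<in> A \<Longrightarrow> f j \<in> carrier M.LM"
  shows "loc_map R W' N h (finsum M.LM f A) = finsum N.LM (\<lambda>j. loc_map R W' N h (f j)) A"
  using assms
proof (induction A rule: finite_induct)
  case (insert j A)
  then show ?case
    by (simp add: M.LM.finsum_insert N.LM.finsum_insert loc_map_add loc_map_closed Pi_def M.LM.finsum_closed)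
qed (simp add: loc_map_zero)

end

locale cech = module R M for R (structure) and M +
  fixes xs
  assumes xs_carrier: "set xs \<subseteq> carrier R"
begin

lemma nth_xs_closed [simp, intro]: "j < length xs \<Longrightarrow> xs ! j \<in> carrier R"
  using xs_carrier nth_mem by blast

lemma monomials_mono:
  assumes "J \<subseteq> J'" "J' \<subseteq> {..<length xs}"
  shows "monomials R xs J \<subseteq> monomials R xs J'"
proof
  fix w assume "w \<in> monomials R xs J"
  then obtain e :: "nat \<Rightarrow> nat" where w: "w = finprod R (\<lambda>j. (xs ! j) [^] e j) J"
    by (auto simp: monomials_def)
  let ?e = "\<lambda>j. if j \<in> J then e j else 0"
  have fin: "finite J'" using assms finite_subset by blast
  have eq: "finprod R (\<lambda>j. (xs ! j) [^] ?e j) J' = finprod R (\<lambda>j. (xs ! j) [^] e j) J"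
    by (rule finprod_mono_neutral_cong_left[symmetric]) (use fin assms in auto)
  then show "w \<in> monomials R xs J'"
    unfolding w monomials_def by (intro CollectI exI[of _ ?e] conjI eq[symmetric] TrueI)
qed

lemma localization_monomials:
  assumes J: "J \<subseteq> {..<length xs}"
  shows "localization R M (monomials R xs J)"
proof (unfold_locales)
  have cl: "(\<lambda>j. (xs ! j) [^] (e j :: nat)) \<in> J \<rightarrow> carrier R" for e using J by auto
  show "monomials R xs J \<subseteq> carrier R"
    using finprod_closed[OF cl] by (auto simp: monomials_def)
  have "\<one> = finprod R (\<lambda>j. (xs ! j) [^] (0::nat)) J" by simp
  then show "\<one> \<in> monomials R xs J"
    unfolding monomials_def by (intro CollectI exI[of _ "\<lambda>_. 0"] conjI TrueI)
  fix u v assume "u \<in> monomials R xs J" "v \<in> monomials R xs J"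
  then obtain e f :: "nat \<Rightarrow> nat" where
    u: "u = finprod R (\<lambda>j. (xs ! j) [^] e j) J" and v: "v = finprod R (\<lambda>j. (xs ! j) [^] f j) J"
    by (auto simp: monomials_def)
  have "u \<otimes> v = finprod R (\<lambda>j. (xs ! j) [^] e j \<otimes> (xs ! j) [^] f j) J"
    unfolding u v by (rule finprod_multf[symmetric, OF cl cl])
  also have "\<dots> = finprod R (\<lambda>j. (xs ! j) [^] (e j + f j)) J"
    by (rule finprod_cong') (use J in \<open>auto simp: nat_pow_mult\<close>)
  finally show "u \<otimes> v \<in> monomials R xs J"
    unfolding monomials_def by (intro CollectI exI[of _ "\<lambda>j. e j + f j"] conjI TrueI)
qed

lemma restriction:
  assumes "J \<subseteq> J'" "J' \<subseteq> {..<length xs}"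
  shows "localized_map R M M (\<lambda>m. m) (monomials R xs J) (monomials R xs J')"
  using localization_monomials[of J] localization_monomials[of J'] monomials_mono[OF assms] assms
  by (simp add: localized_map_def localized_map_axioms_def module_map_def module_map_axioms_def
        module_axioms)

abbreviation C where "C i \<equiv> cech_cochains R xs M i"
abbreviation LMJ where "LMJ J \<equiv> cech_loc R xs M J"
abbreviation d where "d i \<equiv> cech_diff R xs M i"

lemma cech_index_subset: "J \<in> cech_index xs i \<Longrightarrow> J \<subseteq> {..<length xs}"
  by (simp add: cech_index_def)

lemma cech_index_finite: "J \<in> cech_index xs i \<Longrightarrow> finite J"
  using cech_index_subset finite_subset by blast

lemma cech_index_remove: "J \<in> cech_index xs (Suc i) \<Longrightarrow> j \<in> J \<Longrightarrow> J - {j} \<in> cech_index xs i"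
  using cech_index_finite[of J "Suc i"] by (auto simp: cech_index_def)

lemma LMJ_abelian_group: "J \<in> cech_index xs i \<Longrightarrow> abelian_group (LMJ J)"
  unfolding cech_loc_def
  by (rule localization.LM_abelian_group[OF localization_monomials[OF cech_index_subset]])

lemma C_group: "group (C i)"
  unfolding cech_cochains_def
  by (rule product_group) (auto intro: abelian_group.a_group LMJ_abelian_group)

lemma C_carrier:
  "c \<in> carrier (C i) \<longleftrightarrow> c \<in> (\<Pi>\<^sub>E J\<in>cech_index xs i. carrier (LMJ J))"
  by (simp add: cech_cochains_def product_group_def)

lemma C_mult: "c \<otimes>\<^bsub>C i\<^esub> c' = (\<lambda>J\<in>cech_index xs i. c J \<oplus>\<^bsub>LMJ J\<^esub> c' J)"
  by (simp add: cech_cochains_def product_group_def)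

lemma C_one: "\<one>\<^bsub>C i\<^esub> = (\<lambda>J\<in>cech_index xs i. \<zero>\<^bsub>LMJ J\<^esub>)"
  by (simp add: cech_cochains_def product_group_def)

definition face where
  "face J c j = (let y = loc_map R (monomials R xs J) M (\<lambda>m. m) (c (J - {j}))
         in if even (card {l \<in> J. l < j}) then y else \<ominus>\<^bsub>LMJ J\<^esub> y)"

lemma d_eq: "d i c = (\<lambda>J\<in>cech_index xs (Suc i). finsum (LMJ J) (face J c) J)"
  by (simp add: cech_diff_def face_def[abs_def] loc_map_def)

lemma face_closed:
  assumes c: "c \<in> carrier (C i)" and J: "J \<in> cech_index xs (Suc i)" "j \<in> J"
  shows "face J c j \<in> carrier (LMJ J)"
    and "loc_map R (monomials R xs J) M (\<lambda>m. m) (c (J - {j})) \<in> carrier (LMJ J)"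
proof -
  interpret LJ: abelian_group "LMJ J" by (rule LMJ_abelian_group[OF J(1)])
  interpret r: localized_map R M M "\<lambda>m. m" "monomials R xs (J - {j})" "monomials R xs J"
    by (rule restriction) (use cech_index_subset[OF J(1)] in auto)
  have "c (J - {j}) \<in> carrier (LMJ (J - {j}))"
    using c cech_index_remove[OF J] by (auto simp: C_carrier)
  then show 1: "loc_map R (monomials R xs J) M (\<lambda>m. m) (c (J - {j})) \<in> carrier (LMJ J)"
    using r.loc_map_closed by (simp add: cech_loc_def)
  then show "face J c j \<in> carrier (LMJ J)"
    by (simp add: face_def Let_def)
qed

lemma d_closed:
  assumes c: "c \<in> carrier (C i)"
  shows "d i c \<in> carrier (C (Suc i))"
proof -
  have "finsum (LMJ J) (face J c) J \<in> carrier (LMJ J)" if J: "J \<in> cech_index xs (Suc i)" for J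
    using abelian_monoid.finsum_closed[OF abelian_group.axioms(1)[OF LMJ_abelian_group[OF J]]]
      face_closed(1)[OF c J] by blast
  then show ?thesis by (simp add: C_carrier d_eq)
qed

lemma face_mult:
  assumes c: "c \<in> carrier (C i)" "c' \<in> carrier (C i)" and J: "J \<in> cech_index xs (Suc i)" "j \<in> J"
  shows "face J (c \<otimes>\<^bsub>C i\<^esub> c') j = face J c j \<oplus>\<^bsub>LMJ J\<^esub> face J c' j"
proof -
  interpret LJ: abelian_group "LMJ J" by (rule LMJ_abelian_group[OF J(1)])
  interpret r: localized_map R M M "\<lambda>m. m" "monomials R xs (J - {j})" "monomials R xs J"
    by (rule restriction) (use cech_index_subset[OF J(1)] in auto)
  have cJ: "c (J - {j}) \<in> carrier (LMJ (J - {j}))" "c' (J - {j}) \<in> carrier (LMJ (J - {j}))"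
    using c cech_index_remove[OF J] by (auto simp: C_carrier)
  have "loc_map R (monomials R xs J) M (\<lambda>m. m) ((c \<otimes>\<^bsub>C i\<^esub> c') (J - {j})) =
    loc_map R (monomials R xs J) M (\<lambda>m. m) (c (J - {j})) \<oplus>\<^bsub>LMJ J\<^esub>
    loc_map R (monomials R xs J) M (\<lambda>m. m) (c' (J - {j}))"
    using cJ cech_index_remove[OF J] r.loc_map_add by (simp add: C_mult cech_loc_def)
  then show ?thesis
    using face_closed(2)[OF c(1) J] face_closed(2)[OF c(2) J]
    by (simp add: face_def Let_def LJ.minus_add)
qed

lemma d_hom: "d i \<in> hom (C i) (C (Suc i))"
proof (rule homI)
  fix c c' assume c: "c \<in> carrier (C i)" "c' \<in> carrier (C i)"
  have "finsum (LMJ J) (face J (c \<otimes>\<^bsub>C i\<^esub> c')) J =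
      finsum (LMJ J) (face J c) J \<oplus>\<^bsub>LMJ J\<^esub> finsum (LMJ J) (face J c') J"
    if J: "J \<in> cech_index xs (Suc i)" for J
  proof -
    interpret LJ: abelian_group "LMJ J" by (rule LMJ_abelian_group[OF J(1)])
    have "finsum (LMJ J) (face J (c \<otimes>\<^bsub>C i\<^esub> c')) J =
       finsum (LMJ J) (\<lambda>j. face J c j \<oplus>\<^bsub>LMJ J\<^esub> face J c' j) J"
      by (rule LJ.finsum_cong') (use face_mult[OF c J] face_closed(1)[OF c(1) J]
          face_closed(1)[OF c(2) J] in auto)
    also have "\<dots> = finsum (LMJ J) (face J c) J \<oplus>\<^bsub>LMJ J\<^esub> finsum (LMJ J) (face J c') J"
      by (rule LJ.finsum_addf) (use face_closed(1)[OF c(1) J]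
          face_closed(1)[OF c(2) J] in auto)
    finally show ?thesis .
  qed
  then show "d i (c \<otimes>\<^bsub>C i\<^esub> c') = d i c \<otimes>\<^bsub>C (Suc i)\<^esub> d i c'"
    unfolding d_eq by (subst C_mult[of "Suc i"], intro restrict_ext) simp
qed (rule d_closed)

lemma coboundaries_subgroup: "subgroup (cech_coboundaries R xs M i) (C i)"
proof (cases i)
  case 0
  then show ?thesis using group.triv_subgroup[OF C_group, of 0] by (simp add: cech_coboundaries_def)
next
  case (Suc k)
  interpret group_hom "C k" "C (Suc k)" "d k"
    using d_hom C_group by (simp add: group_hom_def group_hom_axioms_def)
  show ?thesis using img_is_subgroup Suc by (simp add: cech_coboundaries_def)
qed

lemma one_cocycle: "\<one>\<^bsub>C i\<^esub> \<in> cech_cocycles R xs M i"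
proof -
  interpret group_hom "C i" "C (Suc i)" "d i"
    using d_hom C_group by (simp add: group_hom_def group_hom_axioms_def)
  show ?thesis by (simp add: cech_cocycles_def kernel_def)
qed

lemma cocycles_subset: "cech_cocycles R xs M i \<subseteq> carrier (C i)"
  by (auto simp: cech_cocycles_def kernel_def)

lemma local_cohomology_carrier:
  "carrier (local_cohomology R xs M i) =
    {cech_coboundaries R xs M i #>\<^bsub>C i\<^esub> c | c. c \<in> cech_cocycles R xs M i}"
  by (auto simp: local_cohomology_def FactGroup_def RCOSETS_def r_coset_def)

end

locale cech_functor = module_map R M N h + cM: cech R M xs + cN: cech R N xs
  for R (structure) and M and N and h and xs
begin

abbreviation F where "F i \<equiv> cech_map R xs N h i"

lemma localized:
  assumes "J \<subseteq> {..<length xs}"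
  shows "localized_map R M N h (monomials R xs J) (monomials R xs J)"
  using cM.localization_monomials[OF assms] cN.localization_monomials[OF assms]
  by (simp add: localized_map_def localized_map_axioms_def module_map_axioms)

lemma F_eq: "F i c = (\<lambda>J\<in>cech_index xs i. loc_map R (monomials R xs J) N h (c J))"
  by (simp add: cech_map_def loc_map_def)

lemma F_closed:
  assumes c: "c \<in> carrier (cM.C i)"
  shows "F i c \<in> carrier (cN.C i)"
  using c localized_map.loc_map_closed[OF localized[OF cM.cech_index_subset]]
  by (auto simp: cM.C_carrier cN.C_carrier F_eq cech_loc_def)

lemma F_hom: "F i \<in> hom (cM.C i) (cN.C i)"
proof (rule homI)
  fix c c' assume c: "c \<in> carrier (cM.C i)" "c' \<in> carrier (cM.C i)"
  have "loc_map R (monomials R xs J) N h (c J \<oplus>\<^bsub>cM.LMJ J\<^esub> c' J) =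
    loc_map R (monomials R xs J) N h (c J) \<oplus>\<^bsub>cN.LMJ J\<^esub> loc_map R (monomials R xs J) N h (c' J)"
    if J: "J \<in> cech_index xs i" for J
    using localized_map.loc_map_add[OF localized[OF cM.cech_index_subset[OF J]], of "c J" "c' J"] c J
    by (auto simp: cM.C_carrier cech_loc_def)
  then show "F i (c \<otimes>\<^bsub>cM.C i\<^esub> c') = F i c \<otimes>\<^bsub>cN.C i\<^esub> F i c'"
    unfolding F_eq by (subst cN.C_mult, intro restrict_ext) (simp add: cM.C_mult)
qed (rule F_closed)

lemma F_face:
  assumes c: "c \<in> carrier (cM.C i)" and J: "J \<in> cech_index xs (Suc i)" "j \<in> J"
  shows "loc_map R (monomials R xs J) N h (cM.face J c j) = cN.face J (F i c) j"
proof -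
  interpret r: localized_map R M M "\<lambda>m. m" "monomials R xs (J - {j})" "monomials R xs J"
    by (rule cM.restriction) (use cM.cech_index_subset[OF J(1)] in auto)
  interpret s: localized_map R N N "\<lambda>m. m" "monomials R xs (J - {j})" "monomials R xs J"
    by (rule cN.restriction) (use cM.cech_index_subset[OF J(1)] in auto)
  interpret a: localized_map R M N h "monomials R xs J" "monomials R xs J"
    by (rule localized) (use cM.cech_index_subset[OF J(1)] in auto)
  interpret b: localized_map R M N h "monomials R xs (J - {j})" "monomials R xs (J - {j})"
    by (rule localized) (use cM.cech_index_subset[OF J(1)] in auto)
  have J': "J - {j} \<in> cech_index xs i" using cM.cech_index_remove[OF J] .
  then have "c (J - {j}) \<in> carrier (cM.LMJ (J - {j}))"
    using c by (auto simp: cM.C_carrier)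
  then obtain m w where m: "m \<in> carrier M" "w \<in> monomials R xs (J - {j})" "c (J - {j}) = r.M.frac m w"
    unfolding cech_loc_def by (rule r.M.LM_cases)
  have w: "w \<in> monomials R xs J" using m(2) r.W_sub by blast
  have eq: "loc_map R (monomials R xs J) N h (loc_map R (monomials R xs J) M (\<lambda>m. m) (c (J - {j}))) =
     loc_map R (monomials R xs J) N (\<lambda>m. m) (F i c (J - {j}))"
    using m w J' by (simp add: F_eq r.loc_map_frac s.loc_map_frac a.loc_map_frac b.loc_map_frac)
  have "loc_map R (monomials R xs J) M (\<lambda>m. m) (c (J - {j})) \<in> carrier r.N.LM"
    using m w by (simp add: r.loc_map_frac)
  then show ?thesis
    using eq a.loc_map_minus by (simp add: cM.face_def cN.face_def Let_def cech_loc_def)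
qed

lemma F_d:
  assumes c: "c \<in> carrier (cM.C i)"
  shows "F (Suc i) (cM.d i c) = cN.d i (F i c)"
proof -
  have "loc_map R (monomials R xs J) N h (finsum (cM.LMJ J) (cM.face J c) J) =
     finsum (cN.LMJ J) (cN.face J (F i c)) J" if J: "J \<in> cech_index xs (Suc i)" for J
  proof -
    interpret a: localized_map R M N h "monomials R xs J" "monomials R xs J"
      by (rule localized) (use cM.cech_index_subset[OF J(1)] in auto)
    have "loc_map R (monomials R xs J) N h (finsum (cM.LMJ J) (cM.face J c) J) =
       finsum (cN.LMJ J) (\<lambda>j. loc_map R (monomials R xs J) N h (cM.face J c j)) J"
      using a.loc_map_finsum[of J "cM.face J c"] cM.cech_index_finite[OF J] cM.face_closed(1)[OF c J]
      by (simp add: cech_loc_def)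
    also have "\<dots> = finsum (cN.LMJ J) (cN.face J (F i c)) J"
      unfolding cech_loc_def
      by (rule a.N.LM.finsum_cong')
        (use F_face[OF c J] cN.face_closed(1)[OF F_closed[OF c] J] in \<open>auto simp: cech_loc_def\<close>)
    finally show ?thesis .
  qed
  then show ?thesis
    unfolding F_eq[of "Suc i"] cN.d_eq by (intro restrict_ext) (simp add: cM.d_eq)
qed

lemma F_coboundaries:
  assumes "b \<in> cech_coboundaries R xs M i"
  shows "F i b \<in> cech_coboundaries R xs N i"
proof (cases i)
  case 0
  interpret group_hom "cM.C i" "cN.C i" "F i"
    using F_hom cM.C_group cN.C_group by (simp add: group_hom_def group_hom_axioms_def)
  show ?thesis using assms 0 hom_one by (simp add: cech_coboundaries_def)
next
  case (Suc k)
  then show ?thesis using assms F_d F_closed by (auto simp: cech_coboundaries_def)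
qed

lemma local_cohomology_map_coset:
  assumes c: "c \<in> carrier (cM.C i)"
  shows "local_cohomology_map R xs N h i (cech_coboundaries R xs M i #>\<^bsub>cM.C i\<^esub> c) =
    cech_coboundaries R xs N i #>\<^bsub>cN.C i\<^esub> F i c"
proof -
  let ?A = "cech_coboundaries R xs M i" let ?B = "cech_coboundaries R xs N i"
  interpret group_hom "cM.C i" "cN.C i" "F i"
    using F_hom cM.C_group cN.C_group by (simp add: group_hom_def group_hom_axioms_def)
  note sA = cM.coboundaries_subgroup[of i] note sB = cN.coboundaries_subgroup[of i]
  have "?B #>\<^bsub>cN.C i\<^esub> F i (b \<otimes>\<^bsub>cM.C i\<^esub> c) = ?B #>\<^bsub>cN.C i\<^esub> F i c" if "b \<in> ?A" for b
  proof -
    have b: "b \<in> carrier (cM.C i)" using that subgroup.subset[OF sA] by blast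
    have "?B #>\<^bsub>cN.C i\<^esub> F i (b \<otimes>\<^bsub>cM.C i\<^esub> c) = (?B #>\<^bsub>cN.C i\<^esub> F i b) #>\<^bsub>cN.C i\<^esub> F i c"
      using b c subgroup.subset[OF sB] by (simp add: H.coset_mult_assoc)
    also have "?B #>\<^bsub>cN.C i\<^esub> F i b = ?B"
      using F_coboundaries[OF that] sB by (simp add: H.coset_join2 b)
    finally show ?thesis .
  qed
  moreover have "?A \<noteq> {}" using subgroup.one_closed[OF sA] by blast
  ultimately show ?thesis
    unfolding local_cohomology_map_def r_coset_def[of _ ?A] by auto
qed

text \<open>On classes, injectivity is a condition on cochains.\<close>

lemma local_cohomology_map_inj:
  assumes "\<And>c. c \<in> carrier (cM.C i) \<Longrightarrow> F i c \<in> cech_coboundaries R xs N i \<Longrightarrow>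
    c \<in> cech_coboundaries R xs M i"
  shows "inj_on (local_cohomology_map R xs N h i) (carrier (local_cohomology R xs M i))"
proof (rule inj_onI)
  let ?A = "cech_coboundaries R xs M i" let ?B = "cech_coboundaries R xs N i"
  interpret group_hom "cM.C i" "cN.C i" "F i"
    using F_hom cM.C_group cN.C_group by (simp add: group_hom_def group_hom_axioms_def)
  note sA = cM.coboundaries_subgroup[of i] note sB = cN.coboundaries_subgroup[of i]
  fix A B assume XY: "A \<in> carrier (local_cohomology R xs M i)" "B \<in> carrier (local_cohomology R xs M i)"
    and eq: "local_cohomology_map R xs N h i A = local_cohomology_map R xs N h i B"
  obtain a b where a: "a \<in> carrier (cM.C i)" "A = ?A #>\<^bsub>cM.C i\<^esub> a"
    and b: "b \<in> carrier (cM.C i)" "B = ?A #>\<^bsub>cM.C i\<^esub> b"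
    using XY cM.cocycles_subset[of i] by (auto simp: cM.local_cohomology_carrier)
  have "?B #>\<^bsub>cN.C i\<^esub> F i a = ?B #>\<^bsub>cN.C i\<^esub> F i b"
    using eq a b by (simp add: local_cohomology_map_coset)
  then have "F i a \<in> ?B #>\<^bsub>cN.C i\<^esub> F i b"
    using H.rcos_self[OF _ sB] a by auto
  then have "F i a \<otimes>\<^bsub>cN.C i\<^esub> inv\<^bsub>cN.C i\<^esub> F i b \<in> ?B"
    using subgroup.rcos_module_imp[OF sB cN.C_group] b by simp
  then have "F i (a \<otimes>\<^bsub>cM.C i\<^esub> inv\<^bsub>cM.C i\<^esub> b) \<in> ?B"
    using a b by simp
  then have "a \<otimes>\<^bsub>cM.C i\<^esub> inv\<^bsub>cM.C i\<^esub> b \<in> ?A"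
    using assms a b by simp
  then have "a \<in> ?A #>\<^bsub>cM.C i\<^esub> b"
    using subgroup.rcos_module_rev[OF sA cM.C_group] a b by simp
  then show "A = B"
    using G.repr_independence[OF _ b(1) sA] a b by simp
qed

text \<open>A cocycle that is not a coboundary and becomes one is a nonzero class with zero image.\<close>

lemma local_cohomology_map_not_inj:
  assumes "c \<in> cech_cocycles R xs M i" "F i c \<in> cech_coboundaries R xs N i"
    "c \<notin> cech_coboundaries R xs M i"
  shows "\<not> inj_on (local_cohomology_map R xs N h i) (carrier (local_cohomology R xs M i))"
proof
  let ?A = "cech_coboundaries R xs M i" let ?B = "cech_coboundaries R xs N i"
  interpret group_hom "cM.C i" "cN.C i" "F i"
    using F_hom cM.C_group cN.C_group by (simp add: group_hom_def group_hom_axioms_def)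
  note sA = cM.coboundaries_subgroup[of i] note sB = cN.coboundaries_subgroup[of i]
  have c: "c \<in> carrier (cM.C i)" using assms(1) cM.cocycles_subset by blast
  assume "inj_on (local_cohomology_map R xs N h i) (carrier (local_cohomology R xs M i))"
  moreover have "local_cohomology_map R xs N h i (?A #>\<^bsub>cM.C i\<^esub> c) =
      local_cohomology_map R xs N h i (?A #>\<^bsub>cM.C i\<^esub> \<one>\<^bsub>cM.C i\<^esub>)"
    using c assms(2) sB subgroup.subset[OF sB]
    by (simp add: local_cohomology_map_coset H.coset_join2)
  ultimately have "?A #>\<^bsub>cM.C i\<^esub> c = ?A #>\<^bsub>cM.C i\<^esub> \<one>\<^bsub>cM.C i\<^esub>"
    by (rule inj_onD) (use assms(1) cM.one_cocycle in \<open>auto simp: cM.local_cohomology_carrier\<close>)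
  then have "c \<in> ?A #>\<^bsub>cM.C i\<^esub> \<one>\<^bsub>cM.C i\<^esub>" using G.rcos_self[OF c sA] by simp
  then show False using assms(3) G.coset_mult_one[OF subgroup.subset[OF sA]] by simp
qed

end

section \<open>Frobenius and the Cech complex of a subring of a field\<close>

text \<open>Primality of \<open>p\<close> enters only through additivity of the \<open>p\<close>-th power, which is easier to transfer
between rings.\<close>

locale frobenius_ring = cring R for R (structure) +
  fixes p :: nat
  assumes p_pos: "p > 0"
    and frobenius_add: "x \<in> carrier R \<Longrightarrow> y \<in> carrier R \<Longrightarrow> (x \<oplus> y) [^] p = x [^] p \<oplus> y [^] p"
begin

abbreviation "FR \<equiv> frobenius_pushforward p R"

lemma FR_simps [simp]:
  "carrier FR = carrier R" "\<zero>\<^bsub>FR\<^esub> = \<zero>" "ring.add FR = ring.add R"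
  "x \<odot>\<^bsub>FR\<^esub> y = (x [^] p) \<otimes> y"
  by (simp_all add: frobenius_pushforward_def)

lemma FR_module: "module R FR"
proof (rule moduleI)
  show "abelian_group FR"
    using a_ac add.l_inv_ex by (intro abelian_groupI) (auto)
qed (auto simp: is_cring m_ac l_distr r_distr frobenius_add nat_pow_distrib)

lemma frobenius_map: "module_map R (self_module R) FR (\<lambda>x. x [^] p)"
  using self_module_module FR_module
  by (simp add: module_map_def module_map_axioms_def frobenius_add nat_pow_distrib)

lemma frobenius_functor:
  assumes "set xs \<subseteq> carrier R"
  shows "cech_functor R (self_module R) FR (\<lambda>x. x [^] p) xs"
  using self_module_module FR_module frobenius_map assms
  by (simp add: cech_functor_def cech_def cech_axioms_def)

end

text \<open>The value of a fraction \<open>m/w\<close> in a field.\<close>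

definition frac_value :: "('m \<Rightarrow> 'l::field) \<Rightarrow> ('r \<Rightarrow> 'l) \<Rightarrow> ('m \<times> 'r) set \<Rightarrow> 'l" where
  "frac_value \<rho> \<chi> A = (case (SOME x. x \<in> A) of (m, w) \<Rightarrow> \<rho> m / \<chi> w)"

locale valued_localization = localization R M W for R (structure) and M (structure) and W +
  fixes \<rho> :: "'c \<Rightarrow> 'l::field" and \<chi> :: "'a \<Rightarrow> 'l"
  assumes \<rho>_add: "m \<in> carrier M \<Longrightarrow> n \<in> carrier M \<Longrightarrow> \<rho> (m \<oplus>\<^bsub>M\<^esub> n) = \<rho> m + \<rho> n"
    and \<rho>_inj: "inj_on \<rho> (carrier M)"
    and \<rho>_smult: "r \<in> carrier R \<Longrightarrow> m \<in> carrier M \<Longrightarrow> \<rho> (r \<odot>\<^bsub>M\<^esub> m) = \<chi> r * \<rho> m"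
    and \<chi>_mult: "r \<in> carrier R \<Longrightarrow> s \<in> carrier R \<Longrightarrow> \<chi> (r \<otimes> s) = \<chi> r * \<chi> s"
    and \<chi>_nonzero: "w \<in> W \<Longrightarrow> \<chi> w \<noteq> 0"
begin

abbreviation "val \<equiv> frac_value \<rho> \<chi>"

text \<open>If scalars act as nonzero factors in a field, a fraction is determined by its value there, and the
localization becomes a subset of the field.\<close>

lemma frac_eq_iff_val:
  assumes c: "m \<in> carrier M" "w \<in> W" "n \<in> carrier M" "v \<in> W"
  shows "frac m w = frac n v \<longleftrightarrow> \<rho> m / \<chi> w = \<rho> n / \<chi> v"
proof -
  have "frac m w = frac n v \<longleftrightarrow> (\<exists>u\<in>W. \<rho> ((u \<otimes> v) \<odot>\<^bsub>M\<^esub> m) = \<rho> ((u \<otimes> w) \<odot>\<^bsub>M\<^esub> n))"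
    using c by (simp add: frac_eq_iff inj_on_eq_iff[OF \<rho>_inj])
  also have "\<dots> \<longleftrightarrow> (\<exists>u\<in>W. \<chi> v * \<rho> m = \<chi> w * \<rho> n)"
    using c by (intro bex_cong) (auto simp: \<rho>_smult \<chi>_mult \<chi>_nonzero)
  also have "\<dots> \<longleftrightarrow> \<rho> m / \<chi> w = \<rho> n / \<chi> v"
    using c \<chi>_nonzero W_one by (auto simp: field_simps)
  finally show ?thesis .
qed

lemma val_frac:
  assumes c: "m \<in> carrier M" "w \<in> W"
  shows "val (frac m w) = \<rho> m / \<chi> w"
proof -
  obtain n v where nv: "(SOME x. x \<in> frac m w) = (n, v)" by force
  have "(n, v) \<in> frac m w"
    unfolding nv[symmetric] by (rule someI[of "\<lambda>x. x \<in> frac m w"]) (rule frac_refl[OF c])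
  from mem_frac_imp_eq[OF c this] have "\<rho> n / \<chi> v = \<rho> m / \<chi> w"
    using c frac_eq_iff_val by blast
  then show ?thesis by (simp add: frac_value_def nv)
qed

lemma val_inj: "C \<in> carrier LM \<Longrightarrow> D \<in> carrier LM \<Longrightarrow> val C = val D \<Longrightarrow> C = D"
  by (elim LM_cases) (simp add: val_frac frac_eq_iff_val)

lemma val_add:
  assumes "C \<in> carrier LM" "D \<in> carrier LM"
  shows "val (C \<oplus>\<^bsub>LM\<^esub> D) = val C + val D"
  by (rule common_denominator[OF assms])
     (simp add: frac_add_same val_frac \<rho>_add add_divide_distrib)

lemma val_zero: "val \<zero>\<^bsub>LM\<^esub> = 0"
proof -
  have "val \<zero>\<^bsub>LM\<^esub> = val \<zero>\<^bsub>LM\<^esub> + val \<zero>\<^bsub>LM\<^esub>"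
    using val_add[of "\<zero>\<^bsub>LM\<^esub>" "\<zero>\<^bsub>LM\<^esub>"] by (simp only: LM.zero_closed LM.r_zero)
  then show ?thesis by (metis add_cancel_right_right)
qed

lemma val_minus:
  assumes "C \<in> carrier LM"
  shows "val (\<ominus>\<^bsub>LM\<^esub> C) = - val C"
  using val_add[of "\<ominus>\<^bsub>LM\<^esub> C" C] assms by (simp add: LM.l_neg val_zero eq_neg_iff_add_eq_0)

lemma val_finsum:
  assumes "finite A" "\<And>j. j \<in> A \<Longrightarrow> f j \<in> carrier LM"
  shows "val (finsum LM f A) = (\<Sum>j\<in>A. val (f j))"
  using assms by (induction A rule: finite_induct) (simp_all add: val_zero val_add Pi_def)

end

text \<open>The Cech differential, computed on values in a field.\<close>

definition alternating_sum :: "(nat set \<Rightarrow> 'l::ab_group_add) \<Rightarrow> nat set \<Rightarrow> 'l" where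
  "alternating_sum z J = (\<Sum>j\<in>J. if even (card {l \<in> J. l < j}) then z (J - {j}) else - z (J - {j}))"

locale valued_cech = cech R M xs for R (structure) and M (structure) and xs +
  fixes \<rho> :: "'c \<Rightarrow> 'l::field" and \<chi> :: "'a \<Rightarrow> 'l"
  assumes valued: "J \<subseteq> {..<length xs} \<Longrightarrow> valued_localization R M (monomials R xs J) \<rho> \<chi>"
begin

abbreviation "val \<equiv> frac_value \<rho> \<chi>"

definition fractions_at where
  "fractions_at J = {\<rho> m / \<chi> w | m w. m \<in> carrier M \<and> w \<in> monomials R xs J}"

lemma val_d:
  assumes c: "c \<in> carrier (C i)" and J: "J \<in> cech_index xs (Suc i)"
  shows "val (d i c J) = alternating_sum (\<lambda>J. val (c J)) J"
proof -
  interpret V: valued_localization R M "monomials R xs J" \<rho> \<chi>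
    by (rule valued[OF cech_index_subset[OF J]])
  have face: "val (face J c j) =
      (if even (card {l \<in> J. l < j}) then val (c (J - {j})) else - val (c (J - {j})))"
    if j: "j \<in> J" for j
  proof -
    interpret W: valued_localization R M "monomials R xs (J - {j})" \<rho> \<chi>
      using cech_index_subset[OF J] by (intro valued) auto
    interpret r: localized_map R M M "\<lambda>m. m" "monomials R xs (J - {j})" "monomials R xs J"
      by (rule restriction) (use cech_index_subset[OF J] in auto)
    have "c (J - {j}) \<in> carrier (LMJ (J - {j}))"
      using c cech_index_remove[OF J j] by (auto simp: C_carrier)
    then obtain m w where m: "m \<in> carrier M" "w \<in> monomials R xs (J - {j})" "c (J - {j}) = W.frac m w"
      unfolding cech_loc_def by (rule W.LM_cases)
    have "w \<in> monomials R xs J" using m(2) r.W_sub by blast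
    then show ?thesis
      using m by (simp add: face_def Let_def cech_loc_def r.loc_map_frac V.val_frac W.val_frac
          V.val_minus)
  qed
  have "val (d i c J) = (\<Sum>j\<in>J. val (face J c j))"
    using V.val_finsum[OF cech_index_finite[OF J], of "face J c"] face_closed(1)[OF c J] J
    by (simp add: d_eq cech_loc_def)
  also have "\<dots> = alternating_sum (\<lambda>J. val (c J)) J"
    unfolding alternating_sum_def by (rule sum.cong) (simp_all add: face)
  finally show ?thesis .
qed

lemma val_in_fractions:
  assumes "c \<in> carrier (C i)" "J \<in> cech_index xs i"
  shows "val (c J) \<in> fractions_at J"
proof -
  interpret V: valued_localization R M "monomials R xs J" \<rho> \<chi>
    by (rule valued[OF cech_index_subset[OF assms(2)]])
  have "c J \<in> carrier V.LM" using assms by (auto simp: C_carrier cech_loc_def)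
  then show ?thesis by (rule V.LM_cases) (auto simp: V.val_frac fractions_at_def)
qed

lemma cochain_eqI:
  assumes "c \<in> carrier (C i)" "c' \<in> carrier (C i)"
    and "\<And>J. J \<in> cech_index xs i \<Longrightarrow> val (c J) = val (c' J)"
  shows "c = c'"
proof (rule PiE_ext)
  show "c \<in> (\<Pi>\<^sub>E J\<in>cech_index xs i. carrier (LMJ J))" "c' \<in> (\<Pi>\<^sub>E J\<in>cech_index xs i. carrier (LMJ J))"
    using assms by (simp_all add: C_carrier)
  fix J assume J: "J \<in> cech_index xs i"
  interpret V: valued_localization R M "monomials R xs J" \<rho> \<chi>
    by (rule valued[OF cech_index_subset[OF J]])
  show "c J = c' J"
    using assms J by (intro V.val_inj) (auto simp: C_carrier cech_loc_def)
qed

text \<open>Together with the injectivity of values: a cochain is the same as a family of field elements with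
prescribed denominators.\<close>

lemma cochain_exists:
  assumes "\<And>J. J \<in> cech_index xs i \<Longrightarrow> z J \<in> fractions_at J"
  obtains c where "c \<in> carrier (C i)" "\<And>J. J \<in> cech_index xs i \<Longrightarrow> val (c J) = z J"
proof -
  have "\<exists>A. A \<in> carrier (LMJ J) \<and> val A = z J" if J: "J \<in> cech_index xs i" for J
  proof -
    interpret V: valued_localization R M "monomials R xs J" \<rho> \<chi>
      by (rule valued[OF cech_index_subset[OF J]])
    obtain m w where "m \<in> carrier M" "w \<in> monomials R xs J" "z J = \<rho> m / \<chi> w"
      using assms[OF J] by (auto simp: fractions_at_def)
    then show ?thesis by (intro exI[of _ "V.frac m w"]) (simp add: cech_loc_def V.val_frac)
  qed
  then obtain A where A: "\<And>J. J \<in> cech_index xs i \<Longrightarrow> A J \<in> carrier (LMJ J) \<and> val (A J) = z J"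
    by metis
  show ?thesis
    by (rule that[of "restrict A (cech_index xs i)"]) (use A in \<open>auto simp: C_carrier\<close>)
qed

end

locale ring_embedding = cring R for R (structure) +
  fixes \<iota> :: "'a \<Rightarrow> 'l::field"
  assumes \<iota>_add: "x \<in> carrier R \<Longrightarrow> y \<in> carrier R \<Longrightarrow> \<iota> (x \<oplus> y) = \<iota> x + \<iota> y"
    and \<iota>_mult: "x \<in> carrier R \<Longrightarrow> y \<in> carrier R \<Longrightarrow> \<iota> (x \<otimes> y) = \<iota> x * \<iota> y"
    and \<iota>_one: "\<iota> \<one> = 1"
    and \<iota>_inj: "inj_on \<iota> (carrier R)"
begin

lemma \<iota>_zero: "\<iota> \<zero> = 0"
proof -
  have "\<iota> \<zero> = \<iota> \<zero> + \<iota> \<zero>"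
    using \<iota>_add[of \<zero> \<zero>] by (simp only: zero_closed r_zero)
  then show ?thesis by (metis add_cancel_right_right)
qed

lemma \<iota>_eq_0_iff: "x \<in> carrier R \<Longrightarrow> \<iota> x = 0 \<longleftrightarrow> x = \<zero>"
  using \<iota>_inj \<iota>_zero by (metis inj_on_eq_iff zero_closed)

lemma \<iota>_pow: "x \<in> carrier R \<Longrightarrow> \<iota> (x [^] (n::nat)) = \<iota> x ^ n"
  by (induction n) (simp_all add: \<iota>_one \<iota>_mult mult.commute)

lemma \<iota>_finprod:
  assumes "finite A" "\<And>j. j \<in> A \<Longrightarrow> f j \<in> carrier R"
  shows "\<iota> (finprod R f A) = (\<Prod>j\<in>A. \<iota> (f j))"
  using assms by (induction A rule: finite_induct) (simp_all add: \<iota>_one \<iota>_mult Pi_def)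

end

locale frobenius_embedding = ring_embedding R \<iota> for R (structure) and \<iota> :: "'a \<Rightarrow> 'l::field" +
  fixes p :: nat
  assumes p_pos': "p > 0"
    and freshman: "\<And>a b :: 'l. (a + b) ^ p = a ^ p + b ^ p"
begin

sublocale frobenius_ring R p
proof
  fix x y assume "x \<in> carrier R" "y \<in> carrier R"
  then show "(x \<oplus> y) [^] p = x [^] p \<oplus> y [^] p"
    by (intro inj_onD[OF \<iota>_inj]) (simp_all add: \<iota>_add \<iota>_pow freshman)
qed (rule p_pos')

lemma freshman_minus: "(- a :: 'l) ^ p = - (a ^ p)"
  using freshman[of "-a" a] p_pos by (simp add: eq_neg_iff_add_eq_0 zero_power)

lemma freshman_diff: "(a - b :: 'l) ^ p = a ^ p - b ^ p"
  using freshman[of a "-b"] by (simp add: freshman_minus)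

lemma freshman_sum: "(sum f A :: 'l) ^ p = (\<Sum>x\<in>A. f x ^ p)"
  using p_pos by (induction A rule: infinite_finite_induct) (simp_all add: freshman zero_power)

definition loc_at where
  "loc_at xs A J = {a / \<iota> w | a w. a \<in> A \<and> w \<in> monomials R xs J}"

text \<open>A criterion for Frobenius to be injective on local cohomology, for a subring \<open>R\<close> of a field with a
larger subring \<open>S\<close> that has a Frobenius splitting \<open>\<sigma>\<close>. If the \<open>p\<close>-th power of a cochain \<open>c\<close> over \<open>R\<close>
is the boundary of \<open>b\<close>, then \<open>c\<close> is the boundary of \<open>\<sigma> b\<close>, which is a cochain over \<open>S\<close>. All
generators but the first multiply \<open>S\<close> into \<open>R\<close>, so \<open>\<sigma> b\<close> is a cochain over \<open>R\<close> except possibly at the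
index sets \<open>{}\<close> and \<open>{0}\<close>. At \<open>{}\<close> weak normality of \<open>R\<close> in \<open>S\<close> suffices; at \<open>{0}\<close> the last hypothesis
provides an element of \<open>S\<close> by which \<open>\<sigma> b\<close> can be corrected.\<close>

theorem cohomology_map_injective:
  fixes \<sigma> :: "'l \<Rightarrow> 'l"
  assumes xs: "set xs \<subseteq> carrier R" "\<zero> \<notin> set xs"
    and S_sub: "\<iota> ` carrier R \<subseteq> S"
    and S_closed: "\<And>s t. s \<in> S \<Longrightarrow> t \<in> S \<Longrightarrow> s - t \<in> S" "\<And>s t. s \<in> S \<Longrightarrow> t \<in> S \<Longrightarrow> s * t \<in> S"
    and \<sigma>_add: "\<And>a b. \<sigma> (a + b) = \<sigma> a + \<sigma> b"
    and \<sigma>_linear: "\<And>a b. \<sigma> (a ^ p * b) = a * \<sigma> b"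
    and \<sigma>_one: "\<sigma> 1 = 1"
    and \<sigma>_S: "\<And>s. s \<in> S \<Longrightarrow> \<sigma> s \<in> S"
    and weakly_normal: "\<And>s. s \<in> S \<Longrightarrow> s ^ p \<in> \<iota> ` carrier R \<Longrightarrow> s \<in> \<iota> ` carrier R"
    and conductor: "\<And>j s. 0 < j \<Longrightarrow> j < length xs \<Longrightarrow> s \<in> S \<Longrightarrow> \<iota> (xs ! j) * s \<in> \<iota> ` carrier R"
    and defect: "\<And>z g. xs \<noteq> [] \<Longrightarrow> z \<in> loc_at xs S {0} \<Longrightarrow> (\<And>j. j < length xs \<Longrightarrow> g \<in> loc_at xs S {j}) \<Longrightarrow>
        z ^ p - g \<in> loc_at xs (\<iota> ` carrier R) {0} \<Longrightarrow>
        \<exists>g'\<in>S. z - g' \<in> loc_at xs (\<iota> ` carrier R) {0}"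
  shows "inj_on (local_cohomology_map R xs (frobenius_pushforward p R) (\<lambda>x. x [^] p) i)
            (carrier (local_cohomology R xs (self_module R) i))"
proof -
  interpret Fr: cech_functor R "self_module R" FR "\<lambda>x. x [^] p" xs
    by (rule frobenius_functor[OF xs(1)])
  let ?A = "\<iota> ` carrier R"
  have mon: "\<iota> w \<noteq> 0" "w \<in> carrier R" if w: "w \<in> monomials R xs J" and J: "J \<subseteq> {..<length xs}" for w J
  proof -
    have fin: "finite J" using J finite_subset by blast
    have x: "xs ! j \<in> carrier R" "xs ! j \<noteq> \<zero>" if "j \<in> J" for j
      using J that xs by (metis lessThan_iff nth_mem subsetD)+
    obtain e :: "nat \<Rightarrow> nat" where w: "w = finprod R (\<lambda>j. (xs ! j) [^] e j) J"
      using w by (auto simp: monomials_def)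
    have "\<iota> w = (\<Prod>j\<in>J. \<iota> (xs ! j) ^ e j)"
      unfolding w using \<iota>_finprod[OF fin] x by (simp add: \<iota>_pow)
    then show "\<iota> w \<noteq> 0" using x fin by (simp add: \<iota>_eq_0_iff)
    show "w \<in> carrier R" unfolding w using x by (auto intro: finprod_closed)
  qed
  interpret V: valued_cech R "self_module R" xs \<iota> \<iota>
    unfolding valued_cech_def valued_cech_axioms_def
  proof (intro conjI allI impI Fr.cM.cech_axioms)
    fix J assume J: "J \<subseteq> {..<length xs}"
    then show "valued_localization R (self_module R) (monomials R xs J) \<iota> \<iota>"
      using Fr.cM.localization_monomials[OF J] mon(1) \<iota>_inj
      by (auto simp: valued_localization_def valued_localization_axioms_def \<iota>_add \<iota>_mult)
  qed
  interpret F: valued_cech R FR xs \<iota> "\<lambda>r. \<iota> r ^ p"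
    unfolding valued_cech_def valued_cech_axioms_def
  proof (intro conjI allI impI Fr.cN.cech_axioms)
    fix J assume J: "J \<subseteq> {..<length xs}"
    then show "valued_localization R FR (monomials R xs J) \<iota> (\<lambda>r. \<iota> r ^ p)"
      using Fr.cN.localization_monomials[OF J] mon(1) \<iota>_inj
      by (auto simp: valued_localization_def valued_localization_axioms_def \<iota>_add \<iota>_mult
          \<iota>_pow power_mult_distrib)
  qed
  have val_F: "F.val (Fr.F i c J) = V.val (c J) ^ p"
    if c: "c \<in> carrier (Fr.cM.C i)" and J: "J \<in> cech_index xs i" for i c J
  proof -
    interpret l: localized_map R "self_module R" FR "\<lambda>x. x [^] p" "monomials R xs J" "monomials R xs J"
      by (rule Fr.localized[OF Fr.cM.cech_index_subset[OF J]])
    interpret VJ: valued_localization R "self_module R" "monomials R xs J" \<iota> \<iota>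
      by (rule V.valued[OF Fr.cM.cech_index_subset[OF J]])
    interpret FJ: valued_localization R FR "monomials R xs J" \<iota> "\<lambda>r. \<iota> r ^ p"
      by (rule F.valued[OF Fr.cM.cech_index_subset[OF J]])
    have "c J \<in> carrier l.M.LM" using c J by (auto simp: Fr.cM.C_carrier cech_loc_def)
    then obtain m w where "m \<in> carrier R" "w \<in> monomials R xs J" "c J = l.M.frac m w"
      using l.M.LM_cases by (metis self_module_simps(1))
    then show ?thesis
      using J by (simp add: Fr.F_eq l.loc_map_frac VJ.val_frac FJ.val_frac \<iota>_pow power_divide)
  qed
  have subJ: "J \<subseteq> {..<length xs}" if "J \<in> cech_index xs k" for J k
    using that by (simp add: cech_index_def)
  have \<sigma>_zero: "\<sigma> 0 = 0" using \<sigma>_add[of 0 0] by (metis add_0_right add_cancel_right_right)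
  have \<sigma>_minus: "\<sigma> (- a) = - \<sigma> a" for a
    using \<sigma>_add[of a "-a"] by (simp add: \<sigma>_zero eq_neg_iff_add_eq_0 add.commute)
  have \<sigma>_sum: "\<sigma> (sum f A) = (\<Sum>x\<in>A. \<sigma> (f x))" for f and A :: "nat set"
    by (induction A rule: infinite_finite_induct) (simp_all add: \<sigma>_add \<sigma>_zero)
  have \<sigma>_alt: "\<sigma> (alternating_sum z J) = alternating_sum (\<lambda>J. \<sigma> (z J)) J" for z J
    unfolding alternating_sum_def \<sigma>_sum by (rule sum.cong) (simp_all add: \<sigma>_minus)
  have \<sigma>_pow: "\<sigma> (a ^ p) = a" for a using \<sigma>_linear[of a 1] by (simp add: \<sigma>_one)
  have S_zero: "0 \<in> S" using S_sub \<iota>_zero by (metis image_subset_iff zero_closed)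
  have S_one: "1 \<in> S" using S_sub \<iota>_one by (metis image_subset_iff one_closed)
  have S_add: "s + t \<in> S" if "s \<in> S" "t \<in> S" for s t
    using S_closed(1)[OF that(1) S_closed(1)[OF S_zero that(2)]] by simp
  have S_pow: "s ^ n \<in> S" if "s \<in> S" for s n
    by (induction n) (use that S_one S_closed(2) in auto)
  have loc_at_diff: "a - b \<in> loc_at xs S J" if a: "a \<in> loc_at xs S J" and b: "b \<in> loc_at xs S J"
    and J: "J \<subseteq> {..<length xs}" for a b J
  proof -
    obtain s w t v where c: "s \<in> S" "w \<in> monomials R xs J" "a = s / \<iota> w"
      "t \<in> S" "v \<in> monomials R xs J" "b = t / \<iota> v"
      using a b by (auto simp: loc_at_def)
    have "w \<otimes> v \<in> monomials R xs J"
      using localization.W_mult[OF Fr.cM.localization_monomials[OF J]] c by blast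
    moreover have "a - b = (s * \<iota> v - t * \<iota> w) / \<iota> (w \<otimes> v)"
      unfolding c(3,6) using mon[OF c(2) J] mon[OF c(5) J] by (simp add: \<iota>_mult diff_frac_eq)
    moreover have "s * \<iota> v - t * \<iota> w \<in> S"
      using c mon[OF _ J] S_sub by (auto intro!: S_closed)
    ultimately show ?thesis unfolding loc_at_def by blast
  qed
  have mon_pow: "w [^] n \<in> monomials R xs J" if "w \<in> monomials R xs J" "J \<subseteq> {..<length xs}" for w J and n :: nat
    using localization.W_mult[OF Fr.cM.localization_monomials[OF that(2)]]
      localization.W_one[OF Fr.cM.localization_monomials[OF that(2)]] that(1)
    by (induction n) auto
  have loc_at_pow: "a ^ n \<in> loc_at xs S J" if a: "a \<in> loc_at xs S J" and J: "J \<subseteq> {..<length xs}" for a J n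
  proof -
    obtain s w where c: "s \<in> S" "w \<in> monomials R xs J" "a = s / \<iota> w"
      using a by (auto simp: loc_at_def)
    then have "a ^ n = s ^ n / \<iota> (w [^] n)"
      using mon[OF _ J] by (simp add: \<iota>_pow power_divide)
    then show ?thesis unfolding loc_at_def using S_pow[OF c(1)] mon_pow[OF c(2) J] by blast
  qed
  have loc_at_const: "s \<in> loc_at xs S J" if s: "s \<in> S" and J: "J \<subseteq> {..<length xs}" for s J
    unfolding loc_at_def
    using s localization.W_one[OF Fr.cM.localization_monomials[OF J]] \<iota>_one
    by (intro CollectI exI[of _ s] exI[of _ \<one>]) simp
  have loc_at_conductor: "a \<in> loc_at xs ?A J"
    if a: "a \<in> loc_at xs S J" and J: "J \<subseteq> {..<length xs}" and j: "j \<in> J" "0 < j" for a J j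
  proof -
    obtain s w where c: "s \<in> S" "w \<in> monomials R xs J" "a = s / \<iota> w"
      using a by (auto simp: loc_at_def)
    have jl: "j < length xs" using j J by blast
    have x: "xs ! j \<in> carrier R" "xs ! j \<noteq> \<zero>" using jl xs by (metis nth_mem subsetD)+
    have "finprod R (\<lambda>l. (xs ! l) [^] (1::nat)) {j} \<in> monomials R xs {j}"
      unfolding monomials_def by (intro CollectI exI[of _ "\<lambda>_. 1"] conjI refl TrueI)
    then have "xs ! j \<in> monomials R xs {j}" using x by simp
    then have xJ: "xs ! j \<in> monomials R xs J" using Fr.cM.monomials_mono[of "{j}" J] j J by blast
    have "a = (\<iota> (xs ! j) * s) / \<iota> (xs ! j \<otimes> w)"
      using c x mon[OF c(2) J] by (simp add: \<iota>_mult \<iota>_eq_0_iff)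
    moreover have "xs ! j \<otimes> w \<in> monomials R xs J"
      using localization.W_mult[OF Fr.cM.localization_monomials[OF J]] c xJ by blast
    ultimately show ?thesis
      unfolding loc_at_def using conductor[OF j(2) jl c(1)] by blast
  qed
  have V_frac: "V.fractions_at J = loc_at xs ?A J" for J
    by (auto simp: V.fractions_at_def loc_at_def)
  have F_frac: "F.fractions_at J \<subseteq> loc_at xs ?A J" if J: "J \<subseteq> {..<length xs}" for J
  proof
    fix z assume "z \<in> F.fractions_at J"
    then obtain m w where m: "m \<in> carrier R" "w \<in> monomials R xs J" "z = \<iota> m / \<iota> w ^ p"
      by (auto simp: F.fractions_at_def)
    then have "z = \<iota> m / \<iota> (w [^] p)" using mon(2)[OF _ J] by (simp add: \<iota>_pow)
    then show "z \<in> loc_at xs ?A J"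
      unfolding loc_at_def using m mon_pow[OF m(2) J] by blast
  qed
  have A_S: "loc_at xs ?A J \<subseteq> loc_at xs S J" for J
    using S_sub by (auto simp: loc_at_def)
  have \<sigma>_loc: "\<sigma> a \<in> loc_at xs S J" if a: "a \<in> loc_at xs ?A J" and J: "J \<subseteq> {..<length xs}" for a J
  proof -
    have "a \<in> loc_at xs S J" using a A_S by blast
    then obtain s w where c: "s \<in> S" "w \<in> monomials R xs J" "a = s / \<iota> w"
      unfolding loc_at_def by blast
    have w: "\<iota> w \<noteq> 0" "\<iota> w \<in> S" using c mon[OF c(2) J] S_sub by auto
    obtain q where q: "p = Suc q" using p_pos gr0_conv_Suc by blast
    have "a = (inverse (\<iota> w)) ^ p * (s * \<iota> w ^ q)"
      using w c by (simp add: q power_inverse field_simps)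
    then have "\<sigma> a = \<sigma> (s * \<iota> w ^ q) / \<iota> w"
      using \<sigma>_linear[of "inverse (\<iota> w)"] by (simp add: field_simps)
    then show ?thesis
      unfolding loc_at_def using c w S_pow S_closed(2) \<sigma>_S by blast
  qed
  show ?thesis
  proof (rule Fr.local_cohomology_map_inj)
    fix c assume c: "c \<in> carrier (Fr.cM.C i)" and Fc: "Fr.F i c \<in> cech_coboundaries R xs FR i"
    show "c \<in> cech_coboundaries R xs (self_module R) i"
    proof (cases i)
      case 0
      have "V.val (c J) = V.val (\<one>\<^bsub>Fr.cM.C i\<^esub> J)" if J: "J \<in> cech_index xs i" for J
      proof -
        have "V.val (c J) ^ p = F.val (\<one>\<^bsub>Fr.cN.C i\<^esub> J)"
          using Fc val_F[OF c J] 0 by (simp add: cech_coboundaries_def)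
        also have "\<dots> = 0"
          using J valued_localization.val_zero[OF F.valued[OF subJ[OF J]]]
          by (simp add: Fr.cN.C_one cech_loc_def)
        finally have "V.val (c J) = 0" by simp
        then show ?thesis
          using J valued_localization.val_zero[OF V.valued[OF subJ[OF J]]]
          by (simp add: Fr.cM.C_one cech_loc_def)
      qed
      then have "c = \<one>\<^bsub>Fr.cM.C i\<^esub>"
        using c group.is_monoid[OF Fr.cM.C_group] monoid.one_closed by (intro V.cochain_eqI) auto
      then show ?thesis using 0 by (simp add: cech_coboundaries_def)
    next
      case (Suc k)
      obtain e where e: "e \<in> carrier (Fr.cN.C k)" "Fr.F i c = Fr.cN.d k e"
        using Fc Suc by (auto simp: cech_coboundaries_def)
      define \<zeta> \<eta> where "\<zeta> = (\<lambda>J. V.val (c J))" and "\<eta> = (\<lambda>J. F.val (e J))"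
      define f where "f = (\<lambda>J. \<sigma> (\<eta> J))"
      have \<eta>: "\<eta> J \<in> loc_at xs ?A J" if "J \<in> cech_index xs k" for J
        using F.val_in_fractions[OF e(1) that] F_frac[OF subJ[OF that]] by (auto simp: \<eta>_def)
      have f: "f J \<in> loc_at xs S J" if "J \<in> cech_index xs k" for J
        using \<sigma>_loc[OF \<eta>[OF that] subJ[OF that]] by (simp add: f_def)
      have \<zeta>p: "\<zeta> J ^ p = alternating_sum \<eta> J" if J: "J \<in> cech_index xs (Suc k)" for J
        using val_F[of c i J] c J e F.val_d[OF e(1) J] Suc by (simp add: \<zeta>_def \<eta>_def)
      have \<zeta>: "\<zeta> J = alternating_sum f J" if J: "J \<in> cech_index xs (Suc k)" for J
        using \<sigma>_alt[of \<eta> J] \<sigma>_pow[of "\<zeta> J"] \<zeta>p[OF J] by (simp add: f_def)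
      have "\<exists>f'. (\<forall>J\<in>cech_index xs k. f' J \<in> loc_at xs ?A J) \<and>
        (\<forall>J\<in>cech_index xs (Suc k). alternating_sum f' J = \<zeta> J)"
      proof (cases "xs = []")
        case True
        have "0 \<in> loc_at xs ?A J" if "J \<in> cech_index xs k" for J
          using localization.W_one[OF Fr.cM.localization_monomials[OF subJ[OF that]]] \<iota>_zero
          unfolding loc_at_def by (intro CollectI exI[of _ 0] exI[of _ \<one>]) force
        then show ?thesis
          using True by (intro exI[of _ "\<lambda>_. 0"]) (auto simp: cech_index_def)
      next
        case xs_ne: False
        then have 0: "0 < length xs" by simp
        consider "k = 0" | "k = 1" | "k \<ge> 2" by linarith
        then show ?thesis
        proof cases
          case 1
          have idx: "{0} \<in> cech_index xs (Suc k)" "{} \<in> cech_index xs k"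
            using 0 1 by (auto simp: cech_index_def)
          have "f {} = \<zeta> {0}" "\<zeta> {0} ^ p = \<eta> {}"
            using \<zeta>[OF idx(1)] \<zeta>p[OF idx(1)] by (simp_all add: alternating_sum_def)
          moreover have loc0: "loc_at xs B {} = B" for B
            by (auto simp: loc_at_def monomials_def \<iota>_one)
          ultimately have "f {} \<in> ?A"
            using weakly_normal f[OF idx(2)] \<eta>[OF idx(2)] by simp
          then have "f J \<in> loc_at xs ?A J" if "J \<in> cech_index xs k" for J
            using that 1 loc0 by (auto simp: cech_index_def finite_subset[of J "{..<length xs}"])
          then show ?thesis using \<zeta> by auto
        next
          case 2
          have idx1: "{j} \<in> cech_index xs k" if "j < length xs" for j
            using that 2 by (auto simp: cech_index_def)
          have pair: "alternating_sum h {a, b} = h {b} - h {a}" if "a < b" for h :: "nat set \<Rightarrow> 'l" and a b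
          proof -
            have sets: "{l \<in> {a, b}. l < a} = {}" "{l \<in> {a, b}. l < b} = {a}"
              "{a, b} - {a} = {b}" "{a, b} - {b} = {a}"
              using that by auto
            have "alternating_sum h {a, b} = (\<Sum>j\<in>{a, b}. if j = a then h {b} else - h {a})"
              unfolding alternating_sum_def
            proof (rule sum.cong[OF refl])
              fix j assume "j \<in> {a, b}"
              then consider "j = a" | "j = b" by blast
              then show "(if even (card {l \<in> {a, b}. l < j}) then h ({a, b} - {j}) else - h ({a, b} - {j}))
                = (if j = a then h {b} else - h {a})"
                by cases (use that in \<open>simp_all only: sets\<close>, simp_all)
            qed
            then show ?thesis using that by simp
          qed
          define g where "g = f {0} ^ p - \<eta> {0}"
          have g_eq: "g = f {j} ^ p - \<eta> {j}" if "j < length xs" for j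
          proof (cases "j = 0")
            case False
            have idx2: "{0, j} \<in> cech_index xs (Suc k)"
              using that 0 2 False by (auto simp: cech_index_def)
            have "(f {j} - f {0}) ^ p = \<eta> {j} - \<eta> {0}"
              using \<zeta>[OF idx2] \<zeta>p[OF idx2] False by (simp add: pair)
            then show ?thesis by (simp add: g_def freshman_diff algebra_simps)
          qed (simp add: g_def)
          have "\<exists>g'\<in>S. f {0} - g' \<in> loc_at xs ?A {0}"
          proof (rule defect[OF xs_ne f[OF idx1[OF 0]]])
            fix j assume j: "j < length xs"
            show "g \<in> loc_at xs S {j}"
              unfolding g_eq[OF j] using j f[OF idx1[OF j]] \<eta>[OF idx1[OF j]] A_S
              by (intro loc_at_diff loc_at_pow) auto
          next
            show "f {0} ^ p - g \<in> loc_at xs ?A {0}"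
              using \<eta>[OF idx1[OF 0]] by (simp add: g_def)
          qed
          then obtain g' where g': "g' \<in> S" "f {0} - g' \<in> loc_at xs ?A {0}" by blast
          have "f J - g' \<in> loc_at xs ?A J" if J: "J \<in> cech_index xs k" for J
          proof -
            obtain j where j: "J = {j}" "j < length xs"
              using J 2 by (auto simp: cech_index_def card_1_singleton_iff)
            show ?thesis
            proof (cases "j = 0")
              case False
              have "f J - g' \<in> loc_at xs S J"
                using f[OF J] loc_at_const[OF g'(1) subJ[OF J]] subJ[OF J] by (rule loc_at_diff)
              then show ?thesis
                using False j subJ[OF J] by (intro loc_at_conductor[of _ J j]) auto
            qed (use g' j in simp)
          qed
          moreover have "alternating_sum (\<lambda>J. f J - g') J = \<zeta> J" if J: "J \<in> cech_index xs (Suc k)" for J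
          proof -
            have "card J = 2" using J 2 by (simp add: cech_index_def)
            then obtain x y where xy: "J = {x, y}" "x \<noteq> y" by (auto simp: card_2_iff)
            then have "J = {min x y, max x y}" "min x y < max x y" by (auto simp: min_def max_def)
            then obtain a b where ab: "J = {a, b}" "a < b" by blast
            show ?thesis unfolding \<zeta>[OF J] unfolding ab(1) by (simp add: pair[OF ab(2)])
          qed
          ultimately show ?thesis by (intro exI[of _ "\<lambda>J. f J - g'"]) auto
        next
          case 3
          have "f J \<in> loc_at xs ?A J" if J: "J \<in> cech_index xs k" for J
          proof -
            have "\<not> J \<subseteq> {0}"
              using J 3 card_mono[of "{0::nat}" J] by (auto simp: cech_index_def)
            then obtain j where "j \<in> J" "0 < j" by auto
            then show ?thesis using loc_at_conductor[OF f[OF J] subJ[OF J]] by blast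
          qed
          then show ?thesis using \<zeta> by auto
        qed
      qed
      then obtain f' where f': "\<And>J. J \<in> cech_index xs k \<Longrightarrow> f' J \<in> loc_at xs ?A J"
        "\<And>J. J \<in> cech_index xs (Suc k) \<Longrightarrow> alternating_sum f' J = \<zeta> J" by blast
      obtain c' where c': "c' \<in> carrier (Fr.cM.C k)" "\<And>J. J \<in> cech_index xs k \<Longrightarrow> V.val (c' J) = f' J"
        using V.cochain_exists[of k f'] f'(1) by (auto simp: V_frac)
      have "Fr.cM.d k c' = c"
      proof (rule V.cochain_eqI)
        show "Fr.cM.d k c' \<in> carrier (Fr.cM.C (Suc k))" using Fr.cM.d_closed[OF c'(1)] .
        show "c \<in> carrier (Fr.cM.C (Suc k))" using c Suc by simp
        fix J assume J: "J \<in> cech_index xs (Suc k)"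
        have "V.val (Fr.cM.d k c' J) = alternating_sum (\<lambda>J. V.val (c' J)) J"
          by (rule V.val_d[OF c'(1) J])
        also have "\<dots> = alternating_sum f' J"
          unfolding alternating_sum_def
          by (rule sum.cong) (use c'(2)[OF Fr.cM.cech_index_remove[OF J]] in auto)
        also have "\<dots> = V.val (c J)" using f'(2)[OF J] by (simp add: \<zeta>_def)
        finally show "V.val (Fr.cM.d k c' J) = V.val (c J)" .
      qed
      then show ?thesis using c'(1) Suc by (auto simp: cech_coboundaries_def)
    qed
  qed
qed

end

section \<open>Local cohomology classes killed by Frobenius\<close>

context frobenius_ring
begin

text \<open>An element killed by powers of finitely many generators has a nonzero multiple killed by the
generators themselves: multiply by each generator as often as the product stays nonzero.\<close>

lemma annihilated_multiple:
  assumes "set xs \<subseteq> carrier R" "b \<in> carrier R" "b \<noteq> \<zero>"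
    and "\<And>x. x \<in> set xs \<Longrightarrow> \<exists>n::nat. x [^] n \<otimes> b = \<zero>"
  shows "\<exists>r\<in>carrier R. r \<otimes> b \<noteq> \<zero> \<and> (\<forall>x\<in>set xs. x \<otimes> (r \<otimes> b) = \<zero>)"
  using assms
proof (induction xs arbitrary: b)
  case Nil
  then show ?case by (intro bexI[of _ \<one>]) auto
next
  case (Cons x xs)
  have x: "x \<in> carrier R" using Cons.prems(1) by simp
  note b = Cons.prems(2)
  define n where "n = (LEAST n::nat. x [^] n \<otimes> b = \<zero>)"
  have n: "x [^] n \<otimes> b = \<zero>"
    unfolding n_def by (rule LeastI_ex) (use Cons.prems(4) in simp)
  have "n \<noteq> 0" using n Cons.prems(2,3) by (metis l_one nat_pow_0)
  then obtain k where k: "n = Suc k" using not0_implies_Suc by blast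
  define c where "c = x [^] k \<otimes> b"
  have c: "c \<in> carrier R" using x b by (simp add: c_def)
  have c0: "c \<noteq> \<zero>"
    using not_less_Least[of k "\<lambda>n. x [^] n \<otimes> b = \<zero>"] k by (auto simp: c_def n_def)
  have xc: "x \<otimes> c = \<zero>"
    using n x b by (simp add: c_def k m_ac)
  have "\<exists>r\<in>carrier R. r \<otimes> c \<noteq> \<zero> \<and> (\<forall>y\<in>set xs. y \<otimes> (r \<otimes> c) = \<zero>)"
  proof (rule Cons.IH[OF _ c c0])
    fix y assume y: "y \<in> set xs"
    then have yc: "y \<in> carrier R" using Cons.prems(1) by auto
    obtain m :: nat where m: "y [^] m \<otimes> b = \<zero>" using Cons.prems(4)[of y] y by auto
    have "y [^] m \<otimes> c = x [^] k \<otimes> (y [^] m \<otimes> b)"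
      using x b yc by (simp add: c_def m_ac)
    then show "\<exists>n::nat. y [^] n \<otimes> c = \<zero>" using m x by auto
  qed (use Cons.prems(1) in simp)
  then obtain r where r: "r \<in> carrier R" "r \<otimes> c \<noteq> \<zero>" "\<forall>y\<in>set xs. y \<otimes> (r \<otimes> c) = \<zero>" by blast
  have "x \<otimes> (r \<otimes> c) = r \<otimes> (x \<otimes> c)" using x r(1) c by (simp add: m_ac)
  then have "x \<otimes> (r \<otimes> c) = \<zero>" using xc r(1) by simp
  moreover have "r \<otimes> c = (r \<otimes> x [^] k) \<otimes> b" using r(1) x b by (simp add: c_def m_ac)
  ultimately show ?case
    using r x by (intro bexI[of _ "r \<otimes> x [^] k"]) auto
qed

text \<open>The fraction \<open>a/d\<close> lies in the localization at each generator \<open>x\<close>, where it is \<open>e/x\<close>. These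
local descriptions form a cocycle of degree \<open>1\<close> whose \<open>p\<close>-th power comes from the global element
\<open>r\<close>. If the cocycle were the boundary of \<open>s\<close>, then \<open>a - d s\<close> would be torsion, and a nonzero
multiple of it would be killed by all generators, hence by the regular element \<open>d\<close>.\<close>

theorem cohomology_map_not_injective:
  assumes xs: "set xs \<subseteq> carrier R" and d: "d \<in> Idl (set xs)"
    and regular: "\<And>r. r \<in> carrier R \<Longrightarrow> d \<otimes> r = \<zero> \<Longrightarrow> r = \<zero>"
    and a: "a \<in> carrier R" "\<And>s. s \<in> carrier R \<Longrightarrow> a \<noteq> d \<otimes> s"
    and absorbs: "\<And>x. x \<in> set xs \<Longrightarrow> \<exists>e\<in>carrier R. a \<otimes> x = d \<otimes> e"
    and pth_power: "r \<in> carrier R" "a [^] p = d [^] p \<otimes> r"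
  shows "\<not> inj_on (local_cohomology_map R xs (frobenius_pushforward p R) (\<lambda>x. x [^] p) 1)
            (carrier (local_cohomology R xs (self_module R) 1))"
proof -
  interpret Fr: cech_functor R "self_module R" FR "\<lambda>x. x [^] p" xs
    by (rule frobenius_functor[OF xs])
  let ?x = "\<lambda>j. xs ! j" and ?W = "monomials R xs"
  have dR: "d \<in> carrier R" using d genideal_ideal[OF xs] ideal.Icarr by metis
  have cancel: "u = v" if "u \<in> carrier R" "v \<in> carrier R" "d \<otimes> u = d \<otimes> v" for u v
  proof -
    have "d \<otimes> (u \<ominus> v) = \<zero>" using that dR by (simp add: r_minus minus_eq r_distr r_neg)
    then show ?thesis using regular[of "u \<ominus> v"] that by (simp add: r_right_minus_eq)
  qed
  have cancel_pow: "u = v" if "u \<in> carrier R" "v \<in> carrier R" "d [^] (n::nat) \<otimes> u = d [^] n \<otimes> v" for u v n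
    using that
  proof (induction n)
    case (Suc n)
    have "d \<otimes> (d [^] n \<otimes> u) = d \<otimes> (d [^] n \<otimes> v)" using Suc.prems dR by (simp add: m_ac)
    then show ?case using Suc dR by (meson cancel m_closed nat_pow_closed)
  qed simp
  have x: "?x j \<in> carrier R" if "j < length xs" for j using that xs nth_mem by blast
  have "\<exists>e. e \<in> carrier R \<and> a \<otimes> ?x j = d \<otimes> e" if "j < length xs" for j
    using absorbs[of "?x j"] that by auto
  then obtain e where e: "\<And>j. j < length xs \<Longrightarrow> e j \<in> carrier R"
    and ae: "\<And>j. j < length xs \<Longrightarrow> a \<otimes> ?x j = d \<otimes> e j" by metis
  have ep: "e j [^] p = ?x j [^] p \<otimes> r" if j: "j < length xs" for j
  proof (rule cancel_pow)
    show "d [^] p \<otimes> e j [^] p = d [^] p \<otimes> (?x j [^] p \<otimes> r)"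
      using arg_cong[OF ae[OF j], of "\<lambda>z. z [^] p"] x[OF j] e[OF j] dR a(1) pth_power
      by (simp add: nat_pow_distrib m_ac)
  qed (use x[OF j] e[OF j] pth_power in auto)
  have W: "localization R (self_module R) (?W J)" if "J \<subseteq> {..<length xs}" for J
    by (rule Fr.cM.localization_monomials[OF that])
  have WF: "localization R FR (?W J)" if "J \<subseteq> {..<length xs}" for J
    by (rule Fr.cN.localization_monomials[OF that])
  have xW: "?x j \<in> ?W {j}" if "j < length xs" for j
  proof -
    have "finprod R (\<lambda>l. (xs ! l) [^] (1::nat)) {j} \<in> ?W {j}"
      unfolding monomials_def by (intro CollectI exI[of _ "\<lambda>_. 1"] conjI refl TrueI)
    then show ?thesis using x[OF that] by simp
  qed
  have idx1: "J \<in> cech_index xs (Suc 0) \<longleftrightarrow> (\<exists>j<length xs. J = {j})" for J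
    by (auto simp: cech_index_def card_1_singleton_iff)
  have idx0: "cech_index xs 0 = {{}}"
    by (auto simp: cech_index_def finite_subset)
  define c where "c = (\<lambda>J\<in>cech_index xs 1. fraction R (?W J) (self_module R) (e (the_elem J)) (?x (the_elem J)))"
  have c_eq: "c {j} = fraction R (?W {j}) (self_module R) (e j) (?x j)" if "j < length xs" for j
    using that idx1[of "{j}"] by (simp add: c_def)
  have cC: "c \<in> carrier (Fr.cM.C 1)"
    unfolding Fr.cM.C_carrier
  proof (rule PiE_I)
    fix J assume "J \<in> cech_index xs 1"
    then obtain j where j: "j < length xs" "J = {j}" using idx1 by auto
    interpret L: localization R "self_module R" "?W {j}" by (rule W) (use j in auto)
    show "c J \<in> carrier (Fr.cM.LMJ J)"
      using L.frac_carrier e[OF j(1)] xW[OF j(1)] j c_eq[OF j(1)] by (simp add: cech_loc_def)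
  qed (simp add: c_def)
  have cocycle: "c \<in> cech_cocycles R xs (self_module R) 1"
  proof -
    have "finsum (Fr.cM.LMJ J) (Fr.cM.face J c) J = \<zero>\<^bsub>Fr.cM.LMJ J\<^esub>" if J: "J \<in> cech_index xs (Suc 1)" for J
    proof -
      have "card J = 2" using J by (simp add: cech_index_def)
      then obtain x' y where xy: "J = {x', y}" "x' \<noteq> y" by (auto simp: card_2_iff)
      then have "J = {min x' y, max x' y}" "min x' y < max x' y" by (auto simp: min_def max_def)
      then obtain j k where jk: "J = {j, k}" "j < k" by blast
      have l: "j < length xs" "k < length xs" "J \<subseteq> {..<length xs}" using J jk by (auto simp: cech_index_def)
      interpret L: localization R "self_module R" "?W J" by (rule W[OF l(3)])
      have sets: "{l \<in> J. l < j} = {}" "{l \<in> J. l < k} = {j}" "J - {j} = {k}" "J - {k} = {j}"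
        using jk by auto
      interpret r1: localized_map R "self_module R" "self_module R" "\<lambda>m. m" "?W {j}" "?W J"
        by (rule Fr.cM.restriction) (use l jk in auto)
      interpret r2: localized_map R "self_module R" "self_module R" "\<lambda>m. m" "?W {k}" "?W J"
        by (rule Fr.cM.restriction) (use l jk in auto)
      have xJ: "?x j \<in> ?W J" "?x k \<in> ?W J" using xW l r1.W_sub r2.W_sub by blast+
      have "?x j \<otimes> e k = ?x k \<otimes> e j"
      proof (rule cancel)
        have "d \<otimes> (?x j \<otimes> e k) = ?x j \<otimes> (a \<otimes> ?x k)"
          using ae[OF l(2)] x e l dR by (simp add: m_lcomm)
        also have "\<dots> = ?x k \<otimes> (a \<otimes> ?x j)" using a(1) x l by (simp add: m_ac)
        also have "\<dots> = d \<otimes> (?x k \<otimes> e j)"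
          using ae[OF l(1)] x e l dR by (simp add: m_lcomm)
        finally show "d \<otimes> (?x j \<otimes> e k) = d \<otimes> (?x k \<otimes> e j)" .
      qed (use x e l in auto)
      then have eq: "L.frac (e j) (?x j) = L.frac (e k) (?x k)"
        using e x l xJ by (intro L.frac_eqI) auto
      have f: "Fr.cM.face J c j = L.frac (e k) (?x k)" "Fr.cM.face J c k = \<ominus>\<^bsub>L.LM\<^esub> L.frac (e j) (?x j)"
        unfolding Fr.cM.face_def sets
        using c_eq l r1.loc_map_frac[of "e j" "?x j"] r2.loc_map_frac[of "e k" "?x k"] e xW
        by (simp_all add: Let_def cech_loc_def)
      have "finsum L.LM (Fr.cM.face J c) {j, k} = Fr.cM.face J c j \<oplus>\<^bsub>L.LM\<^esub> Fr.cM.face J c k"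
        using jk(2) e l xJ by (subst L.LM.finsum_insert) (auto simp: f)
      then show ?thesis
        using e l xJ by (simp add: jk(1)[symmetric] f eq L.LM.r_neg cech_loc_def)
    qed
    then have "Fr.cM.d 1 c = \<one>\<^bsub>Fr.cM.C (Suc 1)\<^esub>"
      unfolding Fr.cM.d_eq Fr.cM.C_one by (intro restrict_ext) simp
    then show ?thesis using cC by (simp add: cech_cocycles_def kernel_def)
  qed
  have sets: "{l \<in> {j}. l < j} = {}" "{j} - {j} = {}" for j :: nat by auto
  have d0: "Fr.cM.d 0 b {j} = fraction R (?W {j}) (self_module R) m \<one>"
    if b: "b {} = fraction R (?W {}) (self_module R) m \<one>" and m: "m \<in> carrier R" and j: "j < length xs" for b m j
  proof -
    interpret L: localization R "self_module R" "?W {j}" by (rule W) (use j in auto)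
    interpret r: localized_map R "self_module R" "self_module R" "\<lambda>m. m" "?W {}" "?W {j}"
      by (rule Fr.cM.restriction) (use j in auto)
    have "Fr.cM.face {j} b j = L.frac m \<one>"
      unfolding Fr.cM.face_def sets using r.loc_map_frac[of m \<one>] m b by (simp add: Let_def)
    then show ?thesis
      using idx1[of "{j}"] j m by (simp add: Fr.cM.d_eq cech_loc_def L.LM.finsum_insert)
  qed
  have d0F: "Fr.cN.d 0 b {j} = fraction R (?W {j}) FR m \<one>"
    if b: "b {} = fraction R (?W {}) FR m \<one>" and m: "m \<in> carrier R" and j: "j < length xs" for b m j
  proof -
    interpret L: localization R FR "?W {j}" by (rule WF) (use j in auto)
    interpret r: localized_map R FR FR "\<lambda>m. m" "?W {}" "?W {j}"
      by (rule Fr.cN.restriction) (use j in auto)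
    have "Fr.cN.face {j} b j = L.frac m \<one>"
      unfolding Fr.cN.face_def sets using r.loc_map_frac[of m \<one>] m b by (simp add: Let_def)
    then show ?thesis
      using idx1[of "{j}"] j m by (simp add: Fr.cN.d_eq cech_loc_def L.LM.finsum_insert)
  qed
  have W0: "?W {} = {\<one>}" by (simp add: monomials_def)
  have Fc: "Fr.F 1 c \<in> cech_coboundaries R xs FR 1"
  proof -
    define b where "b = (\<lambda>J\<in>cech_index xs 0. fraction R (?W J) FR r \<one>)"
    interpret L0: localization R FR "?W {}" by (rule WF) auto
    have b: "b \<in> carrier (Fr.cN.C 0)"
      unfolding Fr.cN.C_carrier b_def
      by (rule PiE_I) (use pth_power(1) L0.frac_carrier[of r \<one>] in \<open>auto simp: idx0 cech_loc_def\<close>)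
    have "Fr.F 1 c J = Fr.cN.d 0 b J" if J: "J \<in> cech_index xs (Suc 0)" for J
    proof -
      obtain j where j: "j < length xs" "J = {j}" using J idx1 by auto
      interpret l: localized_map R "self_module R" FR "\<lambda>x. x [^] p" "?W {j}" "?W {j}"
        by (rule Fr.localized) (use j in auto)
      have "Fr.F 1 c J = l.N.frac (e j [^] p) (?x j)"
        using J l.loc_map_frac[of "e j" "?x j"] e[OF j(1)] xW[OF j(1)] c_eq[OF j(1)] j
        by (simp add: Fr.F_eq)
      also have "\<dots> = l.N.frac r \<one>"
        using e[OF j(1)] x[OF j(1)] xW[OF j(1)] pth_power(1) ep[OF j(1)]
        by (intro l.N.frac_eqI) (auto simp: m_ac)
      also have "\<dots> = Fr.cN.d 0 b J"
        using d0F[of b r j] j pth_power(1) by (simp add: b_def idx0)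
      finally show ?thesis .
    qed
    then have "Fr.F 1 c = Fr.cN.d 0 b"
      using Fr.F_closed[OF cC] Fr.cN.d_closed[OF b] unfolding Fr.cN.C_carrier
      by (intro PiE_ext) auto
    then show ?thesis using b by (simp add: cech_coboundaries_def)
  qed
  have "c \<notin> cech_coboundaries R xs (self_module R) 1"
  proof
    assume "c \<in> cech_coboundaries R xs (self_module R) 1"
    then obtain b where b: "b \<in> carrier (Fr.cM.C 0)" "c = Fr.cM.d 0 b"
      by (auto simp: cech_coboundaries_def)
    interpret L0: localization R "self_module R" "?W {}" by (rule W) auto
    have "b {} \<in> carrier L0.LM" using b(1) by (auto simp: Fr.cM.C_carrier idx0 cech_loc_def)
    then obtain s where s: "s \<in> carrier R" "b {} = L0.frac s \<one>"
      using W0 by (elim L0.LM_cases) auto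
    define f where "f = a \<ominus> d \<otimes> s"
    have f: "f \<in> carrier R" using a(1) s(1) dR by (simp add: f_def)
    have f0: "f \<noteq> \<zero>" using a(2)[OF s(1)] a(1) s(1) dR by (simp add: f_def r_right_minus_eq)
    have nil: "\<exists>n::nat. ?x j [^] n \<otimes> f = \<zero>" if j: "j < length xs" for j
    proof -
      interpret L: localization R "self_module R" "?W {j}" by (rule W) (use j in auto)
      have "L.frac (e j) (?x j) = L.frac s \<one>"
        using d0[of b s j] s j c_eq[OF j] b(2) by simp
      then obtain u where u: "u \<in> ?W {j}" "u \<otimes> \<one> \<otimes> e j = u \<otimes> ?x j \<otimes> s"
        using L.frac_eq_iff[of "e j" "?x j" s \<one>] e[OF j] xW[OF j] s(1) by auto
      obtain k :: "nat \<Rightarrow> nat" where "u = finprod R (\<lambda>l. (?x l) [^] k l) {j}"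
        using u(1) unfolding monomials_def by blast
      then have n: "u = ?x j [^] k j" using x[OF j] by simp
      define n where "n = k j"
      have "?x j [^] Suc n \<otimes> f = ?x j [^] n \<otimes> (a \<otimes> ?x j) \<ominus> d \<otimes> (?x j [^] n \<otimes> ?x j \<otimes> s)"
        using x[OF j] a(1) s(1) dR by (simp add: f_def minus_eq r_distr r_minus m_ac)
      also have "?x j [^] n \<otimes> (a \<otimes> ?x j) = d \<otimes> (?x j [^] n \<otimes> e j)"
        using ae[OF j] x[OF j] e[OF j] dR by (simp add: m_lcomm)
      also have "?x j [^] n \<otimes> e j = ?x j [^] n \<otimes> ?x j \<otimes> s"
        using u(2) x[OF j] e[OF j] by (simp add: n n_def)
      finally have "?x j [^] Suc n \<otimes> f = \<zero>"
        using x[OF j] s(1) dR by (simp add: r_right_minus_eq)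
      then show ?thesis by blast
    qed
    have "\<exists>t\<in>carrier R. t \<otimes> f \<noteq> \<zero> \<and> (\<forall>x\<in>set xs. x \<otimes> (t \<otimes> f) = \<zero>)"
      by (rule annihilated_multiple[OF xs f f0]) (use nil in \<open>auto simp: in_set_conv_nth\<close>)
    then obtain t where t: "t \<in> carrier R" "t \<otimes> f \<noteq> \<zero>" "\<forall>x\<in>set xs. x \<otimes> (t \<otimes> f) = \<zero>" by blast
    have "ideal {x \<in> carrier R. x \<otimes> (t \<otimes> f) = \<zero>} R"
    proof (rule idealI)
      show "subgroup {x \<in> carrier R. x \<otimes> (t \<otimes> f) = \<zero>} (add_monoid R)"
        by (rule add.subgroupI) (use t f in \<open>auto simp: l_distr l_minus\<close>)
      fix x y assume x: "x \<in> {x \<in> carrier R. x \<otimes> (t \<otimes> f) = \<zero>}" and y: "y \<in> carrier R"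
      have "(y \<otimes> x) \<otimes> (t \<otimes> f) = y \<otimes> (x \<otimes> (t \<otimes> f))"
        using x y t(1) f by (intro m_assoc) auto
      then show "y \<otimes> x \<in> {x \<in> carrier R. x \<otimes> (t \<otimes> f) = \<zero>}" using x y by simp
      then show "x \<otimes> y \<in> {x \<in> carrier R. x \<otimes> (t \<otimes> f) = \<zero>}" using x y by (simp add: m_comm)
    qed (rule ring_axioms)
    then have "Idl (set xs) \<subseteq> {x \<in> carrier R. x \<otimes> (t \<otimes> f) = \<zero>}"
      by (rule genideal_minimal) (use t xs in auto)
    then have "d \<otimes> (t \<otimes> f) = \<zero>" using d by auto
    then show False using regular[of "t \<otimes> f"] t f by simp
  qed
  with cocycle Fc show ?thesis by (rule Fr.local_cohomology_map_not_inj)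
qed

end

section \<open>Polynomials in several variables and their evaluation\<close>

abbreviation "keys \<equiv> Poly_Mapping.keys"
abbreviation "lookup \<equiv> Poly_Mapping.lookup"

text \<open>The axioms of a commutative ring pulled back along an injective map that respects the operations,
so that the mathematics of polynomials over a record can be done with type classes.\<close>

lemma cring_via_embedding:
  fixes h :: "'a \<Rightarrow> 'b::comm_ring_1"
  assumes inj: "inj_on h (carrier R)"
    and one: "\<one>\<^bsub>R\<^esub> \<in> carrier R" "h \<one>\<^bsub>R\<^esub> = 1" and zero: "\<zero>\<^bsub>R\<^esub> \<in> carrier R" "h \<zero>\<^bsub>R\<^esub> = 0"
    and add: "\<And>x y. x \<in> carrier R \<Longrightarrow> y \<in> carrier R \<Longrightarrow> x \<oplus>\<^bsub>R\<^esub> y \<in> carrier R"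
      "\<And>x y. x \<in> carrier R \<Longrightarrow> y \<in> carrier R \<Longrightarrow> h (x \<oplus>\<^bsub>R\<^esub> y) = h x + h y"
    and mult: "\<And>x y. x \<in> carrier R \<Longrightarrow> y \<in> carrier R \<Longrightarrow> x \<otimes>\<^bsub>R\<^esub> y \<in> carrier R"
      "\<And>x y. x \<in> carrier R \<Longrightarrow> y \<in> carrier R \<Longrightarrow> h (x \<otimes>\<^bsub>R\<^esub> y) = h x * h y"
    and neg: "\<And>x. x \<in> carrier R \<Longrightarrow> \<exists>y\<in>carrier R. h y = - h x"
  shows "cring R"
proof (rule cringI)
  note eqI = inj_onD[OF inj]
  show "abelian_group R"
  proof (rule abelian_groupI)
    fix x assume x: "x \<in> carrier R"
    obtain y where "y \<in> carrier R" "h y = - h x" using neg[OF x] by blast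
    then show "\<exists>y\<in>carrier R. y \<oplus>\<^bsub>R\<^esub> x = \<zero>\<^bsub>R\<^esub>"
      using x by (intro bexI[of _ y] eqI) (simp_all add: add zero)
  qed (auto intro!: eqI simp: add zero algebra_simps)
  show "comm_monoid R"
    by (rule comm_monoidI) (auto intro!: eqI simp: mult one algebra_simps)
qed (auto intro!: inj_onD[OF inj] simp: add mult algebra_simps)

lemma finite_submultisets: "finite {a. a \<subseteq># m}"
proof (induction m)
  case (add x m)
  have "{a. a \<subseteq># add_mset x m} \<subseteq> {a. a \<subseteq># m} \<union> add_mset x ` {a. a \<subseteq># m}"
  proof
    fix a assume a: "a \<in> {a. a \<subseteq># add_mset x m}"
    show "a \<in> {a. a \<subseteq># m} \<union> add_mset x ` {a. a \<subseteq># m}"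
    proof (cases "x \<in># a")
      case True
      then have "a = add_mset x (a - {#x#})" "a - {#x#} \<subseteq># m"
        using a by (auto simp: insert_DiffM) (metis insert_DiffM mset_subset_eq_add_mset_cancel)
      then show ?thesis by blast
    next
      case False
      then have "a \<subseteq># m"
        using a diff_single_trivial[OF False] subset_eq_diff_conv[of a "{#x#}" m] by simp
      then show ?thesis by blast
    qed
  qed
  then show ?case using add finite_subset by (metis finite_UnI finite_imageI)
qed simp

text \<open>Substitution of values for the variables, the coefficients being mapped by a homomorphism.\<close>

definition insert_values ::
  "('k::zero \<Rightarrow> 'b::comm_semiring_1) \<Rightarrow> ('i \<Rightarrow> 'b) \<Rightarrow> ('i multiset \<Rightarrow>\<^sub>0 'k) \<Rightarrow> 'b" where
  "insert_values inc v P = (\<Sum>m\<in>keys P. inc (lookup P m) * prod_mset (image_mset v m))"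

locale ring_hom_type =
  fixes inc :: "'k::comm_ring_1 \<Rightarrow> 'b::comm_ring_1"
  assumes inc_add: "inc (a + b) = inc a + inc b"
    and inc_mult: "inc (a * b) = inc a * inc b"
    and inc_one: "inc 1 = 1"
begin

lemma inc_zero: "inc 0 = 0"
  using inc_add[of 0 0] by (metis add_0_right add_cancel_right_right)

abbreviation "iv \<equiv> insert_values inc"

lemma insert_values_superset:
  assumes "finite A" "keys P \<subseteq> A"
  shows "iv v P = (\<Sum>m\<in>A. inc (lookup P m) * prod_mset (image_mset v m))"
  unfolding insert_values_def
  by (rule sum.mono_neutral_left) (use assms in \<open>auto simp: inc_zero in_keys_iff\<close>)

lemma insert_values_zero: "iv v 0 = 0"
  by (simp add: insert_values_def)

lemma insert_values_add: "iv v (P + Q) = iv v P + iv v Q"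
proof -
  let ?A = "keys P \<union> keys Q"
  have "iv v (P + Q) = (\<Sum>m\<in>?A. inc (lookup (P + Q) m) * prod_mset (image_mset v m))"
    by (rule insert_values_superset) (use keys_add[of P Q] in auto)
  also have "\<dots> = iv v P + iv v Q"
    by (simp add: insert_values_superset[of ?A] lookup_add inc_add distrib_right sum.distrib)
  finally show ?thesis .
qed

lemma insert_values_single: "iv v (Poly_Mapping.single m c) = inc c * prod_mset (image_mset v m)"
  by (simp add: insert_values_def inc_zero)

lemma pm_induct [case_names single add]:
  fixes P :: "'i multiset \<Rightarrow>\<^sub>0 'k"
  assumes "\<And>m c. S (Poly_Mapping.single m c)" "\<And>P Q. S P \<Longrightarrow> S Q \<Longrightarrow> S (P + Q)"
  shows "S P"
proof (induction P rule: update_induct)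
  case const
  then show ?case using assms(1)[of "{#}" 0] by simp
next
  case (update f a b)
  have "Poly_Mapping.update a b f = f + Poly_Mapping.single a b"
    using update(1) by (intro poly_mapping_eqI)
      (auto simp: lookup_update lookup_add lookup_single in_keys_iff when_def)
  then show ?case using assms update by metis
qed

lemma insert_values_mult: "iv v (P * Q) = iv v P * iv v Q"
proof (induction P rule: pm_induct)
  case (single m c)
  show ?case
  proof (induction Q rule: pm_induct)
    case (single n d)
    then show ?case by (simp add: mult_single insert_values_single inc_mult mult_ac)
  next
    case (add P Q)
    then show ?case
      by (simp only: distrib_left insert_values_add)
  qed
qed (simp add: distrib_right insert_values_add)

lemma insert_values_one: "iv v 1 = 1"
  using insert_values_single[of v "{#}" 1] by (simp add: inc_one)

end

text \<open>A ring that a bijection identifies with a field given as a type.\<close>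

locale field_coding =
  fixes K :: "('a, 'c) ring_scheme" and dec :: "'a \<Rightarrow> 'k::field" and N :: nat
  assumes dec_bij: "bij_betw dec (carrier K) UNIV"
    and K_closed: "\<zero>\<^bsub>K\<^esub> \<in> carrier K" "\<one>\<^bsub>K\<^esub> \<in> carrier K"
      "a \<in> carrier K \<Longrightarrow> b \<in> carrier K \<Longrightarrow> a \<oplus>\<^bsub>K\<^esub> b \<in> carrier K"
      "a \<in> carrier K \<Longrightarrow> b \<in> carrier K \<Longrightarrow> a \<otimes>\<^bsub>K\<^esub> b \<in> carrier K"
    and dec_zero: "dec \<zero>\<^bsub>K\<^esub> = 0" and dec_one: "dec \<one>\<^bsub>K\<^esub> = 1"
    and dec_add: "a \<in> carrier K \<Longrightarrow> b \<in> carrier K \<Longrightarrow> dec (a \<oplus>\<^bsub>K\<^esub> b) = dec a + dec b"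
    and dec_mult: "a \<in> carrier K \<Longrightarrow> b \<in> carrier K \<Longrightarrow> dec (a \<otimes>\<^bsub>K\<^esub> b) = dec a * dec b"
begin

definition enc :: "'k \<Rightarrow> 'a" where "enc = inv_into (carrier K) dec"

lemma dec_inj: "inj_on dec (carrier K)" using dec_bij by (rule bij_betw_imp_inj_on)

lemma dec_enc [simp]: "dec (enc c) = c"
  unfolding enc_def using dec_bij by (simp add: bij_betw_def f_inv_into_f)

lemma enc_closed [simp, intro]: "enc c \<in> carrier K"
  unfolding enc_def using dec_bij by (metis UNIV_I bij_betw_def inv_into_into)

lemma enc_dec: "a \<in> carrier K \<Longrightarrow> enc (dec a) = a"
  by (rule inj_onD[OF dec_inj]) auto

lemma dec_eq_0_iff: "a \<in> carrier K \<Longrightarrow> dec a = 0 \<longleftrightarrow> a = \<zero>\<^bsub>K\<^esub>"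
  using inj_on_eq_iff[OF dec_inj _ K_closed(1)] dec_zero by simp

lemma K_cring: "cring K"
  by (rule cring_via_embedding[OF dec_inj])
    (auto simp: K_closed dec_zero dec_one dec_add dec_mult intro: bexI[of _ "enc _"])

sublocale K: cring K by (rule K_cring)

lemma dec_finsum:
  assumes "finite A" "\<And>x. x \<in> A \<Longrightarrow> f x \<in> carrier K"
  shows "dec (finsum K f A) = (\<Sum>x\<in>A. dec (f x))"
  using assms by (induction A rule: finite_induct) (auto simp: dec_zero dec_add Pi_def)

abbreviation "S \<equiv> mpoly_ring K N"

text \<open>Polynomials over the record \<open>K\<close> correspond to finitely supported functions with values in the type
that \<open>K\<close> encodes.\<close>

definition pm :: "(nat multiset \<Rightarrow> 'a) \<Rightarrow> nat multiset \<Rightarrow>\<^sub>0 'k" where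
  "pm f = Abs_poly_mapping (\<lambda>m. dec (f m))"

definition mp :: "(nat multiset \<Rightarrow>\<^sub>0 'k) \<Rightarrow> nat multiset \<Rightarrow> 'a" where
  "mp P = (\<lambda>m. enc (lookup P m))"

lemma S_carrier:
  "f \<in> carrier S \<longleftrightarrow> (\<forall>m. f m \<in> carrier K) \<and> finite {m. f m \<noteq> \<zero>\<^bsub>K\<^esub>} \<and>
     (\<forall>m. f m \<noteq> \<zero>\<^bsub>K\<^esub> \<longrightarrow> set_mset m \<subseteq> {..N})"
  by (simp add: mpoly_ring_def)

lemma lookup_pm: "f \<in> carrier S \<Longrightarrow> lookup (pm f) m = dec (f m)"
  unfolding pm_def by (subst lookup_Abs_poly_mapping) (auto simp: S_carrier dec_eq_0_iff)

lemma keys_pm: "f \<in> carrier S \<Longrightarrow> keys (pm f) = {m. f m \<noteq> \<zero>\<^bsub>K\<^esub>}"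
  by (auto simp: in_keys_iff lookup_pm S_carrier dec_eq_0_iff)

lemma enc_eq_0_iff: "enc c = \<zero>\<^bsub>K\<^esub> \<longleftrightarrow> c = 0"
  using dec_eq_0_iff[of "enc c"] by simp

lemma mp_closed: "\<forall>m\<in>keys P. set_mset m \<subseteq> {..N} \<Longrightarrow> mp P \<in> carrier S"
  by (simp add: S_carrier mp_def enc_eq_0_iff in_keys_iff)

lemma pm_mp: "\<forall>m\<in>keys P. set_mset m \<subseteq> {..N} \<Longrightarrow> pm (mp P) = P"
  by (rule poly_mapping_eqI) (simp add: lookup_pm mp_closed, simp add: mp_def)

lemma mp_pm: "f \<in> carrier S \<Longrightarrow> mp (pm f) = f"
  by (auto simp: mp_def lookup_pm enc_dec S_carrier)

lemma pm_inj: "inj_on pm (carrier S)"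
  by (rule inj_on_inverseI[of _ mp]) (rule mp_pm)

lemma keys_pm_vars: "f \<in> carrier S \<Longrightarrow> m \<in> keys (pm f) \<Longrightarrow> set_mset m \<subseteq> {..N}"
  using keys_pm by (auto simp: S_carrier)

lemma add_eq_mp: 
  assumes "f \<in> carrier S" "g \<in> carrier S"
  shows "f \<oplus>\<^bsub>S\<^esub> g = mp (pm f + pm g)"
proof
  fix m show "(f \<oplus>\<^bsub>S\<^esub> g) m = mp (pm f + pm g) m"
    using assms by (intro inj_onD[OF dec_inj])
      (auto simp: mpoly_ring_def mp_def lookup_add lookup_pm S_carrier dec_add)
qed

lemma lookup_mult_submultisets:
  "lookup (P * Q) m = (\<Sum>a | a \<subseteq># m. lookup P a * lookup Q (m - a))"
  for P Q :: "'i multiset \<Rightarrow>\<^sub>0 'k"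
proof -
  have inner: "(\<Sum>q. (lookup Q q when m = l + q)) = (if l \<subseteq># m then lookup Q (m - l) else 0)" for l
  proof (cases "l \<subseteq># m")
    case True
    then have "(lookup Q q when m = l + q) = (lookup Q (m - l) when q = m - l)" for q
      by (auto simp: when_def)
    then show ?thesis using True by simp
  next
    case False
    then have "(lookup Q q when m = l + q) = 0" for q by (auto simp: when_def)
    then show ?thesis using False by simp
  qed
  have "lookup (P * Q) m = (\<Sum>l. if l \<subseteq># m then lookup P l * lookup Q (m - l) else 0)"
    unfolding lookup_mult inner by (rule arg_cong[of _ _ Sum_any]) auto
  also have "\<dots> = (\<Sum>l\<in>{a. a \<subseteq># m}. if l \<subseteq># m then lookup P l * lookup Q (m - l) else 0)"
    by (rule Sum_any.expand_superset) (auto simp: finite_submultisets)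
  finally show ?thesis by simp
qed

lemma mult_eq_mp: 
  assumes "f \<in> carrier S" "g \<in> carrier S"
  shows "f \<otimes>\<^bsub>S\<^esub> g = mp (pm f * pm g)"
proof
  fix m
  have fg: "f a \<otimes>\<^bsub>K\<^esub> g b \<in> carrier K" for a b
    using assms by (auto simp: S_carrier)
  have "(f \<otimes>\<^bsub>S\<^esub> g) m = (\<Oplus>\<^bsub>K\<^esub>a\<in>{a. a \<subseteq># m}. f a \<otimes>\<^bsub>K\<^esub> g (m - a))"
    by (simp add: mpoly_ring_def)
  also have "\<dots> = enc (dec (\<Oplus>\<^bsub>K\<^esub>a\<in>{a. a \<subseteq># m}. f a \<otimes>\<^bsub>K\<^esub> g (m - a)))"
    using fg by (subst enc_dec) (auto intro!: K.finsum_closed)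
  also have "dec (\<Oplus>\<^bsub>K\<^esub>a\<in>{a. a \<subseteq># m}. f a \<otimes>\<^bsub>K\<^esub> g (m - a)) = lookup (pm f * pm g) m"
    using assms by (subst dec_finsum)
      (auto simp: finite_submultisets fg lookup_mult_submultisets lookup_pm S_carrier dec_mult)
  finally show "(f \<otimes>\<^bsub>S\<^esub> g) m = mp (pm f * pm g) m" by (simp add: mp_def)
qed

lemma keys_add_vars:
  assumes "f \<in> carrier S" "g \<in> carrier S"
  shows "\<forall>m\<in>keys (pm f + pm g). set_mset m \<subseteq> {..N}"
  using keys_add[of "pm f" "pm g"] keys_pm_vars assms by blast

lemma keys_mult_vars:
  assumes "f \<in> carrier S" "g \<in> carrier S"
  shows "\<forall>m\<in>keys (pm f * pm g). set_mset m \<subseteq> {..N}"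
proof
  fix m assume "m \<in> keys (pm f * pm g)"
  then obtain a b where "m = a + b" "a \<in> keys (pm f)" "b \<in> keys (pm g)"
    using keys_mult[of "pm f" "pm g"] by blast
  then show "set_mset m \<subseteq> {..N}" using keys_pm_vars[OF assms(1), of a] keys_pm_vars[OF assms(2), of b] by simp
qed

lemma pm_add: "f \<in> carrier S \<Longrightarrow> g \<in> carrier S \<Longrightarrow> pm (f \<oplus>\<^bsub>S\<^esub> g) = pm f + pm g"
  by (simp add: add_eq_mp pm_mp keys_add_vars)

lemma pm_mult: "f \<in> carrier S \<Longrightarrow> g \<in> carrier S \<Longrightarrow> pm (f \<otimes>\<^bsub>S\<^esub> g) = pm f * pm g"
  by (simp add: mult_eq_mp pm_mp keys_mult_vars)

lemma zero_S: "\<zero>\<^bsub>S\<^esub> = mp 0" "\<zero>\<^bsub>S\<^esub> = (\<lambda>m. \<zero>\<^bsub>K\<^esub>)"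
  by (auto simp: mpoly_ring_def mp_def enc_eq_0_iff[of 0, simplified])

lemma one_S: "\<one>\<^bsub>S\<^esub> = mp 1"
proof
  fix m show "\<one>\<^bsub>S\<^esub> m = mp 1 m"
    by (intro inj_onD[OF dec_inj]) (auto simp: mpoly_ring_def mp_def lookup_one when_def K_closed dec_zero dec_one)
qed

lemma S_cring: "cring S"
proof (rule cring_via_embedding[OF pm_inj])
  show "\<one>\<^bsub>S\<^esub> \<in> carrier S" "\<zero>\<^bsub>S\<^esub> \<in> carrier S" by (auto simp: one_S zero_S(1) mp_closed)
  show "pm \<one>\<^bsub>S\<^esub> = 1" "pm \<zero>\<^bsub>S\<^esub> = 0" by (auto simp: one_S zero_S(1) pm_mp)
  fix f assume f: "f \<in> carrier S"
  have k: "\<forall>m\<in>keys (- pm f). set_mset m \<subseteq> {..N}"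
    using keys_pm_vars[OF f] by (simp add: in_keys_iff)
  then show "\<exists>g\<in>carrier S. pm g = - pm f"
    by (intro bexI[of _ "mp (- pm f)"]) (auto simp: pm_mp mp_closed)
  fix g assume g: "g \<in> carrier S"
  show "f \<oplus>\<^bsub>S\<^esub> g \<in> carrier S" "f \<otimes>\<^bsub>S\<^esub> g \<in> carrier S"
    using f g by (auto simp: add_eq_mp mult_eq_mp mp_closed keys_add_vars keys_mult_vars)
qed (auto simp: pm_add pm_mult)

sublocale S: cring S by (rule S_cring)

lemma pm_zero: "pm \<zero>\<^bsub>S\<^esub> = 0" and pm_one: "pm \<one>\<^bsub>S\<^esub> = 1"
  by (auto simp: one_S zero_S(1) pm_mp)

lemma pm_minus: "f \<in> carrier S \<Longrightarrow> pm (\<ominus>\<^bsub>S\<^esub> f) = - pm f"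
  using pm_add[of "\<ominus>\<^bsub>S\<^esub> f" f] by (simp add: S.l_neg pm_zero eq_neg_iff_add_eq_0)

lemma pm_eqD: "f \<in> carrier S \<Longrightarrow> g \<in> carrier S \<Longrightarrow> pm f = pm g \<Longrightarrow> f = g"
  using pm_inj by (rule inj_onD)

subsection \<open>Forms\<close>

abbreviation "form \<equiv> homogeneous K N"

lemma form_closed: "form d f \<Longrightarrow> f \<in> carrier S"
  by (simp add: homogeneous_def)

lemma form_iff: "form d f \<longleftrightarrow> f \<in> carrier S \<and> (\<forall>m\<in>keys (pm f). size m = d)"
  by (auto simp: homogeneous_def keys_pm)

declare form_closed [intro]

lemma form_zero [simp, intro]: "form d \<zero>\<^bsub>S\<^esub>"
  by (simp add: form_iff pm_zero)

lemma form_one [simp, intro]: "form 0 \<one>\<^bsub>S\<^esub>"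
  by (simp add: form_iff pm_one)

lemma form_add [intro]: "form d f \<Longrightarrow> form d g \<Longrightarrow> form d (f \<oplus>\<^bsub>S\<^esub> g)"
  using keys_add[of "pm f" "pm g"] by (auto simp: form_iff pm_add)

lemma form_minus [intro]: "form d f \<Longrightarrow> form d (\<ominus>\<^bsub>S\<^esub> f)"
  by (auto simp: form_iff pm_minus in_keys_iff)

lemma form_mult [intro]: "form d f \<Longrightarrow> form e g \<Longrightarrow> form (d + e) (f \<otimes>\<^bsub>S\<^esub> g)"
  using keys_mult[of "pm f" "pm g"] by (fastforce simp: form_iff pm_mult)

lemma form_pow [intro]: "form d f \<Longrightarrow> form (n * d) (f [^]\<^bsub>S\<^esub> (n::nat))"
proof (induction n)
  case (Suc n)
  then show ?case using form_mult[of "n * d" "f [^]\<^bsub>S\<^esub> n" d f] by (simp add: add.commute)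
qed simp

abbreviation "hcomp \<equiv> homogeneous_component K"

lemma hcomp_form: "f \<in> carrier S \<Longrightarrow> form d (hcomp d f)"
  by (auto simp: homogeneous_def homogeneous_component_def S_carrier K_closed
      intro: rev_finite_subset[of "{m. f m \<noteq> \<zero>\<^bsub>K\<^esub>}"])

lemma hcomp_of_form: "form d f \<Longrightarrow> hcomp e f = (if d = e then f else \<zero>\<^bsub>S\<^esub>)"
proof
  fix m assume "form d f"
  then show "hcomp e f m = (if d = e then f else \<zero>\<^bsub>S\<^esub>) m"
    by (cases "f m = \<zero>\<^bsub>K\<^esub>") (auto simp: homogeneous_def homogeneous_component_def zero_S(2))
qed

lemma lookup_hcomp:
  "f \<in> carrier S \<Longrightarrow> lookup (pm (hcomp d f)) m = (if size m = d then lookup (pm f) m else 0)"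
  using form_closed[OF hcomp_form, of f d]
  by (simp add: lookup_pm homogeneous_component_def dec_zero)

definition var :: "nat \<Rightarrow> nat multiset \<Rightarrow> 'a" where
  "var i = mp (Poly_Mapping.single {#i#} 1)"

definition const :: "'k \<Rightarrow> nat multiset \<Rightarrow> 'a" where
  "const c = mp (Poly_Mapping.single {#} c)"

lemma pm_var: "i \<le> N \<Longrightarrow> pm (var i) = Poly_Mapping.single {#i#} 1"
  by (simp add: var_def pm_mp)

lemma pm_const: "pm (const c) = Poly_Mapping.single {#} c"
  by (simp add: const_def pm_mp)

lemma form_var [simp, intro]: "i \<le> N \<Longrightarrow> form 1 (var i)"
  by (auto simp: form_iff pm_var) (simp add: var_def mp_closed)

lemma form_const [simp, intro]: "form 0 (const c)"
proof -
  have "const c \<in> carrier S" unfolding const_def by (rule mp_closed) simp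
  then show ?thesis by (simp add: form_iff pm_const)
qed

definition ev :: "('k \<Rightarrow> 'b::comm_ring_1) \<Rightarrow> (nat \<Rightarrow> 'b) \<Rightarrow> (nat multiset \<Rightarrow> 'a) \<Rightarrow> 'b" where
  "ev inc v f = insert_values inc v (pm f)"

end

locale evaluation = field_coding K dec N + ring_hom_type inc
  for K :: "('a, 'c) ring_scheme" and dec :: "'a \<Rightarrow> 'k::field" and N :: nat
    and inc :: "'k \<Rightarrow> 'b::comm_ring_1" +
  fixes v :: "nat \<Rightarrow> 'b"
begin

abbreviation "E \<equiv> ev inc v"

lemma E_add: "f \<in> carrier S \<Longrightarrow> g \<in> carrier S \<Longrightarrow> E (f \<oplus>\<^bsub>S\<^esub> g) = E f + E g"
  by (simp add: ev_def pm_add insert_values_add)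

lemma E_mult: "f \<in> carrier S \<Longrightarrow> g \<in> carrier S \<Longrightarrow> E (f \<otimes>\<^bsub>S\<^esub> g) = E f * E g"
  by (simp add: ev_def pm_mult insert_values_mult)

lemma E_zero: "E \<zero>\<^bsub>S\<^esub> = 0" and E_one: "E \<one>\<^bsub>S\<^esub> = 1"
  by (simp_all add: ev_def pm_zero pm_one insert_values_zero insert_values_one)

lemma E_minus: "f \<in> carrier S \<Longrightarrow> E (\<ominus>\<^bsub>S\<^esub> f) = - E f"
  using E_add[of "\<ominus>\<^bsub>S\<^esub> f" f] by (simp add: S.l_neg E_zero eq_neg_iff_add_eq_0)

lemma E_diff: "f \<in> carrier S \<Longrightarrow> g \<in> carrier S \<Longrightarrow> E (f \<ominus>\<^bsub>S\<^esub> g) = E f - E g"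
  by (simp add: S.minus_eq E_add E_minus)

lemma E_pow: "f \<in> carrier S \<Longrightarrow> E (f [^]\<^bsub>S\<^esub> (n::nat)) = E f ^ n"
  by (induction n) (simp_all add: E_one E_mult mult.commute)

lemma E_var: "i \<le> N \<Longrightarrow> E (var i) = v i"
  by (simp add: ev_def pm_var insert_values_single inc_one)

lemma E_const: "E (const c) = inc c"
  by (simp add: ev_def pm_const insert_values_single)

definition graded_kernel where
  "graded_kernel = {f \<in> carrier S. \<forall>d. E (hcomp d f) = 0}"

lemma form_in_graded_kernel: "form d f \<Longrightarrow> f \<in> graded_kernel \<longleftrightarrow> E f = 0"
  by (auto simp: graded_kernel_def hcomp_of_form E_zero)

end

locale domain_evaluation = evaluation K dec N inc v
  for K :: "('a, 'c) ring_scheme" and dec :: "'a \<Rightarrow> 'k::field" and N :: nat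
    and inc :: "'k \<Rightarrow> 'b::idom" and v
begin

text \<open>The Rees trick: an additional variable keeps track of the degree.\<close>

sublocale z: evaluation K dec N "\<lambda>c. [:inc c:]" "\<lambda>i. Polynomial.monom (v i) (Suc 0)"
  by unfold_locales (simp_all add: inc_add inc_mult inc_one one_pCons)

text \<open>The coefficients of the extended evaluation are the values of the homogeneous components.\<close>

lemma coeff_z: 
  assumes f: "f \<in> carrier S"
  shows "Polynomial.coeff (z.E f) d = E (hcomp d f)"
proof -
  have pr: "prod_mset (image_mset (\<lambda>i. Polynomial.monom (v i) (Suc 0)) m) =
      Polynomial.monom (prod_mset (image_mset v m)) (size m)" for m
    by (induction m) (simp_all add: mult_monom monom_0 one_pCons)
  have "Polynomial.coeff (z.E f) d = (\<Sum>m\<in>keys (pm f). Polynomial.coeff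
      (Polynomial.monom (inc (lookup (pm f) m) * prod_mset (image_mset v m)) (size m)) d)"
    by (simp add: ev_def insert_values_def coeff_sum pr smult_monom)
  also have "\<dots> = (\<Sum>m\<in>keys (pm f). inc (lookup (pm (hcomp d f)) m) * prod_mset (image_mset v m))"
    using f by (intro sum.cong) (auto simp: lookup_hcomp inc_zero)
  also have "\<dots> = E (hcomp d f)"
    unfolding ev_def using f
    by (subst insert_values_superset[of "keys (pm f)"]) (auto simp: in_keys_iff lookup_hcomp split: if_splits)
  finally show ?thesis .
qed

lemma graded_kernel_iff: "f \<in> graded_kernel \<longleftrightarrow> f \<in> carrier S \<and> z.E f = 0"
  by (auto simp: graded_kernel_def poly_eq_iff coeff_z)

text \<open>The largest homogeneous ideal inside the kernel of an evaluation is the kernel of the evaluation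
with the additional variable, whose target is again a domain.\<close>

lemma graded_kernel_prime: "primeideal graded_kernel S"
proof -
  have "ideal graded_kernel S"
  proof (rule idealI[OF S.ring_axioms])
    show "subgroup graded_kernel (add_monoid S)"
    proof (rule S.add.subgroupI)
      show "graded_kernel \<noteq> {}" using z.E_zero S.zero_closed graded_kernel_iff by blast
    qed (auto simp: graded_kernel_iff z.E_add z.E_minus a_inv_def[symmetric])
  qed (auto simp: graded_kernel_iff z.E_mult)
  then show ?thesis
  proof (rule primeidealI[OF _ S.is_cring])
    have "\<one>\<^bsub>S\<^esub> \<notin> graded_kernel" by (simp add: graded_kernel_iff z.E_one)
    then show "carrier S \<noteq> graded_kernel" by auto
  qed (auto simp: graded_kernel_iff z.E_mult)
qed

lemma graded_kernel_homogeneous: "homogeneous_ideal K N graded_kernel"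
proof -
  have "hcomp d f \<in> graded_kernel" if "f \<in> graded_kernel" for f d
    using that form_in_graded_kernel[OF hcomp_form, of f d] by (simp add: graded_kernel_def)
  then show ?thesis
    using primeideal.axioms(1)[OF graded_kernel_prime] by (simp add: homogeneous_ideal_def)
qed

lemma graded_kernel_relevant:
  assumes "i \<le> N" "v i \<noteq> 0"
  shows "\<not> irrelevant_ideal K N \<subseteq> graded_kernel"
proof -
  have "var i \<in> irrelevant_ideal K N"
    using form_closed[OF form_var[OF assms(1)]]
    by (simp add: irrelevant_ideal_def) (simp add: var_def mp_def lookup_single enc_eq_0_iff)
  moreover have "var i \<notin> graded_kernel"
    using assms by (simp add: form_in_graded_kernel[OF form_var] E_var)
  ultimately show ?thesis by blast
qed

end

section \<open>Finite generation of homogeneous ideals\<close>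

text \<open>Dickson's lemma for the divisibility order on monomials.\<close>

lemma dickson_multisets:
  assumes "finite V" "\<And>m. m \<in> A \<Longrightarrow> set_mset m \<subseteq> V"
  shows "\<exists>B\<subseteq>A. finite B \<and> (\<forall>m\<in>A. \<exists>b\<in>B. b \<subseteq># m)"
  using assms
proof (induction V arbitrary: A rule: finite_induct)
  case empty
  then have "A \<subseteq> {{#}}" by auto
  then show ?case by (intro exI[of _ A]) (auto intro: finite_subset)
next
  case (insert x V)
  define r where "r = (\<lambda>m. filter_mset (\<lambda>y. y \<noteq> x) m)"
  have le_iff: "m \<subseteq># n \<longleftrightarrow> r m \<subseteq># r n \<and> count m x \<le> count n x" for m n
  proof
    assume a: "r m \<subseteq># r n \<and> count m x \<le> count n x"
    show "m \<subseteq># n"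
    proof (rule mset_subset_eqI)
      fix y
      show "count m y \<le> count n y"
      proof (cases "y = x")
        case False
        then show ?thesis using mset_subset_eq_count[of "r m" "r n" y] a by (simp add: r_def)
      qed (use a in simp)
    qed
  qed (auto simp: r_def mset_subset_eq_count multiset_filter_mono)
  have IH: "\<exists>B\<subseteq>{m \<in> A. P m}. finite B \<and> (\<forall>m\<in>A. P m \<longrightarrow> (\<exists>b\<in>B. r b \<subseteq># r m))" for P
  proof -
    have "\<exists>B'\<subseteq>r ` {m \<in> A. P m}. finite B' \<and> (\<forall>m\<in>r ` {m \<in> A. P m}. \<exists>b\<in>B'. b \<subseteq># m)"
    proof (rule insert.IH)
      fix n assume "n \<in> r ` {m \<in> A. P m}"
      then obtain m where "m \<in> A" "n = r m" by blast
      then show "set_mset n \<subseteq> V" using insert.prems[of m] by (auto simp: r_def)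
    qed
    then obtain B' where B': "B' \<subseteq> r ` {m \<in> A. P m}" "finite B'"
      "\<forall>m\<in>r ` {m \<in> A. P m}. \<exists>b\<in>B'. b \<subseteq># m" by blast
    obtain B where "B \<subseteq> {m \<in> A. P m}" "finite B" "B' = r ` B"
      using finite_subset_image[OF B'(2,1)] by blast
    then show ?thesis using B'(3) by (intro exI[of _ B]) auto
  qed
  obtain B0 where B0: "B0 \<subseteq> A" "finite B0" "\<forall>m\<in>A. \<exists>b\<in>B0. r b \<subseteq># r m"
    using IH[of "\<lambda>_. True"] by auto
  define k where "k = (\<Sum>b\<in>B0. count b x)"
  have k: "\<forall>b\<in>B0. count b x \<le> k"
    using B0(2) by (auto simp: k_def intro!: member_le_sum)
  have "\<exists>B\<subseteq>A. finite B \<and> (\<forall>b\<in>B. count b x = j) \<and> (\<forall>m\<in>A. count m x = j \<longrightarrow> (\<exists>b\<in>B. r b \<subseteq># r m))" for j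
    using IH[of "\<lambda>m. count m x = j"] by blast
  then obtain B where B: "\<And>j. B j \<subseteq> A" "\<And>j. finite (B j)" "\<And>j. \<forall>b\<in>B j. count b x = j"
    "\<And>j. \<forall>m\<in>A. count m x = j \<longrightarrow> (\<exists>b\<in>B j. r b \<subseteq># r m)" by metis
  show ?case
  proof (intro exI[of _ "B0 \<union> (\<Union>j\<le>k. B j)"] conjI ballI)
    fix m assume m: "m \<in> A"
    show "\<exists>b\<in>B0 \<union> (\<Union>j\<le>k. B j). b \<subseteq># m"
    proof (cases "count m x \<le> k")
      case True
      then obtain b where "b \<in> B (count m x)" "r b \<subseteq># r m" using B(4)[of "count m x"] m by blast
      moreover from this have "count b x = count m x" using B(3) by blast
      ultimately show ?thesis using True by (subst le_iff) auto
    next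
      case False
      obtain b where "b \<in> B0" "r b \<subseteq># r m" using B0(3) m by blast
      then show ?thesis using k False by (subst le_iff) (auto intro!: bexI[of _ b])
    qed
  qed (use B0 B in auto)
qed

context field_coding
begin

lemma mp_add:
  assumes "\<forall>m\<in>keys P. set_mset m \<subseteq> {..N}" "\<forall>m\<in>keys Q. set_mset m \<subseteq> {..N}"
  shows "mp (P + Q) = mp P \<oplus>\<^bsub>S\<^esub> mp Q"
  using assms by (simp add: add_eq_mp mp_closed pm_mp)

text \<open>Additive predicates may be checked on the monomials that occur.\<close>

lemma poly_induct:
  assumes f: "f \<in> carrier S" and zero: "P \<zero>\<^bsub>S\<^esub>"
    and add: "\<And>f g. f \<in> carrier S \<Longrightarrow> g \<in> carrier S \<Longrightarrow> P f \<Longrightarrow> P g \<Longrightarrow> P (f \<oplus>\<^bsub>S\<^esub> g)"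
    and single: "\<And>m c. m \<in> keys (pm f) \<Longrightarrow> P (mp (Poly_Mapping.single m c))"
  shows "P f"
proof -
  have "P (mp (\<Sum>m\<in>A. Poly_Mapping.single m (lookup (pm f) m))) \<and>
      keys (\<Sum>m\<in>A. Poly_Mapping.single m (lookup (pm f) m)) \<subseteq> A" if "A \<subseteq> keys (pm f)" for A
    using finite_subset[OF that finite_keys] that
  proof (induction A rule: finite_induct)
    case (insert m A)
    let ?s = "\<Sum>m\<in>A. Poly_Mapping.single m (lookup (pm f) m)"
    have k: "\<forall>m\<in>keys ?s. set_mset m \<subseteq> {..N}"
      using insert keys_pm_vars[OF f] by blast
    have k': "\<forall>n\<in>keys (Poly_Mapping.single m (lookup (pm f) m)). set_mset n \<subseteq> {..N}"
      using insert.prems keys_pm_vars[OF f] by auto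
    have "P (mp (Poly_Mapping.single m (lookup (pm f) m) + ?s))"
      unfolding mp_add[OF k' k]
      by (rule add) (use insert single mp_closed[OF k] mp_closed[OF k'] in auto)
    moreover have "keys (Poly_Mapping.single m (lookup (pm f) m) + ?s) \<subseteq> insert m A"
      using keys_add[of "Poly_Mapping.single m (lookup (pm f) m)" ?s] insert
        keys_single[of m "lookup (pm f) m"] by (auto split: if_splits)
    ultimately show ?case using insert by simp
  qed (use zero in \<open>simp add: zero_S(1)\<close>)
  then have "P (mp (\<Sum>m\<in>keys (pm f). Poly_Mapping.single m (lookup (pm f) m)))" by blast
  also have "(\<Sum>m\<in>keys (pm f). Poly_Mapping.single m (lookup (pm f) m)) = pm f"
    by (rule poly_mapping_eqI)
      (auto simp: lookup_sum lookup_single when_def in_keys_iff sum.If_cases if_distrib)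
  finally show ?thesis using f by (simp add: mp_pm)
qed

lemma form_single: "set_mset m \<subseteq> {..N} \<Longrightarrow> form (size m) (mp (Poly_Mapping.single m c))"
  by (simp add: form_iff mp_closed pm_mp)

abbreviation "lmon f \<equiv> Max (keys (pm f))"

lemma lmon_in:
  assumes "f \<in> carrier S" "f \<noteq> \<zero>\<^bsub>S\<^esub>"
  shows "lmon f \<in> keys (pm f)"
proof -
  have "pm f \<noteq> 0" using assms pm_eqD[OF assms(1) S.zero_closed] by (auto simp: pm_zero)
  then show ?thesis by (intro Max_in) (auto simp: poly_mapping_eq_iff fun_eq_iff in_keys_iff)
qed

inductive graded_span for B d where
  zero: "graded_span B d \<zero>\<^bsub>S\<^esub>"
| gen: "(e, b) \<in> B \<Longrightarrow> form e b \<Longrightarrow> form c a \<Longrightarrow> c + e = d \<Longrightarrow> graded_span B d (a \<otimes>\<^bsub>S\<^esub> b)"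
| add: "graded_span B d f \<Longrightarrow> graded_span B d g \<Longrightarrow> graded_span B d (f \<oplus>\<^bsub>S\<^esub> g)"

lemma graded_span_form: "graded_span B d f \<Longrightarrow> form d f"
  by (induction rule: graded_span.induct) auto

text \<open>Hilbert's basis theorem in graded form. The leading monomials (in the multiset order) of the forms in
\<open>G\<close> have finitely many minimal ones by Dickson's lemma; forms realizing them generate, since
subtracting multiples lowers the leading monomial, and that order is well-founded.\<close>

lemma graded_submodule_finitely_generated:
  fixes G :: "nat \<Rightarrow> (nat multiset \<Rightarrow> 'a) \<Rightarrow> bool"
  assumes G_form: "\<And>d f. G d f \<Longrightarrow> form d f"
    and G_diff: "\<And>d f g. G d f \<Longrightarrow> G d g \<Longrightarrow> G d (f \<ominus>\<^bsub>S\<^esub> g)"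
    and G_mult: "\<And>d e a f. form e a \<Longrightarrow> G d f \<Longrightarrow> G (e + d) (a \<otimes>\<^bsub>S\<^esub> f)"
  shows "\<exists>B. finite B \<and> (\<forall>e b. (e, b) \<in> B \<longrightarrow> G e b) \<and> (\<forall>d f. G d f \<longrightarrow> graded_span B d f)"
proof -
  define A where "A = {lmon f | d f. G d f \<and> f \<noteq> \<zero>\<^bsub>S\<^esub>}"
  have "set_mset m \<subseteq> {..N}" if m: "m \<in> A" for m
  proof -
    obtain d f where f: "G d f" "f \<noteq> \<zero>\<^bsub>S\<^esub>" "m = lmon f" using m unfolding A_def by blast
    then show ?thesis using lmon_in keys_pm_vars G_form form_closed by metis
  qed
  then obtain B0 where B0: "B0 \<subseteq> A" "finite B0" "\<forall>m\<in>A. \<exists>b\<in>B0. b \<subseteq># m"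
    using dickson_multisets[of "{..N}" A] by auto
  have "\<forall>b\<in>B0. \<exists>x. G (fst x) (snd x) \<and> snd x \<noteq> \<zero>\<^bsub>S\<^esub> \<and> b = lmon (snd x)"
    using B0(1) unfolding A_def by fastforce
  then obtain pick where pick: "\<And>b. b \<in> B0 \<Longrightarrow> G (fst (pick b)) (snd (pick b))"
    "\<And>b. b \<in> B0 \<Longrightarrow> snd (pick b) \<noteq> \<zero>\<^bsub>S\<^esub>" "\<And>b. b \<in> B0 \<Longrightarrow> b = lmon (snd (pick b))"
    by metis
  define B where "B = pick ` B0"
  have main: "graded_span B d f" if f: "G d f" for d f
    using f
  proof (induction "lmon f" arbitrary: f rule: less_induct)
    case less
    note f = less.prems
    have fS: "f \<in> carrier S" using G_form[OF f] by auto
    show ?case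
    proof (cases "f = \<zero>\<^bsub>S\<^esub>")
      case False
      define m where "m = lmon f"
      have m: "m \<in> keys (pm f)" unfolding m_def by (rule lmon_in[OF fS False])
      have "m \<in> A" using f False unfolding A_def m_def by blast
      then obtain b where b: "b \<in> B0" "b \<subseteq># m" using B0(3) by blast
      define e g where "e = fst (pick b)" and "g = snd (pick b)"
      have g: "G e g" "g \<noteq> \<zero>\<^bsub>S\<^esub>" "b = lmon g" "(e, g) \<in> B"
        using pick[OF b(1)] b(1) by (auto simp: e_def g_def B_def)
      have gS: "g \<in> carrier S" using G_form[OF g(1)] by auto
      have bg: "b \<in> keys (pm g)" unfolding g(3) by (rule lmon_in[OF gS g(2)])
      define t where "t = m - b"
      have mt: "m = t + b" using b(2) by (simp add: t_def)
      define c where "c = lookup (pm f) m / lookup (pm g) b"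
      define a where "a = mp (Poly_Mapping.single t c)"
      have tv: "set_mset t \<subseteq> {..N}" using keys_pm_vars[OF fS m] mt by auto
      have a: "form (size t) a" unfolding a_def by (rule form_single[OF tv])
      have pa: "pm a = Poly_Mapping.single t c" unfolding a_def using tv by (simp add: pm_mp)
      have "size m = d" using G_form[OF f] m by (auto simp: form_iff)
      moreover have "size b = e" using G_form[OF g(1)] bg by (auto simp: form_iff)
      ultimately have deg: "size t + e = d" using mt by simp
      have look: "lookup (pm a * pm g) k = (if t \<subseteq># k then c * lookup (pm g) (k - t) else 0)" for k
      proof -
        have "lookup (pm a * pm g) k = (\<Sum>a | a \<subseteq># k. if a = t then c * lookup (pm g) (k - t) else 0)"
          unfolding lookup_mult_submultisets pa
          by (rule sum.cong) (auto simp: lookup_single when_def)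
        then show ?thesis by (simp add: finite_submultisets)
      qed
      define f' where "f' = f \<ominus>\<^bsub>S\<^esub> a \<otimes>\<^bsub>S\<^esub> g"
      have ag: "form d (a \<otimes>\<^bsub>S\<^esub> g)" "G d (a \<otimes>\<^bsub>S\<^esub> g)"
        using form_mult[OF a G_form[OF g(1)]] G_mult[OF a g(1)] deg by auto
      have agS: "a \<otimes>\<^bsub>S\<^esub> g \<in> carrier S" using ag(1) by auto
      have f': "G d f'" unfolding f'_def by (rule G_diff[OF f ag(2)])
      have f'S: "f' \<in> carrier S" using G_form[OF f'] by auto
      have look': "lookup (pm f') k = lookup (pm f) k - (if t \<subseteq># k then c * lookup (pm g) (k - t) else 0)" for k
        using fS agS a gS form_closed[OF a]
        by (simp add: f'_def S.minus_eq pm_add pm_minus pm_mult lookup_minus look)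
      have small: "k < m" if k: "k \<in> keys (pm f')" for k
      proof -
        have "k \<noteq> m"
        proof
          assume "k = m"
          then have "lookup (pm f') k = lookup (pm f) m - c * lookup (pm g) b"
            using look'[of m] mt by simp
          also have "\<dots> = 0" using bg by (simp add: c_def in_keys_iff)
          finally show False using k by (simp add: in_keys_iff)
        qed
        moreover have "k \<le> m"
        proof (cases "k \<in> keys (pm f)")
          case True then show ?thesis unfolding m_def by simp
        next
          case False
          then have "t \<subseteq># k" "k - t \<in> keys (pm g)"
            using k look'[of k] by (auto simp: in_keys_iff split: if_splits)
          then have "k - t \<le> b" unfolding g(3) by simp
          then have "t + (k - t) \<le> t + b" by (rule add_left_mono)
          then show ?thesis using \<open>t \<subseteq># k\<close> mt by simp
        qed
        ultimately show ?thesis by simp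
      qed
      have "graded_span B d f'"
      proof (cases "f' = \<zero>\<^bsub>S\<^esub>")
        case False
        then have "lmon f' < lmon f" using small[OF lmon_in[OF f'S False]] by (simp add: m_def)
        then show ?thesis by (rule less.hyps[OF _ f'])
      qed (simp add: graded_span.zero)
      moreover have "graded_span B d (a \<otimes>\<^bsub>S\<^esub> g)"
        by (rule graded_span.gen[OF g(4) G_form[OF g(1)] a deg])
      ultimately have "graded_span B d (f' \<oplus>\<^bsub>S\<^esub> a \<otimes>\<^bsub>S\<^esub> g)" by (rule graded_span.add)
      also have "f' \<oplus>\<^bsub>S\<^esub> a \<otimes>\<^bsub>S\<^esub> g = f"
        using fS agS by (simp add: f'_def S.minus_eq S.a_assoc S.l_neg)
      finally show ?thesis .
    qed (simp add: graded_span.zero)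
  qed
  have GB: "G e b" if "(e, b) \<in> B" for e b
  proof -
    obtain b' where "b' \<in> B0" "pick b' = (e, b)" using \<open>(e, b) \<in> B\<close> unfolding B_def by auto
    then show ?thesis using pick(1)[of b'] by simp
  qed
  have "finite B" using B0(2) by (simp add: B_def)
  then show ?thesis using GB main by blast
qed

end

section \<open>The stalks of a closed subscheme of projective space\<close>

locale graded_stalk = field_coding K dec N
  for K :: "('a, 'c) ring_scheme" and dec :: "'a \<Rightarrow> 'k::field" and N :: nat +
  fixes I Q :: "(nat multiset \<Rightarrow> 'a) set"
  assumes I_hom: "homogeneous_ideal K N I" and Q_point: "Q \<in> proj_points K N I"
begin

lemma I_ideal: "ideal I S" using I_hom by (simp add: homogeneous_ideal_def)
lemma Q_prime: "primeideal Q S" and I_Q: "I \<subseteq> Q" and Q_hom: "homogeneous_ideal K N Q"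
  and Q_relevant: "\<not> irrelevant_ideal K N \<subseteq> Q"
  using Q_point by (auto simp: proj_points_def)

sublocale I: ideal I S by (rule I_ideal)
sublocale Q: primeideal Q S by (rule Q_prime)

abbreviation "A \<equiv> S Quot I"
abbreviation "cl f \<equiv> I +>\<^bsub>S\<^esub> f"

sublocale A: cring A by (rule I.quotient_is_cring[OF S_cring])

lemma cl_closed: "f \<in> carrier S \<Longrightarrow> cl f \<in> carrier A"
  using ring_hom_memE(1)[OF I.rcos_ring_hom] .

lemma cl_simps:
  assumes "f \<in> carrier S" "g \<in> carrier S"
  shows "cl f \<oplus>\<^bsub>A\<^esub> cl g = cl (f \<oplus>\<^bsub>S\<^esub> g)" "cl f \<otimes>\<^bsub>A\<^esub> cl g = cl (f \<otimes>\<^bsub>S\<^esub> g)"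
  using assms ring_hom_memE[OF I.rcos_ring_hom] by auto

lemma cl_one: "\<one>\<^bsub>A\<^esub> = cl \<one>\<^bsub>S\<^esub>"
  using ring_hom_memE(4)[OF I.rcos_ring_hom] by simp

lemma cl_zero: "\<zero>\<^bsub>A\<^esub> = cl \<zero>\<^bsub>S\<^esub>"
  using ring_hom_zero[OF I.rcos_ring_hom S.ring_axioms A.ring_axioms] by simp

lemma cl_eq_iff: "f \<in> carrier S \<Longrightarrow> g \<in> carrier S \<Longrightarrow> cl f = cl g \<longleftrightarrow> f \<ominus>\<^bsub>S\<^esub> g \<in> I"
  using S.quotient_eq_iff_same_a_r_cos[OF I_ideal] by simp

definition W where "W = {cl g | g d. form d g \<and> g \<notin> Q}"

lemma one_notin_Q: "\<one>\<^bsub>S\<^esub> \<notin> Q"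
  using Q.one_imp_carrier Q.I_notcarr by blast

lemma mult_notin_Q: "f \<in> carrier S \<Longrightarrow> g \<in> carrier S \<Longrightarrow> f \<notin> Q \<Longrightarrow> g \<notin> Q \<Longrightarrow> f \<otimes>\<^bsub>S\<^esub> g \<notin> Q"
  using Q.I_prime by blast

lemma pow_notin_Q: "f \<in> carrier S \<Longrightarrow> f \<notin> Q \<Longrightarrow> f [^]\<^bsub>S\<^esub> (n::nat) \<notin> Q"
  by (induction n) (auto simp: one_notin_Q mult_notin_Q)

sublocale L: ring_localization A W
proof
  show "W \<subseteq> carrier A" by (auto simp: W_def intro: cl_closed)
  show "\<one>\<^bsub>A\<^esub> \<in> W" unfolding W_def cl_one using one_notin_Q form_one by blast
  fix u v assume "u \<in> W" "v \<in> W"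
  then obtain f d g e where f: "u = cl f" "form d f" "f \<notin> Q" and g: "v = cl g" "form e g" "g \<notin> Q"
    by (auto simp: W_def)
  have c: "f \<in> carrier S" "g \<in> carrier S" using f g by auto
  have "u \<otimes>\<^bsub>A\<^esub> v = cl (f \<otimes>\<^bsub>S\<^esub> g)" using f g c by (simp add: cl_simps)
  then show "u \<otimes>\<^bsub>A\<^esub> v \<in> W"
    using form_mult[OF f(2) g(2)] mult_notin_Q[OF c f(3) g(3)] unfolding W_def by blast
qed

text \<open>The fraction of two forms in the stalk.\<close>

definition q where "q f g = fraction A W (self_module A) (cl f) (cl g)"

abbreviation "T \<equiv> proj_stalk K N I Q"

lemma T_def': "T = L.LR\<lparr>carrier := {q f g | f g d. form d f \<and> form d g \<and> g \<notin> Q}\<rparr>"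
  unfolding proj_stalk_def Let_def q_def W_def by simp

lemma T_carrier: "carrier T = {q f g | f g d. form d f \<and> form d g \<and> g \<notin> Q}"
  by (simp add: T_def')

lemma q_closed [intro]: "form d f \<Longrightarrow> form d g \<Longrightarrow> g \<notin> Q \<Longrightarrow> q f g \<in> carrier T"
  unfolding T_carrier by blast

lemma T_cases:
  assumes "x \<in> carrier T"
  obtains f g d where "form d f" "form d g" "g \<notin> Q" "x = q f g"
  using assms unfolding T_carrier by blast

lemma W_cl: "form d g \<Longrightarrow> g \<notin> Q \<Longrightarrow> cl g \<in> W"
  unfolding W_def by blast

lemma q_eq_iff:
  assumes f: "form d f" "form d g" "g \<notin> Q" and f': "form e f'" "form e g'" "g' \<notin> Q"
  shows "q f g = q f' g' \<longleftrightarrow>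
    (\<exists>t c. form c t \<and> t \<notin> Q \<and> t \<otimes>\<^bsub>S\<^esub> (g' \<otimes>\<^bsub>S\<^esub> f \<ominus>\<^bsub>S\<^esub> g \<otimes>\<^bsub>S\<^esub> f') \<in> I)"
proof -
  note c = form_closed[OF f(1)] form_closed[OF f(2)] form_closed[OF f'(1)] form_closed[OF f'(2)]
  have "q f g = q f' g' \<longleftrightarrow> (\<exists>u\<in>W. u \<otimes>\<^bsub>A\<^esub> cl g' \<otimes>\<^bsub>A\<^esub> cl f = u \<otimes>\<^bsub>A\<^esub> cl g \<otimes>\<^bsub>A\<^esub> cl f')"
    unfolding q_def by (rule L.frac_ring_eq_iff) (use f f' c W_cl in \<open>auto intro: cl_closed\<close>)
  also have "\<dots> \<longleftrightarrow> (\<exists>t c. form c t \<and> t \<notin> Q \<and>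
      cl t \<otimes>\<^bsub>A\<^esub> cl g' \<otimes>\<^bsub>A\<^esub> cl f = cl t \<otimes>\<^bsub>A\<^esub> cl g \<otimes>\<^bsub>A\<^esub> cl f')"
    unfolding W_def by blast
  also have "\<dots> \<longleftrightarrow> (\<exists>t c. form c t \<and> t \<notin> Q \<and> t \<otimes>\<^bsub>S\<^esub> (g' \<otimes>\<^bsub>S\<^esub> f \<ominus>\<^bsub>S\<^esub> g \<otimes>\<^bsub>S\<^esub> f') \<in> I)"
  proof (intro ex_cong1 conj_cong refl)
    fix t k assume "form k t"
    then have t: "t \<in> carrier S" by auto
    have "t \<otimes>\<^bsub>S\<^esub> g' \<otimes>\<^bsub>S\<^esub> f \<ominus>\<^bsub>S\<^esub> t \<otimes>\<^bsub>S\<^esub> g \<otimes>\<^bsub>S\<^esub> f' = t \<otimes>\<^bsub>S\<^esub> (g' \<otimes>\<^bsub>S\<^esub> f \<ominus>\<^bsub>S\<^esub> g \<otimes>\<^bsub>S\<^esub> f')"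
      using t c by (simp add: S.minus_eq S.r_distr S.r_minus S.m_assoc)
    then show "cl t \<otimes>\<^bsub>A\<^esub> cl g' \<otimes>\<^bsub>A\<^esub> cl f = cl t \<otimes>\<^bsub>A\<^esub> cl g \<otimes>\<^bsub>A\<^esub> cl f' \<longleftrightarrow>
        t \<otimes>\<^bsub>S\<^esub> (g' \<otimes>\<^bsub>S\<^esub> f \<ominus>\<^bsub>S\<^esub> g \<otimes>\<^bsub>S\<^esub> f') \<in> I"
      using t c by (simp add: cl_closed cl_simps cl_eq_iff)
  qed
  finally show ?thesis .
qed

lemma q_eqI:
  assumes f: "form d f" "form d g" "g \<notin> Q" and f': "form e f'" "form e g'" "g' \<notin> Q"
    and eq: "g' \<otimes>\<^bsub>S\<^esub> f = g \<otimes>\<^bsub>S\<^esub> f'"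
  shows "q f g = q f' g'"
proof -
  have "\<one>\<^bsub>S\<^esub> \<otimes>\<^bsub>S\<^esub> (g' \<otimes>\<^bsub>S\<^esub> f \<ominus>\<^bsub>S\<^esub> g \<otimes>\<^bsub>S\<^esub> f') = \<zero>\<^bsub>S\<^esub>"
    using eq form_closed[OF f(1)] form_closed[OF f(2)] form_closed[OF f'(1)] form_closed[OF f'(2)]
    by (simp add: S.minus_eq S.r_neg)
  then show ?thesis
    unfolding q_eq_iff[OF f f'] using one_notin_Q form_one I.zero_closed by metis
qed

lemma q_add_LR:
  assumes f: "form d f" "form d g" "g \<notin> Q" and f': "form e f'" "form e g'" "g' \<notin> Q"
  shows "q f g \<oplus>\<^bsub>L.LR\<^esub> q f' g' = q (g' \<otimes>\<^bsub>S\<^esub> f \<oplus>\<^bsub>S\<^esub> g \<otimes>\<^bsub>S\<^esub> f') (g \<otimes>\<^bsub>S\<^esub> g')"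
  unfolding q_def
  using form_closed[OF f(1)] form_closed[OF f(2)] form_closed[OF f'(1)] form_closed[OF f'(2)]
    W_cl[OF f(2,3)] W_cl[OF f'(2,3)]
  by (subst L.add_LR) (auto simp: cl_closed cl_simps)

lemma q_mult_LR:
  assumes f: "form d f" "form d g" "g \<notin> Q" and f': "form e f'" "form e g'" "g' \<notin> Q"
  shows "q f g \<otimes>\<^bsub>L.LR\<^esub> q f' g' = q (f \<otimes>\<^bsub>S\<^esub> f') (g \<otimes>\<^bsub>S\<^esub> g')"
  unfolding q_def
  using form_closed[OF f(1)] form_closed[OF f(2)] form_closed[OF f'(1)] form_closed[OF f'(2)]
    W_cl[OF f(2,3)] W_cl[OF f'(2,3)]
  by (subst L.mult_LR) (auto simp: cl_closed cl_simps)

lemma q_one_LR: "\<one>\<^bsub>L.LR\<^esub> = q \<one>\<^bsub>S\<^esub> \<one>\<^bsub>S\<^esub>"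
  by (simp add: L.LR_simps q_def cl_one)

lemma q_zero_LR: "form d g \<Longrightarrow> g \<notin> Q \<Longrightarrow> q \<zero>\<^bsub>S\<^esub> g = \<zero>\<^bsub>L.LR\<^esub>"
  using L.frac_zero[OF W_cl, of d g] by (simp add: q_def cl_zero[symmetric] L.LR_simps)

lemma T_cring: "cring T"
proof -
  interpret LR: cring L.LR by (rule L.LR_cring)
  have LRc: "q f g \<in> carrier L.LR" if "form d f" "form d g" "g \<notin> Q" for d f g
    using cl_closed[OF form_closed[OF that(1)]] W_cl[OF that(2,3)] by (simp add: q_def L.LR_simps)
  have sub: "subring (carrier T) L.LR"
  proof (rule LR.subringI)
    show "carrier T \<subseteq> carrier L.LR" by (auto elim!: T_cases intro: LRc)
    show "\<one>\<^bsub>L.LR\<^esub> \<in> carrier T" unfolding q_one_LR by (rule q_closed[of 0]) (auto simp: one_notin_Q)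
    fix x assume "x \<in> carrier T"
    then obtain f g d where f: "form d f" "form d g" "g \<notin> Q" "x = q f g" by (rule T_cases)
    have m: "form d (\<ominus>\<^bsub>S\<^esub> f)" using f(1) by auto
    have "q (\<ominus>\<^bsub>S\<^esub> f) g \<oplus>\<^bsub>L.LR\<^esub> q f g = q \<zero>\<^bsub>S\<^esub> (g \<otimes>\<^bsub>S\<^esub> g)"
      unfolding q_add_LR[OF m f(2,3) f(1,2,3)] using form_closed[OF f(1)] form_closed[OF f(2)]
      by (simp add: S.r_minus S.l_neg)
    also have "\<dots> = \<zero>\<^bsub>L.LR\<^esub>"
      using q_zero_LR[OF form_mult[OF f(2,2)]] mult_notin_Q[of g g] form_closed[OF f(2)] f(3) by blast
    finally have "\<ominus>\<^bsub>L.LR\<^esub> x = q (\<ominus>\<^bsub>S\<^esub> f) g"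
      unfolding f(4) by (rule LR.minus_equality[OF _ LRc[OF f(1-3)] LRc[OF m f(2,3)]])
    then show "\<ominus>\<^bsub>L.LR\<^esub> x \<in> carrier T" using m f by auto
    fix y assume "y \<in> carrier T"
    then obtain f' g' e where f': "form e f'" "form e g'" "g' \<notin> Q" "y = q f' g'" by (rule T_cases)
    have gg: "g \<otimes>\<^bsub>S\<^esub> g' \<notin> Q" using mult_notin_Q f f' form_closed by blast
    show "x \<otimes>\<^bsub>L.LR\<^esub> y \<in> carrier T"
      unfolding f(4) f'(4) q_mult_LR[OF f(1-3) f'(1-3)]
      using form_mult[OF f(1) f'(1)] form_mult[OF f(2) f'(2)] gg by auto
    show "x \<oplus>\<^bsub>L.LR\<^esub> y \<in> carrier T"
      unfolding f(4) f'(4) q_add_LR[OF f(1-3) f'(1-3)]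
      using form_add[OF form_mult[OF f'(2) f(1)]] form_mult[OF f(2) f'(1)] form_mult[OF f(2) f'(2)] gg
      by (intro q_closed[of "e + d"]) (auto simp: add.commute)
  qed
  then have "cring (L.LR\<lparr>carrier := carrier T\<rparr>)"
    using LR.subcringI'[OF sub] LR.subcring_iff subringE(1)[OF sub] by blast
  then show ?thesis by (simp add: T_def')
qed

sublocale T: cring T by (rule T_cring)

lemma q_add:
  assumes "form d f" "form d g" "g \<notin> Q" "form e f'" "form e g'" "g' \<notin> Q"
  shows "q f g \<oplus>\<^bsub>T\<^esub> q f' g' = q (g' \<otimes>\<^bsub>S\<^esub> f \<oplus>\<^bsub>S\<^esub> g \<otimes>\<^bsub>S\<^esub> f') (g \<otimes>\<^bsub>S\<^esub> g')"
  using q_add_LR[OF assms] by (simp add: T_def')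

lemma q_mult:
  assumes "form d f" "form d g" "g \<notin> Q" "form e f'" "form e g'" "g' \<notin> Q"
  shows "q f g \<otimes>\<^bsub>T\<^esub> q f' g' = q (f \<otimes>\<^bsub>S\<^esub> f') (g \<otimes>\<^bsub>S\<^esub> g')"
  using q_mult_LR[OF assms] by (simp add: T_def')

lemma q_one: "\<one>\<^bsub>T\<^esub> = q \<one>\<^bsub>S\<^esub> \<one>\<^bsub>S\<^esub>" 
  using q_one_LR by (simp add: T_def')

lemma q_zero: "form d g \<Longrightarrow> g \<notin> Q \<Longrightarrow> q \<zero>\<^bsub>S\<^esub> g = \<zero>\<^bsub>T\<^esub>"
  using q_zero_LR by (simp add: T_def')

lemma q_pow:
  assumes "form d f" "form d g" "g \<notin> Q"
  shows "q f g [^]\<^bsub>T\<^esub> (n::nat) = q (f [^]\<^bsub>S\<^esub> n) (g [^]\<^bsub>S\<^esub> n)"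
proof (induction n)
  case (Suc n)
  then show ?case
    using q_mult[OF form_pow[OF assms(1)] form_pow[OF assms(2)] pow_notin_Q assms]
      form_closed[OF assms(2)] assms(3) by simp
qed (simp add: q_one)

lemma q_add_same:
  assumes f: "form d f" "form d f'" "form d g" "g \<notin> Q"
  shows "q f g \<oplus>\<^bsub>T\<^esub> q f' g = q (f \<oplus>\<^bsub>S\<^esub> f') g"
proof -
  note c = form_closed[OF f(1)] form_closed[OF f(2)] form_closed[OF f(3)]
  have gg: "g \<otimes>\<^bsub>S\<^esub> g \<notin> Q" using mult_notin_Q f c by blast
  have 1: "form (d + d) (g \<otimes>\<^bsub>S\<^esub> f \<oplus>\<^bsub>S\<^esub> g \<otimes>\<^bsub>S\<^esub> f')" using f by (intro form_add form_mult)
  show ?thesis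
    unfolding q_add[OF f(1,3,4) f(2,3,4)]
    by (rule q_eqI[OF 1 form_mult[OF f(3,3)] gg form_add[OF f(1,2)] f(3,4)])
      (use c in \<open>simp add: S.r_distr S.m_assoc\<close>)
qed

lemma q_minus:
  assumes f: "form d f" "form d g" "g \<notin> Q"
  shows "\<ominus>\<^bsub>T\<^esub> q f g = q (\<ominus>\<^bsub>S\<^esub> f) g"
proof (rule T.minus_equality)
  show "q (\<ominus>\<^bsub>S\<^esub> f) g \<oplus>\<^bsub>T\<^esub> q f g = \<zero>\<^bsub>T\<^esub>"
    using f form_closed[OF f(1)] form_minus[OF f(1)] by (simp add: q_add_same S.l_neg q_zero)
qed (use f in auto)

subsection \<open>The stalk is local\<close>

lemma numerator_in_Q:
  assumes f: "form d f" "form d g" "g \<notin> Q" and f': "form e f'" "form e g'" "g' \<notin> Q"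
    and eq: "q f g = q f' g'" and Q: "f' \<in> Q"
  shows "f \<in> Q"
proof -
  note c = form_closed[OF f(1)] form_closed[OF f(2)] form_closed[OF f'(1)] form_closed[OF f'(2)]
  obtain t k where t: "form k t" "t \<notin> Q" "t \<otimes>\<^bsub>S\<^esub> (g' \<otimes>\<^bsub>S\<^esub> f \<ominus>\<^bsub>S\<^esub> g \<otimes>\<^bsub>S\<^esub> f') \<in> I"
    using eq unfolding q_eq_iff[OF f f'] by blast
  have tS: "t \<in> carrier S" using t by auto
  have "g' \<otimes>\<^bsub>S\<^esub> f \<ominus>\<^bsub>S\<^esub> g \<otimes>\<^bsub>S\<^esub> f' \<in> Q"
    using Q.I_prime[OF tS _ subsetD[OF I_Q t(3)]] t(2) c by auto
  moreover have "g \<otimes>\<^bsub>S\<^esub> f' \<in> Q" using Q c Q.I_l_closed by blast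
  ultimately have "(g' \<otimes>\<^bsub>S\<^esub> f \<ominus>\<^bsub>S\<^esub> g \<otimes>\<^bsub>S\<^esub> f') \<oplus>\<^bsub>S\<^esub> g \<otimes>\<^bsub>S\<^esub> f' \<in> Q"
    by (rule Q.a_closed)
  then have "g' \<otimes>\<^bsub>S\<^esub> f \<in> Q" using c by (simp add: S.minus_eq S.a_assoc S.l_neg)
  then show ?thesis using Q.I_prime[of g' f] c f'(3) by blast
qed

definition M where "M = {q f g | f g d. form d f \<and> form d g \<and> g \<notin> Q \<and> f \<in> Q}"

lemma q_in_M_iff:
  assumes f: "form d f" "form d g" "g \<notin> Q"
  shows "q f g \<in> M \<longleftrightarrow> f \<in> Q"
  using numerator_in_Q[OF f] f unfolding M_def by blast

lemma M_ideal: "ideal M T"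
proof (rule idealI[OF T.ring_axioms])
  show "subgroup M (add_monoid T)"
  proof (rule T.add.subgroupI)
    show "M \<subseteq> carrier T" unfolding M_def by auto
    have "q \<zero>\<^bsub>S\<^esub> \<one>\<^bsub>S\<^esub> \<in> M" by (subst q_in_M_iff[of 0]) (auto simp: one_notin_Q)
    then show "M \<noteq> {}" by blast
    fix x assume "x \<in> M"
    then obtain f g d where f: "form d f" "form d g" "g \<notin> Q" "f \<in> Q" "x = q f g" unfolding M_def by blast
    show "\<ominus>\<^bsub>T\<^esub> x \<in> M"
      unfolding f(5) q_minus[OF f(1-3)] q_in_M_iff[OF form_minus[OF f(1)] f(2,3)] using f(4) by simp
    fix y assume "y \<in> M"
    then obtain f' g' e where f': "form e f'" "form e g'" "g' \<notin> Q" "f' \<in> Q" "y = q f' g'" unfolding M_def by blast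
    note c = form_closed[OF f(1)] form_closed[OF f(2)] form_closed[OF f'(1)] form_closed[OF f'(2)]
    show "x \<oplus>\<^bsub>T\<^esub> y \<in> M"
      unfolding f(5) f'(5) q_add[OF f(1-3) f'(1-3)]
      using form_mult[OF f'(2) f(1)] form_mult[OF f(2) f'(1)] form_mult[OF f(2) f'(2)] mult_notin_Q[of g g'] f f' c
      by (subst q_in_M_iff[of "d + e"]) (auto simp: add.commute intro!: Q.a_closed Q.I_l_closed form_add)
  qed
  fix x y assume "x \<in> M" and y: "y \<in> carrier T"
  then obtain f g d where f: "form d f" "form d g" "g \<notin> Q" "f \<in> Q" "x = q f g" unfolding M_def by blast
  obtain f' g' e where f': "form e f'" "form e g'" "g' \<notin> Q" "y = q f' g'" using y by (rule T_cases)
  note c = form_closed[OF f(1)] form_closed[OF f(2)] form_closed[OF f'(1)] form_closed[OF f'(2)]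
  show "y \<otimes>\<^bsub>T\<^esub> x \<in> M"
    unfolding f(5) f'(4) q_mult[OF f'(1-3) f(1-3)]
    using form_mult[OF f'(1) f(1)] form_mult[OF f'(2) f(2)] mult_notin_Q[of g' g] f f' c
    by (subst q_in_M_iff) (auto intro!: Q.I_l_closed)
  then show "x \<otimes>\<^bsub>T\<^esub> y \<in> M" using y f by (simp add: T.m_comm[of _ y] q_closed)
qed

lemma one_notin_M: "\<one>\<^bsub>T\<^esub> \<notin> M"
  unfolding q_one by (subst q_in_M_iff[of 0]) (auto simp: one_notin_Q)

lemma ideal_not_in_M:
  assumes J: "ideal J T" and x: "x \<in> J" "x \<notin> M"
  shows "J = carrier T"
proof -
  interpret J: ideal J T by (rule J)
  obtain f g d where f: "form d f" "form d g" "g \<notin> Q" "x = q f g"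
    using J.Icarr[OF x(1)] by (rule T_cases)
  have fQ: "f \<notin> Q" using x(2) unfolding f(4) q_in_M_iff[OF f(1-3)] .
  have "q g f \<otimes>\<^bsub>T\<^esub> x \<in> J" using x(1) f fQ by (intro J.I_l_closed) auto
  also have "q g f \<otimes>\<^bsub>T\<^esub> x = \<one>\<^bsub>T\<^esub>"
    unfolding f(4) q_mult[OF f(2,1) fQ f(1-3)] q_one
    using f fQ form_closed[OF f(1)] form_closed[OF f(2)] form_mult[OF f(2,1)] form_mult[OF f(1,2)] mult_notin_Q[of f g]
    by (intro q_eqI[of "d + d" _ _ 0]) (auto simp: one_notin_Q S.m_comm)
  finally show ?thesis by (rule J.one_imp_carrier)
qed

lemma M_maximal: "maximalideal M T"
proof (rule maximalidealI[OF M_ideal])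
  show "carrier T \<noteq> M" using one_notin_M T.one_closed by blast
  fix J assume "ideal J T" "M \<subseteq> J" "J \<subseteq> carrier T"
  then show "J = M \<or> J = carrier T" using ideal_not_in_M by blast
qed

lemma maximal_unique:
  assumes "maximalideal J T"
  shows "J = M"
proof -
  interpret J: maximalideal J T by (rule assms)
  have "x \<in> M" if "x \<in> J" for x
    using ideal_not_in_M[OF J.ideal_axioms that] J.I_notcarr by blast
  then have "J \<subseteq> M" by blast
  then show ?thesis
    using J.I_maximal[OF M_ideal] M_maximal maximalideal.I_notcarr ideal.Icarr[OF M_ideal] by blast
qed

subsection \<open>The stalk is Noetherian\<close>

lemma var_notin_Q: "\<exists>i\<le>N. var i \<notin> Q"
proof (rule ccontr)
  assume "\<not> ?thesis"
  then have vars: "var i \<in> Q" if "i \<le> N" for i using that by blast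
  have "f \<in> Q" if f: "f \<in> irrelevant_ideal K N" for f
  proof -
    have fS: "f \<in> carrier S" "f {#} = \<zero>\<^bsub>K\<^esub>" using f by (auto simp: irrelevant_ideal_def)
    show ?thesis
    proof (rule poly_induct[OF fS(1), where P = "\<lambda>f. f \<in> Q"])
      fix m c assume m: "m \<in> keys (pm f)"
      then have "m \<noteq> {#}" using fS by (auto simp: keys_pm)
      then obtain i n where i: "m = add_mset i n" by (meson multiset_cases)
      have mN: "i \<le> N" "set_mset n \<subseteq> {..N}" using keys_pm_vars[OF fS(1) m] i by auto
      have nS: "mp (Poly_Mapping.single n c) \<in> carrier S" using mN by (intro mp_closed) simp
      have vS: "var i \<in> carrier S" using mN(1) by blast
      have "mp (Poly_Mapping.single m c) = mp (Poly_Mapping.single n c) \<otimes>\<^bsub>S\<^esub> var i"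
        using mN nS vS by (simp add: mult_eq_mp pm_var pm_mp mult_single i)
      also have "\<dots> \<in> Q" using vars[OF mN(1)] nS by (rule Q.I_l_closed)
      finally show "mp (Poly_Mapping.single m c) \<in> Q" .
    qed auto
  qed
  then show False using Q_relevant by blast
qed

definition y where "y = var (SOME i. i \<le> N \<and> var i \<notin> Q)"

lemma y_form: "form 1 y" and y_notin: "y \<notin> Q"
proof -
  have "(SOME i. i \<le> N \<and> var i \<notin> Q) \<le> N \<and> var (SOME i. i \<le> N \<and> var i \<notin> Q) \<notin> Q"
    using someI_ex[of "\<lambda>i. i \<le> N \<and> var i \<notin> Q"] var_notin_Q by blast
  then show "form 1 y" "y \<notin> Q" unfolding y_def by (blast intro: form_var)+
qed

abbreviation "yp n \<equiv> y [^]\<^bsub>S\<^esub> (n::nat)"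

lemma yp: "form n (yp n)" "yp n \<notin> Q" "yp n \<in> carrier S"
  using form_pow[OF y_form, of n] pow_notin_Q[OF form_closed[OF y_form] y_notin, of n] by auto

lemma ideal_finitely_generated:
  assumes J: "ideal J T"
  shows "\<exists>B\<subseteq>carrier T. finite B \<and> J = Idl\<^bsub>T\<^esub> B"
proof -
  interpret J: ideal J T by (rule J)
  define G where "G d f \<longleftrightarrow> form d f \<and> q f (yp d) \<in> J" for d f
  have G_all: "q f g \<in> J \<longleftrightarrow> G d f" if f: "form d f" "form d g" "g \<notin> Q" for d f g
  proof -
    have mul: "q f h \<in> J" if h: "form d h" "h \<notin> Q" and k: "form d k" "k \<notin> Q" "q f k \<in> J" for h k
    proof -
      note c = form_closed[OF f(1)] form_closed[OF h(1)] form_closed[OF k(1)]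
      have "q f h = q k h \<otimes>\<^bsub>T\<^esub> q f k"
        unfolding q_mult[OF k(1) h f(1) k(1,2)]
        using form_mult[OF k(1) f(1)] form_mult[OF h(1) k(1)] mult_notin_Q[of h k] f h k c
        by (intro q_eqI[of d _ _ "d + d"]) (auto simp: S.m_ac)
      then show ?thesis using J.I_l_closed[OF k(3), of "q k h"] k h by auto
    qed
    show ?thesis using mul[OF f(2,3) yp(1,2)] mul[OF yp(1,2) f(2,3)] f by (auto simp: G_def)
  qed
  have G1: "form d f" if "G d f" for d f using that by (simp add: G_def)
  have G2: "G d (f \<ominus>\<^bsub>S\<^esub> g)" if f: "G d f" and g: "G d g" for d f g
    proof -
      have h: "form d f" "form d g" "form d (\<ominus>\<^bsub>S\<^esub> g)" using f g by (auto simp: G_def)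
      have "q f (yp d) \<oplus>\<^bsub>T\<^esub> \<ominus>\<^bsub>T\<^esub> q g (yp d) = q (f \<ominus>\<^bsub>S\<^esub> g) (yp d)"
        unfolding q_minus[OF h(2) yp(1,2)] S.minus_eq by (rule q_add_same[OF h(1,3) yp(1,2)])
      moreover have "q f (yp d) \<oplus>\<^bsub>T\<^esub> \<ominus>\<^bsub>T\<^esub> q g (yp d) \<in> J"
        using f g by (auto simp: G_def)
      ultimately show ?thesis using h by (auto simp: G_def S.minus_eq)
    qed
  have G3: "G (e + d) (a \<otimes>\<^bsub>S\<^esub> f)" if a: "form e a" and f: "G d f" for d e a f
    proof -
      have fd: "form d f" "q f (yp d) \<in> J" using f by (auto simp: G_def)
      have "q a (yp e) \<otimes>\<^bsub>T\<^esub> q f (yp d) \<in> J" using fd a yp(1,2) by (intro J.I_l_closed) auto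
      then have "q (a \<otimes>\<^bsub>S\<^esub> f) (yp e \<otimes>\<^bsub>S\<^esub> yp d) \<in> J" unfolding q_mult[OF a yp(1,2) fd(1) yp(1,2)] .
      then show ?thesis
        using fd a y_form by (simp add: G_def S.nat_pow_mult form_mult form_closed)
    qed
  obtain B where B: "finite B" "\<And>e b. (e, b) \<in> B \<Longrightarrow> G e b" and gen: "\<And>d f. G d f \<Longrightarrow> graded_span B d f"
    using graded_submodule_finitely_generated[of G, OF G1 G2 G3] by blast
  define C where "C = (\<lambda>(e, b). q b (yp e)) ` B"
  have CJ: "C \<subseteq> J" using B(2) by (auto simp: C_def G_def)
  have CT: "C \<subseteq> carrier T" using CJ J.a_subset by blast
  interpret Id: ideal "Idl\<^bsub>T\<^esub> C" T by (rule T.genideal_ideal[OF CT])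
  have "J \<subseteq> Idl\<^bsub>T\<^esub> C"
  proof
    fix x assume x: "x \<in> J"
    obtain f g d where f: "form d f" "form d g" "g \<notin> Q" "x = q f g"
      using J.Icarr[OF x] by (rule T_cases)
    have "graded_span B d f" using x f G_all by (auto intro: gen)
    then have "q f g \<in> Idl\<^bsub>T\<^esub> C"
    proof (induction rule: graded_span.induct)
      case zero
      show ?case using f by (simp add: q_zero Id.zero_closed)
    next
      case (add h h')
      then show ?case
        using Id.a_closed[OF add.IH] q_add_same[OF graded_span_form graded_span_form f(2,3)] by simp
    next
      case (gen e b c a)
      note eb = gen(1) and b = gen(2) and a = gen(3) and deg = gen(4)
      have aS: "a \<in> carrier S" "b \<in> carrier S" "g \<in> carrier S" using a b f by auto
      have ay: "form d (a \<otimes>\<^bsub>S\<^esub> yp e)" using form_mult[OF a yp(1)[of e]] deg by simp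
      have "q b (yp e) \<in> Idl\<^bsub>T\<^esub> C" using T.genideal_self[OF CT] eb by (auto simp: C_def)
      then have "q (a \<otimes>\<^bsub>S\<^esub> yp e) g \<otimes>\<^bsub>T\<^esub> q b (yp e) \<in> Idl\<^bsub>T\<^esub> C"
        using ay f by (intro Id.I_l_closed) auto
      also have "q (a \<otimes>\<^bsub>S\<^esub> yp e) g \<otimes>\<^bsub>T\<^esub> q b (yp e) = q (a \<otimes>\<^bsub>S\<^esub> b) g"
        unfolding q_mult[OF ay f(2,3) b yp(1,2)]
        using form_mult[OF ay b] form_mult[OF f(2) yp(1)[of e]] mult_notin_Q[OF aS(3) yp(3) f(3) yp(2)]
          form_mult[OF a b] deg f aS yp(3)
        by (intro q_eqI[of "d + e" _ _ d]) (auto simp: S.m_ac)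
      finally show ?case .
    qed
    then show "x \<in> Idl\<^bsub>T\<^esub> C" using f by simp
  qed
  moreover have "Idl\<^bsub>T\<^esub> C \<subseteq> J" by (rule T.genideal_minimal[OF J CJ])
  ultimately show ?thesis using CT B(1) by (intro exI[of _ C]) (auto simp: C_def)
qed

lemma T_noetherian: "noetherian_ring T"
  by (rule T.noetherian_ringI) (use ideal_finitely_generated in blast)

end

lemma count_sum_replicate:
  "count (\<Sum>i\<le>n. replicate_mset (k i) i) j = (if j \<le> n then k j else 0)" for n :: nat
  by (simp add: count_sum)

lemma set_sum_replicate: "set_mset (\<Sum>i\<le>n. replicate_mset (k i) i) \<subseteq> {..n}" for n :: nat
proof
  fix j assume "j \<in># (\<Sum>i\<le>n. replicate_mset (k i) i)"
  then have "count (\<Sum>i\<le>n. replicate_mset (k i) i) j \<noteq> 0" by (metis not_in_iff)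
  then show "j \<in> {..n}" by (auto simp: count_sum_replicate split: if_splits)
qed

context field_coding
begin

lemma pm_pow: "f \<in> carrier S \<Longrightarrow> pm (f [^]\<^bsub>S\<^esub> (n::nat)) = pm f ^ n"
  by (induction n) (simp_all add: pm_one pm_mult mult.commute)

lemma single_power: "Poly_Mapping.single m c ^ n = Poly_Mapping.single (repeat_mset n m) (c ^ n)"
  for m :: "'i multiset" and c :: 'k
  by (induction n) (simp_all add: mult_single)

lemma const_add: "const (a + b) = const a \<oplus>\<^bsub>S\<^esub> const b"
  by (simp add: const_def mp_add[symmetric] single_add)

lemma const_zero: "const 0 = \<zero>\<^bsub>S\<^esub>" and const_one: "const 1 = \<one>\<^bsub>S\<^esub>"
  by (simp_all add: const_def zero_S(1) one_S)

end

text \<open>Over a perfect field every coefficient is a \<open>p\<close>-th power, which makes the stalks F-finite.\<close>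

locale perfect_stalk = graded_stalk K dec N I Q
  for K :: "('a, 'c) ring_scheme" and dec :: "'a \<Rightarrow> 'k::field" and N :: nat and I Q +
  fixes p :: nat
  assumes p_prime: "Factorial_Ring.prime p" and CHAR_p: "CHAR('k) = p"
    and perfect: "\<exists>b::'k. b ^ p = c"
begin

lemma form_frobenius_add:
  assumes f: "f \<in> carrier S" "g \<in> carrier S"
  shows "(f \<oplus>\<^bsub>S\<^esub> g) [^]\<^bsub>S\<^esub> p = f [^]\<^bsub>S\<^esub> p \<oplus>\<^bsub>S\<^esub> g [^]\<^bsub>S\<^esub> p"
proof -
  have "(of_nat p :: nat multiset \<Rightarrow>\<^sub>0 'k) = 0"
    using CHAR_p of_nat_CHAR[where 'a = 'k] by (simp add: of_nat_single)
  then have "CHAR(nat multiset \<Rightarrow>\<^sub>0 'k) dvd p" by (simp add: of_nat_eq_0_iff_char_dvd)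
  moreover have "CHAR(nat multiset \<Rightarrow>\<^sub>0 'k) \<noteq> 1"
  proof
    assume "CHAR(nat multiset \<Rightarrow>\<^sub>0 'k) = 1"
    then have "(of_nat 1 :: nat multiset \<Rightarrow>\<^sub>0 'k) = 0" by (metis of_nat_CHAR)
    then show False by simp
  qed
  ultimately have char: "CHAR(nat multiset \<Rightarrow>\<^sub>0 'k) = p"
    using p_prime by (auto simp: prime_nat_iff)
  have "(pm f + pm g) ^ p = pm f ^ p + pm g ^ p"
    by (rule freshmans_dream) (use char p_prime in simp_all)
  then have "pm ((f \<oplus>\<^bsub>S\<^esub> g) [^]\<^bsub>S\<^esub> p) = pm (f [^]\<^bsub>S\<^esub> p \<oplus>\<^bsub>S\<^esub> g [^]\<^bsub>S\<^esub> p)"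
    using f by (simp add: pm_pow pm_add)
  then show ?thesis using f by (intro pm_eqD) auto
qed

lemma T_frobenius_add:
  assumes x: "x \<in> carrier T" "x' \<in> carrier T"
  shows "(x \<oplus>\<^bsub>T\<^esub> x') [^]\<^bsub>T\<^esub> p = x [^]\<^bsub>T\<^esub> p \<oplus>\<^bsub>T\<^esub> x' [^]\<^bsub>T\<^esub> p"
proof -
  obtain f g d where f: "form d f" "form d g" "g \<notin> Q" "x = q f g" by (rule T_cases[OF x(1)])
  obtain f' g' e where f': "form e f'" "form e g'" "g' \<notin> Q" "x' = q f' g'" by (rule T_cases[OF x(2)])
  note c = form_closed[OF f(1)] form_closed[OF f(2)] form_closed[OF f'(1)] form_closed[OF f'(2)]
  have n: "form (d + e) (g' \<otimes>\<^bsub>S\<^esub> f \<oplus>\<^bsub>S\<^esub> g \<otimes>\<^bsub>S\<^esub> f')"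
    using form_mult[OF f'(2) f(1)] form_mult[OF f(2) f'(1)] by (auto simp: add.commute)
  have "(x \<oplus>\<^bsub>T\<^esub> x') [^]\<^bsub>T\<^esub> p = q ((g' \<otimes>\<^bsub>S\<^esub> f \<oplus>\<^bsub>S\<^esub> g \<otimes>\<^bsub>S\<^esub> f') [^]\<^bsub>S\<^esub> p) ((g \<otimes>\<^bsub>S\<^esub> g') [^]\<^bsub>S\<^esub> p)"
    unfolding f(4) f'(4) q_add[OF f(1-3) f'(1-3)]
    by (rule q_pow[OF n form_mult[OF f(2) f'(2)]]) (use mult_notin_Q c f f' in blast)
  also have "\<dots> = x [^]\<^bsub>T\<^esub> p \<oplus>\<^bsub>T\<^esub> x' [^]\<^bsub>T\<^esub> p"
    unfolding f(4) f'(4) q_pow[OF f(1-3)] q_pow[OF f'(1-3)]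
    using c by (subst q_add[OF form_pow[OF f(1)] form_pow[OF f(2)] pow_notin_Q[OF c(2) f(3)]
          form_pow[OF f'(1)] form_pow[OF f'(2)] pow_notin_Q[OF c(4) f'(3)]])
      (simp add: form_frobenius_add S.nat_pow_distrib)
  finally show ?thesis .
qed

sublocale Fr: frobenius_ring T p
  by unfold_locales (use T_frobenius_add p_prime prime_gt_0_nat in auto)

lemma T_has_char: "has_char T p"
proof -
  have "[n] \<cdot>\<^bsub>T\<^esub> \<one>\<^bsub>T\<^esub> = q (const (of_nat n)) \<one>\<^bsub>S\<^esub>" for n :: nat
  proof (induction n)
    case 0
    then show ?case using q_zero[OF form_one one_notin_Q] by (simp add: const_zero)
  next
    case (Suc n)
    have "[Suc n] \<cdot>\<^bsub>T\<^esub> \<one>\<^bsub>T\<^esub> = q (const (of_nat n)) \<one>\<^bsub>S\<^esub> \<oplus>\<^bsub>T\<^esub> q (const 1) \<one>\<^bsub>S\<^esub>"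
      using Suc by (simp add: T.add.nat_pow_Suc q_one const_one)
    also have "\<dots> = q (const (of_nat n + 1)) \<one>\<^bsub>S\<^esub>"
      unfolding const_add by (rule q_add_same) (auto simp: one_notin_Q)
    finally show ?case by (simp add: add.commute)
  qed
  moreover have "const (of_nat p) = \<zero>\<^bsub>S\<^esub>"
    using CHAR_p of_nat_CHAR[where 'a = 'k] by (simp add: const_zero)
  ultimately have "[p] \<cdot>\<^bsub>T\<^esub> \<one>\<^bsub>T\<^esub> = \<zero>\<^bsub>T\<^esub>"
    using q_zero[OF form_one one_notin_Q] by simp
  moreover have "\<one>\<^bsub>T\<^esub> \<noteq> \<zero>\<^bsub>T\<^esub>"
    using one_notin_M ideal.Icarr[OF M_ideal] additive_subgroup.zero_closed[OF ideal.axioms(1)[OF M_ideal]] by metis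
  ultimately show ?thesis using p_prime by (simp add: has_char_def)
qed

text \<open>Write a fraction with denominator \<open>g\<^sup>p\<close> and split each exponent in the numerator by division with
remainder by \<open>p\<close>: over the \<open>p\<close>-th powers, finitely many monomials in the coordinates generate.\<close>

lemma T_F_finite: "fin_gen_module T (frobenius_pushforward p T)"
proof -
  interpret FM: module T Fr.FR by (rule Fr.FR_module)
  define D where "D = (\<Sum>i\<le>N. replicate_mset p i)"
  define B where "B = (\<lambda>\<mu>. q (mp (Poly_Mapping.single \<mu> 1)) (yp (size \<mu>))) ` {\<mu>. \<mu> \<subseteq># D}"
  have Dv: "set_mset \<mu> \<subseteq> {..N}" if "\<mu> \<subseteq># D" for \<mu>
    using set_mset_mono[OF that] set_sum_replicate[of "\<lambda>_. p" N] unfolding D_def by (rule order_trans)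
  have finB: "finite B" unfolding B_def by (rule finite_imageI) (rule finite_submultisets)
  have BT: "B \<subseteq> carrier T" 
  proof
    fix b assume "b \<in> B"
    then obtain \<mu> where \<mu>: "\<mu> \<subseteq># D" "b = q (mp (Poly_Mapping.single \<mu> 1)) (yp (size \<mu>))"
      unfolding B_def by blast
    show "b \<in> carrier T" unfolding \<mu>(2)
      by (rule q_closed[OF form_single[OF Dv[OF \<mu>(1)]] yp(1,2)])
  qed
  define Z where "Z = {x. \<exists>c\<in>B \<rightarrow> carrier T. x = (\<Oplus>\<^bsub>Fr.FR\<^esub> b\<in>B. c b \<odot>\<^bsub>Fr.FR\<^esub> b)}"
  have cl: "c b \<odot>\<^bsub>Fr.FR\<^esub> b \<in> carrier Fr.FR" if "c \<in> B \<rightarrow> carrier T" "b \<in> B" for c b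
    using that BT by (intro FM.smult_closed) auto
  have Z_add: "x \<oplus>\<^bsub>T\<^esub> x' \<in> Z" if x: "x \<in> Z" "x' \<in> Z" for x x'
  proof -
    obtain c c' where c: "c \<in> B \<rightarrow> carrier T" "x = (\<Oplus>\<^bsub>Fr.FR\<^esub> b\<in>B. c b \<odot>\<^bsub>Fr.FR\<^esub> b)"
      and c': "c' \<in> B \<rightarrow> carrier T" "x' = (\<Oplus>\<^bsub>Fr.FR\<^esub> b\<in>B. c' b \<odot>\<^bsub>Fr.FR\<^esub> b)"
      using x unfolding Z_def by blast
    have "x \<oplus>\<^bsub>T\<^esub> x' = x \<oplus>\<^bsub>Fr.FR\<^esub> x'" by simp
    also have "\<dots> = (\<Oplus>\<^bsub>Fr.FR\<^esub> b\<in>B. c b \<odot>\<^bsub>Fr.FR\<^esub> b \<oplus>\<^bsub>Fr.FR\<^esub> c' b \<odot>\<^bsub>Fr.FR\<^esub> b)"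
      unfolding c(2) c'(2) by (rule FM.M.finsum_addf[symmetric]) (use cl c c' in auto)
    also have "\<dots> = (\<Oplus>\<^bsub>Fr.FR\<^esub> b\<in>B. (c b \<oplus>\<^bsub>T\<^esub> c' b) \<odot>\<^bsub>Fr.FR\<^esub> b)"
    proof (rule FM.M.finsum_cong'[OF refl])
      show "(\<lambda>b. (c b \<oplus>\<^bsub>T\<^esub> c' b) \<odot>\<^bsub>Fr.FR\<^esub> b) \<in> B \<rightarrow> carrier Fr.FR"
        using cl[of "\<lambda>b. c b \<oplus>\<^bsub>T\<^esub> c' b"] c c' by (auto simp: Pi_iff)
      fix b assume "b \<in> B"
      then show "c b \<odot>\<^bsub>Fr.FR\<^esub> b \<oplus>\<^bsub>Fr.FR\<^esub> c' b \<odot>\<^bsub>Fr.FR\<^esub> b = (c b \<oplus>\<^bsub>T\<^esub> c' b) \<odot>\<^bsub>Fr.FR\<^esub> b"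
        using c(1) c'(1) BT by (intro FM.smult_l_distr[symmetric]) auto
    qed
    finally show ?thesis using c(1) c'(1) unfolding Z_def
      by (intro CollectI bexI[of _ "\<lambda>b. c b \<oplus>\<^bsub>T\<^esub> c' b"]) auto
  qed
  have Z_gen: "(r [^]\<^bsub>T\<^esub> p) \<otimes>\<^bsub>T\<^esub> b \<in> Z" if r: "r \<in> carrier T" and b: "b \<in> B" for r b
  proof -
    define c where "c = (\<lambda>b'. if b = b' then r else \<zero>\<^bsub>T\<^esub>)"
    have c: "c \<in> B \<rightarrow> carrier T" using r by (auto simp: c_def)
    have rB: "(\<lambda>b'. r \<odot>\<^bsub>Fr.FR\<^esub> b') \<in> B \<rightarrow> carrier Fr.FR"
      using cl[of "\<lambda>_. r"] r by auto
    have "(\<Oplus>\<^bsub>Fr.FR\<^esub> b'\<in>B. c b' \<odot>\<^bsub>Fr.FR\<^esub> b') =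
        (\<Oplus>\<^bsub>Fr.FR\<^esub> b'\<in>B. if b = b' then r \<odot>\<^bsub>Fr.FR\<^esub> b' else \<zero>\<^bsub>Fr.FR\<^esub>)"
    proof (rule FM.M.finsum_cong'[OF refl])
      show "(\<lambda>b'. if b = b' then r \<odot>\<^bsub>Fr.FR\<^esub> b' else \<zero>\<^bsub>Fr.FR\<^esub>) \<in> B \<rightarrow> carrier Fr.FR"
        using rB FM.M.zero_closed by (simp add: Pi_iff)
      fix b' assume "b' \<in> B"
      then show "c b' \<odot>\<^bsub>Fr.FR\<^esub> b' = (if b = b' then r \<odot>\<^bsub>Fr.FR\<^esub> b' else \<zero>\<^bsub>Fr.FR\<^esub>)"
        unfolding c_def using BT FM.smult_l_null[of b'] by auto
    qed
    also have "\<dots> = r \<odot>\<^bsub>Fr.FR\<^esub> b"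
      using FM.M.finsum_singleton[OF b finB rB] .
    finally show ?thesis unfolding Z_def using c by (intro CollectI bexI[of _ c]) simp_all
  qed
  have Z_zero: "\<zero>\<^bsub>T\<^esub> \<in> Z"
  proof -
    define b where "b = q (mp (Poly_Mapping.single {#} 1)) (yp (size ({#} :: nat multiset)))"
    have b: "b \<in> B" unfolding B_def b_def by (rule imageI) simp
    have "\<zero>\<^bsub>T\<^esub> [^]\<^bsub>T\<^esub> p = \<zero>\<^bsub>T\<^esub>" using Fr.p_pos by (intro T.nat_pow_zero) simp
    moreover have "b \<in> carrier T" using b BT by blast
    ultimately show ?thesis using Z_gen[OF T.zero_closed b] by simp
  qed
  have key: "q h (g [^]\<^bsub>S\<^esub> p) \<in> Z" if g: "form d g" "g \<notin> Q" and h: "form (p * d) h" for d g h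
  proof -
    have gp: "form (p * d) (g [^]\<^bsub>S\<^esub> p)" "g [^]\<^bsub>S\<^esub> p \<notin> Q" "g [^]\<^bsub>S\<^esub> p \<in> carrier S" "g \<in> carrier S"
      using form_pow[OF g(1)] pow_notin_Q[OF form_closed[OF g(1)] g(2)] g(1) by auto
    have "form (p * d) h \<and> q h (g [^]\<^bsub>S\<^esub> p) \<in> Z"
    proof (rule poly_induct[OF form_closed[OF h], where P = "\<lambda>h. form (p * d) h \<and> q h (g [^]\<^bsub>S\<^esub> p) \<in> Z"])
      show "form (p * d) \<zero>\<^bsub>S\<^esub> \<and> q \<zero>\<^bsub>S\<^esub> (g [^]\<^bsub>S\<^esub> p) \<in> Z" using q_zero[OF gp(1,2)] Z_zero by simp
      show "form (p * d) (f \<oplus>\<^bsub>S\<^esub> f') \<and> q (f \<oplus>\<^bsub>S\<^esub> f') (g [^]\<^bsub>S\<^esub> p) \<in> Z"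
        if "form (p * d) f \<and> q f (g [^]\<^bsub>S\<^esub> p) \<in> Z" "form (p * d) f' \<and> q f' (g [^]\<^bsub>S\<^esub> p) \<in> Z" for f f'
        using that Z_add q_add_same[of "p * d" f f' "g [^]\<^bsub>S\<^esub> p"] gp form_add by metis
      fix m and c :: 'k assume "m \<in> keys (pm h)"
      then have m: "size m = p * d" "set_mset m \<subseteq> {..N}"
        using h keys_pm_vars[of h m] by (auto simp: form_iff)
      define a \<mu> where "a = (\<Sum>i\<le>N. replicate_mset (count m i div p) i)"
        and "\<mu> = (\<Sum>i\<le>N. replicate_mset (count m i mod p) i)"
      have count0: "count m j = 0" if "\<not> j \<le> N" for j
        using m(2) that by (meson atMost_iff not_in_iff subsetD)
      have m_eq: "m = repeat_mset p a + \<mu>"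
        by (rule multiset_eqI) (auto simp: a_def \<mu>_def count_sum_replicate count0)
      have av: "set_mset a \<subseteq> {..N}" "set_mset \<mu> \<subseteq> {..N}"
        unfolding a_def \<mu>_def by (rule set_sum_replicate)+
      have \<mu>D: "\<mu> \<subseteq># D"
        using Fr.p_pos by (intro mset_subset_eqI) (simp add: \<mu>_def D_def count_sum_replicate less_imp_le)
      have sz: "p * d = p * size a + size \<mu>" using m(1) unfolding m_eq by simp
      have ad: "size a \<le> d" using sz Fr.p_pos by (metis le_add1 mult_le_cancel1)
      define s where "s = d - size a"
      have sz': "size \<mu> = s * p" using sz ad by (simp add: s_def diff_mult_distrib algebra_simps)
      obtain b where b: "b ^ p = c" using perfect by blast
      define A' U where "A' = mp (Poly_Mapping.single a b)" and "U = mp (Poly_Mapping.single \<mu> 1)"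
      have A': "form (size a) A'" and U: "form (size \<mu>) U"
        unfolding A'_def U_def using av by (auto intro: form_single)
      have AS: "A' \<in> carrier S" "U \<in> carrier S" using A' U by auto
      have mc: "mp (Poly_Mapping.single m c) = A' [^]\<^bsub>S\<^esub> p \<otimes>\<^bsub>S\<^esub> U"
        using AS av m(2)
        by (intro pm_eqD) (simp_all add: mp_closed pm_mp pm_mult pm_pow A'_def U_def single_power mult_single m_eq b)
      have Ay: "form d (A' \<otimes>\<^bsub>S\<^esub> yp s)" using form_mult[OF A' yp(1)[of s]] ad by (simp add: s_def)
      have fm: "form (p * d) (mp (Poly_Mapping.single m c))"
        using form_single[OF m(2)] m(1) by metis
      have UB: "q U (yp (size \<mu>)) \<in> B" unfolding B_def U_def using \<mu>D by blast
      have "(q (A' \<otimes>\<^bsub>S\<^esub> yp s) g [^]\<^bsub>T\<^esub> p) \<otimes>\<^bsub>T\<^esub> q U (yp (size \<mu>)) \<in> Z"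
        by (rule Z_gen[OF _ UB]) (use Ay g in auto)
      also have "(q (A' \<otimes>\<^bsub>S\<^esub> yp s) g [^]\<^bsub>T\<^esub> p) \<otimes>\<^bsub>T\<^esub> q U (yp (size \<mu>)) =
          q ((A' \<otimes>\<^bsub>S\<^esub> yp s) [^]\<^bsub>S\<^esub> p \<otimes>\<^bsub>S\<^esub> U) (g [^]\<^bsub>S\<^esub> p \<otimes>\<^bsub>S\<^esub> yp (size \<mu>))"
        unfolding q_pow[OF Ay g] by (rule q_mult[OF form_pow[OF Ay] gp(1,2) U yp(1,2)])
      also have "\<dots> = q (mp (Poly_Mapping.single m c)) (g [^]\<^bsub>S\<^esub> p)"
      proof (rule q_eqI[OF form_mult[OF form_pow[OF Ay] U] form_mult[OF gp(1) yp(1)] _ fm gp(1,2)])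
        show "g [^]\<^bsub>S\<^esub> p \<otimes>\<^bsub>S\<^esub> yp (size \<mu>) \<notin> Q" using mult_notin_Q[OF gp(3) yp(3) gp(2) yp(2)] .
        have "(A' \<otimes>\<^bsub>S\<^esub> yp s) [^]\<^bsub>S\<^esub> p = A' [^]\<^bsub>S\<^esub> p \<otimes>\<^bsub>S\<^esub> yp (size \<mu>)"
          using AS yp(3)[of s] form_closed[OF y_form] by (simp add: S.nat_pow_distrib S.nat_pow_pow sz')
        then show "g [^]\<^bsub>S\<^esub> p \<otimes>\<^bsub>S\<^esub> ((A' \<otimes>\<^bsub>S\<^esub> yp s) [^]\<^bsub>S\<^esub> p \<otimes>\<^bsub>S\<^esub> U) =
            (g [^]\<^bsub>S\<^esub> p \<otimes>\<^bsub>S\<^esub> yp (size \<mu>)) \<otimes>\<^bsub>S\<^esub> mp (Poly_Mapping.single m c)"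
          unfolding mc using AS yp(3)[of "size \<mu>"] gp by (simp add: S.m_ac)
      qed
      finally show "form (p * d) (mp (Poly_Mapping.single m c)) \<and>
          q (mp (Poly_Mapping.single m c)) (g [^]\<^bsub>S\<^esub> p) \<in> Z" using fm by blast
    qed
    then show ?thesis by blast
  qed
  have "x \<in> Z" if x: "x \<in> carrier T" for x
  proof -
    obtain f g d where f: "form d f" "form d g" "g \<notin> Q" "x = q f g" by (rule T_cases[OF x])
    obtain r where r: "p = Suc r" using Fr.p_pos gr0_conv_Suc by blast
    have h: "form (p * d) (f \<otimes>\<^bsub>S\<^esub> g [^]\<^bsub>S\<^esub> r)" using form_mult[OF f(1) form_pow[OF f(2), of r]] by (simp add: r)
    have "x = q (f \<otimes>\<^bsub>S\<^esub> g [^]\<^bsub>S\<^esub> r) (g [^]\<^bsub>S\<^esub> p)"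
      unfolding f(4) using h form_pow[OF f(2), of p] pow_notin_Q[OF form_closed[OF f(2)] f(3)] f
        mult_notin_Q[OF form_closed[OF f(2)] S.nat_pow_closed[OF form_closed[OF f(2)]] f(3)]
        form_closed[OF f(1)] form_closed[OF f(2)]
      by (intro q_eqI) (auto simp: r S.m_ac)
    then show ?thesis using key[OF f(2,3) h] by simp
  qed
  then show ?thesis
    unfolding fin_gen_module_def using finB BT by (intro exI[of _ B]) (auto simp: Z_def)
qed

lemma F_finite_local_ring: "F_finite_local_ring T p"
  unfolding F_finite_local_ring_def F_finite_local_ring_axioms_def
  using T_cring T_noetherian T_has_char T_F_finite M_maximal maximal_unique by blast

lemma max_ideal_eq: "F_finite_local_ring.max_ideal T = M"
  unfolding F_finite_local_ring.max_ideal_def[OF F_finite_local_ring]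
  using M_maximal maximal_unique by (rule the_equality)

theorem F_injective_at_iff:
  "F_injective_at p K N I Q \<longleftrightarrow>
    (\<exists>xs. set xs \<subseteq> carrier T \<and> Idl\<^bsub>T\<^esub> (set xs) = M \<and>
      (\<forall>i. inj_on (local_cohomology_map T xs (frobenius_pushforward p T) (\<lambda>x. x [^]\<^bsub>T\<^esub> p) i)
        (carrier (local_cohomology T xs (self_module T) i))))"
  unfolding F_injective_at_def F_finite_local_ring.F_injective_def[OF F_finite_local_ring] max_ideal_eq ..

end

section \<open>The polynomial ring in two variables\<close>

text \<open>The ring \<open>k[x, y]\<close> is represented as \<open>k[x][y]\<close>.\<close>

definition cc :: "'k::comm_ring_1 \<Rightarrow> 'k poly poly" where "cc c = [:[:c:]:]"
definition xx :: "'k::comm_ring_1 poly poly" where "xx = [:[:0, 1:]:]"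
definition yy :: "'k::comm_ring_1 poly poly" where "yy = [:0, 1:]"

text \<open>Restriction to the line \<open>y = 0\<close> has parameter \<open>x\<close>, restriction to \<open>x = 0\<close> has parameter \<open>y\<close>; in the
third map \<open>y\<close> is replaced by \<open>x\<^sup>2\<close>, so that both lines can be compared.\<close>

definition at_y0 :: "'k::comm_ring_1 poly poly \<Rightarrow> 'k poly" where
  "at_y0 F = Polynomial.coeff F 0"
definition at_x0 :: "'k::comm_ring_1 poly poly \<Rightarrow> 'k poly" where
  "at_x0 F = map_poly (\<lambda>p. Polynomial.coeff p 0) F"
definition at_x0_sq :: "'k::comm_ring_1 poly poly \<Rightarrow> 'k poly" where
  "at_x0_sq F = pcompose (at_x0 F) [:0, 0, 1:]"
definition delta :: "'k::comm_ring_1 poly poly \<Rightarrow> 'k poly" where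
  "delta F = at_y0 F - at_x0_sq F"

lemma cc_add: "cc (a + b) = cc a + cc b" and cc_mult: "cc (a * b) = cc a * cc b"
  and cc_one: "cc 1 = 1" and cc_zero: "cc 0 = 0"
  by (simp_all add: cc_def one_pCons)

lemma at_y0_simps [simp]:
  "at_y0 0 = 0" "at_y0 1 = 1" "at_y0 (F + G) = at_y0 F + at_y0 G" "at_y0 (F - G) = at_y0 F - at_y0 G"
  "at_y0 (F * G) = at_y0 F * at_y0 G" "at_y0 (F ^ n) = at_y0 F ^ n"
  "at_y0 (cc c) = [:c:]" "at_y0 xx = [:0, 1:]" "at_y0 yy = 0"
  for F G :: "'k::comm_ring_1 poly poly"
proof -
  have m: "at_y0 (F * G) = at_y0 F * at_y0 G" for F G :: "'k poly poly"
    by (simp add: at_y0_def coeff_mult)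
  show "at_y0 (F * G) = at_y0 F * at_y0 G" by (rule m)
  show "at_y0 (F ^ n) = at_y0 F ^ n"
    by (induction n) (simp_all add: m, simp add: at_y0_def)
qed (simp_all add: at_y0_def cc_def xx_def yy_def)

lemma coeff_at_x0: "Polynomial.coeff (at_x0 F) j = Polynomial.coeff (Polynomial.coeff F j) 0"
  by (simp add: at_x0_def coeff_map_poly)

lemma at_x0_one [simp]: "at_x0 1 = 1"
  by (rule poly_eqI) (simp add: coeff_at_x0 one_pCons coeff_pCons split: nat.splits)

lemma at_x0_simps [simp]:
  "at_x0 0 = 0" "at_x0 (F + G) = at_x0 F + at_x0 G" "at_x0 (F - G) = at_x0 F - at_x0 G"
  "at_x0 (F * G) = at_x0 F * at_x0 G" "at_x0 (F ^ n) = at_x0 F ^ n"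
  "at_x0 (cc c) = [:c:]" "at_x0 xx = 0" "at_x0 yy = [:0, 1:]"
  for F G :: "'k::comm_ring_1 poly poly"
proof -
  have m: "at_x0 (F * G) = at_x0 F * at_x0 G" for F G :: "'k poly poly"
    by (rule poly_eqI) (simp add: coeff_at_x0 coeff_mult coeff_sum)
  show "at_x0 (F * G) = at_x0 F * at_x0 G" by (rule m)
  show "at_x0 (F ^ n) = at_x0 F ^ n" by (induction n) (simp_all add: m)
qed (auto intro!: poly_eqI simp: coeff_at_x0 cc_def xx_def yy_def coeff_pCons one_pCons split: nat.splits)

lemma at_x0_sq_simps [simp]:
  "at_x0_sq 0 = 0" "at_x0_sq 1 = 1" "at_x0_sq (F + G) = at_x0_sq F + at_x0_sq G"
  "at_x0_sq (F - G) = at_x0_sq F - at_x0_sq G"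
  "at_x0_sq (F * G) = at_x0_sq F * at_x0_sq G" "at_x0_sq (F ^ n) = at_x0_sq F ^ n"
  "at_x0_sq (cc c) = [:c:]" "at_x0_sq xx = 0" "at_x0_sq yy = [:0, 0, 1:]"
  for F G :: "'k::idom poly poly"
proof -
  have m: "at_x0_sq (F * G) = at_x0_sq F * at_x0_sq G" for F G :: "'k poly poly"
    by (simp add: at_x0_sq_def pcompose_mult)
  show "at_x0_sq (F * G) = at_x0_sq F * at_x0_sq G" by (rule m)
  show "at_x0_sq (F ^ n) = at_x0_sq F ^ n"
    by (induction n) (simp_all add: m, simp add: at_x0_sq_def pcompose_1)
qed (simp_all add: at_x0_sq_def pcompose_add pcompose_diff pcompose_1 pcompose_pCons pcompose_const)

lemma poly_at_x0_sq: "poly (at_x0_sq F) t = poly (at_x0 F) (t ^ 2)" for F :: "'k::idom poly poly"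
  by (simp add: at_x0_sq_def poly_pcompose power2_eq_square)

lemma delta_simps [simp]:
  "delta 0 = 0" "delta 1 = 0" "delta (F + G) = delta F + delta G" "delta (F - G) = delta F - delta G"
  for F G :: "'k::idom poly poly"
  by (simp_all add: delta_def)

lemma delta_mult_left: "delta H = 0 \<Longrightarrow> delta (H * F) = at_y0 H * delta F"
  for F H :: "'k::idom poly poly"
  by (simp add: delta_def algebra_simps)

lemma delta_at_0: "poly (delta F) 0 = 0" for F :: "'k::idom poly poly"
  by (simp add: delta_def poly_at_x0_sq)
     (simp add: poly_0_coeff_0 coeff_at_x0 at_y0_def)

subsection \<open>Divisibility by the variables\<close>

lemma yy_dvd_iff: "yy dvd F \<longleftrightarrow> at_y0 F = 0"
proof
  assume "at_y0 F = 0"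
  then have "F = yy * poly_shift 1 F"
    by (intro poly_eqI) (auto simp: at_y0_def yy_def coeff_pCons coeff_poly_shift split: nat.splits)
  then show "yy dvd F" by (metis dvd_triv_left)
qed (auto simp: dvd_def)

lemma xx_dvd_iff: "xx dvd F \<longleftrightarrow> at_x0 F = 0" for F :: "'k::idom poly poly"
proof
  assume "at_x0 F = 0"
  then have "Polynomial.coeff (Polynomial.coeff F j) 0 = 0" for j
    by (metis coeff_at_x0 coeff_0)
  then have "[:0, 1:] dvd Polynomial.coeff F j" for j
    using poly_eq_0_iff_dvd[of "Polynomial.coeff F j" 0] by (simp add: poly_0_coeff_0)
  then show "xx dvd F" unfolding xx_def const_poly_dvd_iff by blast
qed (auto simp: dvd_def)

lemma xy_dvd_iff: "xx * yy dvd F \<longleftrightarrow> at_x0 F = 0 \<and> at_y0 F = 0" for F :: "'k::idom poly poly"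
proof
  assume a: "at_x0 F = 0 \<and> at_y0 F = 0"
  then obtain G where G: "F = yy * G" using yy_dvd_iff by (metis dvdE)
  then have "at_x0 G = 0" using a by simp
  then obtain H where "G = xx * H" using xx_dvd_iff by (metis dvdE)
  then show "xx * yy dvd F" using G by (simp add: mult_ac)
qed (auto simp: dvd_def)

lemma xy_nonzero: "xx \<noteq> (0 :: 'k::idom poly poly)" "yy \<noteq> (0 :: 'k poly poly)"
  by (simp_all add: xx_def yy_def)

text \<open>An \<open>H\<close> that vanishes on neither axis has no factor in common with \<open>x y\<close>.\<close>

lemma xy_dvd_cancel:
  fixes F H :: "'k::idom poly poly"
  assumes "at_x0 H \<noteq> 0" "at_y0 H \<noteq> 0" "(xx * yy) ^ n dvd H * F"
  shows "(xx * yy) ^ n dvd F"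
  using assms(3)
proof (induction n arbitrary: F)
  case (Suc n)
  have "xx * yy dvd H * F" using Suc.prems by (metis dvd_mult_left power_Suc)
  then have "xx * yy dvd F" using assms by (simp add: xy_dvd_iff)
  then obtain G where G: "F = (xx * yy) * G" by (metis dvdE)
  then have "(xx * yy) * (xx * yy) ^ n dvd (xx * yy) * (H * G)" using Suc.prems by (simp add: mult_ac)
  then have "(xx * yy) ^ n dvd H * G" 
  proof -
    have "xx * yy \<noteq> (0 :: 'k poly poly)" by (simp add: xy_nonzero)
    then show ?thesis
      using \<open>(xx * yy) * (xx * yy) ^ n dvd (xx * yy) * (H * G)\<close> by (simp only: dvd_mult_cancel_left) simp
  qed
  then show ?case using Suc.IH[of G] G by (simp add: mult_dvd_mono)
qed simp

lemma poly_poly_induct [case_names add monomial]: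
  fixes F :: "'k::comm_ring_1 poly poly"
  assumes add: "\<And>F G. P F \<Longrightarrow> P G \<Longrightarrow> P (F + G)"
    and mon: "\<And>i j. P (cc (Polynomial.coeff (Polynomial.coeff F j) i) * xx ^ i * yy ^ j)"
  shows "P F"
proof -
  have sum: "P (sum f A)" if "finite A" "A \<noteq> {}" "\<And>a. a \<in> A \<Longrightarrow> P (f a)" for f and A :: "nat set"
    using that by (induction A rule: finite_ne_induct) (auto intro: add)
  have y: "yy ^ j * [:p:] = Polynomial.monom p j" for j and p :: "'k poly"
    by (induction j) (simp_all add: yy_def monom_0 monom_Suc mult_ac)
  have x: "cc c * xx ^ i = [:Polynomial.monom c i:]" for c :: 'k and i
    by (induction i) (simp_all add: cc_def xx_def monom_0 monom_Suc mult_ac)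
  have "P (\<Sum>j\<le>Polynomial.degree F. \<Sum>i\<le>Polynomial.degree (Polynomial.coeff F j).
      cc (Polynomial.coeff (Polynomial.coeff F j) i) * xx ^ i * yy ^ j)"
    by (intro sum mon) auto
  also have "(\<Sum>j\<le>Polynomial.degree F. \<Sum>i\<le>Polynomial.degree (Polynomial.coeff F j).
      cc (Polynomial.coeff (Polynomial.coeff F j) i) * xx ^ i * yy ^ j) =
     (\<Sum>j\<le>Polynomial.degree F. yy ^ j * [:\<Sum>i\<le>Polynomial.degree (Polynomial.coeff F j).
        Polynomial.monom (Polynomial.coeff (Polynomial.coeff F j) i) i:])"
  proof (rule sum.cong[OF refl])
    fix j
    have s: "[:sum f A:] = (\<Sum>a\<in>A. [:f a:])" for f and A :: "nat set"
    proof (induction A rule: infinite_finite_induct)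
      case (insert x A)
      have "[:f x + sum f A:] = [:f x:] + [:sum f A:]" by simp
      then show ?case using insert by simp
    qed simp_all
    show "(\<Sum>i\<le>Polynomial.degree (Polynomial.coeff F j).
      cc (Polynomial.coeff (Polynomial.coeff F j) i) * xx ^ i * yy ^ j) = yy ^ j * [:\<Sum>i\<le>Polynomial.degree (Polynomial.coeff F j).
        Polynomial.monom (Polynomial.coeff (Polynomial.coeff F j) i) i:]"
      unfolding s sum_distrib_left x by (rule sum.cong) (simp_all add: mult.commute)
  qed
  also have "\<dots> = F"
    unfolding poly_as_sum_of_monoms y by (rule refl)
  finally show ?thesis .
qed

subsection \<open>A Frobenius splitting\<close>

definition halve_poly :: "('r \<Rightarrow> 'r) \<Rightarrow> 'r::comm_ring_1 poly \<Rightarrow> 'r poly" where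
  "halve_poly s P = Abs_poly (\<lambda>i. s (Polynomial.coeff P (2 * i)))"

definition splitting :: "('r::comm_ring_1 \<Rightarrow> 'r) \<Rightarrow> bool" where
  "splitting s \<longleftrightarrow> (\<forall>a b. s (a + b) = s a + s b) \<and> (\<forall>a b. s (a\<^sup>2 * b) = a * s b) \<and> s 1 = 1"

lemma splitting_zero: "splitting s \<Longrightarrow> s 0 = 0"
  unfolding splitting_def by (metis add_0_right add_cancel_right_right)

lemma coeff_halve_poly:
  assumes "s 0 = 0"
  shows "Polynomial.coeff (halve_poly s P) i = s (Polynomial.coeff P (2 * i))"
proof -
  have "\<forall>i > Polynomial.degree P. s (Polynomial.coeff P (2 * i)) = 0"
    using assms by (auto simp: coeff_eq_0)
  then show ?thesis unfolding halve_poly_def by (subst coeff_Abs_poly) auto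
qed

lemma square_add_char2:
  fixes a b :: "'r::comm_ring_1"
  assumes "(2::'r) = 0"
  shows "(a + b)\<^sup>2 = a\<^sup>2 + b\<^sup>2"
  using assms by (simp add: power2_sum)

lemma two_poly: "(2::'r::comm_ring_1) = 0 \<Longrightarrow> (2::'r poly) = 0"
  by (metis numeral_poly pCons_0_0)

lemma splitting_halve_poly:
  fixes s :: "'r::comm_ring_1 \<Rightarrow> 'r"
  assumes s: "splitting s" and two: "(2::'r) = 0"
  shows "splitting (halve_poly s)"
proof -
  have s0: "s 0 = 0" by (rule splitting_zero[OF s])
  have add: "halve_poly s (P + Q) = halve_poly s P + halve_poly s Q" for P Q
    using s by (intro poly_eqI) (simp add: coeff_halve_poly s0 splitting_def)
  have mon: "halve_poly s ((Polynomial.monom a n)\<^sup>2 * Q) = Polynomial.monom a n * halve_poly s Q" for a n Q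
  proof (rule poly_eqI)
    fix i
    have "(Polynomial.monom a n)\<^sup>2 = Polynomial.monom (a\<^sup>2) (2 * n)"
      by (simp add: power2_eq_square mult_monom mult_2)
    moreover have "2 * i - 2 * n = 2 * (i - n)" by simp
    ultimately show "Polynomial.coeff (halve_poly s ((Polynomial.monom a n)\<^sup>2 * Q)) i =
        Polynomial.coeff (Polynomial.monom a n * halve_poly s Q) i"
      using s by (auto simp: coeff_halve_poly s0 coeff_monom_mult splitting_def)
  qed
  have "halve_poly s (P\<^sup>2 * Q) = P * halve_poly s Q" for P Q
  proof -
    have "halve_poly s ((\<Sum>i\<in>A. Polynomial.monom (f i) i)\<^sup>2 * Q) = (\<Sum>i\<in>A. Polynomial.monom (f i) i) * halve_poly s Q"
      if "finite A" for A and f :: "nat \<Rightarrow> 'r"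
      using that
    proof (induction A rule: finite_induct)
      case empty
      show ?case by (intro poly_eqI) (simp add: coeff_halve_poly s0)
    next
      case (insert x A)
      then show ?case
        by (simp add: square_add_char2[OF two_poly[OF two]] distrib_right add mon)
    qed
    from this[of "{..Polynomial.degree P}" "Polynomial.coeff P"] show ?thesis
      by (simp add: poly_as_sum_of_monoms)
  qed
  moreover have "halve_poly s 1 = 1"
    using s by (intro poly_eqI) (auto simp: coeff_halve_poly s0 one_pCons coeff_pCons splitting_def split: nat.splits)
  ultimately show ?thesis using add by (simp add: splitting_def)
qed

definition fract_splitting :: "('r::idom \<Rightarrow> 'r) \<Rightarrow> 'r fract \<Rightarrow> 'r fract" where
  "fract_splitting s z = (SOME w. \<exists>a b. b \<noteq> 0 \<and> z = Fract a b \<and> w = Fract (s (a * b)) b)"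

lemma fract_splitting_Fract:
  assumes s: "splitting s" and b: "b \<noteq> 0"
  shows "fract_splitting s (Fract a b) = Fract (s (a * b)) b"
proof -
  have lin: "s (u\<^sup>2 * w) = u * s w" for u w using s by (simp add: splitting_def)
  have wd: "Fract (s (c * d)) d = Fract (s (a * b)) b" if d: "d \<noteq> 0" "Fract a b = Fract c d" for c d
  proof -
    have eq: "a * d = c * b" using d b by (simp add: eq_fract)
    have "b * s (c * d) = s (b\<^sup>2 * (c * d))" by (simp add: lin)
    also have "b\<^sup>2 * (c * d) = (c * b) * b * d" by (simp add: power2_eq_square mult_ac)
    also have "\<dots> = d\<^sup>2 * (a * b)" unfolding eq[symmetric] by (simp add: power2_eq_square mult_ac)
    finally have "b * s (c * d) = d * s (a * b)" by (simp add: lin)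
    then show ?thesis using d b by (simp add: eq_fract mult.commute)
  qed
  have "\<exists>a' b'. b' \<noteq> 0 \<and> Fract a b = Fract a' b' \<and> fract_splitting s (Fract a b) = Fract (s (a' * b')) b'"
    unfolding fract_splitting_def by (rule someI_ex) (use b in blast)
  then show ?thesis using wd by metis
qed

lemma two_fract: "(2::'r::idom) = 0 \<Longrightarrow> (2::'r fract) = 0"
  by (metis One_fract_def Zero_fract_def add_fract mult_1 mult_1_right one_add_one one_neq_zero)

lemma splitting_fract:
  fixes s :: "'r::idom \<Rightarrow> 'r"
  assumes s: "splitting s"
  shows "splitting (fract_splitting s)"
  unfolding splitting_def
proof (intro conjI allI)
  have add: "s (u + w) = s u + s w" and lin: "s (u\<^sup>2 * w) = u * s w" for u w
    using s by (simp_all add: splitting_def)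
  fix z w :: "'r fract"
  obtain a b where z: "z = Fract a b" "b \<noteq> 0" by (cases z)
  obtain c d where w: "w = Fract c d" "d \<noteq> 0" by (cases w)
  have "s ((a * d + c * b) * (b * d)) = s (d\<^sup>2 * (a * b)) + s (b\<^sup>2 * (c * d))"
    unfolding add[symmetric] by (rule arg_cong[of _ _ s]) (simp add: power2_eq_square algebra_simps)
  then show "fract_splitting s (z + w) = fract_splitting s z + fract_splitting s w"
  proof -
    assume key: "s ((a * d + c * b) * (b * d)) = s (d\<^sup>2 * (a * b)) + s (b\<^sup>2 * (c * d))"
    have "fract_splitting s (z + w) = Fract (s ((a * d + c * b) * (b * d))) (b * d)"
      unfolding z(1) w(1) add_fract[OF z(2) w(2)]
      by (rule fract_splitting_Fract[OF s]) (use z w in simp)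
    also have "\<dots> = Fract (s (a * b) * d + s (c * d) * b) (b * d)"
      unfolding key lin by (simp add: mult.commute)
    also have "\<dots> = fract_splitting s z + fract_splitting s w"
      unfolding z(1) w(1) fract_splitting_Fract[OF s z(2)] fract_splitting_Fract[OF s w(2)]
      using z w by simp
    finally show ?thesis .
  qed
  have "s (a\<^sup>2 * c * (b\<^sup>2 * d)) = s ((a * b)\<^sup>2 * (c * d))"
    by (rule arg_cong[of _ _ s]) (simp add: power2_eq_square mult_ac)
  then have key: "s (a\<^sup>2 * c * (b\<^sup>2 * d)) = (a * b) * s (c * d)" by (simp only: lin)
  have "fract_splitting s (z\<^sup>2 * w) = fract_splitting s (Fract (a\<^sup>2 * c) (b\<^sup>2 * d))"
    unfolding z(1) w(1) by (simp add: power2_eq_square)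
  also have "\<dots> = Fract (s (a\<^sup>2 * c * (b\<^sup>2 * d))) (b\<^sup>2 * d)"
    by (rule fract_splitting_Fract[OF s]) (use z w in simp)
  also have "\<dots> = Fract (a * s (c * d)) (b * d)"
    unfolding key using z w by (simp add: eq_fract power2_eq_square)
  also have "\<dots> = z * fract_splitting s w"
    unfolding z(1) w(1) fract_splitting_Fract[OF s w(2)] by simp
  finally show "fract_splitting s (z\<^sup>2 * w) = z * fract_splitting s w" .
next
  show "fract_splitting s 1 = 1"
    using fract_splitting_Fract[OF s, of 1 1] s by (simp add: One_fract_def splitting_def)
qed

subsection \<open>A polygon of monomials\<close>

text \<open>The \<open>n\<close>-fold multiple of the convex hull of the exponents of the five coordinate functions.\<close>

definition polygon :: "nat \<Rightarrow> (nat \<times> nat) set" where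
  "polygon n = {(i, j). i \<le> 2 * n \<and> i + j \<le> 3 * n \<and> j \<le> i + n}"

definition in_polygon :: "nat \<Rightarrow> 'k::comm_ring_1 poly poly \<Rightarrow> bool" where
  "in_polygon n F \<longleftrightarrow> (\<forall>i j. Polynomial.coeff (Polynomial.coeff F j) i \<noteq> 0 \<longrightarrow> (i, j) \<in> polygon n)"

lemma in_polygon_add: "in_polygon n F \<Longrightarrow> in_polygon n G \<Longrightarrow> in_polygon n (F + G)"
  unfolding in_polygon_def by (metis add.left_neutral coeff_add)

lemma in_polygon_mult:
  assumes F: "in_polygon n F" and G: "in_polygon m G"
  shows "in_polygon (n + m) (F * G)"
  unfolding in_polygon_def
proof (intro allI impI)
  fix i j assume "Polynomial.coeff (Polynomial.coeff (F * G) j) i \<noteq> 0"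
  then have "(\<Sum>l\<le>j. \<Sum>k\<le>i. Polynomial.coeff (Polynomial.coeff F l) k *
      Polynomial.coeff (Polynomial.coeff G (j - l)) (i - k)) \<noteq> 0"
    by (simp add: coeff_mult coeff_sum)
  then obtain l where l: "l \<le> j" "(\<Sum>k\<le>i. Polynomial.coeff (Polynomial.coeff F l) k *
      Polynomial.coeff (Polynomial.coeff G (j - l)) (i - k)) \<noteq> 0"
    by (meson atMost_iff sum.not_neutral_contains_not_neutral)
  then obtain k where k: "k \<le> i" "Polynomial.coeff (Polynomial.coeff F l) k *
      Polynomial.coeff (Polynomial.coeff G (j - l)) (i - k) \<noteq> 0"
    by (meson atMost_iff sum.not_neutral_contains_not_neutral)
  then have "(k, l) \<in> polygon n" "(i - k, j - l) \<in> polygon m"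
    using F G unfolding in_polygon_def by (metis mult_zero_left, metis mult_zero_right)
  then show "(i, j) \<in> polygon (n + m)" using l(1) k(1) by (auto simp: polygon_def)
qed

lemma in_polygon_halve:
  fixes F :: "'k::field poly poly"
  assumes s: "s 0 = 0" and F: "in_polygon (2 * n) F"
  shows "in_polygon n (halve_poly (halve_poly s) F)"
proof -
  have h0: "halve_poly s 0 = 0" by (rule poly_eqI) (simp add: coeff_halve_poly s)
  show ?thesis
    unfolding in_polygon_def
  proof (intro allI impI)
    fix i j assume "Polynomial.coeff (Polynomial.coeff (halve_poly (halve_poly s) F) j) i \<noteq> 0"
    then have "Polynomial.coeff (Polynomial.coeff F (2 * j)) (2 * i) \<noteq> 0"
      using s by (auto simp: coeff_halve_poly s h0)
    then have "(2 * i, 2 * j) \<in> polygon (2 * n)" using F by (auto simp: in_polygon_def)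
    then show "(i, j) \<in> polygon n" by (auto simp: polygon_def)
  qed
qed

section \<open>The surface\<close>

context evaluation
begin

lemma E_single: "set_mset m \<subseteq> {..N} \<Longrightarrow> E (mp (Poly_Mapping.single m c)) = inc c * prod_mset (image_mset v m)"
  by (simp add: ev_def pm_mp insert_values_single)

lemma E_induct:
  assumes f: "f \<in> carrier S"
    and add: "\<And>a b. P a \<Longrightarrow> P b \<Longrightarrow> P (a + b)" and mult: "\<And>a b. P a \<Longrightarrow> P b \<Longrightarrow> P (a * b)"
    and const: "\<And>c. P (inc c)" and var: "\<And>i. i \<le> N \<Longrightarrow> P (v i)"
  shows "P (E f)"
proof (rule poly_induct[OF f, where P = "\<lambda>f. P (E f)"])
  show "P (E \<zero>\<^bsub>S\<^esub>)" using const[of 0] by (simp add: E_zero inc_zero)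
  show "P (E (f \<oplus>\<^bsub>S\<^esub> g))" if "f \<in> carrier S" "g \<in> carrier S" "P (E f)" "P (E g)" for f g
    using that add by (simp add: E_add)
  fix m c assume "m \<in> keys (pm f)"
  then have m: "set_mset m \<subseteq> {..N}" using keys_pm_vars[OF f] by blast
  have "P (prod_mset (image_mset v m))"
    using m by (induction m) (use const[of 1] in \<open>auto simp: inc_one intro: mult var\<close>)
  then show "P (E (mp (Poly_Mapping.single m c)))" using m const by (auto simp: E_single intro: mult)
qed

end

text \<open>The affine parametrization of the surface; the first coordinate is \<open>1\<close>.\<close>

definition gens :: "nat \<Rightarrow> 'k::comm_ring_1 poly poly" where
  "gens i = [1, xx\<^sup>2 + yy, xx * yy, xx\<^sup>2 * yy, xx * yy\<^sup>2] ! i"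

lemma gens_simps [simp]:
  "gens 0 = 1" "gens (Suc 0) = xx\<^sup>2 + yy" "gens 2 = xx * yy" "gens 3 = xx\<^sup>2 * yy" "gens 4 = xx * yy\<^sup>2"
  by (simp_all add: gens_def eval_nat_numeral)

lemma le_4_cases:
  assumes "i \<le> (4::nat)"
  obtains "i = 0" | "i = 1" | "i = 2" | "i = 3" | "i = 4"
  using assms by linarith

locale surface = field_coding K dec 4
  for K :: "('a, 'c) ring_scheme" and dec :: "'a \<Rightarrow> 'k::alg_closed_field" +
  assumes two: "(2::'k) = 0"
begin

sublocale D: domain_evaluation K dec 4 cc gens
  by unfold_locales (simp_all add: cc_add cc_mult cc_one)

abbreviation "I \<equiv> D.graded_kernel"

lemma CHAR_2: "CHAR('k) = 2"
proof -
  have "CHAR('k) dvd 2" using two of_nat_eq_0_iff_char_dvd[where 'a = 'k, of 2] by simp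
  then have "CHAR('k) = 1 \<or> CHAR('k) = 2" by (metis One_nat_def dvd_imp_le le_Suc_eq le_numeral_extra(4) nat_dvd_not_less not_less numeral_2_eq_2 one_le_numeral pos2 zero_less_one dvd_0_left_iff le_zero_eq)
  moreover have "CHAR('k) \<noteq> 1" by (metis of_nat_1 of_nat_CHAR zero_neq_one)
  ultimately show ?thesis by blast
qed

text \<open>The values of the forms of degree \<open>n\<close>, as polynomials in \<open>x\<close> and \<open>y\<close>.\<close>

definition V :: "nat \<Rightarrow> 'k poly poly \<Rightarrow> bool" where
  "V n F \<longleftrightarrow> (\<exists>f. form n f \<and> D.E f = F)"

lemma V_E: "form n f \<Longrightarrow> V n (D.E f)" unfolding V_def by blast

lemma V_add: "V n F \<Longrightarrow> V n G \<Longrightarrow> V n (F + G)"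
  unfolding V_def by (metis D.E_add form_add form_closed)

lemma V_mult: "V n F \<Longrightarrow> V m G \<Longrightarrow> V (n + m) (F * G)"
  unfolding V_def by (metis D.E_mult form_mult form_closed)

lemma V_cc: "V 0 (cc c)" unfolding V_def using form_const D.E_const by blast
lemma V_one: "V 0 1" using V_cc[of 1] by (simp add: cc_one)
lemma V_zero: "V n 0" unfolding V_def using form_zero D.E_zero by blast

lemma V_gens: "i \<le> 4 \<Longrightarrow> V 1 (gens i)" unfolding V_def using form_var D.E_var by blast

lemma V_gens_simps:
  "V 1 1" "V 1 (xx\<^sup>2 + yy)" "V 1 (xx * yy)" "V 1 (xx\<^sup>2 * yy)" "V 1 (xx * yy\<^sup>2)"
  using V_gens[of 0] V_gens[of 1] V_gens[of 2] V_gens[of 3] V_gens[of 4] by simp_all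

lemma V_pow: "V n F \<Longrightarrow> V (m * n) (F ^ m)"
  by (induction m) (auto intro: V_mult V_one)

lemma V_mono: "V n F \<Longrightarrow> n \<le> m \<Longrightarrow> V m F"
  using V_mult[of n F "m - n" 1] V_pow[OF V_gens_simps(1), of "m - n"] by simp

lemma minus_char2: "- F = F" for F :: "'k poly poly"
  using two_poly[OF two_poly[OF two]] by (metis add.inverse_unique mult_2 mult_zero_left)

lemma diff_char2: "F - G = F + G" for F G :: "'k poly poly"
  by (metis diff_conv_add_uminus minus_char2)

lemma V_diff: "V n F \<Longrightarrow> V n G \<Longrightarrow> V n (F - G)"
  by (simp add: diff_char2 V_add)

text \<open>The coordinate ring of the chart \<open>X\<^sub>0 \<noteq> 0\<close>; the constant coordinate makes the values of forms an
increasing union.\<close>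

definition R0 :: "'k poly poly \<Rightarrow> bool" where "R0 F \<longleftrightarrow> (\<exists>n. V n F)"

lemma R0_V: "V n F \<Longrightarrow> R0 F" unfolding R0_def by blast
lemma R0_add: "R0 F \<Longrightarrow> R0 G \<Longrightarrow> R0 (F + G)"
  unfolding R0_def by (metis V_add V_mono max.cobounded1 max.cobounded2)
lemma R0_mult: "R0 F \<Longrightarrow> R0 G \<Longrightarrow> R0 (F * G)"
  unfolding R0_def by (metis V_mult)
lemma R0_cc: "R0 (cc c)" and R0_zero: "R0 0" and R0_one: "R0 1"
  using R0_V V_cc V_zero V_one by blast+
lemma R0_diff: "R0 F \<Longrightarrow> R0 G \<Longrightarrow> R0 (F - G)"
  by (simp add: diff_char2 R0_add)
lemmas R0_gens = V_gens_simps[THEN R0_V]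

lemma delta_E: "f \<in> carrier S \<Longrightarrow> delta (D.E f) = 0"
proof (rule D.E_induct[where P = "\<lambda>F. delta F = 0"])
  fix i :: nat assume "i \<le> 4"
  then show "delta (gens i :: 'k poly poly) = 0"
    by (cases rule: le_4_cases) (simp_all add: delta_def power2_eq_square)
qed (auto simp: delta_mult_left, simp add: delta_def)

lemma delta_R0: "R0 F \<Longrightarrow> delta F = 0"
  unfolding R0_def V_def using delta_E by blast

lemma E_var_simps:
  "D.E (var 0) = 1" "D.E (var 1) = xx\<^sup>2 + yy" "D.E (var (Suc 0)) = xx\<^sup>2 + yy" "D.E (var 2) = xx * yy"
  "D.E (var 3) = xx\<^sup>2 * yy" "D.E (var 4) = xx * yy\<^sup>2"
  using D.E_var[of 0] D.E_var[of 1] D.E_var[of 2] D.E_var[of 3] D.E_var[of 4] by simp_all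

lemma at_y0_R0: "R0 G \<Longrightarrow> at_y0 G = at_x0_sq G"
  using delta_R0 by (simp add: delta_def)

text \<open>The ideal generated by the last three coordinates. It turns out to be the conductor \<open>x y k[x, y]\<close>.\<close>

definition J :: "'k poly poly \<Rightarrow> bool" where
  "J F \<longleftrightarrow> (\<exists>a b c. R0 a \<and> R0 b \<and> R0 c \<and> F = a * (xx * yy) + b * (xx\<^sup>2 * yy) + c * (xx * yy\<^sup>2))"

lemma J_R0: "J F \<Longrightarrow> R0 F"
  unfolding J_def by (auto intro!: R0_add R0_mult R0_gens)

lemma J_add: "J F \<Longrightarrow> J G \<Longrightarrow> J (F + G)"
proof -
  assume "J F" "J G"
  then obtain a b c a' b' c' where *: "R0 a" "R0 b" "R0 c" "R0 a'" "R0 b'" "R0 c'"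
    "F = a * (xx * yy) + b * (xx\<^sup>2 * yy) + c * (xx * yy\<^sup>2)"
    "G = a' * (xx * yy) + b' * (xx\<^sup>2 * yy) + c' * (xx * yy\<^sup>2)"
    unfolding J_def by blast
  show "J (F + G)" unfolding J_def
    by (intro exI[of _ "a + a'"] exI[of _ "b + b'"] exI[of _ "c + c'"])
      (use * in \<open>auto intro: R0_add simp: algebra_simps\<close>)
qed

lemma J_mult: "R0 H \<Longrightarrow> J F \<Longrightarrow> J (H * F)"
proof -
  assume H: "R0 H" and "J F"
  then obtain a b c where *: "R0 a" "R0 b" "R0 c" "F = a * (xx * yy) + b * (xx\<^sup>2 * yy) + c * (xx * yy\<^sup>2)"
    unfolding J_def by blast
  show "J (H * F)" unfolding J_def
    by (intro exI[of _ "H * a"] exI[of _ "H * b"] exI[of _ "H * c"])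
      (use * H in \<open>auto intro: R0_mult simp: algebra_simps\<close>)
qed

lemma J_diff: "J F \<Longrightarrow> J G \<Longrightarrow> J (F - G)"
  by (simp add: diff_char2 J_add)

lemma J_gens: "J (xx * yy)" "J (xx\<^sup>2 * yy)" "J (xx * yy\<^sup>2)"
  unfolding J_def
  by (rule exI[of _ 1], rule exI[of _ 0], rule exI[of _ 0], simp add: R0_zero R0_one,
      rule exI[of _ 0], rule exI[of _ 1], rule exI[of _ 0], simp add: R0_zero R0_one,
      rule exI[of _ 0], rule exI[of _ 0], rule exI[of _ 1], simp add: R0_zero R0_one)

text \<open>Multiplication by \<open>x y\<close> and by \<open>x\<^sup>2 + y\<close> generates all monomials divisible by \<open>x y\<close> from the first few.\<close>

lemma J_monomial: "1 \<le> i \<Longrightarrow> 1 \<le> j \<Longrightarrow> J (xx ^ i * yy ^ j)"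
proof (induction "i + j" arbitrary: i j rule: less_induct)
  case less
  have mixed: "J (xx ^ i' * yy ^ j')" if ij: "2 \<le> i'" "2 \<le> j'" "i' + j' \<le> i + j + 1" for i' j'
  proof -
    have "J (xx ^ (i' - 1) * yy ^ (j' - 1))" using ij by (intro less.hyps) auto
    then have "J ((xx ^ (i' - 1) * yy ^ (j' - 1)) * (xx * yy))" by (rule J_mult[OF J_R0 J_gens(1)])
    moreover have "xx ^ i' = xx ^ (i' - 1) * (xx :: 'k poly poly)" "yy ^ j' = yy ^ (j' - 1) * (yy :: 'k poly poly)"
      using ij by (metis One_nat_def Suc_1 Suc_le_D diff_Suc_1 power_Suc2)+
    ultimately show ?thesis by (simp add: mult_ac)
  qed
  consider "i \<ge> 2" "j \<ge> 2" | "i = 1" "j = 1" | "i = 2" "j = 1" | "i = 1" "j = 2" | "i \<ge> 3" "j = 1" | "i = 1" "j \<ge> 3"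
    using less.prems by linarith
  then show ?case
  proof cases
    case 1 then show ?thesis by (intro mixed) auto
  next
    case 5
    then obtain k where k: "i = k + 2" "1 \<le> k" by (metis add.commute le_add_diff_inverse2 numeral_3_eq_3 Suc_le_mono add_2_eq_Suc' One_nat_def add_leD1 le_Suc_ex nat_add_left_cancel_le one_add_one plus_nat.simps(2) Suc_eq_plus1 numeral_2_eq_2 le_add1)
    have eq: "xx ^ i * yy ^ j = (xx\<^sup>2 + yy) * (xx ^ k * yy ^ 1) - xx ^ k * yy ^ (2::nat)"
      using 5 k by (simp add: power_add algebra_simps power2_eq_square)
    have "J (xx ^ k * yy ^ 1)" using k 5 by (intro less.hyps) auto
    moreover have "J (xx ^ k * yy ^ 2)" using k 5 by (intro less.hyps) auto
    ultimately show ?thesis unfolding eq by (intro J_diff J_mult[OF R0_gens(2)])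
  next
    case 6
    then obtain k where k: "j = k + 1" "2 \<le> k" by (metis Suc_eq_plus1 Suc_le_D Suc_le_mono numeral_2_eq_2 numeral_3_eq_3)
    have eq: "xx ^ i * yy ^ j = (xx\<^sup>2 + yy) * (xx ^ 1 * yy ^ k) - xx ^ 3 * yy ^ k"
      using 6 k by (simp add: power_add algebra_simps power2_eq_square eval_nat_numeral)
    have "J (xx ^ 1 * yy ^ k)" using k 6 by (intro less.hyps) auto
    moreover have "J (xx ^ 3 * yy ^ k)" using k 6 by (intro mixed) auto
    ultimately show ?thesis unfolding eq by (intro J_diff J_mult[OF R0_gens(2)])
  qed (use J_gens in auto)
qed

lemma J_xy: "J (xx * yy * F)"
proof (rule poly_poly_induct[where P = "\<lambda>F. J (xx * yy * F)" and F = F])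
  show "J (xx * yy * (F + G))" if "J (xx * yy * F)" "J (xx * yy * G)" for F G
    using J_add[OF that] by (simp add: distrib_left)
  fix i j
  have "J (cc (Polynomial.coeff (Polynomial.coeff F j) i) * (xx ^ Suc i * yy ^ Suc j))"
    by (intro J_mult R0_cc J_monomial) auto
  then show "J (xx * yy * (cc (Polynomial.coeff (Polynomial.coeff F j) i) * xx ^ i * yy ^ j))"
    by (simp add: mult_ac)
qed

text \<open>A function on the double curve extends to the surface, because the coordinate \<open>x\<^sup>2 + y\<close> restricts to
the parameter of the line \<open>x = 0\<close>.\<close>

definition lift_u :: "'k poly \<Rightarrow> 'k poly poly" where
  "lift_u g = poly (map_poly cc g) (xx\<^sup>2 + yy)"

lemma lift_u_pCons: "lift_u (pCons a g) = cc a + (xx\<^sup>2 + yy) * lift_u g"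
  by (simp add: lift_u_def map_poly_pCons cc_zero)

lemma lift_u_0: "lift_u 0 = 0" by (simp add: lift_u_def)

lemma R0_lift_u: "R0 (lift_u g)"
  by (induction g) (auto simp: lift_u_pCons lift_u_0 intro!: R0_add R0_mult R0_cc R0_zero R0_gens)

lemma at_x0_lift_u: "at_x0 (lift_u g) = g"
  by (induction g) (simp_all add: lift_u_pCons lift_u_0)

lemma lift_u_linear: "lift_u ([:-c, 1:] * g) = (xx\<^sup>2 + yy - cc c) * lift_u g"
proof -
  have mp: "map_poly cc (p * q) = map_poly cc p * map_poly cc q" for p q :: "'k poly"
  proof (rule poly_eqI)
    fix n
    have s: "cc (sum h T) = (\<Sum>x\<in>T. cc (h x))" for h :: "nat \<Rightarrow> 'k" and T
      by (induction T rule: infinite_finite_induct) (simp_all add: cc_zero cc_add)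
    show "Polynomial.coeff (map_poly cc (p * q)) n = Polynomial.coeff (map_poly cc p * map_poly cc q) n"
      by (simp add: coeff_map_poly coeff_mult cc_zero cc_mult s)
  qed
  have m: "cc (- c) = - cc c" by (simp add: cc_def)
  show ?thesis
    unfolding lift_u_def mp by (simp add: map_poly_pCons cc_zero cc_one m algebra_simps)
qed

text \<open>Subtracting the extension of its restriction to \<open>x = 0\<close> makes an \<open>F\<close> without defect vanish on both
axes.\<close>

lemma delta_zero_decomposition:
  assumes "delta F = 0"
  shows "J (F - lift_u (at_x0 F))" and "xx * yy dvd F - lift_u (at_x0 F)"
proof -
  let ?H = "F - lift_u (at_x0 F)"
  have x: "at_x0 ?H = 0" by (simp add: at_x0_lift_u)
  have "delta ?H = 0" using assms delta_R0[OF R0_lift_u] by simp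
  then have "at_y0 ?H = 0" using x by (simp add: delta_def at_x0_sq_def)
  then show d: "xx * yy dvd ?H" using x by (simp add: xy_dvd_iff)
  then show "J ?H" using J_xy by (metis dvdE)
qed

lemma R0_iff_delta: "R0 F \<longleftrightarrow> delta F = 0"
proof
  assume "delta F = 0"
  then have "R0 (F - lift_u (at_x0 F) + lift_u (at_x0 F))"
    by (intro R0_add R0_lift_u J_R0 delta_zero_decomposition)
  then show "R0 F" by simp
qed (rule delta_R0)

lemma R0_xy: "R0 (xx * yy * F)" by (rule J_R0[OF J_xy])

subsection \<open>Monomials at infinity\<close>

lemma E_in_polygon: 
  assumes f: "form n f"
  shows "in_polygon n (D.E f)"
proof -
  have "form n f \<and> in_polygon n (D.E f)"
  proof (rule poly_induct[OF form_closed[OF f], where P = "\<lambda>f. form n f \<and> in_polygon n (D.E f)"])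
    show "form n \<zero>\<^bsub>S\<^esub> \<and> in_polygon n (D.E \<zero>\<^bsub>S\<^esub>)" by (simp add: D.E_zero in_polygon_def)
    show "form n (f \<oplus>\<^bsub>S\<^esub> g) \<and> in_polygon n (D.E (f \<oplus>\<^bsub>S\<^esub> g))"
      if "f \<in> carrier S" "g \<in> carrier S" "form n f \<and> in_polygon n (D.E f)" "form n g \<and> in_polygon n (D.E g)" for f g
      using that by (auto simp: D.E_add in_polygon_add)
    fix m and c :: 'k assume "m \<in> keys (pm f)"
    then have m: "set_mset m \<subseteq> {..4}" "size m = n" using f keys_pm_vars by (auto simp: form_iff)
    have g: "in_polygon 1 (gens i :: 'k poly poly)" if "i \<le> 4" for i
      using that by (cases rule: le_4_cases)
        (auto simp: in_polygon_def polygon_def xx_def yy_def power2_eq_square coeff_pCons one_pCons split: nat.splits)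
    have "in_polygon (size m) (prod_mset (image_mset gens m) :: 'k poly poly)"
      using m(1)
    proof (induction m)
      case empty
      show ?case by (auto simp: in_polygon_def polygon_def coeff_pCons one_pCons split: nat.splits)
    next
      case (add i m)
      then show ?case using in_polygon_mult[OF g[of i], of "size m"] by simp
    qed
    moreover have "in_polygon 0 (cc c)"
      by (auto simp: in_polygon_def polygon_def cc_def coeff_pCons split: nat.splits)
    ultimately have "in_polygon n (D.E (mp (Poly_Mapping.single m c)))"
      using m in_polygon_mult[of 0] by (fastforce simp: D.E_single)
    then show "form n (mp (Poly_Mapping.single m c)) \<and> in_polygon n (D.E (mp (Poly_Mapping.single m c)))"
      using form_single[OF m(1)] m(2) by simp
  qed
  then show ?thesis by blast
qed

lemma V_infinity: "V 2 (xx ^ 4 * yy)" "V 2 (xx * yy ^ 3)"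
proof -
  have "V (1 + 1) ((xx\<^sup>2 + yy) * (xx\<^sup>2 * yy) - (xx * yy) * (xx * yy))"
    by (intro V_diff V_mult V_gens_simps)
  moreover have "(xx\<^sup>2 + yy) * (xx\<^sup>2 * yy) - (xx * yy) * (xx * yy) = xx ^ 4 * (yy :: 'k poly poly)"
    by (simp add: algebra_simps eval_nat_numeral)
  ultimately show "V 2 (xx ^ 4 * yy)" by (simp only: one_add_one)
  have "V (1 + 1) ((xx\<^sup>2 + yy) * (xx * yy\<^sup>2) - (xx * yy) * (xx\<^sup>2 * yy))"
    by (intro V_diff V_mult V_gens_simps)
  moreover have "(xx\<^sup>2 + yy) * (xx * yy\<^sup>2) - (xx * yy) * (xx\<^sup>2 * yy) = xx * (yy :: 'k poly poly) ^ 3"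
    by (simp add: algebra_simps eval_nat_numeral)
  ultimately show "V 2 (xx * yy ^ 3)" by (simp only: one_add_one)
qed

text \<open>Each monomial of the polygon is reached by forms after multiplication with the coordinate \<open>h\<close>. Near
the two ends of the polygon this needs \<open>x\<^sup>4 y\<close> and \<open>x y\<^sup>3\<close>, which are quadratic in the coordinates.\<close>

lemma V_monomial_infinity:
  assumes ij: "(i, j) \<in> polygon n" and h: "h = 3 \<or> h = 4"
  shows "\<exists>m. V (n + m) (xx ^ i * yy ^ j * gens h ^ m)"
proof -
  have b: "i \<le> 2 * n" "i + j \<le> 3 * n" "j \<le> i + n" using ij by (auto simp: polygon_def)
  have V4: "V (a * 1 + b * 1 + c * 1 + e * 2) ((xx * yy) ^ a * (xx\<^sup>2 * yy) ^ b * (xx * yy\<^sup>2) ^ c * w ^ e)"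
    if "V 2 w" for a b c e w
    by (intro V_mult V_pow V_gens_simps that)
  have mono: "(xx * yy) ^ a * (xx\<^sup>2 * yy) ^ b * (xx * yy\<^sup>2) ^ c * (xx ^ s * yy ^ t) ^ e =
     xx ^ (a + 2 * b + c + s * e) * (yy :: 'k poly poly) ^ (a + b + 2 * c + t * e)" for a b c e s t
    by (simp add: power_mult_distrib power_mult[symmetric] power_add mult_ac)
  have w: "V 2 (xx ^ 4 * yy ^ 1)" "V 2 (xx ^ 1 * yy ^ 3)" using V_infinity by simp_all
  have W1: "V (a * 1 + b * 1 + c * 1 + e * 2) (xx ^ (a + 2 * b + c + 4 * e) * yy ^ (a + b + 2 * c + 1 * e))" for a b c e
    using V4[OF w(1), of a b c e] unfolding mono .
  have W2: "V (a * 1 + b * 1 + c * 1 + e * 2) (xx ^ (a + 2 * b + c + 1 * e) * yy ^ (a + b + 2 * c + 3 * e))" for a b c e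
    using V4[OF w(2), of a b c e] unfolding mono .
  have L3: "xx ^ i * yy ^ j * gens 3 ^ m = xx ^ (i + 2 * m) * (yy :: 'k poly poly) ^ (j + m)" for m
    by (simp add: power_mult_distrib power_mult[symmetric] power_add mult_ac)
  have L4: "xx ^ i * yy ^ j * gens 4 ^ m = xx ^ (i + m) * (yy :: 'k poly poly) ^ (j + 2 * m)" for m
    by (simp add: power_mult_distrib power_mult[symmetric] power_add mult_ac)
  consider "h = 3" "j \<le> n" | "h = 3" "j > n" | "h = 4" "i \<le> n" | "h = 4" "i > n" using h by linarith
  then show ?thesis
  proof cases
    case 1
    define a b where "a = 2 * n - i" and "b = n - j"
    have eq: "i + 2 * (a + 2 * b) = a + 2 * n + 0 + 4 * b" "j + (a + 2 * b) = a + n + 2 * 0 + 1 * b"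
      "n + (a + 2 * b) = a * 1 + n * 1 + 0 * 1 + b * 2"
      using 1 \<open>i \<le> 2 * n\<close> by (auto simp: a_def b_def)
    show ?thesis
      by (rule exI[of _ "a + 2 * b"], unfold 1(1) L3 eq) (rule W1)
  next
    case 2
    define a c where "a = 3 * n - i - j" and "c = j - n"
    have eq: "i + 2 * (a + c) = a + 2 * n + c + 4 * 0" "j + (a + c) = a + n + 2 * c + 1 * 0"
      "n + (a + c) = a * 1 + n * 1 + c * 1 + 0 * 2"
      using 2 b by (auto simp: a_def c_def)
    show ?thesis
      by (rule exI[of _ "a + c"], unfold 2(1) L3 eq) (rule W1)
  next
    case 3
    define a b where "a = n - i" and "b = n + i - j"
    have eq: "i + (2 * a + b) = b + 2 * 0 + n + 1 * a" "j + 2 * (2 * a + b) = b + 0 + 2 * n + 3 * a"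
      "n + (2 * a + b) = b * 1 + 0 * 1 + n * 1 + a * 2"
      using 3 b by (auto simp: a_def b_def)
    show ?thesis
      by (rule exI[of _ "2 * a + b"], unfold 3(1) L4 eq) (rule W2)
  next
    case 4
    define c b where "c = i - n" and "b = 3 * n - i - j"
    have eq: "i + (b + c) = b + 2 * c + n + 1 * 0" "j + 2 * (b + c) = b + c + 2 * n + 3 * 0"
      "n + (b + c) = b * 1 + c * 1 + n * 1 + 0 * 2"
      using 4 b by (auto simp: c_def b_def)
    show ?thesis
      by (rule exI[of _ "b + c"], unfold 4(1) L4 eq) (rule W2)
  qed
qed

lemma V_polygon:
  assumes F: "in_polygon n F" and h: "h = 3 \<or> h = 4"
  shows "\<exists>m. V (n + m) (F * gens h ^ m)"
proof (rule poly_poly_induct[where F = F and P = "\<lambda>F. \<exists>m. V (n + m) (F * gens h ^ m)"])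
  have up: "V (n + (m + k)) (G * gens h ^ (m + k))" if "V (n + m) (G * gens h ^ m)" for G m k
    using V_mult[OF that V_pow[OF V_gens[of h], of k]] h
    by (auto simp: power_add mult_ac add_ac)
  fix F G assume "\<exists>m. V (n + m) (F * gens h ^ m)" "\<exists>m. V (n + m) (G * gens h ^ m)"
  then obtain m k where mk: "V (n + m) (F * gens h ^ m)" "V (n + k) (G * gens h ^ k)" by blast
  have "V (n + (m + k)) (F * gens h ^ (m + k) + G * gens h ^ (m + k))"
    using up[OF mk(1), of k] up[OF mk(2), of m] by (intro V_add) (simp_all add: add.commute)
  then show "\<exists>m. V (n + m) ((F + G) * gens h ^ m)" by (auto simp: distrib_right)
next
  fix i j
  let ?c = "Polynomial.coeff (Polynomial.coeff F j) i"
  show "\<exists>m. V (n + m) (cc ?c * xx ^ i * yy ^ j * gens h ^ m)"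
  proof (cases "?c = 0")
    case True
    then show ?thesis using V_zero by (auto simp: cc_zero)
  next
    case False
    then obtain m where "V (n + m) (xx ^ i * yy ^ j * gens h ^ m)"
      using V_monomial_infinity[OF _ h, of i j n] F by (auto simp: in_polygon_def)
    from V_mult[OF V_cc[of ?c] this] show ?thesis by (auto simp: mult_ac)
  qed
qed

subsection \<open>Square roots and the splitting\<close>

definition sqroot :: "'k \<Rightarrow> 'k" where "sqroot c = (SOME b. b\<^sup>2 = c)"

lemma sqroot_sq: "(sqroot c)\<^sup>2 = c"
  unfolding sqroot_def by (rule someI_ex) (use nth_root_exists[of 2 c] in simp)

lemma square_inj: "a\<^sup>2 = b\<^sup>2 \<Longrightarrow> a = b" for a b :: 'k
proof -
  assume "a\<^sup>2 = b\<^sup>2"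
  then have "(a + b)\<^sup>2 = 2 * b\<^sup>2" using square_add_char2[OF two, of a b] by simp
  then have "a + b = 0" using two by simp
  then show "a = b" using two by (metis add.inverse_inverse add_eq_0_iff mult_2 mult_zero_left)
qed

lemma splitting_sqroot: "splitting sqroot"
  unfolding splitting_def
  by (intro conjI allI; rule square_inj)
    (simp_all add: sqroot_sq square_add_char2[OF two] power_mult_distrib)

definition \<sigma>B :: "'k poly poly \<Rightarrow> 'k poly poly" where "\<sigma>B = halve_poly (halve_poly sqroot)"

lemma splitting_\<sigma>B: "splitting \<sigma>B"
  unfolding \<sigma>B_def by (intro splitting_halve_poly splitting_sqroot two_poly two)

definition \<sigma>L :: "'k poly poly fract \<Rightarrow> 'k poly poly fract" where "\<sigma>L = fract_splitting \<sigma>B"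

lemma splitting_\<sigma>L: "splitting \<sigma>L"
  unfolding \<sigma>L_def by (rule splitting_fract[OF splitting_\<sigma>B])

lemma \<sigma>L_Fract: "b \<noteq> 0 \<Longrightarrow> \<sigma>L (Fract a b) = Fract (\<sigma>B (a * b)) b"
  unfolding \<sigma>L_def by (rule fract_splitting_Fract[OF splitting_\<sigma>B])

end

section \<open>F-injectivity of the surface\<close>

locale surface_point = surface K dec
  for K :: "('a, 'c) ring_scheme" and dec :: "'a \<Rightarrow> 'k::alg_closed_field" +
  fixes Q :: "(nat multiset \<Rightarrow> 'a) set"
  assumes Q: "Q \<in> proj_points K 4 I"
begin

sublocale perfect_stalk K dec 4 I Q 2
proof unfold_locales
  show "homogeneous_ideal K 4 I" by (rule D.graded_kernel_homogeneous)
  show "Q \<in> proj_points K 4 I" by (rule Q)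
  show "Factorial_Ring.prime (2::nat)" by (rule two_is_prime_nat)
  show "CHAR('k) = 2" by (rule CHAR_2)
  show "\<exists>b::'k. b ^ 2 = c" for c by (rule nth_root_exists) simp
qed

lemma E_nonzero: "form d g \<Longrightarrow> g \<notin> Q \<Longrightarrow> D.E g \<noteq> 0"
  using D.form_in_graded_kernel I_Q by blast

text \<open>The stalk as a subring of the field of rational functions in \<open>x\<close> and \<open>y\<close>.\<close>

definition iota where
  "iota x = (SOME z. \<exists>f g d. form d f \<and> form d g \<and> g \<notin> Q \<and> x = q f g \<and> z = Fract (D.E f) (D.E g))"

lemma q_eq_iff_Fract:
  assumes f: "form d f" "form d g" "g \<notin> Q" and f': "form e f'" "form e g'" "g' \<notin> Q"
  shows "q f g = q f' g' \<longleftrightarrow> Fract (D.E f) (D.E g) = Fract (D.E f') (D.E g')"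
proof -
  note c = form_closed[OF f(1)] form_closed[OF f(2)] form_closed[OF f'(1)] form_closed[OF f'(2)]
  have h: "form (d + e) (g' \<otimes>\<^bsub>S\<^esub> f \<ominus>\<^bsub>S\<^esub> g \<otimes>\<^bsub>S\<^esub> f')"
    using form_mult[OF f'(2) f(1)] form_mult[OF f(2) f'(1)]
    by (auto simp: S.minus_eq add.commute)
  have "Fract (D.E f) (D.E g) = Fract (D.E f') (D.E g') \<longleftrightarrow> D.E (g' \<otimes>\<^bsub>S\<^esub> f \<ominus>\<^bsub>S\<^esub> g \<otimes>\<^bsub>S\<^esub> f') = 0"
    using E_nonzero[OF f(2,3)] E_nonzero[OF f'(2,3)] c
    by (simp add: eq_fract D.E_diff D.E_mult mult.commute)
  also have "\<dots> \<longleftrightarrow> q f g = q f' g'"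
    unfolding q_eq_iff[OF f f']
  proof
    assume "D.E (g' \<otimes>\<^bsub>S\<^esub> f \<ominus>\<^bsub>S\<^esub> g \<otimes>\<^bsub>S\<^esub> f') = 0"
    then have "\<one>\<^bsub>S\<^esub> \<otimes>\<^bsub>S\<^esub> (g' \<otimes>\<^bsub>S\<^esub> f \<ominus>\<^bsub>S\<^esub> g \<otimes>\<^bsub>S\<^esub> f') \<in> I"
      using h D.form_in_graded_kernel form_closed[OF h] by simp
    then show "\<exists>t c. form c t \<and> t \<notin> Q \<and> t \<otimes>\<^bsub>S\<^esub> (g' \<otimes>\<^bsub>S\<^esub> f \<ominus>\<^bsub>S\<^esub> g \<otimes>\<^bsub>S\<^esub> f') \<in> I"
      using one_notin_Q form_one by blast
  next
    assume "\<exists>t c. form c t \<and> t \<notin> Q \<and> t \<otimes>\<^bsub>S\<^esub> (g' \<otimes>\<^bsub>S\<^esub> f \<ominus>\<^bsub>S\<^esub> g \<otimes>\<^bsub>S\<^esub> f') \<in> I"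
    then obtain t k where t: "form k t" "t \<notin> Q" "t \<otimes>\<^bsub>S\<^esub> (g' \<otimes>\<^bsub>S\<^esub> f \<ominus>\<^bsub>S\<^esub> g \<otimes>\<^bsub>S\<^esub> f') \<in> I" by blast
    have "D.E (t \<otimes>\<^bsub>S\<^esub> (g' \<otimes>\<^bsub>S\<^esub> f \<ominus>\<^bsub>S\<^esub> g \<otimes>\<^bsub>S\<^esub> f')) = 0"
      using D.form_in_graded_kernel[OF form_mult[OF t(1) h]] t(3) by simp
    then show "D.E (g' \<otimes>\<^bsub>S\<^esub> f \<ominus>\<^bsub>S\<^esub> g \<otimes>\<^bsub>S\<^esub> f') = 0"
      using E_nonzero[OF t(1,2)] D.E_mult[OF form_closed[OF t(1)] form_closed[OF h]] by simp
  qed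
  finally show ?thesis by simp
qed

lemma iota_q:
  assumes f: "form d f" "form d g" "g \<notin> Q"
  shows "iota (q f g) = Fract (D.E f) (D.E g)"
proof -
  have "\<exists>f' g' d. form d f' \<and> form d g' \<and> g' \<notin> Q \<and> q f g = q f' g' \<and> iota (q f g) = Fract (D.E f') (D.E g')"
    unfolding iota_def by (rule someI_ex) (use f in blast)
  then show ?thesis using q_eq_iff_Fract[OF f] by metis
qed

lemma two_L: "(2 :: 'k poly poly fract) = 0"
  by (intro two_fract two_poly two)

sublocale emb: frobenius_embedding T iota 2
proof
  fix x x' assume "x \<in> carrier T" "x' \<in> carrier T"
  then obtain f g d f' g' e where f: "form d f" "form d g" "g \<notin> Q" "x = q f g"
    and f': "form e f'" "form e g'" "g' \<notin> Q" "x' = q f' g'"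
    by (elim T_cases)
  note c = form_closed[OF f(1)] form_closed[OF f(2)] form_closed[OF f'(1)] form_closed[OF f'(2)]
  note nz = E_nonzero[OF f(2,3)] E_nonzero[OF f'(2,3)]
  have gg: "g \<otimes>\<^bsub>S\<^esub> g' \<notin> Q" using mult_notin_Q c f f' by blast
  have a: "form (d + e) (g' \<otimes>\<^bsub>S\<^esub> f \<oplus>\<^bsub>S\<^esub> g \<otimes>\<^bsub>S\<^esub> f')"
    using form_mult[OF f'(2) f(1)] form_mult[OF f(2) f'(1)] by (auto simp: add.commute)
  show "iota (x \<oplus>\<^bsub>T\<^esub> x') = iota x + iota x'"
    unfolding f(4) f'(4) q_add[OF f(1-3) f'(1-3)] iota_q[OF a form_mult[OF f(2) f'(2)] gg]
      iota_q[OF f(1-3)] iota_q[OF f'(1-3)]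
    using nz c by (simp add: D.E_add D.E_mult algebra_simps)
  show "iota (x \<otimes>\<^bsub>T\<^esub> x') = iota x * iota x'"
    unfolding f(4) f'(4) q_mult[OF f(1-3) f'(1-3)] iota_q[OF form_mult[OF f(1) f'(1)] form_mult[OF f(2) f'(2)] gg]
      iota_q[OF f(1-3)] iota_q[OF f'(1-3)]
    using nz c by (simp add: D.E_mult)
next
  show "iota \<one>\<^bsub>T\<^esub> = 1"
    unfolding q_one by (subst iota_q[of 0]) (auto simp: one_notin_Q D.E_one One_fract_def)
  show "inj_on iota (carrier T)"
  proof (rule inj_onI)
    fix x x' assume "x \<in> carrier T" "x' \<in> carrier T" and eq: "iota x = iota x'"
    then obtain f g d f' g' e where f: "form d f" "form d g" "g \<notin> Q" "x = q f g"
      and f': "form e f'" "form e g'" "g' \<notin> Q" "x' = q f' g'"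
      by (elim T_cases)
    show "x = x'"
      using eq unfolding f(4) f'(4) iota_q[OF f(1-3)] iota_q[OF f'(1-3)] q_eq_iff_Fract[OF f(1-3) f'(1-3)] .
  qed
  show "(a + b)\<^sup>2 = a\<^sup>2 + b\<^sup>2" for a b :: "'k poly poly fract" by (rule square_add_char2[OF two_L])
qed simp

lemma iota_image: "iota ` carrier T = {Fract (D.E f) (D.E g) | f g d. form d f \<and> form d g \<and> g \<notin> Q}"
proof (intro equalityI subsetI)
  fix z assume "z \<in> iota ` carrier T"
  then obtain x where x: "x \<in> carrier T" "z = iota x" by blast
  then obtain f g d where "form d f" "form d g" "g \<notin> Q" "x = q f g" by (elim T_cases)
  then show "z \<in> {Fract (D.E f) (D.E g) | f g d. form d f \<and> form d g \<and> g \<notin> Q}"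
    using x iota_q by blast
next
  fix z assume "z \<in> {Fract (D.E f) (D.E g) | f g d. form d f \<and> form d g \<and> g \<notin> Q}"
  then obtain f g d where f: "form d f" "form d g" "g \<notin> Q" "z = Fract (D.E f) (D.E g)" by blast
  show "z \<in> iota ` carrier T"
    unfolding f(4) iota_q[OF f(1-3), symmetric] by (rule imageI[OF q_closed[OF f(1-3)]])
qed

lemma iota_diff: "x \<in> carrier T \<Longrightarrow> x' \<in> carrier T \<Longrightarrow> iota (x \<ominus>\<^bsub>T\<^esub> x') = iota x - iota x'"
proof -
  assume x: "x \<in> carrier T" "x' \<in> carrier T"
  have "iota (x \<ominus>\<^bsub>T\<^esub> x') + iota x' = iota ((x \<ominus>\<^bsub>T\<^esub> x') \<oplus>\<^bsub>T\<^esub> x')"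
    using x by (intro emb.\<iota>_add[symmetric]) auto
  also have "(x \<ominus>\<^bsub>T\<^esub> x') \<oplus>\<^bsub>T\<^esub> x' = x" using x by (simp add: T.minus_eq T.a_assoc T.l_neg)
  finally show ?thesis by (simp add: eq_diff_eq)
qed

lemma image_diff: "a \<in> iota ` carrier T \<Longrightarrow> b \<in> iota ` carrier T \<Longrightarrow> a - b \<in> iota ` carrier T"
  by (elim imageE) (simp only: iota_diff[symmetric], intro imageI T.minus_closed)
lemma image_mult: "a \<in> iota ` carrier T \<Longrightarrow> b \<in> iota ` carrier T \<Longrightarrow> a * b \<in> iota ` carrier T"
  by (elim imageE) (simp only: emb.\<iota>_mult[symmetric], intro imageI T.m_closed)

lemma \<sigma>L_additive: "\<sigma>L (a + b) = \<sigma>L a + \<sigma>L b" and \<sigma>L_linear: "\<sigma>L (a\<^sup>2 * b) = a * \<sigma>L b" and \<sigma>L_one: "\<sigma>L 1 = 1"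
  using splitting_\<sigma>L by (simp_all add: splitting_def)

lemma loc_at_single:
  assumes "xs ! j \<in> carrier T"
  shows "emb.loc_at xs B {j} = {s / iota (xs ! j) ^ n | s n. s \<in> B}"
proof -
  have "monomials T xs {j} = {xs ! j [^]\<^bsub>T\<^esub> n | n::nat. True}"
  proof (intro equalityI subsetI)
    fix w assume "w \<in> monomials T xs {j}"
    then obtain e :: "nat \<Rightarrow> nat" where "w = finprod T (\<lambda>l. (xs ! l) [^]\<^bsub>T\<^esub> e l) {j}"
      unfolding monomials_def by blast
    then show "w \<in> {xs ! j [^]\<^bsub>T\<^esub> n | n::nat. True}" using assms by auto
  next
    fix w assume "w \<in> {xs ! j [^]\<^bsub>T\<^esub> n | n::nat. True}"
    then obtain n :: nat where "w = xs ! j [^]\<^bsub>T\<^esub> n" by blast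
    then have w: "w = finprod T (\<lambda>l. (xs ! l) [^]\<^bsub>T\<^esub> n) {j}" using assms by simp
    show "w \<in> monomials T xs {j}"
      unfolding monomials_def by (intro CollectI exI[of _ "\<lambda>_. n"] conjI w TrueI)
  qed
  note mon = this
  show ?thesis
  proof (intro equalityI subsetI)
    fix z assume "z \<in> emb.loc_at xs B {j}"
    then obtain s w where s: "z = s / iota w" "s \<in> B" "w \<in> monomials T xs {j}"
      unfolding emb.loc_at_def by blast
    then obtain n :: nat where "w = xs ! j [^]\<^bsub>T\<^esub> n" using mon by blast
    then have "z = s / iota (xs ! j) ^ n" using s(1) emb.\<iota>_pow[OF assms] by simp
    then show "z \<in> {s / iota (xs ! j) ^ n | s n. s \<in> B}" using s(2) by blast
  next
    fix z assume "z \<in> {s / iota (xs ! j) ^ n | s n. s \<in> B}"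
    then obtain s n where s: "z = s / iota (xs ! j) ^ n" "s \<in> B" by blast
    then have "z = s / iota (xs ! j [^]\<^bsub>T\<^esub> n)" using emb.\<iota>_pow[OF assms] by simp
    moreover have "xs ! j [^]\<^bsub>T\<^esub> n \<in> monomials T xs {j}" using mon by blast
    ultimately show "z \<in> emb.loc_at xs B {j}" unfolding emb.loc_at_def using s(2) by blast
  qed
qed

subsection \<open>Away from the double curve\<close>

text \<open>The splitting sends \<open>f/g = f g/g\<^sup>2\<close> to a numerator over \<open>g\<close>. That numerator is supported on the
polygon of the degree of \<open>g\<close>, so it becomes a form after multiplication by a power of the coordinate
\<open>h\<close>, a unit at the point.\<close>

lemma chart_split:
  assumes h: "h = 3 \<or> h = 4" and var: "var h \<notin> Q" and z: "z \<in> iota ` carrier T"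
  shows "\<sigma>L z \<in> iota ` carrier T"
proof -
  obtain f g d where f: "form d f" "form d g" "g \<notin> Q" "z = Fract (D.E f) (D.E g)"
    using z unfolding iota_image by blast
  have h4: "h \<le> 4" using h by auto
  have fg: "form (2 * d) (f \<otimes>\<^bsub>S\<^esub> g)" using form_mult[OF f(1,2)] by (simp add: mult_2)
  have "in_polygon d (\<sigma>B (D.E (f \<otimes>\<^bsub>S\<^esub> g)))"
    unfolding \<sigma>B_def by (intro in_polygon_halve splitting_zero splitting_sqroot E_in_polygon fg)
  then obtain m where "V (d + m) (\<sigma>B (D.E (f \<otimes>\<^bsub>S\<^esub> g)) * gens h ^ m)" using V_polygon[OF _ h] by blast
  then obtain r where r: "form (d + m) r" "D.E r = \<sigma>B (D.E (f \<otimes>\<^bsub>S\<^esub> g)) * gens h ^ m"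
    unfolding V_def by blast
  define g' where "g' = g \<otimes>\<^bsub>S\<^esub> var h [^]\<^bsub>S\<^esub> m"
  have vS: "var h \<in> carrier S" using h4 by blast
  have g': "form (d + m) g'" unfolding g'_def using form_mult[OF f(2) form_pow[OF form_var[OF h4], of m]] by simp
  have g'Q: "g' \<notin> Q"
    unfolding g'_def using mult_notin_Q[OF form_closed[OF f(2)] _ f(3) pow_notin_Q[OF vS var]] vS by blast
  have Eg': "D.E g' = D.E g * gens h ^ m"
    unfolding g'_def using D.E_mult[OF form_closed[OF f(2)]] D.E_pow[OF vS] D.E_var[OF h4] vS by simp
  have "\<sigma>L z = Fract (\<sigma>B (D.E f * D.E g)) (D.E g)"
    unfolding f(4) by (rule \<sigma>L_Fract[OF E_nonzero[OF f(2,3)]])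
  also have "\<dots> = Fract (D.E r) (D.E g')"
    using E_nonzero[OF f(2,3)] E_nonzero[OF g' g'Q] D.E_mult[OF form_closed[OF f(1)] form_closed[OF f(2)]]
    by (simp add: eq_fract r(2) Eg' mult_ac)
  finally show ?thesis unfolding iota_image using r(1) g' g'Q by blast
qed

theorem F_injective_chart:
  assumes h: "h = 3 \<or> h = 4" and var: "var h \<notin> Q"
  shows "F_injective_at 2 K 4 I Q"
proof -
  obtain C where C: "C \<subseteq> carrier T" "finite C" "M = Idl\<^bsub>T\<^esub> C"
    using ideal_finitely_generated[OF M_ideal] by blast
  obtain xs where xs: "set xs = C - {\<zero>\<^bsub>T\<^esub>}" using C(2) finite_list by (metis finite_Diff)
  have xsT: "set xs \<subseteq> carrier T" "\<zero>\<^bsub>T\<^esub> \<notin> set xs" using xs C(1) by auto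
  have "C \<subseteq> Idl\<^bsub>T\<^esub> (set xs)"
    using T.genideal_self[OF xsT(1)] xs
      additive_subgroup.zero_closed[OF ideal.axioms(1)[OF T.genideal_ideal[OF xsT(1)]]] by blast
  then have "M \<subseteq> Idl\<^bsub>T\<^esub> (set xs)" unfolding C(3) by (rule T.genideal_minimal[OF T.genideal_ideal[OF xsT(1)]])
  moreover have "Idl\<^bsub>T\<^esub> (set xs) \<subseteq> M"
    by (rule T.genideal_minimal[OF M_ideal]) (use xs C(3) T.genideal_self[OF C(1)] in blast)
  ultimately have Idl: "Idl\<^bsub>T\<^esub> (set xs) = M" by blast
  have "inj_on (local_cohomology_map T xs (frobenius_pushforward 2 T) (\<lambda>x. x [^]\<^bsub>T\<^esub> (2::nat)) i)
      (carrier (local_cohomology T xs (self_module T) i))" for i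
  proof (rule emb.cohomology_map_injective[OF xsT subset_refl image_diff image_mult \<sigma>L_additive \<sigma>L_linear \<sigma>L_one
        chart_split[OF h var]])
    fix j s assume "j < length xs" "s \<in> iota ` carrier T"
    moreover from this have "xs ! j \<in> carrier T" using xsT(1) nth_mem by blast
    ultimately show "iota (xs ! j) * s \<in> iota ` carrier T" by (intro image_mult imageI)
  next
    fix z g assume "z \<in> emb.loc_at xs (iota ` carrier T) {0}"
    moreover have "0 \<in> iota ` carrier T"
      unfolding emb.\<iota>_zero[symmetric] by (rule imageI[OF T.zero_closed])
    ultimately show "\<exists>g'\<in>iota ` carrier T. z - g' \<in> emb.loc_at xs (iota ` carrier T) {0}"
      by (intro bexI[of _ 0]) simp_all
  qed auto
  then show ?thesis unfolding F_injective_at_iff using xsT(1) Idl by blast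
qed

end

section \<open>Points of the double curve\<close>

context surface_point
begin

lemma mult_in_Q_iff:
  assumes f: "f \<in> carrier S" and g: "g \<in> carrier S"
  shows "f \<otimes>\<^bsub>S\<^esub> g \<in> Q \<longleftrightarrow> f \<in> Q \<or> g \<in> Q"
proof
  assume "f \<in> Q \<or> g \<in> Q"
  then show "f \<otimes>\<^bsub>S\<^esub> g \<in> Q"
    by (elim disjE) (rule Q.I_r_closed[OF _ g] Q.I_l_closed[OF _ f], assumption)+
qed (use mult_notin_Q[OF f g] in blast)

lemma in_Q_by_E:
  assumes "form d f" "form d g" "D.E f = D.E g" "g \<in> Q"
  shows "f \<in> Q"
proof -
  have c: "f \<in> carrier S" "g \<in> carrier S" using assms by auto
  have "form d (f \<ominus>\<^bsub>S\<^esub> g)" using assms by (auto simp: S.minus_eq)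
  then have "f \<ominus>\<^bsub>S\<^esub> g \<in> Q" using assms(3) c D.form_in_graded_kernel I_Q by (auto simp: D.E_diff)
  then have "(f \<ominus>\<^bsub>S\<^esub> g) \<oplus>\<^bsub>S\<^esub> g \<in> Q" using assms(4) by (rule Q.a_closed)
  then show ?thesis using c by (simp add: S.minus_eq S.a_assoc S.l_neg)
qed

lemma var_closed [simp]: "i \<le> 4 \<Longrightarrow> var i \<in> carrier S" by blast

lemma var_2_in_Q:
  assumes "var 3 \<in> Q" "var 4 \<in> Q"
  shows "var 2 \<in> Q"
proof (rule ccontr)
  assume "var 2 \<notin> Q"
  then have n: "var 2 [^]\<^bsub>S\<^esub> (3::nat) \<notin> Q" by (intro pow_notin_Q) auto
  have "form 3 (var 2 [^]\<^bsub>S\<^esub> (3::nat))" using form_pow[OF form_var[of 2], of 3] by simp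
  moreover have "form (1 + (1 + 1)) (var 0 \<otimes>\<^bsub>S\<^esub> (var 3 \<otimes>\<^bsub>S\<^esub> var 4))"
    by (intro form_mult form_var) auto
  then have "form 3 (var 0 \<otimes>\<^bsub>S\<^esub> (var 3 \<otimes>\<^bsub>S\<^esub> var 4))" by (simp add: numeral_3_eq_3)
  moreover have "D.E (var 2 [^]\<^bsub>S\<^esub> (3::nat)) = D.E (var 0 \<otimes>\<^bsub>S\<^esub> (var 3 \<otimes>\<^bsub>S\<^esub> var 4))"
    by (simp add: D.E_pow D.E_mult E_var_simps power3_eq_cube power2_eq_square mult_ac)
  moreover have "var 0 \<otimes>\<^bsub>S\<^esub> (var 3 \<otimes>\<^bsub>S\<^esub> var 4) \<in> Q"
    using assms by (intro Q.I_l_closed) auto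
  ultimately show False using in_Q_by_E n by blast
qed

abbreviation "x0p n \<equiv> var 0 [^]\<^bsub>S\<^esub> (n::nat)"

lemma x0p: "form n (x0p n)" "x0p n \<in> carrier S" "D.E (x0p n) = 1"
  using form_pow[OF form_var[of 0], of n] by (auto simp: D.E_pow E_var_simps)

text \<open>Two forms with the same restriction to the line \<open>x = 0\<close> differ, after multiplication with powers of
the first coordinate, by a combination of the last three coordinates.\<close>

lemma curve_congruence:
  assumes v: "var 0 \<notin> Q" "var 3 \<in> Q" "var 4 \<in> Q"
    and f: "form d f" and g: "form e g" "g \<in> Q" and eq: "at_x0 (D.E f) = at_x0 (D.E g)"
  shows "f \<in> Q"
proof -
  have c: "f \<in> carrier S" "g \<in> carrier S" using f g by auto
  let ?h = "D.E f - D.E g"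
  have "delta ?h = 0" using delta_E c by simp
  moreover have "at_x0 ?h = 0" using eq by simp
  ultimately have "J ?h" using delta_zero_decomposition(1)[of ?h] by (simp add: lift_u_0)
  then obtain a b c' where abc: "R0 a" "R0 b" "R0 c'"
    "?h = a * (xx * yy) + b * (xx\<^sup>2 * yy) + c' * (xx * yy\<^sup>2)"
    unfolding J_def by blast
  obtain i j k where "V i a" "V j b" "V k c'" using abc(1-3) unfolding R0_def by blast
  then have "V (i + j + k) a" "V (i + j + k) b" "V (i + j + k) c'" by (auto elim: V_mono)
  then obtain n fa fb fc where F: "form n fa" "D.E fa = a" "form n fb" "D.E fb = b" "form n fc" "D.E fc = c'"
    unfolding V_def by blast
  have Fc: "fa \<in> carrier S" "fb \<in> carrier S" "fc \<in> carrier S" using F by auto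
  define r where "r = fa \<otimes>\<^bsub>S\<^esub> var 2 \<oplus>\<^bsub>S\<^esub> fb \<otimes>\<^bsub>S\<^esub> var 3 \<oplus>\<^bsub>S\<^esub> fc \<otimes>\<^bsub>S\<^esub> var 4"
  have r: "form (n + 1) r" unfolding r_def using F by (intro form_add form_mult form_var) auto
  have rQ: "r \<in> Q" unfolding r_def
    using v var_2_in_Q Fc by (intro Q.a_closed Q.I_l_closed) auto
  have rc: "r \<in> carrier S" using r by blast
  have rE: "D.E r = ?h" unfolding r_def abc(4)
    using Fc F by (simp add: D.E_add D.E_mult E_var_simps)
  have "f \<otimes>\<^bsub>S\<^esub> x0p (e + (n + 1)) \<in> Q"
  proof (rule in_Q_by_E)
    show "form (d + (e + (n + 1))) (f \<otimes>\<^bsub>S\<^esub> x0p (e + (n + 1)))" using f x0p by (intro form_mult)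
    have 1: "form (e + (d + (n + 1))) (g \<otimes>\<^bsub>S\<^esub> x0p (d + (n + 1)))" using g x0p by (intro form_mult)
    have 2: "form ((n + 1) + (d + e)) (r \<otimes>\<^bsub>S\<^esub> x0p (d + e))" using r x0p by (intro form_mult)
    show "form (d + (e + (n + 1))) (g \<otimes>\<^bsub>S\<^esub> x0p (d + (n + 1)) \<oplus>\<^bsub>S\<^esub> r \<otimes>\<^bsub>S\<^esub> x0p (d + e))"
      using form_add[of "d + (e + (n + 1))"] 1 2 by (simp add: add_ac)
    show "D.E (f \<otimes>\<^bsub>S\<^esub> x0p (e + (n + 1))) = D.E (g \<otimes>\<^bsub>S\<^esub> x0p (d + (n + 1)) \<oplus>\<^bsub>S\<^esub> r \<otimes>\<^bsub>S\<^esub> x0p (d + e))"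
      using c rc x0p(2,3) by (simp add: D.E_add D.E_mult rE E_var_simps)
    show "g \<otimes>\<^bsub>S\<^esub> x0p (d + (n + 1)) \<oplus>\<^bsub>S\<^esub> r \<otimes>\<^bsub>S\<^esub> x0p (d + e) \<in> Q"
      using g rQ x0p(2) by (intro Q.a_closed Q.I_r_closed)
  qed
  moreover have "x0p (e + (n + 1)) \<notin> Q" using v by (intro pow_notin_Q) auto
  ultimately show ?thesis using mult_notin_Q[OF c(1) x0p(2)] by blast
qed

lemma lift_form: "\<exists>n f. form n f \<and> D.E f = lift_u p"
  using R0_lift_u[of p] unfolding R0_def V_def by blast

text \<open>The linear form that cuts out the point with parameter \<open>c\<close> on the double curve.\<close>

definition lin :: "'k \<Rightarrow> nat multiset \<Rightarrow> 'a" where "lin c = var 1 \<ominus>\<^bsub>S\<^esub> const c \<otimes>\<^bsub>S\<^esub> var 0"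

lemma lin: "form 1 (lin c)" "lin c \<in> carrier S" "D.E (lin c) = xx\<^sup>2 + yy - cc c"
proof -
  have "form (0 + 1) (const c \<otimes>\<^bsub>S\<^esub> var 0)" by (intro form_mult form_const form_var) simp
  then have "form 1 (const c \<otimes>\<^bsub>S\<^esub> var 0)" by simp
  moreover have "form 1 (var 1)" by (rule form_var) simp
  ultimately show 1: "form 1 (lin c)" unfolding lin_def S.minus_eq by (intro form_add form_minus)
  show "lin c \<in> carrier S" using 1 by blast
  have "const c \<in> carrier S" using form_const by blast
  then show "D.E (lin c) = xx\<^sup>2 + yy - cc c"
    unfolding lin_def by (simp add: D.E_diff D.E_mult D.E_const E_var_simps)
qed

lemma at_x0_u: "at_x0 (xx\<^sup>2 + yy - cc c) = [:- c, 1:]" for c :: 'k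
  by (simp add: power2_eq_square)

lemma const_multiple_notin_Q:
  assumes v: "var 0 \<notin> Q" "var 3 \<in> Q" "var 4 \<in> Q" and f: "form d f" "at_x0 (D.E f) = [:a:]" and a: "a \<noteq> 0"
  shows "f \<notin> Q"
proof
  assume "f \<in> Q"
  have ca: "const a \<in> carrier S" "const (inverse a) \<in> carrier S" using form_const by blast+
  have "const a \<in> Q"
    by (rule curve_congruence[OF v form_const f(1) \<open>f \<in> Q\<close>]) (simp add: D.E_const f(2))
  then have "const (inverse a) \<otimes>\<^bsub>S\<^esub> const a \<in> Q" using ca by (intro Q.I_l_closed)
  then have "\<one>\<^bsub>S\<^esub> \<in> Q"
    using a ca by (intro in_Q_by_E[of 0 "\<one>\<^bsub>S\<^esub>" "const (inverse a) \<otimes>\<^bsub>S\<^esub> const a"])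
      (auto simp: D.E_one D.E_mult D.E_const cc_mult[symmetric] cc_one form_mult[of 0 _ 0, simplified])
  then show False using one_notin_Q by blast
qed

lemma lin_factor:
  assumes v: "var 0 \<notin> Q" "var 3 \<in> Q" "var 4 \<in> Q" and f: "form d f" "at_x0 (D.E f) = [:- c, 1:] * p"
    and h: "form e h" "at_x0 (D.E h) = p"
  shows "f \<in> Q \<longleftrightarrow> lin c \<in> Q \<or> h \<in> Q"
proof -
  have hc: "h \<in> carrier S" using h by auto
  have lh: "form (1 + e) (lin c \<otimes>\<^bsub>S\<^esub> h)" using lin(1) h(1) by (rule form_mult)
  have eq: "at_x0 (D.E f) = at_x0 (D.E (lin c \<otimes>\<^bsub>S\<^esub> h))"
    using lin(2,3) hc by (simp only: f(2) h(2) D.E_mult at_x0_simps(4) lin(3) at_x0_u)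
  have "f \<in> Q \<longleftrightarrow> lin c \<otimes>\<^bsub>S\<^esub> h \<in> Q"
    using curve_congruence[OF v f(1) lh _ eq] curve_congruence[OF v lh f(1) _ eq[symmetric]] by blast
  also have "\<dots> \<longleftrightarrow> lin c \<in> Q \<or> h \<in> Q"
    by (rule mult_in_Q_iff[OF lin(2) hc])
  finally show ?thesis .
qed

text \<open>A form in \<open>Q\<close> restricts to a polynomial in one variable that splits into linear factors, and \<open>Q\<close> is
prime.\<close>

lemma lin_in_Q_exists:
  assumes v: "var 0 \<notin> Q" "var 3 \<in> Q" "var 4 \<in> Q"
    and f: "form d f" "f \<in> Q" "at_x0 (D.E f) \<noteq> 0"
  shows "\<exists>c. lin c \<in> Q"
  using f
proof (induction "Polynomial.degree (at_x0 (D.E f))" arbitrary: d f rule: less_induct)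
  case less
  let ?p = "at_x0 (D.E f)"
  show ?case
  proof (cases "Polynomial.degree ?p = 0")
    case True
    then obtain a where a: "?p = [:a:]" by (rule degree_eq_zeroE)
    then show ?thesis using const_multiple_notin_Q[OF v less.prems(1) a] less.prems by auto
  next
    case False
    then obtain c where "poly ?p c = 0" using alg_closed_imp_poly_has_root[of ?p] by auto
    then obtain p where p: "?p = [:- c, 1:] * p" using poly_eq_0_iff_dvd by (metis dvdE)
    obtain e h where h: "form e h" "D.E h = lift_u p" using lift_form by blast
    have hp: "at_x0 (D.E h) = p" using h by (simp add: at_x0_lift_u)
    have p0: "p \<noteq> 0" using p less.prems(3) by auto
    have "lin c \<in> Q \<or> h \<in> Q" using lin_factor[OF v less.prems(1) p h(1) hp] less.prems(2) by blast
    moreover have "Polynomial.degree p < Polynomial.degree ?p"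
      unfolding p using p0 by (subst degree_mult_eq) auto
    ultimately show ?thesis using less.hyps[of h e] h hp p0 by auto
  qed
qed

lemma in_Q_iff_root:
  assumes v: "var 0 \<notin> Q" "var 3 \<in> Q" "var 4 \<in> Q" and l: "lin c \<in> Q" and f: "form d f"
  shows "f \<in> Q \<longleftrightarrow> poly (at_x0 (D.E f)) c = 0"
proof
  have fc: "f \<in> carrier S" using f by blast
  assume fQ: "f \<in> Q"
  define a where "a = poly (at_x0 (D.E f)) c"
  show "poly (at_x0 (D.E f)) c = 0"
  proof (rule ccontr)
    assume a0: "poly (at_x0 (D.E f)) c \<noteq> 0"
    define g where "g = f \<ominus>\<^bsub>S\<^esub> const a \<otimes>\<^bsub>S\<^esub> x0p d"
    have ca: "form (0 + d) (const a \<otimes>\<^bsub>S\<^esub> x0p d)" by (intro form_mult form_const x0p)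
    have cac: "const a \<otimes>\<^bsub>S\<^esub> x0p d \<in> carrier S" "const a \<in> carrier S" using ca form_const by blast+
    have g: "form d g" unfolding g_def S.minus_eq using f ca by (intro form_add form_minus) auto
    have Ec: "D.E (const a \<otimes>\<^bsub>S\<^esub> x0p d) = cc a" using cac x0p by (simp add: D.E_mult D.E_const)
    have Eg: "D.E g = D.E f - cc a" unfolding g_def using fc cac Ec by (simp add: D.E_diff)
    have "poly (at_x0 (D.E g)) c = 0" by (simp add: Eg a_def)
    then obtain p where p: "at_x0 (D.E g) = [:- c, 1:] * p" using poly_eq_0_iff_dvd by (metis dvdE)
    obtain e h where h: "form e h" "D.E h = lift_u p" using lift_form by blast
    have "g \<in> Q" using lin_factor[OF v g p h(1)] h l by (simp add: at_x0_lift_u)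
    then have "f \<ominus>\<^bsub>S\<^esub> g \<in> Q" using fQ Q.a_inv_closed Q.a_closed unfolding S.minus_eq by blast
    moreover have "form d (f \<ominus>\<^bsub>S\<^esub> g)" unfolding S.minus_eq using f g by (intro form_add form_minus)
    moreover have "at_x0 (D.E (f \<ominus>\<^bsub>S\<^esub> g)) = [:a:]"
      using fc form_closed[OF g] by (simp add: D.E_diff Eg)
    ultimately show False using const_multiple_notin_Q[OF v] a0 by (auto simp: a_def)
  qed
next
  assume "poly (at_x0 (D.E f)) c = 0"
  then obtain p where p: "at_x0 (D.E f) = [:- c, 1:] * p" using poly_eq_0_iff_dvd by (metis dvdE)
  obtain e h where h: "form e h" "D.E h = lift_u p" using lift_form by blast
  show "f \<in> Q" using lin_factor[OF v f p h(1)] h l by (simp add: at_x0_lift_u)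
qed

end

lemma diff_eq_add_char2: "(2::'r) = 0 \<Longrightarrow> a - b = a + b" for a b :: "'r::comm_ring_1"
proof -
  assume "(2::'r) = 0"
  then have "2 * b = 0" by simp
  then have "b + b = 0" by (simp only: mult_2)
  then show ?thesis by (metis add_diff_cancel_right' add.assoc add_0_right)
qed

lemma dvd_cancel_linear_power:
  fixes a P :: "'k::idom poly"
  assumes a: "poly a c \<noteq> 0" and dvd: "[:- c, 1:] ^ m dvd a * P"
  shows "[:- c, 1:] ^ m dvd P"
proof (cases "P = 0")
  case False
  have "a \<noteq> 0" using a by auto
  then have "m \<le> Polynomial.order c (a * P)" using dvd False by (subst (asm) order_divides) simp
  also have "\<dots> = Polynomial.order c P"
    using False \<open>a \<noteq> 0\<close> a by (subst order_mult) (auto simp: order_0I)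
  finally show ?thesis using order_divides by blast
qed simp

text \<open>A point of the double curve in the chart \<open>X\<^sub>0 \<noteq> 0\<close>. The polynomials that \<open>good\<close> selects are those
that are units of the curve at the point.\<close>

locale curve_point = surface_point K dec Q
  for K :: "('a, 'c) ring_scheme" and dec :: "'a \<Rightarrow> 'k::alg_closed_field" and Q +
  fixes good :: "'k poly \<Rightarrow> bool"
  assumes v: "var 0 \<notin> Q" "var 3 \<in> Q" "var 4 \<in> Q"
    and good_iff: "form d f \<Longrightarrow> f \<notin> Q \<longleftrightarrow> good (at_x0 (D.E f))"
begin

lemma good_zero: "\<not> good 0"
  using good_iff[OF form_zero[of 0]] by (simp add: D.E_zero)

lemma good_mult: "good (p * p') \<longleftrightarrow> good p \<and> good p'"
proof -
  obtain n f m g where f: "form n f" "D.E f = lift_u p" and g: "form m g" "D.E g = lift_u p'"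
    using lift_form by metis
  have c: "f \<in> carrier S" "g \<in> carrier S" using f g by auto
  have "good (at_x0 (D.E (f \<otimes>\<^bsub>S\<^esub> g))) \<longleftrightarrow> f \<notin> Q \<and> g \<notin> Q"
    using good_iff[OF form_mult[OF f(1) g(1)]] mult_in_Q_iff[OF c] by blast
  then show ?thesis
    using good_iff[OF f(1)] good_iff[OF g(1)] c by (simp add: D.E_mult f g at_x0_lift_u)
qed

lemma R0_power: "R0 F \<Longrightarrow> R0 (F ^ n)"
  by (induction n) (auto intro: R0_one R0_mult)

lemma good_nonzero:
  assumes "good (at_x0 G)"
  shows "G \<noteq> 0" "at_x0 G \<noteq> 0" "at_x0_sq G \<noteq> 0"
proof -
  show 1: "at_x0 G \<noteq> 0" using assms good_zero by metis
  then show "G \<noteq> 0" by auto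
  show "at_x0_sq G \<noteq> 0" unfolding at_x0_sq_def using 1 by (auto dest: pcompose_eq_0)
qed

lemma iota_image_curve: "iota ` carrier T = {Fract F G | F G. R0 F \<and> R0 G \<and> good (at_x0 G)}"
proof (intro equalityI subsetI)
  fix z assume "z \<in> iota ` carrier T"
  then obtain f g d where f: "form d f" "form d g" "g \<notin> Q" "z = Fract (D.E f) (D.E g)"
    unfolding iota_image by blast
  then show "z \<in> {Fract F G | F G. R0 F \<and> R0 G \<and> good (at_x0 G)}"
    using good_iff[OF f(2)] V_E R0_V by blast
next
  fix z assume "z \<in> {Fract F G | F G. R0 F \<and> R0 G \<and> good (at_x0 G)}"
  then obtain F G where z: "R0 F" "R0 G" "good (at_x0 G)" "z = Fract F G" by blast
  obtain i j where "V i F" "V j G" using z unfolding R0_def by blast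
  then have "V (i + j) F" "V (i + j) G" by (auto elim: V_mono)
  then obtain f g where "form (i + j) f" "D.E f = F" "form (i + j) g" "D.E g = G" unfolding V_def by blast
  then show "z \<in> iota ` carrier T" unfolding iota_image using good_iff z by blast
qed

lemma FractI: "R0 F \<Longrightarrow> R0 G \<Longrightarrow> good (at_x0 G) \<Longrightarrow> Fract F G \<in> iota ` carrier T"
  unfolding iota_image_curve by blast

text \<open>The localization of \<open>k[x, y]\<close> at the units of the stalk, which is its normalization.\<close>

definition N1 where "N1 = {Fract F G | F G. R0 G \<and> good (at_x0 G)}"

lemma N1_I: "R0 G \<Longrightarrow> good (at_x0 G) \<Longrightarrow> Fract F G \<in> N1" unfolding N1_def by blast

lemma N1_closed: 
  assumes s: "s \<in> N1" "t \<in> N1"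
  shows "s - t \<in> N1" "s * t \<in> N1"
proof -
  obtain F G F' G' where *: "s = Fract F G" "R0 G" "good (at_x0 G)" "t = Fract F' G'" "R0 G'" "good (at_x0 G')"
    using s unfolding N1_def by blast
  have G: "R0 (G * G')" "good (at_x0 (G * G'))" using * by (auto simp: R0_mult good_mult)
  have "s - t = Fract (F * G' - F' * G) (G * G')"
    using good_nonzero(1)[OF *(3)] good_nonzero(1)[OF *(6)] by (simp add: * mult.commute)
  then show "s - t \<in> N1" using N1_I[OF G] by simp
  have "s * t = Fract (F * F') (G * G')" by (simp add: *)
  then show "s * t \<in> N1" using N1_I[OF G] by simp
qed

lemma N1_split: "s \<in> N1 \<Longrightarrow> \<sigma>L s \<in> N1"
  unfolding N1_def using \<sigma>L_Fract good_nonzero(1) by blast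

lemma image_sub_N1: "iota ` carrier T \<subseteq> N1"
  unfolding iota_image_curve N1_def by blast

lemma delta_square: "delta (F\<^sup>2) = (delta F)\<^sup>2" for F :: "'k poly poly"
proof -
  note d = diff_eq_add_char2[OF two_poly[OF two]]
  have "delta (F\<^sup>2) = (at_y0 F)\<^sup>2 + (at_x0_sq F)\<^sup>2" by (simp add: delta_def d)
  also have "\<dots> = (delta F)\<^sup>2" by (simp add: delta_def d square_add_char2[OF two_poly[OF two]])
  finally show ?thesis .
qed

lemma image_iff:
  assumes G: "R0 G" "good (at_x0 G)"
  shows "Fract F G \<in> iota ` carrier T \<longleftrightarrow> R0 F"
proof
  assume "Fract F G \<in> iota ` carrier T"
  then obtain F' G' where *: "Fract F G = Fract F' G'" "R0 F'" "R0 G'" "good (at_x0 G')"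
    unfolding iota_image_curve by blast
  have "G' * F = F' * G"
    using *(1) good_nonzero(1)[OF G(2)] good_nonzero(1)[OF *(4)] by (simp add: eq_fract mult.commute)
  then have "delta (G' * F) = 0" using delta_R0[OF R0_mult[OF *(2) G(1)]] by simp
  then have "at_y0 G' * delta F = 0" using delta_mult_left[OF delta_R0[OF *(3)]] by simp
  then show "R0 F" using at_y0_R0[OF *(3)] good_nonzero(3)[OF *(4)] by (simp add: R0_iff_delta)
qed (use FractI G in blast)

text \<open>The defect of a square is the square of the defect.\<close>

lemma N1_weakly_normal:
  assumes s: "s \<in> N1" "s\<^sup>2 \<in> iota ` carrier T"
  shows "s \<in> iota ` carrier T"
proof -
  obtain F G where *: "s = Fract F G" "R0 G" "good (at_x0 G)" using s unfolding N1_def by blast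
  have G2: "R0 (G * G)" "good (at_x0 (G * G))" using * by (auto simp: R0_mult good_mult)
  have "Fract (F\<^sup>2) (G * G) \<in> iota ` carrier T"
    using s(2) by (simp add: * power2_eq_square)
  then have "delta (F\<^sup>2) = 0" using image_iff[OF G2] R0_iff_delta by blast
  then have "R0 F" by (simp add: delta_square R0_iff_delta)
  then show ?thesis unfolding *(1) using * by (intro FractI)
qed

lemma N1_conductor: "s \<in> N1 \<Longrightarrow> Fract (xx * yy * F) 1 * s \<in> iota ` carrier T"
proof -
  assume "s \<in> N1"
  then obtain H G where *: "s = Fract H G" "R0 G" "good (at_x0 G)" unfolding N1_def by blast
  have "Fract (xx * yy * F) 1 * s = Fract (xx * yy * (F * H)) G" by (simp add: * mult_ac)
  then show ?thesis using FractI[OF R0_xy] * by metis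
qed

definition pt where "pt i = q (var i) (var 0)"

lemma pt: "i \<le> 4 \<Longrightarrow> pt i \<in> carrier T" "i \<le> 4 \<Longrightarrow> iota (pt i) = Fract (gens i) 1"
  using q_closed[OF form_var form_var[of 0] v(1), of i] iota_q[OF form_var form_var[of 0] v(1), of i]
  by (simp_all add: pt_def D.E_var)

lemma pt_in_M: "pt 2 \<in> M" "pt 3 \<in> M" "pt 4 \<in> M"
  using v var_2_in_Q by (auto simp: pt_def q_in_M_iff[OF form_var form_var[of 0] v(1)])

lemma pt_conductor: "i \<in> {2, 3, 4} \<Longrightarrow> s \<in> N1 \<Longrightarrow> iota (pt i) * s \<in> iota ` carrier T"
  using N1_conductor[of s 1] N1_conductor[of s xx] N1_conductor[of s yy] pt(2)[of i]
  by (auto simp: power2_eq_square mult_ac)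

lemma pt_nonzero: "pt 2 \<noteq> \<zero>\<^bsub>T\<^esub>" "pt 3 \<noteq> \<zero>\<^bsub>T\<^esub>" "pt 4 \<noteq> \<zero>\<^bsub>T\<^esub>"
  using pt(2)[of 2] pt(2)[of 3] pt(2)[of 4] emb.\<iota>_zero
  by (auto simp: Zero_fract_def eq_fract xy_nonzero)

lemma Idl_image:
  assumes xs: "set xs \<subseteq> carrier T"
  shows "a \<in> iota ` (Idl\<^bsub>T\<^esub> (set xs)) \<Longrightarrow> b \<in> iota ` (Idl\<^bsub>T\<^esub> (set xs)) \<Longrightarrow> a + b \<in> iota ` (Idl\<^bsub>T\<^esub> (set xs))"
    and "x \<in> set xs \<Longrightarrow> t \<in> iota ` carrier T \<Longrightarrow> t * iota x \<in> iota ` (Idl\<^bsub>T\<^esub> (set xs))"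
proof -
  interpret Id: ideal "Idl\<^bsub>T\<^esub> (set xs)" T by (rule T.genideal_ideal[OF xs])
  {
    assume "a \<in> iota ` (Idl\<^bsub>T\<^esub> (set xs))" "b \<in> iota ` (Idl\<^bsub>T\<^esub> (set xs))"
    then obtain y z where "y \<in> Idl\<^bsub>T\<^esub> (set xs)" "z \<in> Idl\<^bsub>T\<^esub> (set xs)" "a = iota y" "b = iota z" by blast
    then show "a + b \<in> iota ` (Idl\<^bsub>T\<^esub> (set xs))"
      using emb.\<iota>_add Id.Icarr Id.a_closed by (intro image_eqI[of _ _ "y \<oplus>\<^bsub>T\<^esub> z"]) auto
  }
  assume x: "x \<in> set xs" and "t \<in> iota ` carrier T"
  then obtain y where y: "y \<in> carrier T" "t = iota y" by blast
  have "x \<in> Idl\<^bsub>T\<^esub> (set xs)" using T.genideal_self[OF xs] x by blast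
  then show "t * iota x \<in> iota ` (Idl\<^bsub>T\<^esub> (set xs))"
    using emb.\<iota>_mult[of y x] y Id.I_l_closed[of x y] x xs by (intro image_eqI[of _ _ "y \<otimes>\<^bsub>T\<^esub> x"]) auto
qed

text \<open>The conductor generates the ideal of the curve, so only local parameters of the curve are left to be
provided.\<close>

lemma Idl_eq_M:
  assumes xs: "set xs \<subseteq> M" "pt 2 \<in> set xs" "pt 3 \<in> set xs" "pt 4 \<in> set xs"
    and lift: "\<And>p G. \<not> good p \<Longrightarrow> R0 G \<Longrightarrow> good (at_x0 G) \<Longrightarrow> Fract (lift_u p) G \<in> iota ` (Idl\<^bsub>T\<^esub> (set xs))"
  shows "Idl\<^bsub>T\<^esub> (set xs) = M"
proof
  have xsT: "set xs \<subseteq> carrier T" using xs(1) ideal.Icarr[OF M_ideal] by blast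
  show "Idl\<^bsub>T\<^esub> (set xs) \<subseteq> M" by (rule T.genideal_minimal[OF M_ideal xs(1)])
  show "M \<subseteq> Idl\<^bsub>T\<^esub> (set xs)"
  proof
    fix x assume "x \<in> M"
    then obtain f g d where f: "form d f" "form d g" "g \<notin> Q" "f \<in> Q" "x = q f g" unfolding M_def by blast
    let ?F = "D.E f" and ?G = "D.E g"
    have G: "R0 ?G" "good (at_x0 ?G)" using good_iff[OF f(2)] f V_E R0_V by blast+
    have F: "R0 ?F" "\<not> good (at_x0 ?F)" using good_iff[OF f(1)] f V_E R0_V by blast+
    obtain a b c where abc: "R0 a" "R0 b" "R0 c"
      "?F - lift_u (at_x0 ?F) = a * (xx * yy) + b * (xx\<^sup>2 * yy) + c * (xx * yy\<^sup>2)"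
      using delta_zero_decomposition(1)[OF delta_R0[OF F(1)]] unfolding J_def by blast
    have nz: "?G \<noteq> 0" by (rule good_nonzero(1)[OF G(2)])
    have "Fract ?F ?G = Fract (lift_u (at_x0 ?F)) ?G + Fract a ?G * iota (pt 2)
        + Fract b ?G * iota (pt 3) + Fract c ?G * iota (pt 4)"
    proof -
      have F_eq: "?F = lift_u (at_x0 ?F) + a * (xx * yy) + b * (xx\<^sup>2 * yy) + c * (xx * yy\<^sup>2)"
        using abc(4) by (simp add: algebra_simps)
      have add: "Fract (u + w) ?G = Fract u ?G + Fract w ?G" for u w
        using nz by (simp add: eq_fract algebra_simps)
      show ?thesis by (subst F_eq) (simp add: add pt(2))
    qed
    also have "\<dots> \<in> iota ` (Idl\<^bsub>T\<^esub> (set xs))"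
      by (intro Idl_image[OF xsT] lift F(2) G xs FractI abc)
    finally have "iota x \<in> iota ` (Idl\<^bsub>T\<^esub> (set xs))" unfolding f(5) iota_q[OF f(1-3)] .
    then obtain x' where "x' \<in> Idl\<^bsub>T\<^esub> (set xs)" "iota x = iota x'" by blast
    moreover from this have "x' \<in> carrier T" using ideal.Icarr[OF T.genideal_ideal[OF xsT]] by blast
    moreover have "x \<in> carrier T" using f by auto
    ultimately show "x \<in> Idl\<^bsub>T\<^esub> (set xs)" using inj_onD[OF emb.\<iota>_inj] by metis
  qed
qed

lemma F_injectiveI:
  assumes xs: "set xs \<subseteq> M" "\<zero>\<^bsub>T\<^esub> \<notin> set xs" "Idl\<^bsub>T\<^esub> (set xs) = M"
    and conductor: "\<And>j. 0 < j \<Longrightarrow> j < length xs \<Longrightarrow> xs ! j \<in> {pt 2, pt 3, pt 4}"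
    and defect: "\<And>z g. xs \<noteq> [] \<Longrightarrow> z \<in> emb.loc_at xs N1 {0} \<Longrightarrow> (\<And>j. j < length xs \<Longrightarrow> g \<in> emb.loc_at xs N1 {j}) \<Longrightarrow>
        z\<^sup>2 - g \<in> emb.loc_at xs (iota ` carrier T) {0} \<Longrightarrow>
        \<exists>g'\<in>N1. z - g' \<in> emb.loc_at xs (iota ` carrier T) {0}"
  shows "F_injective_at 2 K 4 I Q"
proof -
  have xsT: "set xs \<subseteq> carrier T" using xs(1) ideal.Icarr[OF M_ideal] by blast
  have cond: "iota (xs ! j) * s \<in> iota ` carrier T" if "0 < j" "j < length xs" "s \<in> N1" for j s
    using conductor[OF that(1,2)] pt_conductor[OF _ that(3)] by auto
  have "inj_on (local_cohomology_map T xs (frobenius_pushforward 2 T) (\<lambda>x. x [^]\<^bsub>T\<^esub> (2::nat)) i)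
      (carrier (local_cohomology T xs (self_module T) i))" for i
    by (rule emb.cohomology_map_injective[OF xsT xs(2) image_sub_N1 N1_closed \<sigma>L_additive \<sigma>L_linear \<sigma>L_one
        N1_split N1_weakly_normal cond defect])
  then show ?thesis unfolding F_injective_at_iff using xsT xs(3) by blast
qed

text \<open>At the generic point of the double curve the conductor is the maximal ideal, so that localizing at any
of its generators already gives the normalization.\<close>

theorem F_injective_generic:
  assumes good: "\<And>p. good p \<longleftrightarrow> p \<noteq> 0"
  shows "F_injective_at 2 K 4 I Q"
proof (rule F_injectiveI)
  let ?xs = "[pt 2, pt 3, pt 4]"
  show 1: "set ?xs \<subseteq> M" using pt_in_M by simp
  have xsT: "set ?xs \<subseteq> carrier T" using 1 ideal.Icarr[OF M_ideal] by blast
  show "\<zero>\<^bsub>T\<^esub> \<notin> set ?xs" using pt_nonzero by auto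
  show "Idl\<^bsub>T\<^esub> (set ?xs) = M"
  proof (rule Idl_eq_M[OF 1])
    fix p G assume "\<not> good p" "R0 G" "good (at_x0 G)"
    then have "Fract (lift_u p) G = Fract 0 G * iota (pt 2)" "Fract 0 G \<in> iota ` carrier T"
      using good FractI[OF R0_zero] good_nonzero(1)[of G] by (auto simp: lift_u_0 pt(2) eq_fract)
    then show "Fract (lift_u p) G \<in> iota ` (Idl\<^bsub>T\<^esub> (set ?xs))"
      using Idl_image(2)[OF xsT, of "pt 2"] by simp
  qed auto
  show "?xs ! j \<in> {pt 2, pt 3, pt 4}" if "0 < j" "j < length ?xs" for j
    using nth_mem[OF that(2)] by auto
  have loc: "emb.loc_at ?xs B {0} = {s / iota (pt 2) ^ n | s n. s \<in> B}" for B
    using loc_at_single[of ?xs 0 B] pt(1)[of 2] by simp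
  fix z g assume "z \<in> emb.loc_at ?xs N1 {0}"
  then obtain s n where s: "s \<in> N1" "z = s / iota (pt 2) ^ n" unfolding loc by blast
  have nz: "iota (pt 2) \<noteq> 0" using pt_nonzero(1) emb.\<iota>_eq_0_iff pt(1)[of 2] by simp
  have "z = (iota (pt 2) * s) / iota (pt 2) ^ Suc n" using nz by (simp add: s)
  then have "z \<in> emb.loc_at ?xs (iota ` carrier T) {0}"
    unfolding loc using pt_conductor[OF _ s(1), of 2] by blast
  moreover have "iota \<zero>\<^bsub>T\<^esub> \<in> N1" using image_sub_N1 T.zero_closed by blast
  then have "0 \<in> N1" by (simp add: emb.\<iota>_zero)
  ultimately show "\<exists>g'\<in>N1. z - g' \<in> emb.loc_at ?xs (iota ` carrier T) {0}"
    by (intro bexI[of _ 0]) simp_all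
qed

end

lemma Fract_eqD: "Fract a b = Fract c d \<Longrightarrow> b \<noteq> 0 \<Longrightarrow> d \<noteq> 0 \<Longrightarrow> a * d = c * b"
  by (simp add: eq_fract)

lemma Fract_eqI: "a * d = c * b \<Longrightarrow> b \<noteq> 0 \<Longrightarrow> d \<noteq> 0 \<Longrightarrow> Fract a b = Fract c d"
  by (simp add: eq_fract)

context curve_point
begin

lemma square_root_dvd:
  fixes P :: "'k poly"
  assumes "([:- a, 1:] ^ m)\<^sup>2 dvd P\<^sup>2"
  shows "[:- a, 1:] ^ m dvd P"
proof (cases "P = 0")
  case False
  have "[:- a, 1:] ^ (2 * m) dvd P * P" using assms by (simp add: power_mult[symmetric] power2_eq_square[of P] mult.commute)
  then have "2 * m \<le> Polynomial.order a (P * P)" using False by (subst (asm) order_divides) simp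
  also have "\<dots> = 2 * Polynomial.order a P" using False by (subst order_mult) simp_all
  finally show ?thesis using order_divides by auto
qed simp

text \<open>Let \<open>u\<close> be the local parameter \<open>x\<^sup>2 + y - c\<close> of the curve and \<open>\<theta> = (x - \<gamma>)\<^sup>2\<close> its restriction to
\<open>y = 0\<close>. If \<open>z = F/(G u\<^sup>n)\<close> and \<open>z\<^sup>2\<close> agrees modulo the stalk localized at \<open>u\<close> with some \<open>g\<close> without
poles, then comparison of defects shows that \<open>\<theta>\<close> to the power \<open>2 n\<close> divides \<open>(\<delta> F)\<^sup>2\<close> up to a unit, so
\<open>\<theta>\<^sup>n\<close> divides \<open>\<delta> F\<close>. The quotient vanishes at \<open>0\<close> because \<open>c \<noteq> 0\<close>, and is therefore the defect of a
polynomial, by which \<open>z\<close> can be corrected.\<close>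

theorem F_injective_closed:
  assumes good: "\<And>p. good p \<longleftrightarrow> poly p c \<noteq> 0" and c: "c \<noteq> 0"
  shows "F_injective_at 2 K 4 I Q"
proof -
  define u where "u = xx\<^sup>2 + yy - cc c"
  define \<gamma> where "\<gamma> = sqroot c"
  have \<gamma>: "\<gamma>\<^sup>2 = c" unfolding \<gamma>_def by (rule sqroot_sq)
  define \<theta> where "\<theta> = at_y0 u"
  have u0: "R0 u" unfolding u_def by (intro R0_diff R0_gens R0_cc)
  have ux: "at_x0 u = [:- c, 1:]" unfolding u_def by (rule at_x0_u)
  have minus_c: "- c = c" using two by (metis add.inverse_unique mult_2 mult_zero_left)
  have \<theta>_eq: "\<theta> = [:- \<gamma>, 1:]\<^sup>2"
  proof -
    have "\<theta> = [:0, 1:]\<^sup>2 + [:- \<gamma>:]\<^sup>2"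
      by (simp add: \<theta>_def u_def power2_eq_square[of "[:- \<gamma>:]"] \<gamma>[symmetric] minus_c[unfolded \<gamma>[symmetric]])
         (simp add: power2_eq_square)
    also have "\<dots> = ([:0, 1:] + [:- \<gamma>:])\<^sup>2" by (rule square_add_char2[OF two_poly[OF two], symmetric])
    finally show ?thesis by simp
  qed
  have \<theta>0: "\<theta> \<noteq> 0" "poly \<theta> 0 \<noteq> 0" using c \<gamma> by (auto simp: \<theta>_eq)
  have u_nz: "u \<noteq> 0" using ux by auto
  have linQ: "lin c \<in> Q" using good_iff[OF lin(1)] good by (simp add: lin(3) power2_eq_square)
  define w where "w = q (lin c) (var 0)"
  have w: "w \<in> M" "w \<in> carrier T" "iota w = Fract u 1"
    using linQ q_in_M_iff[OF lin(1) form_var[of 0] v(1), of c] q_closed[OF lin(1) form_var[of 0] v(1), of c]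
      iota_q[OF lin(1) form_var[of 0] v(1), of c]
    by (simp_all add: w_def lin(3) u_def E_var_simps)
  let ?xs = "[w, pt 2, pt 3, pt 4]"
  have upow: "iota w ^ n = Fract (u ^ n) 1" for n
    by (induction n) (simp_all add: w(3) One_fract_def)
  have ppow: "iota (pt 2) ^ n = Fract ((xx * yy) ^ n) 1" for n
    by (induction n) (simp_all add: pt(2) One_fract_def)
  have xyn: "(xx * yy) ^ n \<noteq> (0 :: 'k poly poly)" for n by (simp add: xy_nonzero)
  show ?thesis
  proof (rule F_injectiveI)
    show 1: "set ?xs \<subseteq> M" using pt_in_M w by simp
    have xsT: "set ?xs \<subseteq> carrier T" using 1 ideal.Icarr[OF M_ideal] by blast
    have "iota w \<noteq> 0" using w(3) u_nz by (simp add: Zero_fract_def eq_fract)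
    then have "w \<noteq> \<zero>\<^bsub>T\<^esub>" using emb.\<iota>_zero by auto
    then show "\<zero>\<^bsub>T\<^esub> \<notin> set ?xs" using pt_nonzero by auto
    show "Idl\<^bsub>T\<^esub> (set ?xs) = M"
    proof (rule Idl_eq_M[OF 1])
      fix p G assume p: "\<not> good p" and G: "R0 G" "good (at_x0 G)"
      then obtain p' where p': "p = [:- c, 1:] * p'" using good poly_eq_0_iff_dvd by (metis dvdE)
      have "Fract (lift_u p) G = Fract (lift_u p') G * iota w"
        unfolding p' lift_u_linear w(3) by (simp add: u_def mult.commute)
      then show "Fract (lift_u p) G \<in> iota ` (Idl\<^bsub>T\<^esub> (set ?xs))"
        using Idl_image(2)[OF xsT, of w] FractI[OF R0_lift_u G] by simp
    qed auto
    show "?xs ! j \<in> {pt 2, pt 3, pt 4}" if j: "0 < j" "j < length ?xs" for j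
    proof -
      have "?xs ! j = [pt 2, pt 3, pt 4] ! (j - 1)" using j by (simp add: nth_Cons')
      moreover have "[pt 2, pt 3, pt 4] ! (j - 1) \<in> set [pt 2, pt 3, pt 4]" using j by (intro nth_mem) auto
      ultimately show ?thesis by auto
    qed
    have loc0: "emb.loc_at ?xs B {0} = {s / iota w ^ n | s n. s \<in> B}" for B
      using loc_at_single[of ?xs 0 B] w(2) by simp
    have loc1: "emb.loc_at ?xs B {1} = {s / iota (pt 2) ^ n | s n. s \<in> B}" for B
      using loc_at_single[of ?xs 1 B] pt(1)[of 2] by simp
    fix z g assume z: "z \<in> emb.loc_at ?xs N1 {0}" and g: "\<And>j. j < length ?xs \<Longrightarrow> g \<in> emb.loc_at ?xs N1 {j}"
      and zg: "z\<^sup>2 - g \<in> emb.loc_at ?xs (iota ` carrier T) {0}"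
    obtain E1 G1 k1 where g1: "R0 G1" "good (at_x0 G1)" "g = Fract E1 G1 / iota w ^ k1"
      using g[of 0] unfolding loc0 N1_def by auto
    obtain E2 G2 k2 where g2: "R0 G2" "good (at_x0 G2)" "g = Fract E2 G2 / iota (pt 2) ^ k2"
      using g[of 1] unfolding loc1 N1_def by auto
    note nz1 = good_nonzero(1)[OF g1(2)] and nz2 = good_nonzero(1)[OF g2(2)]
    have "Fract E1 (G1 * u ^ k1) = Fract E2 (G2 * (xx * yy) ^ k2)"
      using g1(3) unfolding g2(3) upow ppow by simp
    then have e: "E1 * (G2 * (xx * yy) ^ k2) = E2 * (G1 * u ^ k1)"
      by (rule Fract_eqD) (use nz1 nz2 u_nz xyn[of k2] in auto)
    have "u ^ k1 * (E2 * G1) = (xx * yy) ^ k2 * (E1 * G2)"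
      using e by (simp only: mult_ac)
    then have "(xx * yy) ^ k2 dvd u ^ k1 * (E2 * G1)" by (rule dvdI)
    moreover have "at_x0 (u ^ k1) \<noteq> 0" "at_y0 (u ^ k1) \<noteq> 0" using ux \<theta>0(1) by (simp_all add: \<theta>_def)
    ultimately have "(xx * yy) ^ k2 dvd E2 * G1" using xy_dvd_cancel by blast
    then obtain E3 where E3: "E2 * G1 = (xx * yy) ^ k2 * E3" by (metis dvdE)
    define G3 where "G3 = G1 * G2"
    have G3: "R0 G3" "good (at_x0 G3)" unfolding G3_def using g1 g2 by (auto simp: R0_mult good_mult)
    note nz3 = good_nonzero(1)[OF G3(2)]
    have g3: "g = Fract E3 G3"
    proof -
      have "g = Fract E2 (G2 * (xx * yy) ^ k2)" unfolding g2(3) ppow by simp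
      moreover have "E2 * G3 = E3 * (G2 * (xx * yy) ^ k2)"
        unfolding G3_def using arg_cong[OF E3, of "\<lambda>t. t * G2"] by (simp only: mult_ac)
      moreover have "Fract E2 (G2 * (xx * yy) ^ k2) = Fract E3 G3"
        by (rule Fract_eqI[OF calculation(2)]) (use nz2 nz3 xyn[of k2] in auto)
      ultimately show ?thesis by simp
    qed
    obtain F G n where z1: "R0 G" "good (at_x0 G)" "z = Fract F G / iota w ^ n"
      using z unfolding loc0 N1_def by auto
    obtain H G4 k where h: "R0 H" "R0 G4" "good (at_x0 G4)" "z\<^sup>2 - g = Fract H G4 / iota w ^ k"
      using zg unfolding loc0 iota_image_curve by auto
    note nzG = good_nonzero(1)[OF z1(2)] and nz4 = good_nonzero(1)[OF h(3)]
    have key: "F\<^sup>2 * (G3 * G4 * u ^ k) - E3 * (G\<^sup>2 * G4 * u ^ (2 * n + k)) = H * (G\<^sup>2 * G3 * u ^ (2 * n))"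
    proof -
      have z: "z = Fract F (G * u ^ n)" unfolding z1(3) upow by simp
      have z2: "z\<^sup>2 = Fract (F * F) ((G * u ^ n) * (G * u ^ n))"
        unfolding z power2_eq_square by simp
      have "z\<^sup>2 = Fract H (G4 * u ^ k) + Fract E3 G3"
        using h(4) unfolding g3 upow by (simp add: diff_eq_eq)
      also have "\<dots> = Fract (H * G3 + E3 * (G4 * u ^ k)) ((G4 * u ^ k) * G3)"
        using nz3 nz4 u_nz by simp
      finally have "(F * F) * ((G4 * u ^ k) * G3) = (H * G3 + E3 * (G4 * u ^ k)) * ((G * u ^ n) * (G * u ^ n))"
        unfolding z2 by (rule Fract_eqD) (use nzG nz3 nz4 u_nz in auto)
      moreover have "u ^ (2 * n + k) = u ^ n * u ^ n * u ^ k" "u ^ (2 * n) = u ^ n * u ^ n"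
        by (simp_all add: power_add mult_2)
      ultimately show ?thesis by (simp only: power2_eq_square) (simp add: algebra_simps)
    qed
    define a b where "a = at_y0 (G3 * G4)" and "b = at_y0 (G\<^sup>2 * G4)"
    have R: "R0 (G3 * G4 * u ^ k)" "R0 (G\<^sup>2 * G4 * u ^ (2 * n + k))" "R0 (G\<^sup>2 * G3 * u ^ (2 * n))"
      by (intro R0_mult R0_power G3 h(2) z1(1) u0)+
    have "delta ((G3 * G4 * u ^ k) * F\<^sup>2 - (G\<^sup>2 * G4 * u ^ (2 * n + k)) * E3) = delta ((G\<^sup>2 * G3 * u ^ (2 * n)) * H)"
      using key by (simp only: mult.commute)
    also have "\<dots> = 0" by (rule delta_R0[OF R0_mult[OF R(3) h(1)]])
    finally have "at_y0 (G3 * G4 * u ^ k) * (delta F)\<^sup>2 = at_y0 (G\<^sup>2 * G4 * u ^ (2 * n + k)) * delta E3"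
      by (simp add: delta_mult_left[OF delta_R0[OF R(1)]] delta_mult_left[OF delta_R0[OF R(2)]] delta_square del: at_y0_simps)
    then have "\<theta> ^ k * (a * (delta F)\<^sup>2) = \<theta> ^ k * (b * \<theta> ^ (2 * n) * delta E3)"
      by (simp add: a_def b_def \<theta>_def power_add mult_ac)
    then have eq: "a * (delta F)\<^sup>2 = \<theta> ^ (2 * n) * (b * delta E3)" using \<theta>0(1) by (simp add: mult_ac)
    have a0: "poly a \<gamma> \<noteq> 0"
    proof -
      have "a = at_x0_sq (G3 * G4)" unfolding a_def using at_y0_R0[OF R0_mult[OF G3(1) h(2)]] .
      moreover have "good (at_x0 (G3 * G4))" using G3 h by (simp add: good_mult)
      ultimately show ?thesis using good \<gamma> by (simp add: poly_at_x0_sq)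
    qed
    have \<theta>_pow: "\<theta> ^ m = [:- \<gamma>, 1:] ^ (2 * m)" for m by (simp only: \<theta>_eq power_mult)
    have "\<theta> ^ (2 * n) dvd a * (delta F)\<^sup>2" unfolding eq by (rule dvd_triv_left)
    then have "\<theta> ^ (2 * n) dvd (delta F)\<^sup>2"
      unfolding \<theta>_pow by (rule dvd_cancel_linear_power[OF a0])
    moreover have "\<theta> ^ (2 * n) = ([:- \<gamma>, 1:] ^ (2 * n))\<^sup>2"
      unfolding \<theta>_pow by (simp only: power_mult[symmetric] mult.commute)
    ultimately have "[:- \<gamma>, 1:] ^ (2 * n) dvd delta F"
      by (intro square_root_dvd) (simp only:)
    then have "\<theta> ^ n dvd delta F" unfolding \<theta>_pow .
    then obtain b0 where b0: "delta F = \<theta> ^ n * b0" by (metis dvdE)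
    have b00: "poly b0 0 = 0" using delta_at_0[of F] \<theta>0(2) by (simp add: b0)
    \<comment> \<open>As a polynomial in \<open>y\<close> the correction is the constant \<open>b0\<close>; it vanishes on \<open>x = 0\<close>.\<close>
    define B where "B = [:b0:]"
    have dB: "delta B = b0"
    proof -
      have "at_x0 B = 0" using b00 by (intro poly_eqI) (simp add: coeff_at_x0 B_def coeff_pCons poly_0_coeff_0 split: nat.splits)
      then show ?thesis by (simp add: delta_def at_x0_sq_def) (simp add: at_y0_def B_def)
    qed
    have "delta (F - u ^ n * B) = 0"
      using delta_mult_left[OF delta_R0[OF R0_power[OF u0]]] by (simp add: dB b0 \<theta>_def)
    then have R: "R0 (F - u ^ n * B)" by (simp add: R0_iff_delta)
    have z': "z = Fract F (G * u ^ n)" unfolding z1(3) upow by simp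
    have "z - Fract B G = Fract (F * G - B * (G * u ^ n)) ((G * u ^ n) * G)"
      unfolding z' using nzG u_nz by simp
    also have "\<dots> = Fract (F - u ^ n * B) (G * u ^ n)"
      by (rule Fract_eqI) (use nzG u_nz in \<open>auto simp: algebra_simps\<close>)
    also have "\<dots> = Fract (F - u ^ n * B) G / iota w ^ n" unfolding upow by simp
    finally have "z - Fract B G = Fract (F - u ^ n * B) G / iota w ^ n" .
    then have "z - Fract B G \<in> emb.loc_at ?xs (iota ` carrier T) {0}"
      unfolding loc0 using FractI[OF R z1(1,2)] by blast
    then show "\<exists>g'\<in>N1. z - g' \<in> emb.loc_at ?xs (iota ` carrier T) {0}"
      using N1_I[OF z1(1,2)] by blast
  qed
qed

end

section \<open>The exceptional points\<close>

context field_coding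
begin

text \<open>A polynomial is the sum of its homogeneous components; partial sums over the degrees avoid finite sums
in the ring.\<close>

lemma homogeneous_ideal_subset:
  assumes A: "homogeneous_ideal K N A" and B: "homogeneous_ideal K N B"
    and forms: "\<And>d f. form d f \<Longrightarrow> f \<in> A \<Longrightarrow> f \<in> B"
  shows "A \<subseteq> B"
proof
  fix f assume fA: "f \<in> A"
  interpret A: ideal A S using A by (simp add: homogeneous_ideal_def)
  interpret B: ideal B S using B by (simp add: homogeneous_ideal_def)
  have f: "f \<in> carrier S" using fA by (rule A.Icarr)
  have fK: "f m \<in> carrier K" for m using f by (simp add: S_carrier)
  define tr where "tr n = (\<lambda>m. if size m < n then f m else \<zero>\<^bsub>K\<^esub>)" for n
  have "tr n \<in> B" for n
  proof (induction n)
    case 0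
    have "tr 0 = \<zero>\<^bsub>S\<^esub>" by (simp add: tr_def zero_S(2))
    then show ?case by (metis B.zero_closed)
  next
    case (Suc n)
    have h: "hcomp n f \<in> B"
      using A fA by (intro forms[OF hcomp_form[OF f]]) (simp add: homogeneous_ideal_def)
    have "tr (Suc n) = tr n \<oplus>\<^bsub>S\<^esub> hcomp n f"
      using fK by (auto simp: tr_def fun_eq_iff homogeneous_component_def mpoly_ring_def)
    then show ?case using B.a_closed[OF Suc.IH h] by (metis)
  qed
  moreover have "f = tr (Suc (Max (size ` keys (pm f))))"
  proof
    fix m
    show "f m = tr (Suc (Max (size ` keys (pm f)))) m"
    proof (cases "f m = \<zero>\<^bsub>K\<^esub>")
      case False
      then have "m \<in> keys (pm f)" using keys_pm[OF f] by simp
      then have "size m \<le> Max (size ` keys (pm f))" by (intro Max_ge) auto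
      then show ?thesis by (simp add: tr_def)
    qed (simp add: tr_def)
  qed
  ultimately show "f \<in> B" by metis
qed

lemma homogeneous_ideal_eqI:
  assumes "homogeneous_ideal K N A" "homogeneous_ideal K N B"
    and "\<And>d f. form d f \<Longrightarrow> f \<in> A \<longleftrightarrow> f \<in> B"
  shows "A = B"
  using assms by (intro equalityI homogeneous_ideal_subset) auto

end

context graded_stalk
begin

text \<open>Modulo the other variables a form of degree \<open>d\<close> is a multiple of the \<open>d\<close>-th power of the variable
\<open>j\<close>, which is not in \<open>Q\<close>.\<close>

lemma coordinate_point:
  assumes j: "j \<le> N" and v: "\<And>i. i \<le> N \<Longrightarrow> i \<noteq> j \<Longrightarrow> var i \<in> Q" and f: "form d f"
  shows "f \<in> Q \<longleftrightarrow> lookup (pm f) (replicate_mset d j) = 0"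
proof -
  define a where "a = lookup (pm f) (replicate_mset d j)"
  define t where "t = const a \<otimes>\<^bsub>S\<^esub> var j [^]\<^bsub>S\<^esub> d"
  have vj: "var j \<in> carrier S" using form_closed[OF form_var[OF j]] .
  have ca: "const c \<in> carrier S" for c using form_closed[OF form_const] .
  have t: "t \<in> carrier S" unfolding t_def using vj ca by simp
  have fc: "f \<in> carrier S" using f by (rule form_closed)
  have pmt: "pm t = Poly_Mapping.single (replicate_mset d j) a"
    using vj ca by (simp add: t_def pm_mult pm_pow pm_const pm_var[OF j] single_power mult_single)
  define g where "g = f \<oplus>\<^bsub>S\<^esub> \<ominus>\<^bsub>S\<^esub> t"
  have g: "g \<in> carrier S" unfolding g_def using fc t by simp
  have gQ: "g \<in> Q"
  proof (rule poly_induct[OF g, where P = "\<lambda>g. g \<in> Q"])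
    show "\<zero>\<^bsub>S\<^esub> \<in> Q" by (rule Q.zero_closed)
    show "f \<oplus>\<^bsub>S\<^esub> g \<in> Q" if "f \<in> Q" "g \<in> Q" for f g using that by (rule Q.a_closed)
    fix m and c :: 'k assume m: "m \<in> keys (pm g)"
    have pg: "lookup (pm g) n = lookup (pm f) n - (if n = replicate_mset d j then a else 0)" for n
      unfolding g_def using fc t
      by (simp add: pm_add pm_minus pmt lookup_add lookup_minus lookup_uminus lookup_single when_def eq_commute[of n])
    have "m \<noteq> replicate_mset d j" using m pg[of m] by (auto simp: in_keys_iff a_def)
    moreover have "m \<in> keys (pm f)" using m pg[of m] calculation by (simp add: in_keys_iff)
    then have sz: "size m = d" "set_mset m \<subseteq> {..N}" using f keys_pm_vars[OF fc] by (auto simp: form_iff)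
    ultimately have "\<not> set_mset m \<subseteq> {j}" using set_mset_subset_singletonD[of m j] by auto
    then obtain i where i: "i \<in># m" "i \<noteq> j" by blast
    have iN: "i \<le> N" using i(1) sz by auto
    let ?s = "mp (Poly_Mapping.single (m - {#i#}) c)"
    have sub: "set_mset (m - {#i#}) \<subseteq> {..N}" using sz(2) by (meson diff_subset_eq_self set_mset_mono subset_trans)
    have s: "?s \<in> carrier S" using form_closed[OF form_single[OF sub]] .
    have m': "mp (Poly_Mapping.single m c) \<in> carrier S" using form_closed[OF form_single[OF sz(2)]] .
    have vi: "var i \<in> carrier S" using form_closed[OF form_var[OF iN]] .
    have "mp (Poly_Mapping.single m c) = var i \<otimes>\<^bsub>S\<^esub> ?s"
    proof (rule pm_eqD[OF m'])
      show "var i \<otimes>\<^bsub>S\<^esub> ?s \<in> carrier S" using s vi by simp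
      have "pm (var i \<otimes>\<^bsub>S\<^esub> ?s) = Poly_Mapping.single {#i#} 1 * Poly_Mapping.single (m - {#i#}) c"
        using sub by (simp add: pm_mult[OF vi s] pm_var[OF iN] pm_mp)
      also have "\<dots> = Poly_Mapping.single m c" using i(1) by (simp add: mult_single)
      finally show "pm (mp (Poly_Mapping.single m c)) = pm (var i \<otimes>\<^bsub>S\<^esub> ?s)" using sz by (simp add: pm_mp)
    qed
    moreover have "var i \<otimes>\<^bsub>S\<^esub> ?s \<in> Q" by (rule Q.I_r_closed[OF v[OF iN i(2)] s])
    ultimately show "mp (Poly_Mapping.single m c) \<in> Q" by simp
  qed
  have f_eq: "f = g \<oplus>\<^bsub>S\<^esub> t" unfolding g_def using fc t by (simp add: S.a_assoc S.l_neg)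
  have "f \<in> Q \<longleftrightarrow> t \<in> Q"
  proof
    assume "t \<in> Q" then show "f \<in> Q" unfolding f_eq using gQ by (intro Q.a_closed)
  next
    assume "f \<in> Q"
    then have "f \<oplus>\<^bsub>S\<^esub> \<ominus>\<^bsub>S\<^esub> g \<in> Q" using gQ by (intro Q.a_closed Q.a_inv_closed)
    moreover have "f \<oplus>\<^bsub>S\<^esub> \<ominus>\<^bsub>S\<^esub> g = t"
    proof -
      have "f \<oplus>\<^bsub>S\<^esub> \<ominus>\<^bsub>S\<^esub> g = (t \<oplus>\<^bsub>S\<^esub> g) \<oplus>\<^bsub>S\<^esub> \<ominus>\<^bsub>S\<^esub> g"
        using f_eq S.a_comm[OF g t] by simp
      then show ?thesis using g t by (simp add: S.a_assoc S.r_neg)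
    qed
    ultimately show "t \<in> Q" by simp
  qed
  also have "\<dots> \<longleftrightarrow> a = 0"
  proof
    assume "a = 0"
    then show "t \<in> Q" using vj Q.zero_closed by (simp add: t_def const_zero)
  next
    assume tQ: "t \<in> Q"
    show "a = 0"
    proof (rule ccontr)
      assume a: "a \<noteq> 0"
      have cb: "const (inverse a) \<in> carrier S" by (rule ca)
      have "const (inverse a) \<otimes>\<^bsub>S\<^esub> t \<in> Q" by (rule Q.I_l_closed[OF tQ cb])
      moreover have "const (inverse a) \<otimes>\<^bsub>S\<^esub> t = var j [^]\<^bsub>S\<^esub> d"
      proof (rule pm_eqD)
        show "const (inverse a) \<otimes>\<^bsub>S\<^esub> t \<in> carrier S" using cb t by simp
        show "var j [^]\<^bsub>S\<^esub> d \<in> carrier S" using vj by simp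
        show "pm (const (inverse a) \<otimes>\<^bsub>S\<^esub> t) = pm (var j [^]\<^bsub>S\<^esub> d)"
          using vj a by (simp add: pm_mult[OF cb t] pmt pm_const mult_single pm_pow pm_var[OF j] single_power)
      qed
      ultimately have "var j \<in> Q" using pow_notin_Q[OF vj, of d] by auto
      moreover obtain i where i: "i \<le> N" "var i \<notin> Q" using var_notin_Q by blast
      ultimately show False using v by (cases "i = j") auto
    qed
  qed
  finally show ?thesis unfolding a_def .
qed

end

context surface
begin

lemma surface_pointI: "Q \<in> proj_points K 4 I \<Longrightarrow> surface_point K dec Q"
  by unfold_locales

text \<open>The two points that are not covered: the point at infinity of the double curve, and its point with
parameter \<open>0\<close>.\<close>

lemma point_cases:
  assumes Q: "Q \<in> proj_points K 4 I" and F: "\<not> F_injective_at 2 K 4 I Q"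
  shows "(\<forall>d f. form d f \<longrightarrow> (f \<in> Q \<longleftrightarrow> lookup (pm f) (replicate_mset d 1) = 0)) \<or>
    (\<forall>d f. form d f \<longrightarrow> (f \<in> Q \<longleftrightarrow> poly (at_x0 (D.E f)) 0 = 0))"
proof -
  interpret Q: surface_point K dec Q by (rule surface_pointI[OF Q])
  have v34: "var 3 \<in> Q" "var 4 \<in> Q" using Q.F_injective_chart F by blast+
  note v2 = Q.var_2_in_Q[OF v34]
  show ?thesis
  proof (cases "var 0 \<in> Q")
    case True
    have "var i \<in> Q" if "i \<le> 4" "i \<noteq> 1" for i
      using that v34 v2 True by (cases rule: le_4_cases) simp_all
    then show ?thesis using Q.coordinate_point[of 1] by simp
  next
    case v0: False
    show ?thesis
    proof (cases "\<exists>c. Q.lin c \<in> Q")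
      case True
      then obtain c where c: "Q.lin c \<in> Q" by blast
      note root = Q.in_Q_iff_root[OF v0 v34 c]
      interpret C: curve_point K dec Q "\<lambda>p. poly p c \<noteq> 0"
        using v0 v34 root by unfold_locales simp_all
      have "c = 0" using C.F_injective_closed[of c] F by blast
      then show ?thesis using root by blast
    next
      case False
      have z: "f \<in> Q \<longleftrightarrow> at_x0 (D.E f) = 0" if f: "form d f" for d f
      proof
        show "f \<in> Q \<Longrightarrow> at_x0 (D.E f) = 0" using Q.lin_in_Q_exists[OF v0 v34 f] False by blast
        assume "at_x0 (D.E f) = 0"
        then show "f \<in> Q"
          by (intro Q.curve_congruence[OF v0 v34 f form_zero[of 0] Q.Q.zero_closed]) (simp add: D.E_zero)
      qed
      interpret C: curve_point K dec Q "\<lambda>p. p \<noteq> 0"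
        using v0 v34 z by unfold_locales simp_all
      show ?thesis using C.F_injective_generic F by blast
    qed
  qed
qed

text \<open>A point is determined by the forms that vanish there, so each of the two cases contains one point
at most.\<close>

theorem finite_exceptional: "finite {Q \<in> proj_points K 4 I. \<not> F_injective_at 2 K 4 I Q}"
proof -
  have sub: "finite {Q \<in> proj_points K 4 I. \<forall>d f. form d f \<longrightarrow> (f \<in> Q \<longleftrightarrow> P d f)}" for P
  proof -
    let ?S = "{Q \<in> proj_points K 4 I. \<forall>d f. form d f \<longrightarrow> (f \<in> Q \<longleftrightarrow> P d f)}"
    have eq: "Q = Q'" if Q: "Q \<in> ?S" "Q' \<in> ?S" for Q Q'
    proof (rule homogeneous_ideal_eqI)
      show "homogeneous_ideal K 4 Q" "homogeneous_ideal K 4 Q'" using Q by (simp_all add: proj_points_def)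
      show "f \<in> Q \<longleftrightarrow> f \<in> Q'" if "form d f" for d f using Q that by simp
    qed
    show ?thesis
    proof (cases "?S = {}")
      case False
      then obtain Q0 where "Q0 \<in> ?S" by (meson ex_in_conv)
      have "?S \<subseteq> {Q0}"
      proof
        fix A assume "A \<in> ?S"
        then have "A = Q0" using \<open>Q0 \<in> ?S\<close> by (rule eq)
        then show "A \<in> {Q0}" by (rule ssubst) (rule singletonI)
      qed
      then show ?thesis by (rule finite_subset) simp
    next
      case True
      then show ?thesis by (simp only: finite.emptyI)
    qed
  qed
  show ?thesis
  proof (rule finite_subset[OF _ finite_UnI[OF sub sub]], rule subsetI)
    fix Q assume "Q \<in> {Q \<in> proj_points K 4 I. \<not> F_injective_at 2 K 4 I Q}"
    then have Q: "Q \<in> proj_points K 4 I" "\<not> F_injective_at 2 K 4 I Q" by simp_all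
    show "Q \<in> {Q \<in> proj_points K 4 I. \<forall>d f. form d f \<longrightarrow> (f \<in> Q \<longleftrightarrow> lookup (pm f) (replicate_mset d 1) = 0)} \<union>
        {Q \<in> proj_points K 4 I. \<forall>d f. form d f \<longrightarrow> (f \<in> Q \<longleftrightarrow> poly (at_x0 (D.E f)) 0 = 0)}"
      using point_cases[OF Q] Q(1) by simp
  qed
qed

end

section \<open>General hyperplane sections\<close>

context field_coding
begin

lemma ev_hom:
  assumes h: "h 0 = 0" "h 1 = 1" "\<And>a b. h (a + b) = h a + h b" "\<And>a b. h (a * b) = h a * h b"
  shows "h (ev inc v f) = ev (\<lambda>c. h (inc c)) (\<lambda>i. h (v i)) f"
proof -
  have "h (prod_mset (image_mset v m)) = prod_mset (image_mset (\<lambda>i. h (v i)) m)" for m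
    by (induction m) (simp_all add: h)
  moreover have "h (sum g A) = (\<Sum>m\<in>A. h (g m))" for g and A :: "nat multiset set"
    by (induction A rule: infinite_finite_induct) (simp_all add: h)
  ultimately show ?thesis by (simp add: ev_def insert_values_def h)
qed

lemma hcomp_add:
  assumes "f \<in> carrier S" "g \<in> carrier S"
  shows "hcomp d (f \<oplus>\<^bsub>S\<^esub> g) = hcomp d f \<oplus>\<^bsub>S\<^esub> hcomp d g"
  by (auto simp: homogeneous_component_def mpoly_ring_def fun_eq_iff K_closed)

lemma homogeneous_principal_ideal:
  assumes l: "form e l"
  shows "homogeneous_ideal K N (PIdl\<^bsub>S\<^esub> l)"
proof -
  have lc: "l \<in> carrier S" using l by (rule form_closed)
  interpret L: ideal "PIdl\<^bsub>S\<^esub> l" S by (rule S.cgenideal_ideal[OF lc])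
  have "hcomp d (s \<otimes>\<^bsub>S\<^esub> l) \<in> PIdl\<^bsub>S\<^esub> l" if s: "s \<in> carrier S" for s d
  proof (rule poly_induct[OF s, where P = "\<lambda>s. hcomp d (s \<otimes>\<^bsub>S\<^esub> l) \<in> PIdl\<^bsub>S\<^esub> l"])
    have "hcomp d \<zero>\<^bsub>S\<^esub> = \<zero>\<^bsub>S\<^esub>" using hcomp_of_form[OF form_zero[of d], of d] by simp
    then show "hcomp d (\<zero>\<^bsub>S\<^esub> \<otimes>\<^bsub>S\<^esub> l) \<in> PIdl\<^bsub>S\<^esub> l" using lc L.zero_closed by simp
    fix f g assume fg: "f \<in> carrier S" "g \<in> carrier S"
      "hcomp d (f \<otimes>\<^bsub>S\<^esub> l) \<in> PIdl\<^bsub>S\<^esub> l" "hcomp d (g \<otimes>\<^bsub>S\<^esub> l) \<in> PIdl\<^bsub>S\<^esub> l"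
    then show "hcomp d ((f \<oplus>\<^bsub>S\<^esub> g) \<otimes>\<^bsub>S\<^esub> l) \<in> PIdl\<^bsub>S\<^esub> l"
      using lc L.a_closed by (simp add: S.l_distr hcomp_add)
  next
    fix m and c :: 'k assume "m \<in> keys (pm s)"
    then have m: "set_mset m \<subseteq> {..N}" using keys_pm_vars[OF s] by blast
    let ?s = "mp (Poly_Mapping.single m c)"
    have sl: "form (size m + e) (?s \<otimes>\<^bsub>S\<^esub> l)" using form_single[OF m] l by (rule form_mult)
    have "?s \<otimes>\<^bsub>S\<^esub> l \<in> PIdl\<^bsub>S\<^esub> l"
      using form_closed[OF form_single[OF m, of c]] unfolding cgenideal_def by blast
    then show "hcomp d (?s \<otimes>\<^bsub>S\<^esub> l) \<in> PIdl\<^bsub>S\<^esub> l"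
      using L.zero_closed unfolding hcomp_of_form[OF sl, of d] by (cases "size m + e = d") simp_all
  qed
  then have "\<forall>f\<in>PIdl\<^bsub>S\<^esub> l. \<forall>d. hcomp d f \<in> PIdl\<^bsub>S\<^esub> l"
    unfolding cgenideal_def by blast
  then show ?thesis using L.ideal_axioms unfolding homogeneous_ideal_def by blast
qed

lemma homogeneous_ideal_add:
  assumes A: "homogeneous_ideal K N A" and B: "homogeneous_ideal K N B"
  shows "homogeneous_ideal K N (A <+>\<^bsub>S\<^esub> B)"
proof -
  have AB: "ideal A S" "ideal B S" using A B by (simp_all add: homogeneous_ideal_def)
  note c = ideal.Icarr[OF AB(1)] ideal.Icarr[OF AB(2)]
  have "hcomp d f \<in> A <+>\<^bsub>S\<^esub> B" if "f \<in> A <+>\<^bsub>S\<^esub> B" for f d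
  proof -
    obtain a b where ab: "a \<in> A" "b \<in> B" "f = a \<oplus>\<^bsub>S\<^esub> b"
      using \<open>f \<in> A <+>\<^bsub>S\<^esub> B\<close> unfolding set_add_def' by blast
    have "hcomp d a \<in> A" "hcomp d b \<in> B" using A B ab by (simp_all add: homogeneous_ideal_def)
    moreover have "hcomp d f = hcomp d a \<oplus>\<^bsub>S\<^esub> hcomp d b" using ab c hcomp_add by simp
    ultimately show ?thesis unfolding set_add_def' by blast
  qed
  then show ?thesis using S.add_ideals[OF AB] by (simp add: homogeneous_ideal_def)
qed

end

context domain_evaluation
begin

lemma E_graded_kernel: "f \<in> graded_kernel \<Longrightarrow> E f = 0"
proof -
  assume f: "f \<in> graded_kernel"
  have "poly (z.E f) 1 = ev (\<lambda>c. poly [:inc c:] 1) (\<lambda>i. poly (Polynomial.monom (v i) (Suc 0)) 1) f"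
    by (rule ev_hom) simp_all
  then have "poly (z.E f) 1 = E f" by (simp add: poly_monom)
  then show "E f = 0" using f by (simp add: graded_kernel_iff)
qed

end

locale surface_section = surface K dec
  for K :: "('a, 'c) ring_scheme" and dec :: "'a \<Rightarrow> 'k::alg_closed_field" +
  fixes l :: "nat multiset \<Rightarrow> 'a"
  assumes l: "form 1 l" "l {#0#} \<noteq> \<zero>\<^bsub>K\<^esub>" "l {#1#} \<noteq> \<zero>\<^bsub>K\<^esub>"
begin

abbreviation "h \<equiv> D.E l"
text \<open>On the line \<open>x = 0\<close> the linear form restricts to \<open>l0 + l1 y\<close>, so \<open>c\<close> is the parameter of the point in
which the hyperplane meets the double curve.\<close>

definition l0 :: 'k where "l0 = dec (l {#0#})"
definition l1 :: 'k where "l1 = dec (l {#1#})"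
definition c :: 'k where "c = - (l0 / l1)"
definition \<gamma> :: 'k where "\<gamma> = sqroot c"

lemma l_closed: "l \<in> carrier S" using l(1) by (rule form_closed)

lemma c_nonzero: "l0 \<noteq> 0" "l1 \<noteq> 0" "c \<noteq> 0" "\<gamma> \<noteq> 0" and \<gamma>_sq: "\<gamma>\<^sup>2 = c"
proof -
  have lK: "l m \<in> carrier K" for m using l_closed by (simp add: S_carrier)
  show 1: "l0 \<noteq> 0" "l1 \<noteq> 0" using l by (simp_all add: l0_def l1_def dec_eq_0_iff lK)
  then show 2: "c \<noteq> 0" by (simp add: c_def)
  show 3: "\<gamma>\<^sup>2 = c" unfolding \<gamma>_def by (rule sqroot_sq)
  show "\<gamma> \<noteq> 0" using 2 3 by auto
qed

lemma at_x0_h: "at_x0 h = [:l0, l1:]"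
proof -
  let ?v = "\<lambda>i. at_x0 (gens i :: 'k poly poly)"
  interpret r: ring_hom_type "\<lambda>c::'k. [:c:]" by unfold_locales (simp_all add: one_pCons)
  let ?A = "(\<lambda>i. {#i#}) ` {..4::nat}"
  have k: "keys (pm l) \<subseteq> ?A"
  proof
    fix m assume m: "m \<in> keys (pm l)"
    then have "size m = 1" "set_mset m \<subseteq> {..4}" using l(1) keys_pm_vars[OF l_closed] by (auto simp: form_iff)
    moreover obtain i where "m = {#i#}" using size_1_singleton_mset[OF calculation(1)] by blast
    ultimately show "m \<in> ?A" by simp
  qed
  have "at_x0 h = ev (\<lambda>c. at_x0 (cc c)) ?v l" by (rule ev_hom) simp_all
  also have "\<dots> = ev (\<lambda>c. [:c:]) ?v l" by simp
  also have "\<dots> = (\<Sum>m\<in>?A. [:lookup (pm l) m:] * prod_mset (image_mset ?v m))"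
    unfolding ev_def by (rule r.insert_values_superset) (use k in auto)
  also have "\<dots> = (\<Sum>i\<le>4. [:lookup (pm l) {#i#}:] * ?v i)"
    by (subst sum.reindex) (auto simp: inj_on_def)
  also have "{..4::nat} = {0, 1, 2, 3, 4}" by auto
  also have "(\<Sum>i\<in>{0, 1, 2, 3, 4}. [:lookup (pm l) {#i#}:] * ?v i) = [:l0, l1:]"
    by (simp add: lookup_pm[OF l_closed] l0_def l1_def power2_eq_square)
  finally show ?thesis .
qed

lemma h_R0: "R0 h" using l(1) V_E R0_V by blast

lemma minus_\<gamma>: "- \<gamma> = \<gamma>" using two by (metis add.inverse_unique mult_2 mult_zero_left)

text \<open>Up to a constant the restriction of the equation to \<open>y = 0\<close> is a square, because that line maps
inseparably to the double curve.\<close>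

lemma at_y0_h: "at_y0 h = [:l1:] * ([:\<gamma>, 1:] * [:\<gamma>, 1:])"
proof -
  have "at_y0 h = pcompose [:l0, l1:] [:0, 0, 1:]"
    using at_y0_R0[OF h_R0] by (simp add: at_x0_sq_def at_x0_h)
  also have "\<dots> = [:l0, 0, l1:]" by (simp add: pcompose_pCons)
  also have "l0 = l1 * (\<gamma> * \<gamma>)"
  proof -
    have "l1 * (\<gamma> * - \<gamma>) = l0" using \<gamma>_sq c_nonzero(2) by (simp add: c_def power2_eq_square)
    then show ?thesis by (simp add: minus_\<gamma> del: mult_minus_right)
  qed
  also have "[:l1 * (\<gamma> * \<gamma>), 0, l1:] = [:l1:] * ([:\<gamma>, 1:] * [:\<gamma>, 1:])"
    using two by (simp add: mult_2[symmetric])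
  finally show ?thesis .
qed

lemma h_nonzero: "at_x0 h \<noteq> 0" "at_y0 h \<noteq> 0"
  using c_nonzero by (simp_all add: at_x0_h at_y0_h)

sublocale P: domain_evaluation K dec 4 "\<lambda>c. c" "\<lambda>i. poly (at_x0 (gens i :: 'k poly poly)) c"
  by unfold_locales simp_all

lemma P_E: "P.E f = poly (at_x0 (D.E f)) c"
proof -
  have "poly (at_x0 (D.E f)) c = ev (\<lambda>a. poly (at_x0 (cc a)) c) (\<lambda>i. poly (at_x0 (gens i)) c) f"
    by (rule ev_hom[where h = "\<lambda>F. poly (at_x0 F) c"]) simp_all
  then show ?thesis by simp
qed

abbreviation "Q \<equiv> P.graded_kernel"
abbreviation "I' \<equiv> hyperplane_section K 4 I (hyperplane K 4 l)"

lemma form_in_Q: "form d f \<Longrightarrow> f \<in> Q \<longleftrightarrow> poly (at_x0 (D.E f)) c = 0"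
  by (simp add: P.form_in_graded_kernel P_E)

lemma I'_homogeneous: "homogeneous_ideal K 4 I'"
  unfolding hyperplane_section_def hyperplane_def
  by (intro homogeneous_ideal_add homogeneous_principal_ideal[OF l(1)] D.graded_kernel_homogeneous)

lemma I'_iff: "f \<in> I' \<longleftrightarrow> (\<exists>i\<in>I. \<exists>s\<in>carrier S. f = i \<oplus>\<^bsub>S\<^esub> s \<otimes>\<^bsub>S\<^esub> l)"
  unfolding hyperplane_section_def hyperplane_def set_add_def' cgenideal_def by auto

lemma Q_point: "Q \<in> proj_points K 4 I'"
proof -
  have Qi: "ideal Q S" using primeideal.axioms(1)[OF P.graded_kernel_prime] .
  have "I \<subseteq> Q"
    by (rule homogeneous_ideal_subset[OF D.graded_kernel_homogeneous P.graded_kernel_homogeneous])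
      (simp add: D.form_in_graded_kernel form_in_Q)
  moreover have "poly (at_x0 h) c = 0" using c_nonzero by (simp add: at_x0_h c_def)
  then have lQ: "l \<in> Q" using form_in_Q[OF l(1)] by simp
  ultimately have IQ: "I \<subseteq> Q" "l \<in> Q" by blast+
  have "I' \<subseteq> Q"
  proof
    fix z assume "z \<in> I'"
    then obtain i s where z: "i \<in> I" "s \<in> carrier S" "z = i \<oplus>\<^bsub>S\<^esub> s \<otimes>\<^bsub>S\<^esub> l" unfolding I'_iff by blast
    have "s \<otimes>\<^bsub>S\<^esub> l \<in> Q" by (rule ideal.I_l_closed[OF Qi IQ(2) z(2)])
    then show "z \<in> Q" unfolding z(3)
      using IQ(1) z(1) by (intro additive_subgroup.a_closed[OF ideal.axioms(1)[OF Qi]]) blast+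
  qed
  then show ?thesis
    using P.graded_kernel_prime P.graded_kernel_homogeneous P.graded_kernel_relevant[of 0]
    by (simp add: proj_points_def)
qed

sublocale perfect_stalk K dec 4 I' Q 2
proof unfold_locales
  show "homogeneous_ideal K 4 I'" by (rule I'_homogeneous)
  show "Q \<in> proj_points K 4 I'" by (rule Q_point)
  show "Factorial_Ring.prime (2::nat)" by (rule two_is_prime_nat)
  show "CHAR('k) = 2" by (rule CHAR_2)
  show "\<exists>b::'k. b ^ 2 = c" for c by (rule nth_root_exists) simp
qed

abbreviation "x0 n \<equiv> var 0 [^]\<^bsub>S\<^esub> (n::nat)"

lemma x0: "form n (x0 n)" "x0 n \<in> carrier S" "D.E (x0 n) = 1" "x0 n \<notin> Q"
proof -
  show 1: "form n (x0 n)" using form_pow[OF form_var[of 0], of n] by simp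
  then show "x0 n \<in> carrier S" by (rule form_closed)
  show 2: "D.E (x0 n) = 1" using form_closed[OF form_var[of 0]] D.E_var[of 0] by (simp add: D.E_pow)
  show "x0 n \<notin> Q" using form_in_Q[OF 1] 2 by simp
qed

text \<open>Local vanishing on the hyperplane section, expressed by polynomials in \<open>x\<close> and \<open>y\<close> without defect:
after multiplication by a unit \<open>\<tau>\<close>, the form is a multiple of the equation \<open>h\<close>.\<close>

lemma local_zero_iff:
  assumes F: "form d F"
  shows "(\<exists>t k. form k t \<and> t \<notin> Q \<and> t \<otimes>\<^bsub>S\<^esub> F \<in> I') \<longleftrightarrow>
    (\<exists>\<tau> w. R0 \<tau> \<and> poly (at_x0 \<tau>) c \<noteq> 0 \<and> R0 w \<and> \<tau> * D.E F = h * w)"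
proof
  have Fc: "F \<in> carrier S" using F by (rule form_closed)
  assume "\<exists>t k. form k t \<and> t \<notin> Q \<and> t \<otimes>\<^bsub>S\<^esub> F \<in> I'"
  then obtain t k where t: "form k t" "t \<notin> Q" "t \<otimes>\<^bsub>S\<^esub> F \<in> I'" by blast
  have tc: "t \<in> carrier S" using t(1) by (rule form_closed)
  obtain i s where i: "i \<in> I" "s \<in> carrier S" "t \<otimes>\<^bsub>S\<^esub> F = i \<oplus>\<^bsub>S\<^esub> s \<otimes>\<^bsub>S\<^esub> l" using t(3) I'_iff by blast
  have ic: "i \<in> carrier S" using i(1) D.graded_kernel_iff by blast
  have "D.E t * D.E F = D.E (t \<otimes>\<^bsub>S\<^esub> F)" using tc Fc by (simp add: D.E_mult)
  also have "\<dots> = h * D.E s"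
    unfolding i(3) using ic i(2) l_closed D.E_graded_kernel[OF i(1)] by (simp add: D.E_add D.E_mult mult.commute)
  finally have "D.E t * D.E F = h * D.E s" .
  moreover have "R0 (D.E t)" "R0 (D.E s)" using delta_E tc i(2) by (simp_all add: R0_iff_delta)
  moreover have "poly (at_x0 (D.E t)) c \<noteq> 0" using form_in_Q[OF t(1)] t(2) by simp
  ultimately show "\<exists>\<tau> w. R0 \<tau> \<and> poly (at_x0 \<tau>) c \<noteq> 0 \<and> R0 w \<and> \<tau> * D.E F = h * w" by blast
next
  have Fc: "F \<in> carrier S" using F by (rule form_closed)
  assume "\<exists>\<tau> w. R0 \<tau> \<and> poly (at_x0 \<tau>) c \<noteq> 0 \<and> R0 w \<and> \<tau> * D.E F = h * w"
  then obtain \<tau> w where \<tau>: "R0 \<tau>" "poly (at_x0 \<tau>) c \<noteq> 0" "R0 w" "\<tau> * D.E F = h * w" by blast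
  obtain k t where t: "form k t" "D.E t = \<tau>" using \<tau>(1) unfolding R0_def V_def by blast
  obtain n s where s: "form n s" "D.E s = w" using \<tau>(3) unfolding R0_def V_def by blast
  have tc: "t \<in> carrier S" and sc: "s \<in> carrier S" using t(1) s(1) by (auto intro: form_closed)
  have tQ: "t \<notin> Q" using form_in_Q[OF t(1)] t(2) \<tau>(2) by simp
  obtain m where m: "m = n + 1" by simp
  let ?t = "x0 m \<otimes>\<^bsub>S\<^esub> t" and ?s = "x0 (k + d) \<otimes>\<^bsub>S\<^esub> s"
  have tF: "form (m + k + d) (?t \<otimes>\<^bsub>S\<^esub> F)" by (intro form_mult x0 t F)
  have "form (k + d + n + 1) (?s \<otimes>\<^bsub>S\<^esub> l)" by (intro form_mult x0 s l)
  then have sl: "form (m + k + d) (?s \<otimes>\<^bsub>S\<^esub> l)" by (simp add: m add_ac)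
  note cs = form_closed[OF tF] form_closed[OF sl]
  have "form (m + k + d) (?t \<otimes>\<^bsub>S\<^esub> F \<ominus>\<^bsub>S\<^esub> ?s \<otimes>\<^bsub>S\<^esub> l)"
    unfolding S.minus_eq by (intro form_add form_minus tF sl)
  moreover have "D.E (?t \<otimes>\<^bsub>S\<^esub> F \<ominus>\<^bsub>S\<^esub> ?s \<otimes>\<^bsub>S\<^esub> l) = 0"
    using cs tc sc Fc l_closed x0(2) \<tau>(4) by (simp add: D.E_diff D.E_mult x0(3) t(2) s(2) mult.commute)
  ultimately have iI: "?t \<otimes>\<^bsub>S\<^esub> F \<ominus>\<^bsub>S\<^esub> ?s \<otimes>\<^bsub>S\<^esub> l \<in> I" by (simp add: D.form_in_graded_kernel)
  have eq: "?t \<otimes>\<^bsub>S\<^esub> F = (?t \<otimes>\<^bsub>S\<^esub> F \<ominus>\<^bsub>S\<^esub> ?s \<otimes>\<^bsub>S\<^esub> l) \<oplus>\<^bsub>S\<^esub> ?s \<otimes>\<^bsub>S\<^esub> l"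
    using cs by (simp add: S.minus_eq S.a_assoc S.l_neg)
  have "?s \<in> carrier S" using x0(2) sc by simp
  then have "?t \<otimes>\<^bsub>S\<^esub> F \<in> I'" using I'_iff iI eq by blast
  moreover have "?t \<notin> Q" by (rule mult_notin_Q[OF x0(2) tc x0(4) tQ])
  moreover have "form (m + k) ?t" by (intro form_mult x0 t)
  ultimately show "\<exists>t k. form k t \<and> t \<notin> Q \<and> t \<otimes>\<^bsub>S\<^esub> F \<in> I'" by blast
qed

lemma q_eq_section_iff:
  assumes f: "form d f" "form d g" "g \<notin> Q" and f': "form e f'" "form e g'" "g' \<notin> Q"
  shows "q f g = q f' g' \<longleftrightarrow> (\<exists>\<tau> w. R0 \<tau> \<and> poly (at_x0 \<tau>) c \<noteq> 0 \<and> R0 w \<and>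
    \<tau> * (D.E g' * D.E f - D.E g * D.E f') = h * w)"
proof -
  note cs = form_closed[OF f(1)] form_closed[OF f(2)] form_closed[OF f'(1)] form_closed[OF f'(2)]
  have "form (e + d) (g' \<otimes>\<^bsub>S\<^esub> f)" by (rule form_mult[OF f'(2) f(1)])
  moreover have "form (e + d) (g \<otimes>\<^bsub>S\<^esub> f')" using form_mult[OF f(2) f'(1)] by (simp add: add.commute)
  ultimately have "form (e + d) (g' \<otimes>\<^bsub>S\<^esub> f \<ominus>\<^bsub>S\<^esub> g \<otimes>\<^bsub>S\<^esub> f')"
    unfolding S.minus_eq by (intro form_add form_minus)
  from local_zero_iff[OF this] show ?thesis
    unfolding q_eq_iff[OF f f'] using cs by (simp add: D.E_diff D.E_mult)
qed

end

context surface_section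
begin

text \<open>In the chart, \<open>s\<close> is integral over the section without belonging to it. As \<open>x y s\<close> and \<open>x y\<close> have no
defect, \<open>s\<close> is the fraction \<open>num/den\<close> below.\<close>

definition s :: "'k poly poly" where "s = xx\<^sup>2 + cc \<gamma> * xx"

lemma s_simps: "at_x0 s = 0" "at_y0 s = [:0, 1:] * [:\<gamma>, 1:]" "delta s = [:0, 1:] * [:\<gamma>, 1:]"
  by (simp_all add: s_def delta_def at_x0_sq_def power2_eq_square)

definition den where "den = q (var 2) (var 0)"
definition alpha where "alpha = (var 1 \<otimes>\<^bsub>S\<^esub> var 2 \<oplus>\<^bsub>S\<^esub> var 4 \<otimes>\<^bsub>S\<^esub> var 0) \<oplus>\<^bsub>S\<^esub> const \<gamma> \<otimes>\<^bsub>S\<^esub> (var 3 \<otimes>\<^bsub>S\<^esub> var 0)"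
definition num where "num = q alpha (x0 2)"

lemma vars: "i \<le> 4 \<Longrightarrow> var i \<in> carrier S"
  using form_closed[OF form_var] .

lemma fv: "form 1 (var 0)" "form 1 (var 2)"
  by (rule form_var, simp)+

lemma var0_notin: "var 0 \<notin> Q"
  using form_in_Q[OF form_var[of 0]] by (simp add: E_var_simps)

lemma alpha: "form 2 alpha" "alpha \<in> carrier S" "D.E alpha = xx * yy * s"
proof -
  have f: "form (1 + 1) (var i \<otimes>\<^bsub>S\<^esub> var j)" if "i \<le> 4" "j \<le> 4" for i j
    by (rule form_mult[OF form_var[OF that(1)] form_var[OF that(2)]])
  have "form (0 + (1 + 1)) (const \<gamma> \<otimes>\<^bsub>S\<^esub> (var 3 \<otimes>\<^bsub>S\<^esub> var 0))"
    by (rule form_mult[OF form_const f]) simp_all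
  then have "form (1 + 1) (const \<gamma> \<otimes>\<^bsub>S\<^esub> (var 3 \<otimes>\<^bsub>S\<^esub> var 0))" by simp
  then have "form (1 + 1) alpha" unfolding alpha_def by (intro form_add f) simp_all
  then show 1: "form 2 alpha" by (simp only: one_add_one)
  then show "alpha \<in> carrier S" by (rule form_closed)
  have c: "const \<gamma> \<in> carrier S" by (rule form_closed[OF form_const])
  have "D.E alpha = (xx\<^sup>2 + yy) * (xx * yy) + xx * yy\<^sup>2 + cc \<gamma> * (xx\<^sup>2 * yy)"
    unfolding alpha_def using c vars by (simp add: D.E_add D.E_mult D.E_const E_var_simps)
  also have "\<dots> = xx * yy * s + 2 * (xx * yy\<^sup>2)"
    by (simp add: s_def algebra_simps power2_eq_square)
  finally show "D.E alpha = xx * yy * s" using two_poly[OF two_poly[OF two]] by simp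
qed

lemma num_closed: "num \<in> carrier T"
  unfolding num_def by (rule q_closed[OF alpha(1) x0(1) x0(4)])

lemma den_mult:
  assumes f: "form d f" "form d g" "g \<notin> Q"
  shows "den \<otimes>\<^bsub>T\<^esub> q f g = q (var 2 \<otimes>\<^bsub>S\<^esub> f) (var 0 \<otimes>\<^bsub>S\<^esub> g)"
    "form (1 + d) (var 2 \<otimes>\<^bsub>S\<^esub> f)" "form (1 + d) (var 0 \<otimes>\<^bsub>S\<^esub> g)" "var 0 \<otimes>\<^bsub>S\<^esub> g \<notin> Q"
    "D.E (var 2 \<otimes>\<^bsub>S\<^esub> f) = xx * yy * D.E f" "D.E (var 0 \<otimes>\<^bsub>S\<^esub> g) = D.E g"
proof -
  note c = form_closed[OF f(1)] form_closed[OF f(2)]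
  show "den \<otimes>\<^bsub>T\<^esub> q f g = q (var 2 \<otimes>\<^bsub>S\<^esub> f) (var 0 \<otimes>\<^bsub>S\<^esub> g)"
    unfolding den_def by (rule q_mult[OF fv(2,1) var0_notin f])
  show "form (1 + d) (var 2 \<otimes>\<^bsub>S\<^esub> f)" "form (1 + d) (var 0 \<otimes>\<^bsub>S\<^esub> g)"
    by (rule form_mult[OF fv(2) f(1)], rule form_mult[OF fv(1) f(2)])
  show "var 0 \<otimes>\<^bsub>S\<^esub> g \<notin> Q" by (rule mult_notin_Q[OF vars c(2) var0_notin f(3)]) simp
  show "D.E (var 2 \<otimes>\<^bsub>S\<^esub> f) = xx * yy * D.E f" "D.E (var 0 \<otimes>\<^bsub>S\<^esub> g) = D.E g"
    using c vars by (simp_all add: D.E_mult E_var_simps)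
qed

lemma E_R0: "form d f \<Longrightarrow> R0 (D.E f)" using V_E R0_V by blast

text \<open>Multiples of \<open>xy\<close> that vanish on the hyperplane section vanish to the order of \<open>xy\<close>.\<close>

lemma xy_dvd_section:
  assumes "xx * yy * G = h * w"
  obtains w1 where "w = xx * yy * w1" "G = h * w1"
proof -
  have xy: "xx * yy \<noteq> (0 :: 'k poly poly)" by (simp add: xy_nonzero)
  have "(xx * yy) ^ 1 dvd h * w" unfolding assms[symmetric] power_one_right by (rule dvd_triv_left)
  then have "(xx * yy) ^ 1 dvd w" by (rule xy_dvd_cancel[OF h_nonzero])
  then obtain w1 where w1: "w = xx * yy * w1" by (auto elim: dvdE)
  have "xx * yy * G = xx * yy * (h * w1)" using assms by (simp add: w1 mult_ac)
  then have "G = h * w1" using xy by (simp only: mult_cancel_left) simp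
  then show ?thesis using that w1 by blast
qed

text \<open>The cofactor of \<open>x y\<close> in a relation is again without defect, since \<open>h\<close> does not vanish on \<open>y = 0\<close>.\<close>

lemma den_regular:
  assumes r: "r \<in> carrier T" "den \<otimes>\<^bsub>T\<^esub> r = \<zero>\<^bsub>T\<^esub>"
  shows "r = \<zero>\<^bsub>T\<^esub>"
proof -
  obtain f g d where f: "form d f" "form d g" "g \<notin> Q" "r = q f g" using r(1) by (rule T_cases)
  note dm = den_mult[OF f(1-3)]
  have "q (var 2 \<otimes>\<^bsub>S\<^esub> f) (var 0 \<otimes>\<^bsub>S\<^esub> g) = q \<zero>\<^bsub>S\<^esub> (var 0 \<otimes>\<^bsub>S\<^esub> g)"
    using r(2) unfolding f(4) dm(1) q_zero[OF dm(3,4)] .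
  then obtain \<tau> w where w: "R0 \<tau>" "poly (at_x0 \<tau>) c \<noteq> 0" "R0 w"
    "\<tau> * (D.E (var 0 \<otimes>\<^bsub>S\<^esub> g) * D.E (var 2 \<otimes>\<^bsub>S\<^esub> f) - D.E (var 0 \<otimes>\<^bsub>S\<^esub> g) * D.E \<zero>\<^bsub>S\<^esub>) = h * w"
    unfolding q_eq_section_iff[OF dm(2-4) form_zero dm(3,4)] by blast
  have "xx * yy * (\<tau> * (D.E g * D.E f)) = h * w"
    using w(4) by (simp add: dm(5,6) D.E_zero mult_ac)
  then obtain w1 where w1: "\<tau> * (D.E g * D.E f) = h * w1" by (rule xy_dvd_section)
  have "delta (h * w1) = 0"
    unfolding w1[symmetric] by (intro delta_R0 R0_mult w(1) E_R0[OF f(1)] E_R0[OF f(2)])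
  then have "delta w1 = 0" using delta_mult_left[OF delta_R0[OF h_R0], of w1] h_nonzero(2) by simp
  then have "R0 w1" by (simp add: R0_iff_delta)
  moreover have "\<tau> * (D.E g * D.E f - D.E g * D.E \<zero>\<^bsub>S\<^esub>) = h * w1" using w1 by (simp add: D.E_zero)
  ultimately have "q f g = q \<zero>\<^bsub>S\<^esub> g"
    unfolding q_eq_section_iff[OF f(1-3) form_zero f(2,3)] using w(1,2) by blast
  then show ?thesis unfolding f(4) q_zero[OF f(2,3)] .
qed

text \<open>Otherwise the defect of \<open>s\<close>, which is \<open>x (x + \<gamma>)\<close>, would be divisible up to units by the restriction
of \<open>h\<close>, which is divisible by \<open>(x + \<gamma>)\<^sup>2\<close>.\<close>

lemma num_not_multiple:
  assumes r: "r \<in> carrier T"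
  shows "num \<noteq> den \<otimes>\<^bsub>T\<^esub> r"
proof
  assume eq: "num = den \<otimes>\<^bsub>T\<^esub> r"
  obtain f g d where f: "form d f" "form d g" "g \<notin> Q" "r = q f g" using r by (rule T_cases)
  note dm = den_mult[OF f(1-3)]
  have "q alpha (x0 2) = q (var 2 \<otimes>\<^bsub>S\<^esub> f) (var 0 \<otimes>\<^bsub>S\<^esub> g)"
    using eq unfolding f(4) dm(1) num_def .
  then obtain \<tau> w where w: "R0 \<tau>" "poly (at_x0 \<tau>) c \<noteq> 0" "R0 w"
    "\<tau> * (D.E (var 0 \<otimes>\<^bsub>S\<^esub> g) * D.E alpha - D.E (x0 2) * D.E (var 2 \<otimes>\<^bsub>S\<^esub> f)) = h * w"
    unfolding q_eq_section_iff[OF alpha(1) x0(1,4) dm(2-4)] by blast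
  have "xx * yy * (\<tau> * (D.E g * s - D.E f)) = h * w"
    using w(4) by (simp add: dm(5,6) alpha(3) x0(3) algebra_simps)
  then obtain w1 where w1: "\<tau> * (D.E g * s - D.E f) = h * w1" by (rule xy_dvd_section)
  have "delta (\<tau> * (D.E g * s - D.E f)) = at_y0 \<tau> * (at_y0 (D.E g) * delta s)"
    using delta_mult_left[OF delta_R0[OF w(1)]] delta_mult_left[OF delta_R0[OF E_R0[OF f(2)]]]
      delta_R0[OF E_R0[OF f(1)]] by simp
  moreover have "delta (h * w1) = at_y0 h * delta w1" by (rule delta_mult_left[OF delta_R0[OF h_R0]])
  ultimately have "[:\<gamma>, 1:] * (at_y0 \<tau> * at_y0 (D.E g) * [:0, 1:]) = [:\<gamma>, 1:] * ([:\<gamma>, 1:] * ([:l1:] * delta w1))"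
    unfolding s_simps at_y0_h using arg_cong[OF w1, of delta] by (simp only: mult_ac)
  then have "at_y0 \<tau> * at_y0 (D.E g) * [:0, 1:] = [:\<gamma>, 1:] * ([:l1:] * delta w1)"
    by (simp only: mult_cancel_left) simp
  then have "poly (at_y0 \<tau> * at_y0 (D.E g) * [:0, 1:]) \<gamma> = poly ([:\<gamma>, 1:] * ([:l1:] * delta w1)) \<gamma>"
    by (rule arg_cong)
  moreover have "poly [:\<gamma>, 1:] \<gamma> = 0" using two by simp
  ultimately have "poly (at_y0 \<tau>) \<gamma> * poly (at_y0 (D.E g)) \<gamma> * poly [:0, 1:] \<gamma> = 0"
    by (simp only: poly_mult mult_zero_left)
  then have "poly (at_y0 \<tau>) \<gamma> * poly (at_y0 (D.E g)) \<gamma> * \<gamma> = 0" by simp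
  moreover have "poly (at_y0 \<tau>) \<gamma> = poly (at_x0 \<tau>) c" "poly (at_y0 (D.E g)) \<gamma> = poly (at_x0 (D.E g)) c"
    using at_y0_R0[OF w(1)] at_y0_R0[OF E_R0[OF f(2)]] \<gamma>_sq by (simp_all add: poly_at_x0_sq)
  moreover have "poly (at_x0 (D.E g)) c \<noteq> 0" using form_in_Q[OF f(2)] f(3) by simp
  ultimately show False using w(2) c_nonzero by simp
qed

text \<open>A form in the maximal ideal agrees on the double curve with a multiple of \<open>h\<close>; the difference lies in
the conductor and remains in the ring after multiplication by \<open>s\<close>.\<close>

lemma num_absorbs:
  assumes x: "x \<in> M"
  shows "\<exists>e\<in>carrier T. num \<otimes>\<^bsub>T\<^esub> x = den \<otimes>\<^bsub>T\<^esub> e"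
proof -
  obtain f g d where f: "form d f" "form d g" "g \<notin> Q" "f \<in> Q" "x = q f g"
    using x unfolding M_def by blast
  let ?F = "D.E f"
  have "poly (at_x0 ?F) c = 0" using f(4) form_in_Q[OF f(1)] by simp
  then obtain k where k: "at_x0 ?F = [:- c, 1:] * k" using poly_eq_0_iff_dvd by (metis dvdE)
  \<comment> \<open>Chosen such that \<open>h v\<close> and \<open>E f\<close> have the same restriction to \<open>x = 0\<close>.\<close>
  define v where "v = cc (inverse l1) * lift_u k"
  have "R0 v" unfolding v_def by (intro R0_mult R0_cc R0_lift_u)
  then have hv: "R0 (h * v)" by (intro R0_mult h_R0)
  have "[:l0, l1:] * [:inverse l1:] = [:- c, 1:]"
    using c_nonzero(2) by (simp add: c_def field_simps)
  then have "at_x0 (h * v) = [:- c, 1:] * k"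
    by (simp only: v_def at_x0_simps at_x0_h at_x0_lift_u mult.assoc[symmetric])
  then have x0': "at_x0 (?F - h * v) = 0" using k by simp
  have "at_y0 (?F - h * v) = at_x0_sq (?F - h * v)" by (intro at_y0_R0 R0_diff E_R0[OF f(1)] hv)
  then have "at_y0 (?F - h * v) = 0" using x0' by (simp add: at_x0_sq_def)
  then have "xx * yy dvd ?F - h * v" using x0' xy_dvd_iff by blast
  then obtain G where G: "?F - h * v = xx * yy * G" by (rule dvdE)
  have "s * (?F - h * v) = xx * yy * (G * s)" unfolding G by (simp add: mult_ac)
  then have "R0 (s * (?F - h * v))" using R0_xy by metis
  then obtain n r where r: "form n r" "D.E r = s * (?F - h * v)" unfolding R0_def V_def by blast
  let ?f = "r \<otimes>\<^bsub>S\<^esub> x0 d" and ?g = "x0 n \<otimes>\<^bsub>S\<^esub> g"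
  have f': "form (n + d) ?f" "form (n + d) ?g" "?g \<notin> Q"
    using form_mult[OF r(1) x0(1)] form_mult[OF x0(1) f(2)] mult_notin_Q[OF x0(2) form_closed[OF f(2)] x0(4) f(3)]
    by simp_all
  note dm = den_mult[OF f']
  have fg: "form (2 + d) (alpha \<otimes>\<^bsub>S\<^esub> f)" "form (2 + d) (x0 2 \<otimes>\<^bsub>S\<^esub> g)" "x0 2 \<otimes>\<^bsub>S\<^esub> g \<notin> Q"
    by (rule form_mult[OF alpha(1) f(1)], rule form_mult[OF x0(1) f(2)],
        rule mult_notin_Q[OF x0(2) form_closed[OF f(2)] x0(4) f(3)])
  have "num \<otimes>\<^bsub>T\<^esub> x = q (alpha \<otimes>\<^bsub>S\<^esub> f) (x0 2 \<otimes>\<^bsub>S\<^esub> g)"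
    unfolding num_def f(5) by (rule q_mult[OF alpha(1) x0(1,4) f(1-3)])
  also have "\<dots> = q (var 2 \<otimes>\<^bsub>S\<^esub> ?f) (var 0 \<otimes>\<^bsub>S\<^esub> ?g)"
    unfolding q_eq_section_iff[OF fg dm(2-4)]
  proof (intro exI conjI)
    show "R0 1" by (rule R0_one)
    show "poly (at_x0 1) c \<noteq> 0" by simp
    show "R0 (xx * yy * (D.E g * s * v))" by (rule R0_xy)
    have e: "D.E (alpha \<otimes>\<^bsub>S\<^esub> f) = xx * yy * s * ?F" "D.E (x0 2 \<otimes>\<^bsub>S\<^esub> g) = D.E g" "D.E ?g = D.E g"
      "D.E ?f = s * (?F - h * v)"
      using alpha form_closed[OF f(1)] form_closed[OF f(2)] form_closed[OF r(1)] x0 r(2)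
      by (simp_all add: D.E_mult)
    show "1 * (D.E (var 0 \<otimes>\<^bsub>S\<^esub> ?g) * D.E (alpha \<otimes>\<^bsub>S\<^esub> f) - D.E (x0 2 \<otimes>\<^bsub>S\<^esub> g) * D.E (var 2 \<otimes>\<^bsub>S\<^esub> ?f)) =
        h * (xx * yy * (D.E g * s * v))"
      unfolding dm(5,6) e by (simp add: algebra_simps)
  qed
  also have "\<dots> = den \<otimes>\<^bsub>T\<^esub> q ?f ?g" by (rule dm(1)[symmetric])
  finally show ?thesis using q_closed[OF f'] by blast
qed

text \<open>The defect of \<open>s\<^sup>2\<close> is \<open>x\<^sup>2 (x + \<gamma>)\<^sup>2\<close>, the same as that of \<open>h x\<^sup>2 / l1\<close>.\<close>

lemma num_square: "\<exists>r\<in>carrier T. num [^]\<^bsub>T\<^esub> (2::nat) = den [^]\<^bsub>T\<^esub> (2::nat) \<otimes>\<^bsub>T\<^esub> r"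
proof -
  define v where "v = cc (inverse l1) * xx\<^sup>2"
  have "delta (h * v) = at_y0 h * delta v" by (rule delta_mult_left[OF delta_R0[OF h_R0]])
  also have "delta v = [:inverse l1:] * ([:0, 1:] * [:0, 1:])"
    by (simp add: v_def delta_def at_x0_sq_def power2_eq_square)
  also have "at_y0 h * \<dots> = ([:l1:] * [:inverse l1:]) * (([:0, 1:] * [:\<gamma>, 1:]) * ([:0, 1:] * [:\<gamma>, 1:]))"
    unfolding at_y0_h by (simp only: mult_ac)
  also have "[:l1:] * [:inverse l1:] = 1" using c_nonzero(2) by (simp add: one_pCons)
  finally have hv: "delta (h * v) = ([:0, 1:] * [:\<gamma>, 1:]) * ([:0, 1:] * [:\<gamma>, 1:])" by simp
  have "delta (s * s) = at_y0 (s * s) - at_x0_sq (s * s)" by (rule delta_def)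
  also have "\<dots> = ([:0, 1:] * [:\<gamma>, 1:]) * ([:0, 1:] * [:\<gamma>, 1:])"
    unfolding at_x0_sq_def at_x0_simps at_y0_simps s_simps by simp
  finally have "delta (s * s - h * v) = 0" using hv by simp
  then obtain n r where r: "form n r" "D.E r = s * s - h * v"
    unfolding R0_iff_delta[symmetric] R0_def V_def by blast
  have rc: "r \<in> carrier S" using r(1) by (rule form_closed)
  let ?t = "var 2 [^]\<^bsub>S\<^esub> (2::nat) \<otimes>\<^bsub>S\<^esub> r" and ?u = "x0 2 \<otimes>\<^bsub>S\<^esub> x0 n"
  have v2: "form 2 (var 2 [^]\<^bsub>S\<^esub> (2::nat))" "var 2 [^]\<^bsub>S\<^esub> (2::nat) \<in> carrier S"
    using form_pow[OF form_var[of 2], of 2] vars by simp_all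
  have tu: "form (2 + n) ?t" "form (2 + n) ?u" "?u \<notin> Q"
    by (rule form_mult[OF v2(1) r(1)], rule form_mult[OF x0(1) x0(1)], rule mult_notin_Q[OF x0(2) x0(2) x0(4) x0(4)])
  let ?a = "alpha [^]\<^bsub>S\<^esub> (2::nat)" and ?b = "x0 2 [^]\<^bsub>S\<^esub> (2::nat)"
  have ab: "form (2 * 2) ?a" "form (2 * 2) ?b" "?b \<notin> Q"
    by (rule form_pow[OF alpha(1)], rule form_pow[OF x0(1)], rule pow_notin_Q[OF x0(2) x0(4)])
  have "num [^]\<^bsub>T\<^esub> (2::nat) = q ?a ?b" unfolding num_def by (rule q_pow[OF alpha(1) x0(1) x0(4)])
  also have "\<dots> = q ?t ?u"
    unfolding q_eq_section_iff[OF ab tu]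
  proof (intro exI conjI)
    show "R0 1" by (rule R0_one)
    show "poly (at_x0 1) c \<noteq> 0" by simp
    show "R0 (xx * yy * (xx * yy * v))" by (rule R0_xy)
    have e: "D.E ?a = (xx * yy * s)\<^sup>2" "D.E ?b = 1" "D.E ?u = 1" "D.E ?t = (xx * yy)\<^sup>2 * (s * s - h * v)"
      using alpha x0 rc v2 r(2) vars by (simp_all add: D.E_mult D.E_pow E_var_simps)
    show "1 * (D.E ?u * D.E ?a - D.E ?b * D.E ?t) = h * (xx * yy * (xx * yy * v))"
      unfolding e by (simp add: algebra_simps power2_eq_square)
  qed
  also have "\<dots> = den [^]\<^bsub>T\<^esub> (2::nat) \<otimes>\<^bsub>T\<^esub> q r (x0 n)"
  proof -
    have "den [^]\<^bsub>T\<^esub> (2::nat) = q (var 2 [^]\<^bsub>S\<^esub> (2::nat)) (x0 2)"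
      unfolding den_def by (rule q_pow[OF fv(2,1) var0_notin])
    then show ?thesis using q_mult[OF v2(1) x0(1) x0(4) r(1) x0(1) x0(4)] by simp
  qed
  finally show ?thesis using q_closed[OF r(1) x0(1) x0(4)] by blast
qed

theorem section_not_F_injective: "\<not> F_injective_scheme 2 K 4 I'"
proof -
  have "\<not> F_injective_at 2 K 4 I' Q"
  proof
    assume "F_injective_at 2 K 4 I' Q"
    then obtain xs where xs: "set xs \<subseteq> carrier T" "Idl\<^bsub>T\<^esub> (set xs) = M"
      and inj: "\<And>i. inj_on (local_cohomology_map T xs (frobenius_pushforward 2 T) (\<lambda>x. x [^]\<^bsub>T\<^esub> (2::nat)) i)
        (carrier (local_cohomology T xs (self_module T) i))"
      unfolding F_injective_at_iff by blast
    have "var 2 \<in> Q" using form_in_Q[OF form_var[of 2]] by (simp add: E_var_simps)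
    then have "den \<in> Idl\<^bsub>T\<^esub> (set xs)"
      unfolding xs(2) den_def by (subst q_in_M_iff[OF fv(2,1) var0_notin]) simp_all
    moreover have "set xs \<subseteq> M" using T.genideal_self[OF xs(1)] xs(2) by simp
    then have "\<exists>e\<in>carrier T. num \<otimes>\<^bsub>T\<^esub> x = den \<otimes>\<^bsub>T\<^esub> e" if "x \<in> set xs" for x
      using num_absorbs that by blast
    moreover obtain r where "r \<in> carrier T" "num [^]\<^bsub>T\<^esub> (2::nat) = den [^]\<^bsub>T\<^esub> (2::nat) \<otimes>\<^bsub>T\<^esub> r"
      using num_square by blast
    ultimately show False
      using Fr.cohomology_map_not_injective[OF xs(1) _ den_regular num_closed num_not_multiple] inj by blast
  qed
  then show ?thesis using Q_point unfolding F_injective_scheme_def by blast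
qed

end

section \<open>Dimension\<close>

text \<open>More vectors than coordinates are linearly dependent, by elimination of one coordinate after the
other.\<close>

lemma dependent_columns:
  fixes a :: "'e \<Rightarrow> 'i \<Rightarrow> 'k::field"
  assumes "finite B" "finite A" "card B < card A"
  shows "\<exists>c. (\<exists>e\<in>A. c e \<noteq> 0) \<and> (\<forall>b\<in>B. (\<Sum>e\<in>A. c e * a e b) = 0)"
  using assms
proof (induction B arbitrary: A a rule: finite_induct)
  case empty
  then obtain e where "e \<in> A" by (metis card.empty less_irrefl ex_in_conv)
  then show ?case by (intro exI[of _ "\<lambda>_. 1"]) auto
next
  case (insert b B)
  show ?case
  proof (cases "\<forall>e\<in>A. a e b = 0")
    case True
    have "card B < card A" using insert by simp
    then obtain c where "\<exists>e\<in>A. c e \<noteq> 0" "\<forall>b\<in>B. (\<Sum>e\<in>A. c e * a e b) = 0"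
      using insert.IH insert.prems by blast
    moreover have "(\<Sum>e\<in>A. c e * a e b) = 0" using True by (intro sum.neutral) simp
    ultimately show ?thesis by blast
  next
    case False
    then obtain e0 where e0: "e0 \<in> A" "a e0 b \<noteq> 0" by blast
    define a' where "a' e i = a e i - a e b / a e0 b * a e0 i" for e i
    have "card B < card (A - {e0})" "finite (A - {e0})" using insert e0 by simp_all
    from insert.IH[OF this(2,1)] obtain c where c: "\<exists>e\<in>A - {e0}. c e \<noteq> 0"
      "\<forall>i\<in>B. (\<Sum>e\<in>A - {e0}. c e * a' e i) = 0" by blast
    \<comment> \<open>The coefficient of the pivot column is chosen so that the coordinate \<open>b\<close> cancels.\<close>
    define t where "t = (\<Sum>e\<in>A - {e0}. c e * (a e b / a e0 b))"
    let ?c = "c(e0 := - t)"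
    have s: "(\<Sum>e\<in>A. ?c e * a e i) = (\<Sum>e\<in>A - {e0}. c e * a' e i)" for i
    proof -
      have "(\<Sum>e\<in>A. ?c e * a e i) = - t * a e0 i + (\<Sum>e\<in>A - {e0}. ?c e * a e i)"
        using insert.prems(1) e0(1) by (subst sum.remove[of _ e0]) simp_all
      also have "(\<Sum>e\<in>A - {e0}. ?c e * a e i) = (\<Sum>e\<in>A - {e0}. c e * a e i)"
        by (intro sum.cong) auto
      also have "- t * a e0 i + \<dots> = (\<Sum>e\<in>A - {e0}. c e * a' e i)"
        by (simp add: t_def a'_def algebra_simps sum_subtractf sum_distrib_left sum_distrib_right)
      finally show ?thesis .
    qed
    have "(\<Sum>e\<in>A - {e0}. c e * a' e b) = 0" using e0 by (intro sum.neutral) (simp add: a'_def)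
    then have "\<forall>i\<in>insert b B. (\<Sum>e\<in>A. ?c e * a e i) = 0" using c(2) unfolding s by simp
    moreover have "\<exists>e\<in>A. ?c e \<noteq> 0" using c(1) by auto
    ultimately show ?thesis by blast
  qed
qed

context field_coding
begin

lemma point_ideal: "Q \<in> proj_points K N I \<Longrightarrow> ideal Q S"
  unfolding proj_points_def homogeneous_ideal_def by blast

lemma point_prime:
  assumes Q: "Q \<in> proj_points K N I" and fg: "f \<in> carrier S" "g \<in> carrier S" "f \<otimes>\<^bsub>S\<^esub> g \<in> Q"
  shows "f \<in> Q \<or> g \<in> Q"
proof -
  have "primeideal Q S" using Q unfolding proj_points_def by blast
  then show ?thesis using primeideal.I_prime fg by metis
qed

abbreviation vanishes :: "(nat multiset \<Rightarrow> 'a) set set \<Rightarrow> (nat multiset \<Rightarrow> 'a) \<Rightarrow> bool"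
  where "vanishes Z f \<equiv> \<forall>Q\<in>Z. f \<in> Q"

lemma irreducible_points: "irreducible_closed K N I Z \<Longrightarrow> Z \<subseteq> proj_points K N I"
  unfolding irreducible_closed_def zariski_closed_def by blast

lemma add_principal_subset_iff:
  assumes J: "ideal J S" and Q: "ideal Q S" and f: "f \<in> carrier S"
  shows "J <+>\<^bsub>S\<^esub> PIdl\<^bsub>S\<^esub> f \<subseteq> Q \<longleftrightarrow> J \<subseteq> Q \<and> f \<in> Q"
proof
  interpret J: ideal J S by (rule J)
  interpret Q: ideal Q S by (rule Q)
  interpret F: ideal "PIdl\<^bsub>S\<^esub> f" S by (rule S.cgenideal_ideal[OF f])
  have mem: "a \<oplus>\<^bsub>S\<^esub> b \<in> J <+>\<^bsub>S\<^esub> PIdl\<^bsub>S\<^esub> f" if "a \<in> J" "b \<in> PIdl\<^bsub>S\<^esub> f" for a b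
    using that unfolding set_add_def' by blast
  {
    assume sub: "J <+>\<^bsub>S\<^esub> PIdl\<^bsub>S\<^esub> f \<subseteq> Q"
    have "\<zero>\<^bsub>S\<^esub> \<oplus>\<^bsub>S\<^esub> f \<in> Q" by (rule subsetD[OF sub mem[OF J.zero_closed S.cgenideal_self[OF f]]])
    then have fQ: "f \<in> Q" using f by simp
    have "J \<subseteq> Q"
    proof
      fix j assume j: "j \<in> J"
      have "j \<oplus>\<^bsub>S\<^esub> \<zero>\<^bsub>S\<^esub> \<in> Q" by (rule subsetD[OF sub mem[OF j F.zero_closed]])
      then show "j \<in> Q" using J.Icarr[OF j] by simp
    qed
    then show "J \<subseteq> Q \<and> f \<in> Q" using fQ by simp
  }
  assume Q': "J \<subseteq> Q \<and> f \<in> Q"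
  show "J <+>\<^bsub>S\<^esub> PIdl\<^bsub>S\<^esub> f \<subseteq> Q"
  proof
    fix z assume "z \<in> J <+>\<^bsub>S\<^esub> PIdl\<^bsub>S\<^esub> f"
    then obtain a s where z: "a \<in> J" "s \<in> carrier S" "z = a \<oplus>\<^bsub>S\<^esub> s \<otimes>\<^bsub>S\<^esub> f"
      unfolding set_add_def' cgenideal_def by blast
    have "s \<otimes>\<^bsub>S\<^esub> f \<in> Q" by (rule Q.I_l_closed[OF conjunct2[OF Q'] z(2)])
    then show "z \<in> Q" unfolding z(3) by (rule Q.a_closed[OF subsetD[OF conjunct1[OF Q'] z(1)]])
  qed
qed

text \<open>An irreducible closed set is covered by the two closed subsets on which \<open>f\<close> and \<open>g\<close> vanish.\<close>

lemma irreducible_product: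
  assumes Z: "irreducible_closed K N I Z" and f: "form d f" and g: "form e g"
    and fg: "vanishes Z (f \<otimes>\<^bsub>S\<^esub> g)"
  shows "vanishes Z f \<or> vanishes Z g"
proof -
  note pts = irreducible_points[OF Z]
  obtain J where J: "homogeneous_ideal K N J" "Z = {Q \<in> proj_points K N I. J \<subseteq> Q}"
    using Z unfolding irreducible_closed_def zariski_closed_def by blast
  have Ji: "ideal J S" using J(1) by (simp add: homogeneous_ideal_def)
  have cl: "zariski_closed K N I {Q \<in> Z. f \<in> Q}" if f: "form d f" for d f
    unfolding zariski_closed_def
  proof (intro exI conjI)
    show "homogeneous_ideal K N (J <+>\<^bsub>S\<^esub> PIdl\<^bsub>S\<^esub> f)"
      by (rule homogeneous_ideal_add[OF J(1) homogeneous_principal_ideal[OF f]])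
    have "J <+>\<^bsub>S\<^esub> PIdl\<^bsub>S\<^esub> f \<subseteq> Q \<longleftrightarrow> J \<subseteq> Q \<and> f \<in> Q" if "Q \<in> proj_points K N I" for Q
      by (rule add_principal_subset_iff[OF Ji point_ideal[OF that] form_closed[OF f]])
    then show "{Q \<in> Z. f \<in> Q} = {Q \<in> proj_points K N I. J <+>\<^bsub>S\<^esub> PIdl\<^bsub>S\<^esub> f \<subseteq> Q}"
      unfolding J(2) by blast
  qed
  have "f \<in> Q \<or> g \<in> Q" if Q: "Q \<in> Z" for Q
    by (rule point_prime[OF subsetD[OF pts Q] form_closed[OF f] form_closed[OF g] bspec[OF fg Q]])
  then have "Z = {Q \<in> Z. f \<in> Q} \<union> {Q \<in> Z. g \<in> Q}" by blast
  moreover have "\<forall>A B. zariski_closed K N I A \<and> zariski_closed K N I B \<and> Z = A \<union> B \<longrightarrow> Z = A \<or> Z = B"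
    using Z unfolding irreducible_closed_def by blast
  ultimately have "Z = {Q \<in> Z. f \<in> Q} \<or> Z = {Q \<in> Z. g \<in> Q}"
    using cl[OF f] cl[OF g] by meson
  then show ?thesis by blast
qed

lemma irreducible_closed_of_point:
  assumes P: "P \<in> proj_points K N I"
  shows "irreducible_closed K N I {Q \<in> proj_points K N I. P \<subseteq> Q}"
proof -
  have h: "homogeneous_ideal K N P" using P by (simp add: proj_points_def)
  let ?V = "{Q \<in> proj_points K N I. P \<subseteq> Q}"
  have eq: "?V = A" if A: "zariski_closed K N I A" "P \<in> A" "A \<subseteq> ?V" for A
  proof -
    obtain J where "A = {Q \<in> proj_points K N I. J \<subseteq> Q}" using A(1) unfolding zariski_closed_def by blast
    then show ?thesis using A(2,3) by blast
  qed
  show ?thesis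
    unfolding irreducible_closed_def
  proof (intro conjI allI impI)
    show "zariski_closed K N I ?V" unfolding zariski_closed_def using h by blast
    show "?V \<noteq> {}" using P by blast
    fix A B assume AB: "zariski_closed K N I A \<and> zariski_closed K N I B \<and> ?V = A \<union> B"
    then have "P \<in> A \<or> P \<in> B" using P by blast
    moreover have "A \<subseteq> ?V" "B \<subseteq> ?V" using AB by simp_all
    ultimately show "?V = A \<or> ?V = B" using eq[of A] eq[of B] AB by meson
  qed
qed

lemma strict_chain_form:
  assumes Z: "irreducible_closed K N I Z" and Z': "Z' \<subseteq> proj_points K N I" and lt: "Z \<subset> Z'"
  shows "\<exists>d f. form d f \<and> vanishes Z f \<and> \<not> vanishes Z' f"
proof -
  obtain J where J: "homogeneous_ideal K N J" "Z = {Q \<in> proj_points K N I. J \<subseteq> Q}"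
    using Z unfolding irreducible_closed_def zariski_closed_def by blast
  obtain Q where Q: "Q \<in> Z'" "Q \<notin> Z" using lt by blast
  then have "\<not> J \<subseteq> Q" "homogeneous_ideal K N Q" using J(2) Z' by (auto simp: proj_points_def)
  then obtain d f where f: "form d f" "f \<in> J" "f \<notin> Q" using homogeneous_ideal_subset[OF J(1), of Q] by meson
  have "vanishes Z f" using J(2) f(2) by blast
  moreover have "\<not> vanishes Z' f" using Q(1) f(3) by blast
  ultimately show ?thesis using f(1) by blast
qed

text \<open>The sum of \<open>Y\<^sup>i H\<^sub>i\<close> over \<open>i < M\<close>, arranged as in Horner's scheme so that the lowest term splits off.\<close>

primrec hsum where
  "hsum Y 0 H = \<zero>\<^bsub>S\<^esub>"
| "hsum Y (Suc M) H = H 0 \<oplus>\<^bsub>S\<^esub> Y \<otimes>\<^bsub>S\<^esub> hsum Y M (\<lambda>i. H (Suc i))"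

lemma hsum_form:
  assumes Y: "form D Y"
  shows "(\<And>i. i < M \<Longrightarrow> form (D * (m + M - i)) (H i)) \<Longrightarrow> form (D * (m + M)) (hsum Y M H)"
proof (induction M arbitrary: H)
  case (Suc M)
  have f: "form (D * (m + M - i)) (H (Suc i))" if "i < M" for i using Suc.prems[of "Suc i"] that by simp
  have 1: "form (D * (m + M)) (hsum Y M (\<lambda>i. H (Suc i)))" by (rule Suc.IH[OF f])
  have "form (D * (m + Suc M)) (H 0)" using Suc.prems[of 0] by simp
  moreover have "form (D * (m + Suc M)) (Y \<otimes>\<^bsub>S\<^esub> hsum Y M (\<lambda>i. H (Suc i)))"
    using form_mult[OF Y 1] by (simp add: algebra_simps)
  ultimately show ?case unfolding hsum.simps by (rule form_add)
qed simp

lemma hsum_zero: "Y \<in> carrier S \<Longrightarrow> (\<And>i. i < M \<Longrightarrow> H i = \<zero>\<^bsub>S\<^esub>) \<Longrightarrow> hsum Y M H = \<zero>\<^bsub>S\<^esub>"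
  by (induction M arbitrary: H) simp_all

text \<open>Divide by the power of \<open>Y\<close> that belongs to the lowest nonzero term. This is possible on \<open>Z'\<close>, where
\<open>Y\<close> does not vanish; on \<open>Z\<close> all further terms vanish.\<close>

lemma hsum_lowest_term:
  assumes Z': "irreducible_closed K N I Z'" and Z: "Z \<subseteq> Z'" and Y: "form D Y" "vanishes Z Y" "\<not> vanishes Z' Y"
  shows "(\<And>i. i < M \<Longrightarrow> form (D * (m + M - i)) (H i)) \<Longrightarrow> (\<And>i. i < M \<Longrightarrow> \<not> nz i \<Longrightarrow> H i = \<zero>\<^bsub>S\<^esub>) \<Longrightarrow>
    \<exists>i<M. nz i \<Longrightarrow> vanishes Z' (hsum Y M H) \<Longrightarrow> \<exists>i<M. nz i \<and> vanishes Z (H i)"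
proof (induction M arbitrary: H nz)
  case (Suc M)
  let ?R = "hsum Y M (\<lambda>i. H (Suc i))"
  have Yc: "Y \<in> carrier S" using Y(1) by (rule form_closed)
  have H0: "H 0 \<in> carrier S" using form_closed[OF Suc.prems(1)[of 0]] by simp
  have f: "form (D * (m + M - i)) (H (Suc i))" if "i < M" for i using Suc.prems(1)[of "Suc i"] that by simp
  have R: "form (D * (m + M)) ?R" by (rule hsum_form[OF Y(1) f])
  have Rc: "?R \<in> carrier S" using R by (rule form_closed)
  show ?case
  proof (cases "nz 0")
    case True
    have "H 0 \<in> Q" if Q: "Q \<in> Z" for Q
    proof -
      interpret Q: ideal Q S by (rule point_ideal[OF subsetD[OF irreducible_points[OF Z'] subsetD[OF Z Q]]])
      have 1: "Y \<otimes>\<^bsub>S\<^esub> ?R \<in> Q" by (rule Q.I_r_closed[OF bspec[OF Y(2) Q] Rc])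
      have 2: "H 0 \<oplus>\<^bsub>S\<^esub> Y \<otimes>\<^bsub>S\<^esub> ?R \<in> Q" using Suc.prems(4) Z Q by auto
      have "(H 0 \<oplus>\<^bsub>S\<^esub> Y \<otimes>\<^bsub>S\<^esub> ?R) \<oplus>\<^bsub>S\<^esub> \<ominus>\<^bsub>S\<^esub> (Y \<otimes>\<^bsub>S\<^esub> ?R) \<in> Q" by (rule Q.a_closed[OF 2 Q.a_inv_closed[OF 1]])
      moreover have "(H 0 \<oplus>\<^bsub>S\<^esub> Y \<otimes>\<^bsub>S\<^esub> ?R) \<oplus>\<^bsub>S\<^esub> \<ominus>\<^bsub>S\<^esub> (Y \<otimes>\<^bsub>S\<^esub> ?R) = H 0"
        using H0 Yc Rc by (simp add: S.a_assoc S.r_neg)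
      ultimately show ?thesis by simp
    qed
    then show ?thesis using True by blast
  next
    case False
    then have "H 0 = \<zero>\<^bsub>S\<^esub>" using Suc.prems(2) by simp
    then have "vanishes Z' (Y \<otimes>\<^bsub>S\<^esub> ?R)" using Suc.prems(4) Yc Rc by simp
    then have v: "vanishes Z' ?R" using irreducible_product[OF Z' Y(1) R] Y(3) by blast
    obtain i where i: "i < Suc M" "nz i" using Suc.prems(3) by blast
    then have "i \<noteq> 0" using False by metis
    then obtain j where "i = Suc j" by (cases i) simp_all
    then have "\<exists>j<M. nz (Suc j)" using i by auto
    then have "\<exists>j<M. nz (Suc j) \<and> vanishes Z (H (Suc j))"
      using Suc.IH[of "\<lambda>i. H (Suc i)" "\<lambda>i. nz (Suc i)"] f Suc.prems(2) v by simp
    then show ?thesis by auto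
  qed
qed simp

end

context evaluation
begin

lemma E_hsum:
  assumes Y: "form D Y"
  shows "(\<And>i. i < M \<Longrightarrow> form (D * (m + M - i)) (H i)) \<Longrightarrow> E (hsum Y M H) = (\<Sum>i<M. E Y ^ i * E (H i))"
proof (induction M arbitrary: H)
  case (Suc M)
  have f: "form (D * (m + M - i)) (H (Suc i))" if "i < M" for i using Suc.prems[of "Suc i"] that by simp
  have c: "H 0 \<in> carrier S" "Y \<in> carrier S" "hsum Y M (\<lambda>i. H (Suc i)) \<in> carrier S"
    using form_closed[OF Suc.prems[of 0]] form_closed[OF Y] form_closed[OF hsum_form[OF Y f]] by simp_all
  have "E (hsum Y M (\<lambda>i. H (Suc i))) = (\<Sum>i<M. E Y ^ i * E (H (Suc i)))" by (rule Suc.IH[OF f])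
  then show ?case
    using c by (simp add: E_add E_mult sum.lessThan_Suc_shift sum_distrib_left mult_ac del: sum.lessThan_Suc)
qed (simp add: E_zero)

end

context surface
begin

text \<open>There are \<open>M\<^sup>3\<close> polynomials, while the number of monomials available to them grows like \<open>M\<^sup>2\<close>; the
constant \<open>70 D\<^sup>2\<close> comes from the bound \<open>(6 M D + 1) (9 M D + 1) \<le> 7 M D \<cdot> 10 M D\<close>.\<close>

lemma relation_exists:
  fixes b :: "nat \<times> nat \<times> nat \<Rightarrow> 'k poly poly"
  assumes D: "0 < D" and M: "M = 70 * D\<^sup>2 + 1"
    and b: "\<And>e. e \<in> {..<M} \<times> {..<M} \<times> {..<M} \<Longrightarrow> in_polygon (3 * M * D) (b e)"
  shows "\<exists>c. (\<exists>e\<in>{..<M} \<times> {..<M} \<times> {..<M}. c e \<noteq> 0) \<and> (\<Sum>e\<in>{..<M} \<times> {..<M} \<times> {..<M}. cc (c e) * b e) = 0"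
proof -
  let ?A = "{..<M} \<times> {..<M} \<times> {..<M}" and ?n = "3 * M * D"
  let ?B = "{..2 * ?n} \<times> {..3 * ?n}"
  have M0: "1 \<le> M * D" using M D by simp
  have "card ?B = (6 * (M * D) + 1) * (9 * (M * D) + 1)" by (simp add: mult_ac)
  also have "\<dots> \<le> (7 * (M * D)) * (10 * (M * D))" using M0 by (intro mult_mono) auto
  also have "\<dots> = (70 * D\<^sup>2) * (M * M)" by (simp add: power2_eq_square)
  also have "\<dots> < M * (M * M)" using M by (intro mult_strict_right_mono) auto
  also have "\<dots> = card ?A" by simp
  finally obtain c where c: "\<exists>e\<in>?A. c e \<noteq> 0"
    "\<forall>p\<in>?B. (\<Sum>e\<in>?A. c e * Polynomial.coeff (Polynomial.coeff (b e) (snd p)) (fst p)) = 0"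
    using dependent_columns[of ?B ?A "\<lambda>e p. Polynomial.coeff (Polynomial.coeff (b e) (snd p)) (fst p)"] by auto
  have "Polynomial.coeff (Polynomial.coeff (\<Sum>e\<in>?A. cc (c e) * b e) j) i = 0" for i j
  proof -
    have "Polynomial.coeff (Polynomial.coeff (\<Sum>e\<in>?A. cc (c e) * b e) j) i =
        (\<Sum>e\<in>?A. c e * Polynomial.coeff (Polynomial.coeff (b e) j) i)"
      by (simp add: coeff_sum cc_def)
    also have "\<dots> = 0"
    proof (cases "(i, j) \<in> ?B")
      case True
      then show ?thesis using bspec[OF c(2) True] by simp
    next
      case False
      have "Polynomial.coeff (Polynomial.coeff (b e) j) i = 0" if "e \<in> ?A" for e
      proof (rule ccontr)
        assume "Polynomial.coeff (Polynomial.coeff (b e) j) i \<noteq> 0"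
        then have "(i, j) \<in> polygon ?n" using b[OF that] unfolding in_polygon_def by blast
        then show False using False by (simp add: polygon_def)
      qed
      then show ?thesis by (intro sum.neutral) simp
    qed
    finally show ?thesis .
  qed
  then have "(\<Sum>e\<in>?A. cc (c e) * b e) = 0" by (intro poly_eqI) simp
  then show ?thesis using c(1) by blast
qed

text \<open>A chain of four irreducible closed sets yields forms \<open>Y1\<close>, \<open>Y2\<close>, \<open>Y3\<close> of a common degree, each
vanishing on one set of the chain and not on the next, and a power of a coordinate that does not
vanish on the first set. By dimension count, suitable monomials in these four forms are linearly
dependent on the surface. In such a relation the lexicographically lowest term would have to vanish on
the smallest set.\<close>

lemma no_chain: "\<not> irreducible_chain K 4 I 3 Z"
proof
  assume ch: "irreducible_chain K 4 I 3 Z"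
  have irr: "irreducible_closed K 4 I (Z i)" if "i \<le> 3" for i
    using ch that unfolding irreducible_chain_def by blast
  note pts = irreducible_points[OF irr]
  have lt: "Z 0 \<subset> Z 1" "Z 1 \<subset> Z 2" "Z 2 \<subset> Z 3"
    using ch unfolding irreducible_chain_def by (auto simp: eval_nat_numeral)
  obtain Q0 where Q0: "Q0 \<in> Z 0" using irr[of 0] unfolding irreducible_closed_def by auto
  have Q0p: "Q0 \<in> proj_points K 4 I" using pts[of 0] Q0 by auto
  interpret Q0: surface_point K dec Q0 by (rule surface_pointI[OF Q0p])
  obtain j where j: "j \<le> 4" "var j \<notin> Q0" using Q0.var_notin_Q by blast
  let ?x = "\<lambda>n::nat. var j [^]\<^bsub>S\<^esub> n"
  have x: "form n (?x n)" "?x n \<notin> Q0" for n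
    using form_pow[OF form_var[OF j(1)], of n] Q0.pow_notin_Q[OF form_closed[OF form_var[OF j(1)]] j(2)] by simp_all
  obtain d1 y1 where y1: "form d1 y1" "vanishes (Z 0) y1" "\<not> vanishes (Z 1) y1"
    using strict_chain_form[OF irr pts lt(1)] by auto
  obtain d2 y2 where y2: "form d2 y2" "vanishes (Z 1) y2" "\<not> vanishes (Z 2) y2"
    using strict_chain_form[OF irr pts lt(2)] by auto
  obtain d3 y3 where y3: "form d3 y3" "vanishes (Z 2) y3" "\<not> vanishes (Z 3) y3"
    using strict_chain_form[OF irr pts lt(3)] by auto
  \<comment> \<open>The summand \<open>1\<close> makes the common degree positive even if all \<open>di\<close> are \<open>0\<close>.\<close>
  define D where "D = 1 + d1 + d2 + d3"
  have Q0_in: "Q0 \<in> Z i" if "i \<le> 3" for i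
  proof -
    have "i = 0 \<or> i = 1 \<or> i = 2 \<or> i = 3" using that by linarith
    then show ?thesis using lt Q0 by auto
  qed
  have raise: "\<exists>Y. form D Y \<and> vanishes (Z i) Y \<and> \<not> vanishes (Z i') Y"
    if y: "form d y" "vanishes (Z i) y" "\<not> vanishes (Z i') y" and d: "d \<le> D" and i: "i \<le> 3" "i' \<le> 3" for d y i i'
  proof -
    have xc: "?x (D - d) \<in> carrier S" using x(1) by (rule form_closed)
    have "form D (y \<otimes>\<^bsub>S\<^esub> ?x (D - d))" using form_mult[OF y(1) x(1)[of "D - d"]] d by simp
    moreover have "vanishes (Z i) (y \<otimes>\<^bsub>S\<^esub> ?x (D - d))"
    proof
      fix Q assume Q: "Q \<in> Z i"
      show "y \<otimes>\<^bsub>S\<^esub> ?x (D - d) \<in> Q"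
        by (rule ideal.I_r_closed[OF point_ideal[OF subsetD[OF pts[OF i(1)] Q]] bspec[OF y(2) Q] xc])
    qed
    moreover have "\<not> vanishes (Z i') (?x (D - d))" using x(2) Q0_in[OF i(2)] by blast
    then have "\<not> vanishes (Z i') (y \<otimes>\<^bsub>S\<^esub> ?x (D - d))"
      using irreducible_product[OF irr[OF i(2)] y(1) x(1)] y(3) by blast
    ultimately show ?thesis by blast
  qed
  have "\<exists>Y. form D Y \<and> vanishes (Z 0) Y \<and> \<not> vanishes (Z 1) Y" by (rule raise[OF y1]) (simp_all add: D_def)
  then obtain Y1 where Y1: "form D Y1" "vanishes (Z 0) Y1" "\<not> vanishes (Z 1) Y1" by blast
  have "\<exists>Y. form D Y \<and> vanishes (Z 1) Y \<and> \<not> vanishes (Z 2) Y" by (rule raise[OF y2]) (simp_all add: D_def)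
  then obtain Y2 where Y2: "form D Y2" "vanishes (Z 1) Y2" "\<not> vanishes (Z 2) Y2" by blast
  have "\<exists>Y. form D Y \<and> vanishes (Z 2) Y \<and> \<not> vanishes (Z 3) Y" by (rule raise[OF y3]) (simp_all add: D_def)
  then obtain Y3 where Y3: "form D Y3" "vanishes (Z 2) Y3" "\<not> vanishes (Z 3) Y3" by blast
  define M where "M = 70 * D\<^sup>2 + 1"
  define b where "b = (\<lambda>(i, j, k). D.E Y3 ^ i * (D.E Y2 ^ j * (D.E Y1 ^ k * D.E (?x (D * (3 * M - i - j - k))))))"
  have pol: "in_polygon (m * D) (D.E Y ^ m)" if "form D Y" for Y m
  proof -
    have "form (m * D) (Y [^]\<^bsub>S\<^esub> m)" using that by (rule form_pow)
    then have "in_polygon (m * D) (D.E (Y [^]\<^bsub>S\<^esub> m))" by (rule E_in_polygon)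
    then show ?thesis using form_closed[OF that] by (simp add: D.E_pow)
  qed
  have "in_polygon (3 * M * D) (b e)" if e: "e \<in> {..<M} \<times> {..<M} \<times> {..<M}" for e
  proof -
    obtain i j k where ijk: "e = (i, j, k)" "i < M" "j < M" "k < M" using e by auto
    define t where "t = 3 * M - i - j - k"
    have t: "i + j + k + t = 3 * M" using ijk unfolding t_def by linarith
    have "in_polygon (i * D + (j * D + (k * D + D * t))) (b e)"
      unfolding b_def ijk(1) prod.case t_def[symmetric]
      by (intro in_polygon_mult pol[OF Y1(1)] pol[OF Y2(1)] pol[OF Y3(1)] E_in_polygon[OF x(1)])
    moreover have "i * D + (j * D + (k * D + D * t)) = 3 * M * D"
      unfolding t[symmetric] by (simp add: algebra_simps)
    ultimately show ?thesis by simp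
  qed
  moreover have "0 < D" by (simp add: D_def)
  ultimately obtain c where c: "\<exists>e\<in>{..<M} \<times> {..<M} \<times> {..<M}. c e \<noteq> 0"
    "(\<Sum>e\<in>{..<M} \<times> {..<M} \<times> {..<M}. cc (c e) * b e) = 0"
    using relation_exists[OF _ M_def] by blast
  define H1 where "H1 i j k = const (c (i, j, k)) \<otimes>\<^bsub>S\<^esub> ?x (D * (3 * M - i - j - k))" for i j k
  define H2 where "H2 i j = hsum Y1 M (H1 i j)" for i j
  define H3 where "H3 i = hsum Y2 M (H2 i)" for i
  have f1: "form (D * ((2 * M - i - j) + M - k)) (H1 i j k)" if "i < M" "j < M" "k < M" for i j k
  proof -
    have "form (0 + D * (3 * M - i - j - k)) (H1 i j k)" unfolding H1_def by (intro form_mult form_const x)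
    moreover have "(2 * M - i - j) + M - k = 3 * M - i - j - k" using that by linarith
    ultimately show ?thesis by simp
  qed
  have f2: "form (D * ((2 * M - i) + M - j)) (H2 i j)" if "i < M" "j < M" for i j
  proof -
    have "form (D * ((2 * M - i - j) + M)) (H2 i j)" unfolding H2_def by (rule hsum_form[OF Y1(1) f1]) (use that in auto)
    moreover have "(2 * M - i) + M - j = (2 * M - i - j) + M" using that by linarith
    ultimately show ?thesis by simp
  qed
  have f3: "form (D * (2 * M + M - i)) (H3 i)" if "i < M" for i
  proof -
    have "form (D * ((2 * M - i) + M)) (H3 i)" unfolding H3_def by (rule hsum_form[OF Y2(1) f2]) (use that in auto)
    moreover have "2 * M + M - i = (2 * M - i) + M" using that by linarith
    ultimately show ?thesis by simp
  qed
  define F where "F = hsum Y3 M H3"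
  have F: "form (D * (2 * M + M)) F" unfolding F_def by (rule hsum_form[OF Y3(1) f3])
  have "D.E F = (\<Sum>i<M. D.E Y3 ^ i * (\<Sum>j<M. D.E Y2 ^ j * (\<Sum>k<M. D.E Y1 ^ k * D.E (H1 i j k))))"
  proof -
    have "D.E F = (\<Sum>i<M. D.E Y3 ^ i * D.E (H3 i))" unfolding F_def by (rule D.E_hsum[OF Y3(1) f3])
    also have "\<dots> = (\<Sum>i<M. D.E Y3 ^ i * (\<Sum>j<M. D.E Y2 ^ j * D.E (H2 i j)))"
    proof (intro sum.cong refl arg_cong2[where f = "(*)"])
      fix i assume "i \<in> {..<M}"
      then show "D.E (H3 i) = (\<Sum>j<M. D.E Y2 ^ j * D.E (H2 i j))"
        unfolding H3_def by (intro D.E_hsum[OF Y2(1) f2]) auto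
    qed
    also have "\<dots> = (\<Sum>i<M. D.E Y3 ^ i * (\<Sum>j<M. D.E Y2 ^ j * (\<Sum>k<M. D.E Y1 ^ k * D.E (H1 i j k))))"
    proof (intro sum.cong refl arg_cong2[where f = "(*)"])
      fix i j assume "i \<in> {..<M}" "j \<in> {..<M}"
      then show "D.E (H2 i j) = (\<Sum>k<M. D.E Y1 ^ k * D.E (H1 i j k))"
        unfolding H2_def by (intro D.E_hsum[OF Y1(1) f1]) auto
    qed
    finally show ?thesis .
  qed
  also have "\<dots> = (\<Sum>e\<in>{..<M} \<times> {..<M} \<times> {..<M}. cc (c e) * b e)"
  proof -
    have "D.E (H1 i j k) = cc (c (i, j, k)) * D.E (?x (D * (3 * M - i - j - k)))" for i j k
      unfolding H1_def using form_closed[OF form_const] form_closed[OF x(1)] by (simp add: D.E_mult D.E_const)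
    then have "D.E Y3 ^ i * (D.E Y2 ^ j * (D.E Y1 ^ k * D.E (H1 i j k))) = cc (c (i, j, k)) * b (i, j, k)" for i j k
      by (simp add: b_def mult_ac)
    then show ?thesis by (simp only: sum.cartesian_product' sum_distrib_left)
  qed
  finally have "D.E F = 0" using c(2) by simp
  then have "F \<in> I" using D.form_in_graded_kernel[OF F] by simp
  then have van: "vanishes (Z 3) F" using pts[of 3] unfolding proj_points_def by blast
  have x1: "Y1 \<in> carrier S" "Y2 \<in> carrier S" using Y1 Y2 form_closed by blast+
  have z1: "H1 i j k = \<zero>\<^bsub>S\<^esub>" if "c (i, j, k) = 0" for i j k
    unfolding H1_def that const_zero using form_closed[OF x(1)] by simp
  let ?nz2 = "\<lambda>i j. \<exists>k<M. c (i, j, k) \<noteq> 0"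
  have z2: "H2 i j = \<zero>\<^bsub>S\<^esub>" if "\<not> ?nz2 i j" for i j
    unfolding H2_def using that z1 by (intro hsum_zero x1) auto
  let ?nz3 = "\<lambda>i. \<exists>j<M. ?nz2 i j"
  have z3: "H3 i = \<zero>\<^bsub>S\<^esub>" if "\<not> ?nz3 i" for i
    unfolding H3_def using that z2 by (intro hsum_zero x1) auto
  have "\<exists>i<M. ?nz3 i" using c(1) by auto
  then have nz3: "\<exists>i<M. ?nz3 i" .
  have "\<exists>i<M. ?nz3 i \<and> vanishes (Z 2) (H3 i)"
  proof (rule hsum_lowest_term[where Z' = "Z 3" and Y = Y3 and D = D and m = "2 * M", OF _ _ _ _ _ _ _ nz3])
    show "irreducible_closed K 4 I (Z 3)" "Z 2 \<subseteq> Z 3" using irr lt by auto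
    show "vanishes (Z 3) (hsum Y3 M H3)" using van unfolding F_def .
  qed (use Y3 f3 z3 in blast)+
  then obtain i where i: "i < M" "?nz3 i" "vanishes (Z 2) (H3 i)" by blast
  have "\<exists>j<M. ?nz2 i j \<and> vanishes (Z 1) (H2 i j)"
  proof (rule hsum_lowest_term[where Z' = "Z 2" and Y = Y2 and D = D and m = "2 * M - i", OF _ _ _ _ _ _ _ i(2)])
    show "irreducible_closed K 4 I (Z 2)" "Z 1 \<subseteq> Z 2" using irr lt by auto
    show "vanishes (Z 2) (hsum Y2 M (H2 i))" using i(3) unfolding H3_def .
  qed (use Y2 f2[OF i(1)] z2 in blast)+
  then obtain j where j': "j < M" "?nz2 i j" "vanishes (Z 1) (H2 i j)" by blast
  have "\<exists>k<M. c (i, j, k) \<noteq> 0 \<and> vanishes (Z 0) (H1 i j k)"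
  proof (rule hsum_lowest_term[where Z' = "Z 1" and Y = Y1 and D = D and m = "2 * M - i - j", OF _ _ _ _ _ _ _ j'(2)])
    show "irreducible_closed K 4 I (Z 1)" "Z 0 \<subseteq> Z 1" using irr lt by auto
    show "vanishes (Z 1) (hsum Y1 M (H1 i j))" using j'(3) unfolding H2_def .
  qed (use Y1 f1[OF i(1) j'(1)] z1 in blast)+
  then obtain k where k: "k < M" "c (i, j, k) \<noteq> 0" "vanishes (Z 0) (H1 i j k)" by blast
  let ?c = "c (i, j, k)"
  have cc: "const ?c \<in> carrier S" "const (inverse ?c) \<in> carrier S" using form_closed[OF form_const] by blast+
  have "const ?c \<otimes>\<^bsub>S\<^esub> ?x (D * (3 * M - i - j - k)) \<in> Q0" using k(3) Q0 unfolding H1_def by blast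
  then have "const ?c \<in> Q0" using Q0.mult_in_Q_iff[OF cc(1) form_closed[OF x(1)]] x(2) by blast
  then have "const (inverse ?c) \<otimes>\<^bsub>S\<^esub> const ?c \<in> Q0" using cc by (intro Q0.Q.I_l_closed)
  moreover have "const (inverse ?c) \<otimes>\<^bsub>S\<^esub> const ?c = \<one>\<^bsub>S\<^esub>"
    using cc k(2) by (intro pm_eqD) (simp_all add: pm_mult pm_const mult_single pm_one)
  ultimately show False using Q0.one_notin_Q by simp
qed

text \<open>The surface, its double curve, and a point on it.\<close>

lemma chain_exists: "\<exists>Z. irreducible_chain K 4 I 2 Z"
proof -
  interpret A: domain_evaluation K dec 4 "\<lambda>a. [:a:]" "\<lambda>i. at_x0 (gens i :: 'k poly poly)"
    by unfold_locales (simp_all add: one_pCons)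
  interpret B: domain_evaluation K dec 4 "\<lambda>a. a" "\<lambda>i. poly (at_x0 (gens i :: 'k poly poly)) 0"
    by unfold_locales simp_all
  have A_E: "A.E f = at_x0 (D.E f)" for f
  proof -
    have "at_x0 (D.E f) = ev (\<lambda>a. at_x0 (cc a)) (\<lambda>i. at_x0 (gens i)) f" by (rule ev_hom) simp_all
    then show ?thesis by simp
  qed
  have B_E: "B.E f = poly (at_x0 (D.E f)) 0" for f
  proof -
    have "poly (at_x0 (D.E f)) 0 = ev (\<lambda>a. poly (at_x0 (cc a)) 0) (\<lambda>i. poly (at_x0 (gens i)) 0) f"
      by (rule ev_hom[where h = "\<lambda>F. poly (at_x0 F) 0"]) simp_all
    then show ?thesis by simp
  qed
  have IA: "I \<subseteq> A.graded_kernel"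
    by (rule homogeneous_ideal_subset[OF D.graded_kernel_homogeneous A.graded_kernel_homogeneous])
      (simp add: D.form_in_graded_kernel A.form_in_graded_kernel A_E)
  have AB: "A.graded_kernel \<subseteq> B.graded_kernel"
    by (rule homogeneous_ideal_subset[OF A.graded_kernel_homogeneous B.graded_kernel_homogeneous])
      (simp add: A.form_in_graded_kernel B.form_in_graded_kernel A_E B_E)
  have P: "I \<in> proj_points K 4 I" "A.graded_kernel \<in> proj_points K 4 I" "B.graded_kernel \<in> proj_points K 4 I"
    using D.graded_kernel_prime D.graded_kernel_homogeneous D.graded_kernel_relevant[of 0]
      A.graded_kernel_prime A.graded_kernel_homogeneous A.graded_kernel_relevant[of 0]
      B.graded_kernel_prime B.graded_kernel_homogeneous B.graded_kernel_relevant[of 0] IA AB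
    by (simp_all add: proj_points_def)
  have v1: "var 1 \<in> B.graded_kernel" "var 1 \<notin> A.graded_kernel"
    using B.form_in_graded_kernel[OF form_var[of 1]] A.form_in_graded_kernel[OF form_var[of 1]] B.E_var[of 1] A.E_var[of 1]
    by (simp_all add: power2_eq_square)
  have v2: "var 2 \<in> A.graded_kernel" "var 2 \<notin> I"
    using A.form_in_graded_kernel[OF form_var[of 2]] D.form_in_graded_kernel[OF form_var[of 2]] A.E_var[of 2] D.E_var[of 2]
    by (simp_all add: xy_nonzero)
  let ?V = "\<lambda>P. {Q \<in> proj_points K 4 I. P \<subseteq> Q}"
  let ?Z = "\<lambda>i::nat. ?V ([B.graded_kernel, A.graded_kernel, I] ! i)"
  have s: "?V B.graded_kernel \<subset> ?V A.graded_kernel" "?V A.graded_kernel \<subset> ?V I"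
    using AB IA P v1 v2 by blast+
  have "irreducible_chain K 4 I 2 ?Z"
    unfolding irreducible_chain_def
  proof (intro conjI allI impI)
    fix i :: nat assume "i \<le> 2"
    then have "i = 0 \<or> i = 1 \<or> i = 2" by linarith
    then show "irreducible_closed K 4 I (?Z i)" using P irreducible_closed_of_point by auto
  next
    fix i :: nat assume "i < 2"
    then have "i = 0 \<or> i = 1" by linarith
    then show "?Z i \<subset> ?Z (Suc i)"
      by (elim disjE) (simp_all only: nth_Cons_0 nth_Cons_Suc One_nat_def s)
  qed
  then show ?thesis by (rule exI[of _ ?Z])
qed

theorem surface: "projective_surface K 4 I"
proof -
  have "Suc 2 = (3::nat)" by simp
  then show ?thesis
    unfolding projective_surface_def has_dimension_def
    using D.graded_kernel_prime D.graded_kernel_homogeneous D.graded_kernel_relevant[of 0] chain_exists no_chain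
    by simp
qed

end

section \<open>The ground field\<close>

context field_coding
begin

lemma K_field: "field K"
proof (rule K.cring_fieldI2)
  show "\<zero>\<^bsub>K\<^esub> \<noteq> \<one>\<^bsub>K\<^esub>" using dec_zero dec_one by auto
  fix a assume a: "a \<in> carrier K" "a \<noteq> \<zero>\<^bsub>K\<^esub>"
  then have "dec a \<noteq> 0" by (simp add: dec_eq_0_iff)
  then have "dec (a \<otimes>\<^bsub>K\<^esub> enc (inverse (dec a))) = dec \<one>\<^bsub>K\<^esub>" using a by (simp add: dec_mult dec_one)
  then have "a \<otimes>\<^bsub>K\<^esub> enc (inverse (dec a)) = \<one>\<^bsub>K\<^esub>"
    by (rule inj_onD[OF dec_inj]) (use a in \<open>simp_all add: K_closed\<close>)
  then show "\<exists>b\<in>carrier K. a \<otimes>\<^bsub>K\<^esub> b = \<one>\<^bsub>K\<^esub>" by blast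
qed

lemma dec_power: "a \<in> carrier K \<Longrightarrow> dec (a [^]\<^bsub>K\<^esub> (n::nat)) = dec a ^ n"
  by (induction n) (simp_all add: dec_one dec_mult K.nat_pow_closed)

text \<open>Polynomials as lists of coefficients, translated to the polynomial type. The leading coefficient is
recorded to control the degree.\<close>

lemma dec_eval:
  assumes "set p \<subseteq> carrier K"
  shows "\<exists>P. (\<forall>x\<in>carrier K. K.eval p x \<in> carrier K \<and> dec (K.eval p x) = poly P (dec x)) \<and>
    (\<forall>n\<ge>length p. Polynomial.coeff P n = 0) \<and> (p \<noteq> [] \<longrightarrow> Polynomial.coeff P (length p - 1) = dec (hd p))"
  using assms
proof (induction p)
  case Nil
  then show ?case by (intro exI[of _ 0]) (simp add: dec_zero K_closed)
next
  case (Cons a p)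
  then obtain P where P: "\<forall>x\<in>carrier K. K.eval p x \<in> carrier K \<and> dec (K.eval p x) = poly P (dec x)"
    "\<forall>n\<ge>length p. Polynomial.coeff P n = 0" by auto
  have a: "a \<in> carrier K" using Cons.prems by simp
  let ?P = "Polynomial.monom (dec a) (length p) + P"
  show ?case
  proof (intro exI[of _ ?P] conjI ballI allI impI)
    fix x assume x: "x \<in> carrier K"
    show "K.eval (a # p) x \<in> carrier K" using a x P by (simp add: K.nat_pow_closed)
    show "dec (K.eval (a # p) x) = poly ?P (dec x)"
      using a x P by (simp add: dec_add dec_mult dec_power poly_monom K.nat_pow_closed)
  next
    fix n assume "length (a # p) \<le> n"
    then show "Polynomial.coeff ?P n = 0" using P(2) by simp
  next
    show "Polynomial.coeff ?P (length (a # p) - 1) = dec (hd (a # p))" using P(2) by simp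
  qed
qed

end

lemma (in field_coding) K_algebraically_closed:
  assumes closed: "\<And>P :: 'k poly. Polynomial.degree P > 0 \<Longrightarrow> \<exists>z. poly P z = 0"
  shows "algebraically_closed K"
proof -
  interpret F: field K by (rule K_field)
  show ?thesis
  proof (rule F.algebraically_closedI)
    fix p assume p: "p \<in> carrier (poly_ring K)" "length p - 1 > 1"
    have pk: "set p \<subseteq> carrier K" "p \<noteq> [] \<Longrightarrow> hd p \<noteq> \<zero>\<^bsub>K\<^esub>"
      using p(1) unfolding univ_poly_carrier[symmetric] polynomial_def by auto
    obtain P where P: "\<forall>x\<in>carrier K. K.eval p x \<in> carrier K \<and> dec (K.eval p x) = poly P (dec x)"
      "p \<noteq> [] \<longrightarrow> Polynomial.coeff P (length p - 1) = dec (hd p)"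
      using dec_eval[OF pk(1)] by blast
    have ne: "p \<noteq> []" using p(2) by auto
    have "hd p \<in> carrier K" using pk(1) ne by (simp add: subset_code(1))
    then have "Polynomial.coeff P (length p - 1) \<noteq> 0" using P(2) ne pk(2) by (simp add: dec_eq_0_iff)
    then have "length p - 1 \<le> Polynomial.degree P" by (rule le_degree)
    then have "Polynomial.degree P > 0" using p(2) by linarith
    then obtain z where z: "poly P z = 0" using closed by blast
    have "K.eval p (enc z) \<in> carrier K" "dec (K.eval p (enc z)) = 0" using P(1) z by simp_all
    then have "K.eval p (enc z) = \<zero>\<^bsub>K\<^esub>" by (simp add: dec_eq_0_iff)
    then show "\<exists>x\<in>carrier K. K.eval p x = \<zero>\<^bsub>K\<^esub>" by (intro bexI[of _ "enc z"]) simp_all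
  qed
qed

text \<open>Every element is one of the finitely many roots of a polynomial over the base field.\<close>

lemma countable_alg_closure:
  assumes "countable (UNIV :: 'a::field set)"
  shows "countable (UNIV :: 'a alg_closure set)"
proof -
  have "countable (UNIV :: 'a poly set)"
  proof (rule countable_subset)
    show "UNIV \<subseteq> range (Poly :: 'a list \<Rightarrow> 'a poly)" by (metis Poly_coeffs rangeI subsetI)
    have "countable (lists (UNIV :: 'a set))" using assms by (rule countable_lists)
    then show "countable (range (Poly :: 'a list \<Rightarrow> 'a poly))" by (simp add: lists_UNIV)
  qed
  then have "countable (\<Union>p\<in>{p :: 'a poly. p \<noteq> 0}. {x. poly (map_poly to_ac p) x = 0})"
  proof (intro countable_UN)
    show "countable {p :: 'a poly. p \<noteq> 0}" using \<open>countable (UNIV :: 'a poly set)\<close> by (rule countable_subset[rotated]) simp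
    fix p :: "'a poly" assume "p \<in> {p. p \<noteq> 0}"
    then have "map_poly to_ac p \<noteq> 0" by (simp add: map_poly_eq_0_iff)
    then show "countable {x. poly (map_poly to_ac p) x = 0}" by (intro countable_finite poly_roots_finite)
  qed
  moreover have "UNIV \<subseteq> (\<Union>p\<in>{p :: 'a poly. p \<noteq> 0}. {x. poly (map_poly to_ac p) x = 0})"
  proof
    fix x :: "'a alg_closure"
    obtain p :: "'a poly" where "p \<noteq> 0" "poly (map_poly to_ac p) x = 0" by (rule alg_closure_algebraic)
    then show "x \<in> (\<Union>p\<in>{p :: 'a poly. p \<noteq> 0}. {x. poly (map_poly to_ac p) x = 0})" by blast
  qed
  ultimately show ?thesis by (rule countable_subset[rotated])
qed

lemma countable_field_coding:
  assumes "countable (UNIV :: 'k::field set)"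
  obtains K :: "nat ring" and dec :: "nat \<Rightarrow> 'k::field" where "field_coding K dec"
proof -
  define e :: "'k::field \<Rightarrow> nat" where "e = to_nat_on UNIV"
  define d :: "nat \<Rightarrow> 'k::field" where "d = from_nat_into UNIV"
  have de: "d (e x) = x" for x using assms by (simp add: d_def e_def)
  define K :: "nat ring" where
    "K = \<lparr>carrier = range e, monoid.mult = (\<lambda>a b. e (d a * d b)), monoid.one = e 1, ring.zero = e 0, ring.add = (\<lambda>a b. e (d a + d b))\<rparr>"
  have "field_coding K d"
  proof
    show "bij_betw d (carrier K) UNIV"
      by (rule bij_betw_byWitness[where f' = e]) (auto simp: K_def de)
  qed (auto simp: K_def de)
  then show ?thesis by (rule that)
qed

text \<open>The open set consists of the hyperplanes whose first two coefficients have nonzero product; it is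
nonempty because it contains \<open>X\<^sub>0 + X\<^sub>1 = 0\<close>.\<close>

lemma (in surface) general_hyperplanes:
  "\<exists>U. dual_open K 4 U \<and> U \<noteq> {} \<and>
    (\<forall>H\<in>U. \<not> F_injective_scheme 2 K 4 (hyperplane_section K 4 I H))"
proof -
  let ?g = "mp (Poly_Mapping.single {#0, 1#} 1)"
  let ?P = "\<lambda>l. mpoly_eval K ?g (\<lambda>i. l {#i#}) \<noteq> \<zero>\<^bsub>K\<^esub>"
  have g: "form 2 ?g" using form_single[of "{#0, 1#}" 1] by (simp add: numeral_2_eq_2)
  have supp: "{m. ?g m \<noteq> \<zero>\<^bsub>K\<^esub>} = {{#0, 1#}}"
    by (auto simp: mp_def lookup_single when_def enc_eq_0_iff)
  have ev: "?P l \<longleftrightarrow> l {#0#} \<noteq> \<zero>\<^bsub>K\<^esub> \<and> l {#1#} \<noteq> \<zero>\<^bsub>K\<^esub>" if l: "l \<in> carrier S" for l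
  proof -
    have lK: "l m \<in> carrier K" for m using l by (simp add: S_carrier)
    have g1: "?g {#0, 1#} = enc 1" by (simp add: mp_def)
    have "mpoly_eval K ?g (\<lambda>i. l {#i#}) = enc 1 \<otimes>\<^bsub>K\<^esub> (l {#0#} \<otimes>\<^bsub>K\<^esub> l {#1#})"
      unfolding mpoly_eval_def supp using lK g1 by (simp add: K.finprod_insert Pi_def)
    also have "dec \<dots> = dec (l {#0#}) * dec (l {#1#})" using lK by (simp add: dec_mult K_closed)
    finally have "dec (mpoly_eval K ?g (\<lambda>i. l {#i#})) = dec (l {#0#}) * dec (l {#1#})" .
    moreover have "mpoly_eval K ?g (\<lambda>i. l {#i#}) \<in> carrier K"
      unfolding mpoly_eval_def supp using lK g1 by (simp add: K.finprod_insert Pi_def)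
    ultimately show ?thesis using lK by (metis dec_eq_0_iff mult_eq_0_iff)
  qed
  let ?U = "{hyperplane K 4 l | l. l \<in> linear_forms K 4 \<and> (\<exists>g\<in>{?g}. mpoly_eval K g (\<lambda>i. l {#i#}) \<noteq> \<zero>\<^bsub>K\<^esub>)}"
  have "dual_open K 4 ?U" unfolding dual_open_def by (rule exI[of _ "{?g}"]) (use g in blast)
  moreover have "?U \<noteq> {}"
  proof -
    define l where "l = var 0 \<oplus>\<^bsub>S\<^esub> var 1"
    have l: "form 1 l" unfolding l_def by (intro form_add form_var) simp_all
    have lc: "l \<in> carrier S" using l by (rule form_closed)
    have "l {#0#} \<in> carrier K" "l {#1#} \<in> carrier K" using lc by (simp_all add: S_carrier)
    moreover have v: "var 0 \<in> carrier S" "var 1 \<in> carrier S" using form_closed[OF form_var] by simp_all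
    have "lookup (pm l) {#0#} = 1" "lookup (pm l) {#1#} = 1"
      unfolding l_def using v by (simp_all add: pm_add pm_var lookup_add lookup_single when_def)
    ultimately have l01: "l {#0#} \<noteq> \<zero>\<^bsub>K\<^esub>" "l {#1#} \<noteq> \<zero>\<^bsub>K\<^esub>"
      using lc by (auto simp: lookup_pm dec_zero)
    then have "l \<noteq> \<zero>\<^bsub>S\<^esub>" by (auto simp: zero_S(2))
    then have "l \<in> linear_forms K 4" using l by (simp add: linear_forms_def)
    then show ?thesis using ev[OF lc] l01 by blast
  qed
  moreover have "\<not> F_injective_scheme 2 K 4 (hyperplane_section K 4 I H)" if H: "H \<in> ?U" for H
  proof -
    obtain l' where l': "H = hyperplane K 4 l'" "l' \<in> linear_forms K 4" "?P l'" using H by blast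
    have f: "form 1 l'" using l'(2) by (simp add: linear_forms_def)
    interpret HS: surface_section K dec l'
      by unfold_locales (use f ev[OF form_closed[OF f]] l'(3) in simp_all)
    show ?thesis unfolding l'(1) by (rule HS.section_not_F_injective)
  qed
  ultimately show ?thesis by blast
qed

lemma (in surface) K_has_char: "has_char K 2"
proof -
  have "[(2::nat)] \<cdot>\<^bsub>K\<^esub> \<one>\<^bsub>K\<^esub> = \<one>\<^bsub>K\<^esub> \<oplus>\<^bsub>K\<^esub> \<one>\<^bsub>K\<^esub>"
    using K_closed(2) by (simp add: numeral_2_eq_2)
  moreover have "dec (\<one>\<^bsub>K\<^esub> \<oplus>\<^bsub>K\<^esub> \<one>\<^bsub>K\<^esub>) = dec \<zero>\<^bsub>K\<^esub>" using two by (simp add: dec_add K_closed dec_one dec_zero)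
  then have "\<one>\<^bsub>K\<^esub> \<oplus>\<^bsub>K\<^esub> \<one>\<^bsub>K\<^esub> = \<zero>\<^bsub>K\<^esub>" by (rule inj_onD[OF dec_inj]) (simp_all add: K_closed)
  moreover have "\<one>\<^bsub>K\<^esub> \<noteq> \<zero>\<^bsub>K\<^esub>" using dec_zero dec_one by auto
  ultimately show ?thesis unfolding has_char_def by simp
qed

theorem theorem7p5:
  "\<exists>(K :: nat ring) (p :: nat) (N :: nat) I.
     algebraically_closed K \<and> has_char K p \<and>
     projective_surface K N I \<and>
     finite {Q \<in> proj_points K N I. \<not> F_injective_at p K N I Q} \<and>
     (\<exists>U. dual_open K N U \<and> U \<noteq> {} \<and>
       (\<forall>H\<in>U. \<not> F_injective_scheme p K N (hyperplane_section K N I H)))"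
proof -
  have "x = 0 \<or> x = 1" for x :: bit by (cases "x = 0") simp_all
  then have "(UNIV :: bit set) \<subseteq> {0, 1}" by blast
  then have "finite (UNIV :: bit set)" by (rule finite_subset) simp
  then have "countable (UNIV :: bit alg_closure set)"
    by (intro countable_alg_closure countable_finite)
  then obtain K :: "nat ring" and dec :: "nat \<Rightarrow> bit alg_closure" where K: "field_coding K dec"
    by (rule countable_field_coding)
  have "to_ac (2 :: bit) = to_ac 0" by simp
  then have two: "(2 :: bit alg_closure) = 0" by (simp only: to_ac_numeral to_ac_0)
  interpret surface K dec by (intro surface.intro surface_axioms.intro K two)
  have "algebraically_closed K"
    by (rule K_algebraically_closed) (rule alg_closed_imp_poly_has_root)
  then show ?thesis
    using K_has_char surface finite_exceptional general_hyperplanes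
    by (intro exI[of _ K] exI[of _ "2 :: nat"] exI[of _ "4 :: nat"] exI[of _ I] conjI)
qed

end
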